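(* Let $d\ge1$ and let $\mu$ be a compactly supported finite positive Borel measure on $\mathbb R^d$. Suppose that for some $a>\frac12$, some $b$ with $d-1<b\le d$, and some constant $C_0$, $$|\widehat\mu(\xi)|\le C_0|\xi|^{-a}\quad(\xi\in\mathbb R^d\setminus\{0\}),\qquad \mu(B(x,r))\le C_0 r^b\quad (x\in\mathbb R^d,\ r>0).$$ Put $$p_{(a,b)}=\frac{2(d-b)+2a-1}{d-b+2a-1},\qquad M_\mu f(x)=\sup_{t>0}|f\ast\mu_t(x)|.$$ Then for every $p>p_{(a,b)}$ there is a constant $C$ such that $\|M_\mu f\|_{L^p(\mathbb R^d)}\le C\|f\|_{L^p(\mathbb R^d)}$ for all $f\in L^p(\mathbb R^d)$. Moreover, there is a constant $C$ such that $$\|M_\mu f\|_{L^{p_{(a,b)},\infty}(\mathbb R^d)}\le C\|f\|_{L^{p_{(a,b)},1}(\mathbb R^d)}$$ for all $f\in L^{p_{(a,b)},1}(\mathbb R^d)$.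
   Context: $B(x,r)$ is the ball of radius $r$ centered at $x$. For $t>0$, $\mu_t$ is the dilated measure defined by $(\mu_t,\phi)=\int\phi(ty)\,d\mu(y)$ for $\phi\in C_c(\mathbb R^d)$, so $f\ast\mu_t(x)=\int f(x-ty)\,d\mu(y)$. The Fourier transform is $\widehat\mu(\xi)=\int e^{-2\pi i x\cdot\xi}\,d\mu(x)$. $L^{p,r}(\mathbb R^d)$ denotes the Lorentz space with respect to Lebesgue measure. *)

theory Defs
  imports "HOL-Probability.Essential_Supremum"
begin

section \<open>Measures on Euclidean space\<close>

definition compactly_supported :: "'a::euclidean_space measure \<Rightarrow> bool" where
  "compactly_supported \<mu> \<longleftrightarrow> (\<exists>K. compact K \<and> emeasure \<mu> (- K) = 0)"

definition fourier_measure :: "'a::euclidean_space measure \<Rightarrow> 'a \<Rightarrow> complex" where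
  "fourier_measure \<mu> \<xi> = (\<integral>x. exp (- 2 * of_real pi * \<i> * of_real (x \<bullet> \<xi>)) \<partial>\<mu>)"

definition dilate :: "real \<Rightarrow> 'a::euclidean_space measure \<Rightarrow> 'a measure" where
  "dilate t \<mu> = distr \<mu> borel (\<lambda>y. t *\<^sub>R y)"

lemma integral_dilate:
  fixes \<phi> :: "'a::euclidean_space \<Rightarrow> complex"
  assumes "sets \<mu> = sets borel" and "\<phi> \<in> borel_measurable borel"
  shows "(\<integral>z. \<phi> z \<partial>dilate t \<mu>) = (\<integral>y. \<phi> (t *\<^sub>R y) \<partial>\<mu>)"
proof -
  have "(\<lambda>y. t *\<^sub>R y) \<in> measurable \<mu> borel"
    using assms(1) by (simp cong: measurable_cong_sets)
  then show ?thesis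
    unfolding dilate_def using assms(2) by (rule integral_distr)
qed

text \<open>
  The functions to which the maximal operator is applied are Lebesgue measurable, not necessarily
  Borel measurable. For such \<open>f\<close>, the function \<open>\<lambda>y. f (x - y)\<close> need only be measurable up to a
  \<open>\<nu>\<close>-null set, so the integral has to be taken with respect to the completion of \<open>\<nu>\<close>. For
  Borel measurable \<open>f\<close> the completion makes no difference.
  The Bochner integral is 0 where the integrand is not integrable, so \<open>convolution_exists\<close>
  records where the convolution is actually defined.
\<close>

definition convolution_exists ::
    "('a::euclidean_space \<Rightarrow> complex) \<Rightarrow> 'a measure \<Rightarrow> 'a \<Rightarrow> bool" where
  "convolution_exists f \<nu> x \<longleftrightarrow> integrable (completion \<nu>) (\<lambda>y. f (x - y))"

definition convolution :: "('a::euclidean_space \<Rightarrow> complex) \<Rightarrow> 'a measure \<Rightarrow> 'a \<Rightarrow> complex" where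
  "convolution f \<nu> x = (\<integral>y. f (x - y) \<partial>completion \<nu>)"

lemma convolution_dilate:
  fixes f :: "'a::euclidean_space \<Rightarrow> complex"
  assumes "sets \<mu> = sets borel" and [measurable]: "f \<in> borel_measurable borel"
  shows "convolution f (dilate t \<mu>) x = (\<integral>y. f (x - t *\<^sub>R y) \<partial>\<mu>)"
proof -
  have "(\<lambda>z. f (x - z)) \<in> borel_measurable borel"
    by measurable
  moreover from this have "(\<lambda>z. f (x - z)) \<in> borel_measurable (dilate t \<mu>)"
    by (simp add: dilate_def)
  ultimately show ?thesis
    using assms(1) by (simp add: convolution_def integral_completion integral_dilate)
qed

definition maximal_function ::
    "'a::euclidean_space measure \<Rightarrow> ('a \<Rightarrow> complex) \<Rightarrow> 'a \<Rightarrow> ennreal" where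
  "maximal_function \<mu> f x = (SUP t\<in>{0<..}. ennreal (cmod (convolution f (dilate t \<mu>) x)))"

definition critical_exponent :: "real \<Rightarrow> real \<Rightarrow> real \<Rightarrow> real" where
  "critical_exponent d a b = (2 * (d - b) + 2 * a - 1) / (d - b + 2 * a - 1)"


section \<open>Lebesgue and Lorentz spaces\<close>

text \<open>
  Norms are defined on functions with values in \<open>[0, \<infinity>]\<close>, so that they apply both to the modulus
  of a complex function and to a maximal function. They are meaningful only for Lebesgue
  measurable functions, because \<open>emeasure\<close> and the lower integral \<open>nn_integral\<close> are used.
\<close>

definition ennpowr :: "ennreal \<Rightarrow> real \<Rightarrow> ennreal" where
  \<comment> \<open>only used for \<open>r > 0\<close>\<close>
  "ennpowr u r = (if u = \<infinity> then \<infinity> else ennreal (enn2real u powr r))"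

definition Lp_norm :: "ennreal \<Rightarrow> ('a::euclidean_space \<Rightarrow> ennreal) \<Rightarrow> ennreal" where
  "Lp_norm p F =
    (if p = \<infinity> then esssup lebesgue F
     else ennpowr (\<integral>\<^sup>+x. ennpowr (F x) (enn2real p) \<partial>lebesgue) (1 / enn2real p))"

definition Lp_space :: "ennreal \<Rightarrow> ('a::euclidean_space \<Rightarrow> complex) set" where
  "Lp_space p = {f \<in> borel_measurable lebesgue. Lp_norm p (\<lambda>x. ennreal (cmod (f x))) < \<infinity>}"

definition decreasing_rearrangement :: "('a::euclidean_space \<Rightarrow> ennreal) \<Rightarrow> real \<Rightarrow> ennreal" where
  "decreasing_rearrangement F s = Inf {u. emeasure lebesgue {x. F x > u} \<le> ennreal s}"

text \<open>
  The usual quasinorm \<open>(\<integral>\<^sub>0\<^sup>\<infinity> (s\<^sup>1\<^sup>/\<^sup>p F\<^sup>*(s))\<^sup>r ds/s)\<^sup>1\<^sup>/\<^sup>r\<close> of \<open>L\<^sup>p\<^sup>,\<^sup>r\<close> for \<open>r < \<infinity>\<close>, and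
  \<open>sup\<^sub>s s\<^sup>1\<^sup>/\<^sup>p F\<^sup>*(s)\<close> for \<open>r = \<infinity>\<close>, where \<open>0 < p < \<infinity>\<close> and \<open>0 < r \<le> \<infinity>\<close>.
\<close>

definition Lorentz_norm :: "real \<Rightarrow> ennreal \<Rightarrow> ('a::euclidean_space \<Rightarrow> ennreal) \<Rightarrow> ennreal" where
  "Lorentz_norm p r F =
    (if r = \<infinity> then (SUP s\<in>{0<..}. ennreal (s powr (1 / p)) * decreasing_rearrangement F s)
     else ennpowr
       (\<integral>\<^sup>+s\<in>{0<..}. ennpowr (ennreal (s powr (1 / p)) * decreasing_rearrangement F s) (enn2real r)
          / ennreal s \<partial>lborel)
       (1 / enn2real r))"

definition Lorentz_space :: "real \<Rightarrow> ennreal \<Rightarrow> ('a::euclidean_space \<Rightarrow> complex) set" where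
  "Lorentz_space p r =
    {f \<in> borel_measurable lebesgue. Lorentz_norm p r (\<lambda>x. ennreal (cmod (f x))) < \<infinity>}"

end

(* Since mu has compact support it is dominated by a multiple of the Gaussian-weighted measure nu,
   whose Fourier transform and its radial derivative both decay like |xi|^(-a). Fix 0 < eps <= 1.
   The part of the average over t nu at frequencies below 1/(eps t) is an average against mu smeared
   at scale eps t; the growth of balls bounds it by eps^(b-d) times the Hardy-Littlewood maximal
   function. By Plancherel and a one-dimensional Sobolev inequality in t, the supremum over t of the
   rest has L^2 norm at most a constant times eps^(a-1/2) ||f||_2. For the indicator function of an
   open set U this gives |{M 1_U > l}| <= C (eps^(b-d)/l + eps^(2a-1)/l^2) |U|, and the choice
   eps^(d-b+2a-1) = c l turns the right-hand side into C l^(-p) |U|, where p is the critical exponent.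
   As weak L^p is normable for p > 1, decomposing f at dyadic heights yields the Lorentz estimate;
   the case p = 1 forces b = d, where mu has a bounded density. Summing the restricted estimates over
   the dyadic layers of f with geometric shares of the level gives the strong bounds above p. *)

theory Submission
  imports Defs "HOL-Probability.Probability"
begin

section \<open>Gaussians\<close>

text \<open>The measure and its dilates may charge Lebesgue-null sets and the supremum runs over
  uncountably many t, so no null set may be discarded before averaging: every majorant must hold at
  every point. This is why open sets carry the argument. Outer regularity supplies them, and Fatou's
  lemma makes the averages of their indicators lower semicontinuous, so that superlevel sets of the
  supremum are open. The transform of an indicator is square integrable but in general not
  integrable; the indicator is therefore smoothed at a scale \<eta>, all constants are kept free of
  \<eta>, and openness of U permits \<eta> to tend to 0. All cut-offs are Gaussian, hence explicit
  on both sides of the Fourier transform. The high frequency multiplier is (1 - exp (- pi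
  \<epsilon>^2 t^2 |\<xi>|^2)) ^ L: its binomial expansion leaves for the low frequencies a finite
  combination of Gaussian smoothings at scales at least \<epsilon> t. That the averages exist off
  one null set common to all t, and that the maximal function is measurable, is extracted from the
  maximal inequality itself, by approximating f with continuous functions.\<close>

definition gauss :: "'a::euclidean_space \<Rightarrow> real" where
  "gauss x = exp (- pi * (norm x)\<^sup>2)"

text \<open>The character of the inverse Fourier transform; \<open>fourier_measure\<close>
  integrates its conjugate.\<close>

definition wave :: "'a::euclidean_space \<Rightarrow> 'a \<Rightarrow> complex" where
  "wave x \<xi> = cis (2 * pi * (x \<bullet> \<xi>))"

lemma gauss_pos [simp]: "gauss x > 0" and gauss_nonneg [simp]: "gauss x \<ge> 0"
  and gauss_le_1 [simp]: "gauss x \<le> 1" and gauss_minus [simp]: "gauss (- x) = gauss x"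
  by (auto simp: gauss_def)

lemma gauss_measurable [measurable]: "gauss \<in> borel_measurable borel"
  unfolding gauss_def by measurable

lemma wave_measurable [measurable]:
  assumes [measurable]: "f \<in> borel_measurable M" "g \<in> borel_measurable M"
  shows "(\<lambda>x. wave (f x) (g x)) \<in> borel_measurable M"
  unfolding wave_def cis_conv_exp by measurable

lemma norm_wave [simp]: "norm (wave x \<xi>) = 1"
  by (simp add: wave_def)

lemma wave_add: "wave (x + y) \<xi> = wave x \<xi> * wave y \<xi>"
  by (simp add: wave_def inner_add_left distrib_left cis_mult)

lemma wave_minus_left: "wave (- x) \<xi> = cnj (wave x \<xi>)"
  by (simp add: wave_def cis_cnj)

lemma wave_minus_right: "wave x (- \<xi>) = cnj (wave x \<xi>)"
  by (simp add: wave_def cis_cnj)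

lemma wave_commute: "wave x \<xi> = wave \<xi> x"
  by (simp add: wave_def inner_commute)

text \<open>The substitution x -> sqrt (2 pi) x turns the standard normal density into exp (- pi
  x^2), so the transform is the characteristic function of the normal law at sqrt (2 pi)
  \<xi>.\<close>

lemma gauss_1d_integrable: "integrable lborel (\<lambda>x::real. exp (- pi * x\<^sup>2))"
  and gauss_1d_fourier:
    "(\<integral>x. exp (- pi * x\<^sup>2) *\<^sub>R cis (2 * pi * (x * \<xi>)) \<partial>lborel) = complex_of_real (exp (- pi * \<xi>\<^sup>2))"
proof -
  let ?c = "sqrt (2 * pi)"
  have c: "?c > 0" by simp
  have d: "std_normal_density (?c * x) * ?c = exp (- pi * x\<^sup>2)" for x :: real
    by (simp add: normal_density_def power_mult_distrib)
  have i1: "integrable lborel std_normal_density"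
    by simp
  have "integrable lborel (\<lambda>x. std_normal_density (0 + ?c * x))"
    using c i1 by (intro lborel_integrable_real_affine) auto
  then have "integrable lborel (\<lambda>x. std_normal_density (?c * x) * ?c)"
    by simp
  then show "integrable lborel (\<lambda>x::real. exp (- pi * x\<^sup>2))"
    by (simp only: d)
  have "complex_of_real (exp (- pi * \<xi>\<^sup>2)) = char std_normal_distribution (?c * \<xi>)"
    by (simp add: char_std_normal_distribution power_mult_distrib)
  also have "\<dots> = (\<integral>x. std_normal_density x *\<^sub>R iexp (?c * \<xi> * x) \<partial>lborel)"
    unfolding char_def by (subst integral_density) (auto simp: )
  also have "\<dots> = \<bar>?c\<bar> *\<^sub>R (\<integral>x. std_normal_density (0 + ?c * x) *\<^sub>R iexp (?c * \<xi> * (0 + ?c * x)) \<partial>lborel)"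
    using c by (intro lborel_integral_real_affine) auto
  also have "\<dots> = ?c *\<^sub>R (\<integral>x. std_normal_density (?c * x) *\<^sub>R iexp (?c * \<xi> * (?c * x)) \<partial>lborel)"
    using c by simp
  also have "\<dots> = (\<integral>x. ?c *\<^sub>R (std_normal_density (?c * x) *\<^sub>R iexp (?c * \<xi> * (?c * x))) \<partial>lborel)"
    by (rule integral_scaleR_right[symmetric])
  also have "\<dots> = (\<integral>x. exp (- pi * x\<^sup>2) *\<^sub>R cis (2 * pi * (x * \<xi>)) \<partial>lborel)"
  proof (rule Bochner_Integration.integral_cong[OF refl])
    fix x :: real
    have e: "?c * \<xi> * (?c * x) = 2 * pi * (x * \<xi>)"
    proof -
      have "?c * \<xi> * (?c * x) = (?c * ?c) * (x * \<xi>)" by (simp only: mult_ac)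
      then show ?thesis by (simp del: real_sqrt_mult)
    qed
    have "?c *\<^sub>R (std_normal_density (?c * x) *\<^sub>R iexp (?c * \<xi> * (?c * x))) =
      (std_normal_density (?c * x) * ?c) *\<^sub>R iexp (?c * \<xi> * (?c * x))"
      by (simp add: mult.commute)
    also have "\<dots> = exp (- pi * x\<^sup>2) *\<^sub>R cis (2 * pi * (x * \<xi>))"
      unfolding d e cis_conv_exp by simp
    finally show "?c *\<^sub>R (std_normal_density (?c * x) *\<^sub>R iexp (?c * \<xi> * (?c * x))) =
      exp (- pi * x\<^sup>2) *\<^sub>R cis (2 * pi * (x * \<xi>))" .
  qed
  finally show "(\<integral>x. exp (- pi * x\<^sup>2) *\<^sub>R cis (2 * pi * (x * \<xi>)) \<partial>lborel) = complex_of_real (exp (- pi * \<xi>\<^sup>2))"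
    by simp
qed

text \<open>Lebesgue measure is the image of a product measure under the coordinate map, so the
  product formulas for integrals carry over. Both \<open>gauss\<close> and \<open>wave\<close> split
  over the basis in this way.\<close>

lemma integral_lborel_prod:
  fixes f :: "'a::euclidean_space \<Rightarrow> real \<Rightarrow> 'b::{real_normed_field,banach,second_countable_topology}"
  assumes f: "\<And>b. b \<in> Basis \<Longrightarrow> integrable lborel (f b)"
  shows "integrable lborel (\<lambda>x::'a. \<Prod>b\<in>Basis. f b (x \<bullet> b))"
    and "(\<integral>x. (\<Prod>b\<in>Basis. f b (x \<bullet> b)) \<partial>lborel) = (\<Prod>b\<in>Basis. \<integral>x. f b x \<partial>lborel)"
proof -
  interpret product_sigma_finite "\<lambda>b::'a. lborel :: real measure"
    by standard
  have m [measurable]: "f b \<in> borel_measurable borel" if "b \<in> Basis" for b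
    using borel_measurable_integrable[OF f[OF that]] by simp
  have m': "(\<lambda>x::'a. \<Prod>b\<in>Basis. f b (x \<bullet> b)) \<in> borel_measurable borel"
    by measurable
  have eq: "(\<Prod>b\<in>Basis. f b ((\<Sum>c\<in>Basis. g c *\<^sub>R c) \<bullet> b)) = (\<Prod>b\<in>Basis. f b (g b))" for g :: "'a \<Rightarrow> real"
    by (intro prod.cong refl arg_cong2[where f=f]) (simp add: inner_sum_left_Basis)
  have mt: "(\<lambda>g::'a \<Rightarrow> real. \<Sum>b\<in>Basis. g b *\<^sub>R b) \<in> measurable (\<Pi>\<^sub>M b\<in>Basis. lborel) borel"
    by measurable
  have i: "integrable (\<Pi>\<^sub>M b\<in>Basis. lborel) (\<lambda>g::'a \<Rightarrow> real. \<Prod>b\<in>Basis. f b (g b))"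
    using f by (intro product_integrable_prod) auto
  show "integrable lborel (\<lambda>x::'a. \<Prod>b\<in>Basis. f b (x \<bullet> b))"
    unfolding lborel_eq[where 'a='a] using m' mt i
    by (subst integrable_distr_eq) (simp_all only: eq)
  show "(\<integral>x. (\<Prod>b\<in>Basis. f b (x \<bullet> b)) \<partial>lborel) = (\<Prod>b\<in>Basis. \<integral>x. f b x \<partial>lborel)"
    unfolding lborel_eq[where 'a='a] using m' mt
    by (subst integral_distr) (simp_all only: eq product_integral_prod[OF finite_Basis f])
qed

lemma gauss_prod: "gauss x = (\<Prod>b\<in>Basis. exp (- pi * (x \<bullet> b)\<^sup>2))" for x :: "'a::euclidean_space"
proof -
  have "(norm x)\<^sup>2 = (\<Sum>b\<in>Basis. (x \<bullet> b)\<^sup>2)"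
    unfolding power2_norm_eq_inner by (subst euclidean_inner) (simp add: power2_eq_square)
  then show ?thesis
    by (simp add: gauss_def exp_sum[symmetric] sum_distrib_left)
qed

lemma wave_prod: "wave x \<xi> = (\<Prod>b\<in>Basis. cis (2 * pi * ((x \<bullet> b) * (\<xi> \<bullet> b))))" for x :: "'a::euclidean_space"
proof -
  have "2 * pi * (x \<bullet> \<xi>) = (\<Sum>b\<in>Basis. 2 * pi * ((x \<bullet> b) * (\<xi> \<bullet> b)))"
    by (subst euclidean_inner) (simp add: sum_distrib_left)
  then show ?thesis
    by (simp add: wave_def cis_conv_exp exp_sum[symmetric] sum_distrib_left)
qed

lemma gauss_integrable [simp]: "integrable lborel (gauss :: 'a::euclidean_space \<Rightarrow> real)"
  using integral_lborel_prod(1)[of "\<lambda>(b::'a) x. exp (- pi * x\<^sup>2)"] gauss_1d_integrable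
  by (simp add: gauss_prod[abs_def])

text \<open>The factor pi in \<open>gauss\<close> is chosen for this: the Gaussian is its own
  transform, and \<xi> = 0 shows that its total mass is 1.\<close>

lemma gauss_fourier:
  "(\<integral>x. gauss x *\<^sub>R wave x \<xi> \<partial>lborel) = complex_of_real (gauss \<xi>)" for \<xi> :: "'a::euclidean_space"
proof -
  let ?f = "\<lambda>(b::'a) x. complex_of_real (exp (- pi * x\<^sup>2)) * cis (2 * pi * (x * (\<xi> \<bullet> b)))"
  have i: "integrable lborel (?f b)" for b
    by (rule Bochner_Integration.integrable_bound[OF gauss_1d_integrable])
       (auto simp: norm_mult cis_conv_exp)
  have "(\<integral>x. gauss x *\<^sub>R wave x \<xi> \<partial>lborel) = (\<integral>x. (\<Prod>b\<in>Basis. ?f b (x \<bullet> b)) \<partial>lborel)"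
    by (simp add: gauss_prod wave_prod scaleR_conv_of_real prod.distrib)
  also have "\<dots> = (\<Prod>b\<in>Basis. \<integral>x. ?f b x \<partial>lborel)"
    using i by (intro integral_lborel_prod)
  also have "\<dots> = (\<Prod>b\<in>Basis. complex_of_real (exp (- pi * (\<xi> \<bullet> b)\<^sup>2)))"
    using gauss_1d_fourier by (simp add: scaleR_conv_of_real)
  finally show ?thesis
    by (simp add: gauss_prod)
qed

lemma integral_gauss [simp]: "(\<integral>x. gauss x \<partial>(lborel :: 'a::euclidean_space measure)) = 1"
proof -
  have "complex_of_real (\<integral>x. gauss (x::'a) \<partial>lborel) = (\<integral>x. complex_of_real (gauss (x::'a)) \<partial>lborel)"
    by simp
  also have "\<dots> = complex_of_real (gauss (0::'a))"
    by (subst gauss_fourier[symmetric]) (simp add: wave_def scaleR_conv_of_real)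
  finally show ?thesis by (simp add: gauss_def)
qed

lemma nn_integral_gauss [simp]: "(\<integral>\<^sup>+x. ennreal (gauss x) \<partial>(lborel :: 'a::euclidean_space measure)) = 1"
  by (subst nn_integral_eq_integral) auto

section \<open>Affine substitutions and Gaussian moments\<close>

lemma nn_integral_lborel_affine:
  fixes f :: "'a::euclidean_space \<Rightarrow> ennreal"
  assumes [measurable]: "f \<in> borel_measurable borel" and c: "c \<noteq> 0"
  shows "(\<integral>\<^sup>+x. f x \<partial>lborel) = ennreal (\<bar>c\<bar> ^ DIM('a)) * (\<integral>\<^sup>+x. f (t + c *\<^sub>R x) \<partial>lborel)"
  by (subst lborel_affine[OF c, of t])
     (simp add: nn_integral_density nn_integral_distr nn_integral_cmult)

lemma integrable_lborel_affine:
  fixes f :: "'a::euclidean_space \<Rightarrow> 'b::{banach,second_countable_topology}"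
  assumes f: "integrable lborel f" and c: "c \<noteq> 0"
  shows "integrable lborel (\<lambda>x. f (t + c *\<^sub>R x))"
proof -
  have [measurable]: "f \<in> borel_measurable borel"
    using f by auto
  have "(\<integral>\<^sup>+x. norm (f x) \<partial>lborel) = ennreal (\<bar>c\<bar> ^ DIM('a)) * (\<integral>\<^sup>+x. norm (f (t + c *\<^sub>R x)) \<partial>lborel)"
    using c by (intro nn_integral_lborel_affine) auto
  moreover have "(\<integral>\<^sup>+x. norm (f x) \<partial>lborel) < \<infinity>"
    using f by (simp add: integrable_iff_bounded)
  ultimately show ?thesis
    using c zero_less_power[of "\<bar>c\<bar>" "DIM('a)"]
    by (auto simp add: integrable_iff_bounded ennreal_mult_less_top ennreal_eq_0_iff linorder_not_less[symmetric]
      simp del: power_abs zero_less_power_abs_iff not_less)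
qed

lemma integral_lborel_affine:
  fixes f :: "'a::euclidean_space \<Rightarrow> 'b::{banach,second_countable_topology}"
  assumes [measurable]: "f \<in> borel_measurable borel" and c: "c \<noteq> 0"
  shows "(\<integral>x. f x \<partial>lborel) = \<bar>c\<bar> ^ DIM('a) *\<^sub>R (\<integral>x. f (t + c *\<^sub>R x) \<partial>lborel)"
  by (subst lborel_affine[OF c, of t])
     (simp add: integral_density integral_distr)

lemma nn_integral_lborel_reflect:
  fixes f :: "'a::euclidean_space \<Rightarrow> ennreal"
  assumes [measurable]: "f \<in> borel_measurable borel"
  shows "(\<integral>\<^sup>+x. f (t - x) \<partial>lborel) = (\<integral>\<^sup>+x. f x \<partial>lborel)"
  using nn_integral_lborel_affine[OF assms, of "-1" t] by simp

lemma integrable_lborel_reflect: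
  fixes f :: "'a::euclidean_space \<Rightarrow> 'b::{banach,second_countable_topology}"
  assumes "integrable lborel f"
  shows "integrable lborel (\<lambda>x. f (t - x))"
  using integrable_lborel_affine[OF assms, of "-1" t] by simp

text \<open>A Gaussian of width 1 / s has as transform the bump of width s and mass 1. It serves
  both as an approximate identity in frequency and as the smoothing kernel in space.\<close>

lemma gauss_fourier_scaled:
  fixes x :: "'a::euclidean_space"
  assumes s: "s > 0"
  shows "(\<integral>\<xi>. gauss (s *\<^sub>R \<xi>) *\<^sub>R wave x \<xi> \<partial>lborel) = complex_of_real (gauss (x /\<^sub>R s) / s ^ DIM('a))"
proof -
  have "complex_of_real (gauss (x /\<^sub>R s)) = (\<integral>\<xi>. gauss \<xi> *\<^sub>R wave (x /\<^sub>R s) \<xi> \<partial>lborel)"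
    by (subst wave_commute, subst gauss_fourier) simp
  also have "\<dots> = \<bar>s\<bar> ^ DIM('a) *\<^sub>R (\<integral>\<xi>. gauss (0 + s *\<^sub>R \<xi>) *\<^sub>R wave (x /\<^sub>R s) (0 + s *\<^sub>R \<xi>) \<partial>lborel)"
    using s by (intro integral_lborel_affine) auto
  also have "\<dots> = s ^ DIM('a) *\<^sub>R (\<integral>\<xi>. gauss (s *\<^sub>R \<xi>) *\<^sub>R wave x \<xi> \<partial>lborel)"
  proof -
    have "s * (inverse s * z) = z" for z using s by simp
    note this[simp]
    show ?thesis using s by (simp add: wave_def)
  qed
  finally show ?thesis
    using s by (simp add: scaleR_conv_of_real field_simps)
qed

lemma gauss_scaled_integrable:
  assumes "s \<noteq> 0"
  shows "integrable lborel (\<lambda>x::'a::euclidean_space. gauss (s *\<^sub>R x))"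
  using integrable_lborel_affine[OF gauss_integrable assms, of 0] by simp

text \<open>The n-th term of the exponential series at c (1 + v), for a natural n at least k,
  already dominates; the shift by 1 costs the factor exp c in the constant.\<close>

lemma powr_le_exp:
  fixes k c :: real
  assumes c: "c > 0"
  obtains C where "C \<ge> 0" "\<And>v::real. v \<ge> 0 \<Longrightarrow> (1 + v) powr k \<le> C * exp (c * v)"
proof -
  obtain n :: nat where n: "k \<le> real n"
    using real_arch_simple by blast
  let ?C = "fact n / c ^ n * exp c"
  have "(1 + v) powr k \<le> ?C * exp (c * v)" if v: "v \<ge> 0" for v
  proof -
    have "(1 + v) powr k \<le> (1 + v) powr real n"
      using v n by (intro powr_mono) auto
    also have "\<dots> = (1 + v) ^ n"
      using v by (simp add: powr_realpow)
    also have "\<dots> = (fact n / c ^ n) * ((c * (1 + v)) ^ n / fact n)"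
      using c by (simp add: power_mult_distrib)
    also have "\<dots> \<le> (fact n / c ^ n) * exp (c * (1 + v))"
    proof (rule mult_left_mono)
      have "c * (1 + v) \<ge> 0" using c v by simp
      from exp_lower_Taylor_quadratic this
      have "(c * (1 + v)) ^ n /\<^sub>R fact n \<le> (\<Sum>m. (c * (1 + v)) ^ m /\<^sub>R fact m)"
        using summable_exp_generic[of "c * (1 + v)"] \<open>c * (1 + v) \<ge> 0\<close>
        by (intro sum_le_suminf[where I="{n}", simplified]) auto
      then show "(c * (1 + v)) ^ n / fact n \<le> exp (c * (1 + v))"
        by (simp add: exp_def field_simps)
    qed (use c in auto)
    also have "\<dots> = ?C * exp (c * v)"
      by (simp add: distrib_left exp_add)
    finally show ?thesis .
  qed
  moreover have "?C \<ge> 0" using c by simp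
  ultimately show ?thesis using that by blast
qed

text \<open>A multiple of exp v pays for the polynomial weight, and v - pi v^2 is at most 1 - pi v^2
  / 4, so a wider Gaussian is an integrable majorant.\<close>

lemma gauss_moment:
  fixes k :: real
  assumes k: "k \<ge> 0"
  shows "integrable lborel (\<lambda>w::'a::euclidean_space. (1 + norm w) powr k * gauss w)"
proof -
  obtain C where C: "C \<ge> 0" "\<And>v::real. v \<ge> 0 \<Longrightarrow> (1 + v) powr k \<le> C * exp (1 * v)"
    using powr_le_exp[of 1] by auto
  have *: "(1 + norm w) powr k * gauss w \<le> (C * exp 1) * gauss ((1/2) *\<^sub>R w)" for w :: 'a
  proof -
    define v where "v = norm w"
    have v: "v \<ge> 0" by (simp add: v_def)
    have "v - pi * v\<^sup>2 \<le> 1 - pi * (v / 2)\<^sup>2"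
    proof -
      have "pi * v\<^sup>2 \<ge> 3 * v\<^sup>2" using pi_gt3 by (intro mult_right_mono) auto
      then have "1 - v + (3/4) * (pi * v\<^sup>2) \<ge> 1 - v + (9/4) * v\<^sup>2" by simp
      moreover have "1 - v + (9/4) * v\<^sup>2 = (1 - v / 2)\<^sup>2 + 2 * v\<^sup>2" by (simp add: power2_eq_square algebra_simps)
      ultimately have "1 - v + (3/4) * (pi * v\<^sup>2) \<ge> 0" by (smt (verit) zero_le_power2)
      then show ?thesis by (simp add: power2_eq_square algebra_simps)
    qed
    then have "exp v * exp (- pi * v\<^sup>2) \<le> exp 1 * exp (- pi * (v / 2)\<^sup>2)"
      by (simp add: exp_add[symmetric])
    then have "C * exp v * exp (- pi * v\<^sup>2) \<le> C * exp 1 * exp (- pi * (v / 2)\<^sup>2)"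
      using C(1) by (simp add: mult_left_mono mult.assoc)
    moreover have "(1 + v) powr k * exp (- pi * v\<^sup>2) \<le> C * exp v * exp (- pi * v\<^sup>2)"
      using C(2)[OF v] by (intro mult_right_mono) auto
    ultimately have "(1 + v) powr k * exp (- pi * v\<^sup>2) \<le> C * exp 1 * exp (- pi * (v / 2)\<^sup>2)"
      by linarith
    then show ?thesis by (simp add: gauss_def v_def)
  qed
  have "integrable lborel (\<lambda>w::'a. (C * exp 1) * gauss ((1/2) *\<^sub>R w))"
    using gauss_scaled_integrable[of "1/2"] by (intro integrable_mult_right) auto
  then show ?thesis
  proof (rule Bochner_Integration.integrable_bound)
    show "AE w::'a in lborel. norm ((1 + norm w) powr k * gauss w) \<le> norm ((C * exp 1) * gauss ((1/2) *\<^sub>R w))"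
      using * C(1) by (intro always_eventually) (auto simp: abs_mult)
  qed measurable
qed

section \<open>Bessel's inequality and the Hardy--Littlewood maximal function\<close>

lemma cnj_measurable [measurable]:
  assumes [measurable]: "f \<in> borel_measurable M"
  shows "(\<lambda>x. cnj (f x)) \<in> borel_measurable M"
proof -
  have [measurable]: "cnj \<in> borel_measurable borel"
    by (intro borel_measurable_continuous_onI continuous_intros)
  show ?thesis by measurable
qed

text \<open>Most integrands below are products of integrable functions of one variable each, up to a
  factor of bounded modulus. A product majorant is then all that the interchange requires.\<close>

lemma (in pair_sigma_finite) Fubini_product_bound:
  fixes f :: "'a \<Rightarrow> 'b \<Rightarrow> complex" and u :: "'a \<Rightarrow> real" and v :: "'b \<Rightarrow> real"
  assumes f: "case_prod f \<in> borel_measurable (M1 \<Otimes>\<^sub>M M2)"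
    and u: "integrable M1 u" and v: "integrable M2 v"
    and le: "\<And>x y. x \<in> space M1 \<Longrightarrow> y \<in> space M2 \<Longrightarrow> cmod (f x y) \<le> u x * v y"
  shows "integrable (M1 \<Otimes>\<^sub>M M2) (case_prod f)"
    and "(\<integral>y. (\<integral>x. f x y \<partial>M1) \<partial>M2) = (\<integral>x. (\<integral>y. f x y \<partial>M2) \<partial>M1)"
proof -
  note [measurable] = f
  have [measurable]: "u \<in> borel_measurable M1" "v \<in> borel_measurable M2"
    using u v by auto
  have i: "integrable M2 (\<lambda>y. f x y)" if x: "x \<in> space M1" for x
  proof (rule Bochner_Integration.integrable_bound)
    show "integrable M2 (\<lambda>y. u x * v y)" using v by simp
    show "(\<lambda>y. f x y) \<in> borel_measurable M2"
      using measurable_Pair2[OF f x] by simp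
    show "AE y in M2. norm (f x y) \<le> norm (u x * v y)"
      using le[OF x] by (intro AE_I2) (metis abs_ge_self order_trans real_norm_def)
  qed
  show I: "integrable (M1 \<Otimes>\<^sub>M M2) (case_prod f)"
  proof (rule Fubini_integrable)
    show "case_prod f \<in> borel_measurable (M1 \<Otimes>\<^sub>M M2)" by (fact f)
    show "AE x in M1. integrable M2 (\<lambda>y. case (x, y) of (x, y) \<Rightarrow> f x y)"
      using i by (intro AE_I2) auto
    show "integrable M1 (\<lambda>x. \<integral>y. norm (case (x, y) of (x, y) \<Rightarrow> f x y) \<partial>M2)"
    proof (rule Bochner_Integration.integrable_bound)
      show "integrable M1 (\<lambda>x. u x * (\<integral>y. v y \<partial>M2))" using u by simp
      show "(\<lambda>x. \<integral>y. norm (case (x, y) of (x, y) \<Rightarrow> f x y) \<partial>M2) \<in> borel_measurable M1"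
        by measurable
      show "AE x in M1. norm (\<integral>y. norm (case (x, y) of (x, y) \<Rightarrow> f x y) \<partial>M2) \<le> norm (u x * (\<integral>y. v y \<partial>M2))"
      proof (rule AE_I2)
        fix x assume x: "x \<in> space M1"
        have "norm (\<integral>y. norm (f x y) \<partial>M2) = (\<integral>y. norm (f x y) \<partial>M2)"
          by simp
        also have "\<dots> \<le> (\<integral>y. u x * v y \<partial>M2)"
          using i[OF x] v le[OF x] by (intro integral_mono) auto
        also have "\<dots> \<le> norm (u x * (\<integral>y. v y \<partial>M2))" by simp
        finally show "norm (\<integral>y. norm (case (x, y) of (x, y) \<Rightarrow> f x y) \<partial>M2) \<le> norm (u x * (\<integral>y. v y \<partial>M2))"
          by simp
      qed
    qed
  qed
  then show "(\<integral>y. (\<integral>x. f x y \<partial>M1) \<partial>M2) = (\<integral>x. (\<integral>y. f x y \<partial>M2) \<partial>M1)"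
    by (rule Fubini_integral)
qed

text \<open>Damping by a Gaussian in x makes the integral of the squared modulus absolutely
  convergent, so it can be expanded as a double integral over frequencies and the x-integral done
  first. This leaves a convolution kernel of mass 1, and Schur's test finishes.\<close>

lemma bessel_gauss:
  fixes h :: "'a::euclidean_space \<Rightarrow> complex"
  assumes h: "integrable lborel h" and r: "r > 0"
  shows "(\<integral>\<^sup>+x. ennreal ((cmod (\<integral>\<xi>. h \<xi> * wave x \<xi> \<partial>lborel))\<^sup>2 * gauss (r *\<^sub>R x)) \<partial>lborel)
    \<le> (\<integral>\<^sup>+\<xi>. ennreal ((cmod (h \<xi>))\<^sup>2) \<partial>lborel)"
proof -
  define F where "F x = (\<integral>\<xi>. h \<xi> * wave x \<xi> \<partial>lborel)" for x
  \<comment> \<open>The transform of the damping factor gauss (r x): a bump of width r and mass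
    1.\<close>
  define k where "k z = gauss (z /\<^sub>R r) / r ^ DIM('a)" for z :: 'a
  have k_nonneg: "k z \<ge> 0" for z using r by (simp add: k_def)
  have [measurable]: "h \<in> borel_measurable borel" using h by auto
  have [measurable]: "k \<in> borel_measurable borel" unfolding k_def by measurable
  have [measurable]: "F \<in> borel_measurable borel" unfolding F_def by measurable
  have ih: "integrable lborel (\<lambda>\<xi>. cmod (h \<xi>))" using h by simp
  have k1: "(\<integral>\<^sup>+\<xi>. ennreal (k \<xi>) \<partial>lborel) = 1"
  proof -
    have "(\<integral>\<^sup>+\<xi>. ennreal (k \<xi>) \<partial>lborel) = ennreal (\<bar>r\<bar> ^ DIM('a)) * (\<integral>\<^sup>+\<xi>. ennreal (k (0 + r *\<^sub>R \<xi>)) \<partial>(lborel :: 'a measure))"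
      using r by (intro nn_integral_lborel_affine) auto
    also have "\<dots> = (\<integral>\<^sup>+\<xi>. ennreal (\<bar>r\<bar> ^ DIM('a)) * ennreal (k (0 + r *\<^sub>R \<xi>)) \<partial>(lborel :: 'a measure))"
      by (rule nn_integral_cmult[symmetric]) measurable
    also have "\<dots> = (\<integral>\<^sup>+\<xi>. ennreal (gauss \<xi>) \<partial>(lborel :: 'a measure))"
      using r by (intro nn_integral_cong) (simp add: k_def ennreal_mult[symmetric])
    finally show ?thesis by simp
  qed
  have k_refl: "k (\<xi> - \<zeta>) = k (\<zeta> - \<xi>)" for \<xi> \<zeta>
    unfolding k_def by (metis gauss_minus minus_diff_eq scaleR_minus_right)
  have k2: "(\<integral>\<^sup>+\<xi>. ennreal (k (\<zeta> - \<xi>)) \<partial>lborel) = 1" for \<zeta>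
    using nn_integral_lborel_reflect[of "\<lambda>\<xi>. ennreal (k \<xi>)" \<zeta>] k1 by simp
  define H where "H p = h (fst p) * cnj (h (snd p))" for p
  have [measurable]: "H \<in> borel_measurable borel" unfolding H_def borel_prod[symmetric] by measurable
  have iH0: "integrable (lborel \<Otimes>\<^sub>M lborel) (\<lambda>(x, y). h x * cnj (h y))"
    by (rule lborel_pair.Fubini_product_bound[of _ "\<lambda>x. cmod (h x)" "\<lambda>x. cmod (h x)"]) (auto intro!: ih simp: norm_mult)
  have iH: "integrable lborel H"
    using iH0 by (simp add: lborel_prod H_def[abs_def] split_beta')
  have iw: "integrable lborel (\<lambda>\<xi>. h \<xi> * wave x \<xi>)" for x
    by (rule Bochner_Integration.integrable_bound[OF ih]) (auto simp: norm_mult)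
  have FF: "F x * cnj (F x) = (\<integral>p. H p * wave x (fst p - snd p) \<partial>lborel)" for x
  proof -
    have i: "integrable (lborel \<Otimes>\<^sub>M lborel) (\<lambda>(\<xi>, \<zeta>). (h \<xi> * wave x \<xi>) * cnj (h \<zeta> * wave x \<zeta>))"
      by (rule lborel_pair.Fubini_product_bound[of _ "\<lambda>x. cmod (h x)" "\<lambda>x. cmod (h x)"]) (auto intro!: ih simp: norm_mult)
    have "F x * cnj (F x) = (\<integral>\<xi>. (\<integral>\<zeta>. (h \<xi> * wave x \<xi>) * cnj (h \<zeta> * wave x \<zeta>) \<partial>lborel) \<partial>lborel)"
    proof -
      have "cnj (F x) = (\<integral>\<zeta>. cnj (h \<zeta> * wave x \<zeta>) \<partial>lborel)"
        unfolding F_def by (rule Bochner_Integration.integral_cnj[symmetric])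
      then show ?thesis
        using iw[of x] unfolding F_def by (simp del: complex_cnj_mult Bochner_Integration.integral_cnj)
    qed
    also have "\<dots> = (\<integral>p. (case p of (\<xi>, \<zeta>) \<Rightarrow> (h \<xi> * wave x \<xi>) * cnj (h \<zeta> * wave x \<zeta>)) \<partial>(lborel \<Otimes>\<^sub>M lborel))"
      using lborel_pair.integral_fst[OF i] by simp
    also have "\<dots> = (\<integral>p. H p * wave x (fst p - snd p) \<partial>(lborel \<Otimes>\<^sub>M lborel))"
      by (intro Bochner_Integration.integral_cong)
         (auto simp: H_def wave_commute[of x] wave_add[of _ "- _", simplified] wave_minus_left)
    finally show ?thesis by (simp add: lborel_prod)
  qed
  have Fle: "cmod (F x) \<le> (\<integral>\<xi>. cmod (h \<xi>) \<partial>lborel)" for x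
    unfolding F_def using integral_norm_bound[of lborel "\<lambda>\<xi>. h \<xi> * wave x \<xi>"] by (simp add: norm_mult)
  have igr: "integrable lborel (\<lambda>x::'a. gauss (r *\<^sub>R x))"
    using r by (intro gauss_scaled_integrable) auto
  have iF: "integrable lborel (\<lambda>x. (cmod (F x))\<^sup>2 * gauss (r *\<^sub>R x))"
  proof (rule Bochner_Integration.integrable_bound)
    show "integrable lborel (\<lambda>x::'a. (\<integral>\<xi>. cmod (h \<xi>) \<partial>lborel)\<^sup>2 * gauss (r *\<^sub>R x))"
      using igr by simp
    show "AE x in lborel. norm ((cmod (F x))\<^sup>2 * gauss (r *\<^sub>R x)) \<le> norm ((\<integral>\<xi>. cmod (h \<xi>) \<partial>lborel)\<^sup>2 * gauss (r *\<^sub>R x))"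
      using Fle by (intro AE_I2) (auto simp: abs_mult intro!: mult_right_mono power_mono)
  qed measurable
  let ?J = "\<integral>x. (cmod (F x))\<^sup>2 * gauss (r *\<^sub>R x) \<partial>lborel"
  have "complex_of_real ?J = (\<integral>x. complex_of_real ((cmod (F x))\<^sup>2 * gauss (r *\<^sub>R x)) \<partial>lborel)"
    by (rule Bochner_Integration.integral_complex_of_real[symmetric])
  also have "\<dots> = (\<integral>x. (\<integral>p. H p * wave x (fst p - snd p) * gauss (r *\<^sub>R x) \<partial>lborel) \<partial>lborel)"
    by (intro Bochner_Integration.integral_cong refl)
       (simp add: FF[symmetric] complex_norm_square[symmetric])
  \<comment> \<open>The pair of frequencies is treated as one variable p, so a single product
    majorant, a Gaussian in x times |H p|, justifies the interchange.\<close>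
  also have "\<dots> = (\<integral>p. (\<integral>x. H p * wave x (fst p - snd p) * gauss (r *\<^sub>R x) \<partial>lborel) \<partial>lborel)"
  proof (rule lborel_pair.Fubini_product_bound(2)[symmetric, of "\<lambda>x p. H p * wave x (fst p - snd p) * gauss (r *\<^sub>R x)" "\<lambda>x. gauss (r *\<^sub>R x)" "\<lambda>p. cmod (H p)"])
    show "(\<lambda>(x, p). H p * wave x (fst p - snd p) * gauss (r *\<^sub>R x)) \<in> borel_measurable (lborel \<Otimes>\<^sub>M lborel)"
    proof -
      have [measurable]: "fst \<in> borel_measurable (lborel :: ('a \<times> 'a) measure)" "snd \<in> borel_measurable (lborel :: ('a \<times> 'a) measure)"
        by (auto intro!: borel_measurable_continuous_onI continuous_intros)
      show ?thesis by measurable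
    qed
  qed (use igr iH in \<open>auto simp: norm_mult\<close>)
  also have "\<dots> = (\<integral>p. H p * k (fst p - snd p) \<partial>lborel)"
  proof (intro Bochner_Integration.integral_cong refl)
    fix p :: "'a \<times> 'a"
    have "(\<integral>x. H p * wave x (fst p - snd p) * gauss (r *\<^sub>R x) \<partial>lborel) =
       (\<integral>x. H p * (gauss (r *\<^sub>R x) *\<^sub>R wave (fst p - snd p) x) \<partial>lborel)"
      by (intro Bochner_Integration.integral_cong refl) (simp add: scaleR_conv_of_real wave_commute mult_ac)
    also have "\<dots> = H p * k (fst p - snd p)"
      by (subst integral_mult_right_zero, subst gauss_fourier_scaled[OF r]) (simp add: k_def)
    finally show "(\<integral>x. H p * wave x (fst p - snd p) * gauss (r *\<^sub>R x) \<partial>lborel) = H p * k (fst p - snd p)" .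
  qed
  finally have J: "complex_of_real ?J = (\<integral>p. H p * k (fst p - snd p) \<partial>lborel)" .
  have "(\<integral>\<^sup>+x. ennreal ((cmod (F x))\<^sup>2 * gauss (r *\<^sub>R x)) \<partial>lborel) = ennreal ?J"
    using iF by (intro nn_integral_eq_integral) auto
  also have "ennreal ?J \<le> ennreal (cmod (complex_of_real ?J))"
    by (intro ennreal_leI) (simp only: norm_of_real abs_ge_self)
  also have "\<dots> = ennreal (cmod (\<integral>p. H p * k (fst p - snd p) \<partial>lborel))"
    by (simp only: J)
  also have "\<dots> \<le> (\<integral>\<^sup>+p. ennreal (cmod (H p * k (fst p - snd p))) \<partial>lborel)"
    by (cases "integrable lborel (\<lambda>p. H p * k (fst p - snd p))")
       (auto intro!: integral_norm_bound_ennreal simp: not_integrable_integral_eq)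
  also have "\<dots> = (\<integral>\<^sup>+p. ennreal (cmod (H p * k (fst p - snd p))) \<partial>(lborel \<Otimes>\<^sub>M lborel))"
    by (simp add: lborel_prod)
  \<comment> \<open>Schur's test: |h(\<xi>) h(\<zeta>)| is at most half the sum of the squares, and
    integrating \<open>k\<close> in the remaining variable gives 1.\<close>
  also have "\<dots> \<le> (\<integral>\<^sup>+p. (ennreal ((cmod (h (fst p)))\<^sup>2 / 2) * ennreal (k (fst p - snd p))
        + ennreal ((cmod (h (snd p)))\<^sup>2 / 2) * ennreal (k (fst p - snd p))) \<partial>(lborel \<Otimes>\<^sub>M lborel))"
  proof (rule nn_integral_mono)
    fix p :: "'a \<times> 'a"
    let ?u = "cmod (h (fst p))" and ?v = "cmod (h (snd p))"
    have "?u * ?v \<le> ?u\<^sup>2 / 2 + ?v\<^sup>2 / 2"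
      using sum_squares_bound[of ?u ?v] by simp
    then have "?u * ?v * k (fst p - snd p) \<le> (?u\<^sup>2 / 2 + ?v\<^sup>2 / 2) * k (fst p - snd p)"
      using k_nonneg by (intro mult_right_mono) auto
    then have "ennreal (cmod (H p * k (fst p - snd p))) \<le> ennreal (?u\<^sup>2 / 2 * k (fst p - snd p) + ?v\<^sup>2 / 2 * k (fst p - snd p))"
      using k_nonneg by (intro ennreal_leI) (simp add: H_def norm_mult distrib_right)
    then show "ennreal (cmod (H p * k (fst p - snd p))) \<le> ennreal (?u\<^sup>2 / 2) * ennreal (k (fst p - snd p))
        + ennreal (?v\<^sup>2 / 2) * ennreal (k (fst p - snd p))"
      using k_nonneg by (simp add: ennreal_plus ennreal_mult del: times_divide_eq_left)
  qed
  also have "\<dots> = (\<integral>\<^sup>+p. ennreal ((cmod (h (fst p)))\<^sup>2 / 2) * ennreal (k (fst p - snd p)) \<partial>(lborel \<Otimes>\<^sub>M lborel))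
     + (\<integral>\<^sup>+p. ennreal ((cmod (h (snd p)))\<^sup>2 / 2) * ennreal (k (fst p - snd p)) \<partial>(lborel \<Otimes>\<^sub>M lborel))"
    by (intro nn_integral_add) measurable
  also have "(\<integral>\<^sup>+p. ennreal ((cmod (h (fst p)))\<^sup>2 / 2) * ennreal (k (fst p - snd p)) \<partial>(lborel \<Otimes>\<^sub>M lborel))
      = (\<integral>\<^sup>+\<xi>. ennreal ((cmod (h \<xi>))\<^sup>2 / 2) \<partial>lborel)"
    by (subst lborel.nn_integral_fst[symmetric]) (auto simp: nn_integral_cmult k2)
  also have "(\<integral>\<^sup>+p. ennreal ((cmod (h (snd p)))\<^sup>2 / 2) * ennreal (k (fst p - snd p)) \<partial>(lborel \<Otimes>\<^sub>M lborel))
      = (\<integral>\<^sup>+\<zeta>. ennreal ((cmod (h \<zeta>))\<^sup>2 / 2) \<partial>lborel)"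
    by (subst lborel_pair.nn_integral_snd[symmetric]) (auto simp: nn_integral_cmult k2 k_refl[of _ "_ :: 'a"])
  also have "(\<integral>\<^sup>+\<xi>. ennreal ((cmod (h \<xi>))\<^sup>2 / 2) \<partial>lborel) + (\<integral>\<^sup>+\<xi>. ennreal ((cmod (h \<xi>))\<^sup>2 / 2) \<partial>lborel)
    = (\<integral>\<^sup>+\<xi>. ennreal ((cmod (h \<xi>))\<^sup>2) \<partial>lborel)"
    by (subst nn_integral_add[symmetric]) (auto simp: ennreal_plus[symmetric] simp del: ennreal_plus)
  finally show ?thesis by (simp add: F_def)
qed

text \<open>Fatou's lemma removes the damping as r = 1 / (n + 1) tends to 0, since the right-hand
  side does not involve r.\<close>

lemma bessel:
  fixes h :: "'a::euclidean_space \<Rightarrow> complex"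
  assumes h: "integrable lborel h"
  shows "(\<integral>\<^sup>+x. ennreal ((cmod (\<integral>\<xi>. h \<xi> * wave x \<xi> \<partial>lborel))\<^sup>2) \<partial>lborel)
    \<le> (\<integral>\<^sup>+\<xi>. ennreal ((cmod (h \<xi>))\<^sup>2) \<partial>lborel)"
proof -
  define F where "F x = (\<integral>\<xi>. h \<xi> * wave x \<xi> \<partial>lborel)" for x
  have [measurable]: "h \<in> borel_measurable borel" using h by auto
  have [measurable]: "F \<in> borel_measurable borel" unfolding F_def by measurable
  let ?r = "\<lambda>n. 1 / (real n + 1)"
  have lim: "(\<lambda>n. ennreal ((cmod (F x))\<^sup>2 * gauss (?r n *\<^sub>R x))) \<longlonglongrightarrow> ennreal ((cmod (F x))\<^sup>2)" for x
  proof -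
    have r0: "?r \<longlonglongrightarrow> 0"
      using LIMSEQ_inverse_real_of_nat by (simp add: inverse_eq_divide add.commute)
    have "(\<lambda>n. exp (- pi * (norm (?r n *\<^sub>R x))\<^sup>2)) \<longlonglongrightarrow> exp (- pi * (norm (0 *\<^sub>R x))\<^sup>2)"
      by (intro tendsto_intros r0)
    then have "(\<lambda>n. gauss (?r n *\<^sub>R x)) \<longlonglongrightarrow> 1"
      unfolding gauss_def by simp
    then have "(\<lambda>n. (cmod (F x))\<^sup>2 * gauss (?r n *\<^sub>R x)) \<longlonglongrightarrow> (cmod (F x))\<^sup>2 * 1"
      by (intro tendsto_intros)
    then show ?thesis
      by (intro tendsto_ennrealI) simp
  qed
  have "(\<integral>\<^sup>+x. ennreal ((cmod (F x))\<^sup>2) \<partial>lborel)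
      = (\<integral>\<^sup>+x. liminf (\<lambda>n. ennreal ((cmod (F x))\<^sup>2 * gauss (?r n *\<^sub>R x))) \<partial>lborel)"
    by (intro nn_integral_cong lim_imp_Liminf[symmetric] lim) auto
  also have "\<dots> \<le> liminf (\<lambda>n. \<integral>\<^sup>+x. ennreal ((cmod (F x))\<^sup>2 * gauss (?r n *\<^sub>R x)) \<partial>lborel)"
    by (intro nn_integral_liminf) measurable
  also have "\<dots> \<le> liminf (\<lambda>n::nat. \<integral>\<^sup>+\<xi>. ennreal ((cmod (h \<xi>))\<^sup>2) \<partial>lborel)"
    unfolding F_def by (intro Liminf_mono always_eventually allI bessel_gauss h) simp
  also have "\<dots> = (\<integral>\<^sup>+\<xi>. ennreal ((cmod (h \<xi>))\<^sup>2) \<partial>lborel)"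
    by (simp add: Liminf_const)
  finally show ?thesis by (simp add: F_def)
qed

text \<open>Averages are normalised by r ^ d instead of the volume of the ball. The volume of the
  unit ball is accounted for in \<open>hl_const\<close>, whose factor 5 ^ d comes from Vitali's
  covering lemma.\<close>

definition hl_maximal :: "('a::euclidean_space \<Rightarrow> ennreal) \<Rightarrow> 'a \<Rightarrow> ennreal" where
  "hl_maximal h x = (SUP r\<in>{0<..}. ennreal (1 / r ^ DIM('a)) * (\<integral>\<^sup>+y. h y * indicator (ball x r) y \<partial>lborel))"

lemma ball_integral_le_hl_maximal:
  fixes x :: "'a::euclidean_space"
  assumes "r > 0"
  shows "(\<integral>\<^sup>+y. h y * indicator (ball x r) y \<partial>lborel) \<le> ennreal (r ^ DIM('a)) * hl_maximal h x"
proof -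
  have "ennreal (1 / r ^ DIM('a)) * (\<integral>\<^sup>+y. h y * indicator (ball x r) y \<partial>lborel) \<le> hl_maximal h x"
    unfolding hl_maximal_def using assms by (intro SUP_upper) auto
  then have "ennreal (r ^ DIM('a)) * (ennreal (1 / r ^ DIM('a)) * (\<integral>\<^sup>+y. h y * indicator (ball x r) y \<partial>lborel))
    \<le> ennreal (r ^ DIM('a)) * hl_maximal h x"
    by (intro mult_left_mono) auto
  then show ?thesis
    using assms by (simp add: mult.assoc[symmetric] ennreal_mult[symmetric])
qed

definition hl_const :: "'a::euclidean_space itself \<Rightarrow> real" where
  "hl_const _ = 5 ^ DIM('a) * measure lborel (ball (0::'a) 1)"

lemma hl_const_nonneg [simp]: "hl_const TYPE('a::euclidean_space) \<ge> 0"
  by (simp add: hl_const_def)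

text \<open>Vitali's covering lemma applied to the balls on which h is heavy: the enlarged disjoint
  balls cover the superlevel set, and their volumes are paid for by the integral of h. The union W
  of these balls is Borel by construction, and the superlevel set is measured through it.\<close>

lemma hl_maximal_weak_type:
  fixes h :: "'a::euclidean_space \<Rightarrow> ennreal"
  assumes [measurable]: "h \<in> borel_measurable borel" and l: "\<alpha> > 0"
  obtains W where "W \<in> sets borel" "{x. hl_maximal h x > ennreal \<alpha>} \<subseteq> W"
    "emeasure lborel W \<le> ennreal (hl_const TYPE('a) / \<alpha>) * (\<integral>\<^sup>+y. h y \<partial>lborel)"
proof (cases "(\<integral>\<^sup>+y. h y \<partial>lborel) = \<infinity>")
  case True
  have "hl_const TYPE('a) > 0"
    using content_ball_pos[of 1 "0::'a"] by (simp add: hl_const_def)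
  then have "ennreal (hl_const TYPE('a) / \<alpha>) * (\<integral>\<^sup>+y. h y \<partial>lborel) = \<infinity>"
    using l True by (auto simp: ennreal_mult_eq_top_iff)
  then show ?thesis by (intro that[of UNIV]) auto
next
  case False
  let ?d = "DIM('a)"
  let ?V = "measure lborel (ball (0::'a) 1)"
  define I where "I = enn2real (\<integral>\<^sup>+y. h y \<partial>lborel)"
  have I: "(\<integral>\<^sup>+y. h y \<partial>lborel) = ennreal I"
    using False by (simp add: I_def less_top)
  have I0: "I \<ge> 0" by (simp add: I_def)
  \<comment> \<open>Centres and radii of the heavy balls; every point of the superlevel set is the
    centre of one.\<close>
  define K where "K = {(x::'a, r). r > 0 \<and> ennreal (\<alpha> * r ^ ?d) \<le> (\<integral>\<^sup>+y. h y * indicator (ball x r) y \<partial>lborel)}"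
  have "{x. hl_maximal h x > ennreal \<alpha>} \<subseteq> (\<Union>i\<in>K. ball (fst i) (snd i))"
  proof
    fix x assume "x \<in> {x. hl_maximal h x > ennreal \<alpha>}"
    then obtain r where r: "r > 0" and
      gt: "ennreal (1 / r ^ ?d) * (\<integral>\<^sup>+y. h y * indicator (ball x r) y \<partial>lborel) > ennreal \<alpha>"
      unfolding hl_maximal_def less_SUP_iff by auto
    have "ennreal (\<alpha> * r ^ ?d) = ennreal (r ^ ?d) * ennreal \<alpha>"
      using r l by (simp add: ennreal_mult mult.commute)
    also have "\<dots> \<le> ennreal (r ^ ?d) * (ennreal (1 / r ^ ?d) * (\<integral>\<^sup>+y. h y * indicator (ball x r) y \<partial>lborel))"
      using gt by (intro mult_left_mono) auto
    also have "\<dots> = (\<integral>\<^sup>+y. h y * indicator (ball x r) y \<partial>lborel)"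
      using r by (simp add: mult.assoc[symmetric] ennreal_mult[symmetric])
    finally have "(x, r) \<in> K" using r by (simp add: K_def)
    then show "x \<in> (\<Union>i\<in>K. ball (fst i) (snd i))"
      using r by force
  qed
  \<comment> \<open>Vitali's lemma needs bounded radii: a heavy ball satisfies \<alpha> r ^ d \<le>
    I.\<close>
  moreover have "0 < snd i \<and> snd i \<le> max 1 (I / \<alpha>)" if iK: "i \<in> K" for i
  proof -
    obtain x r where i: "i = (x, r)" and r: "r > 0" and
      le: "ennreal (\<alpha> * r ^ ?d) \<le> (\<integral>\<^sup>+y. h y * indicator (ball x r) y \<partial>lborel)"
      using iK by (auto simp: K_def)
    note le
    also have "(\<integral>\<^sup>+y. h y * indicator (ball x r) y \<partial>lborel) \<le> ennreal I"
      unfolding I[symmetric] by (intro nn_integral_mono) (auto split: split_indicator)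
    finally have "\<alpha> * r ^ ?d \<le> I" using I0 by (simp add: ennreal_le_iff)
    then have *: "r ^ ?d \<le> I / \<alpha>" using l by (simp add: field_simps)
    have "r \<le> max 1 (I / \<alpha>)"
    proof (cases "r \<le> 1")
      case False
      then have "r \<le> r ^ ?d" using self_le_power[of r ?d] by simp
      with * show ?thesis by simp
    qed simp
    then show ?thesis using r i by simp
  qed
  ultimately obtain C where C: "countable C" "C \<subseteq> K"
     "pairwise (\<lambda>i j. disjnt (ball (fst i) (snd i)) (ball (fst j) (snd j))) C"
     "{x. hl_maximal h x > ennreal \<alpha>} \<subseteq> (\<Union>i\<in>C. ball (fst i) (5 * snd i))"
    by (rule Vitali_covering_lemma_balls[where K=K and a=fst and r=snd and B="max 1 (I / \<alpha>)"])
  let ?W = "\<Union>i\<in>C. ball (fst i) (5 * snd i)"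
  \<comment> \<open>Countable subadditivity, and later disjoint additivity, are written as integrals
    against counting measure so that the index set \<open>C\<close> is not enumerated.\<close>
  have "emeasure lborel ?W = (\<integral>\<^sup>+x. indicator ?W x \<partial>lborel)"
    using C(1) by (intro nn_integral_indicator[symmetric]) auto
  also have "\<dots> \<le> (\<integral>\<^sup>+x. (\<integral>\<^sup>+i. indicator (ball (fst i) (5 * snd i)) x \<partial>count_space C) \<partial>lborel)"
  proof (rule nn_integral_mono)
    fix x
    show "indicator ?W x \<le> (\<integral>\<^sup>+i. (indicator (ball (fst i) (5 * snd i)) x :: ennreal) \<partial>count_space C)"
    proof (cases "x \<in> ?W")
      case True
      then obtain i where i: "i \<in> C" "x \<in> ball (fst i) (5 * snd i)" by auto
      have "(indicator (ball (fst i) (5 * snd i)) x :: ennreal) \<le> (\<integral>\<^sup>+i. indicator (ball (fst i) (5 * snd i)) x \<partial>count_space C)"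
        using i by (intro nn_integral_ge_point) auto
      then show ?thesis using i True by simp
    qed simp
  qed
  also have "\<dots> = (\<integral>\<^sup>+i. (\<integral>\<^sup>+x. indicator (ball (fst i) (5 * snd i)) x \<partial>lborel) \<partial>count_space C)"
    using C(1) by (intro nn_integral_count_space_nn_integral) (auto intro!: borel_measurable_indicator)
  also have "\<dots> \<le> (\<integral>\<^sup>+i. ennreal (5 ^ ?d * ?V / \<alpha>) * emeasure (density lborel h) (ball (fst i) (snd i)) \<partial>count_space C)"
  proof (rule nn_integral_mono)
    fix i assume "i \<in> space (count_space C)"
    then have "i \<in> K" using C by auto
    then obtain x r where i: "i = (x, r)" and r: "r > 0" and
      le: "ennreal (\<alpha> * r ^ ?d) \<le> (\<integral>\<^sup>+y. h y * indicator (ball x r) y \<partial>lborel)"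
      by (auto simp: K_def)
    have "(\<integral>\<^sup>+x. indicator (ball (fst i) (5 * snd i)) x \<partial>lborel) = emeasure lborel (ball x (5 * r))"
      using i by simp
    also have "\<dots> = ennreal (measure lborel (ball x (5 * r)))"
      using emeasure_lborel_ball_finite[of x "5 * r"] by (intro emeasure_eq_ennreal_measure) auto

    also have "measure lborel (ball x (5 * r)) = (5 * r) ^ ?d * ?V"
      using r by (intro content_ball_conv_unit_ball) auto
    also have "(5 * r) ^ ?d * ?V = 5 ^ ?d * ?V / \<alpha> * (\<alpha> * r ^ ?d)"
      using l by (simp add: power_mult_distrib)
    also have "ennreal \<dots> = ennreal (5 ^ ?d * ?V / \<alpha>) * ennreal (\<alpha> * r ^ ?d)"
      using l r by (intro ennreal_mult) auto
    also have "\<dots> \<le> ennreal (5 ^ ?d * ?V / \<alpha>) * (\<integral>\<^sup>+y. h y * indicator (ball x r) y \<partial>lborel)"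
      using le by (intro mult_left_mono) auto
    also have "(\<integral>\<^sup>+y. h y * indicator (ball x r) y \<partial>lborel) = emeasure (density lborel h) (ball (fst i) (snd i))"
      using i by (subst emeasure_density) auto
    finally show "(\<integral>\<^sup>+x. indicator (ball (fst i) (5 * snd i)) x \<partial>lborel)
      \<le> ennreal (5 ^ ?d * ?V / \<alpha>) * emeasure (density lborel h) (ball (fst i) (snd i))" .
  qed
  also have "\<dots> = ennreal (5 ^ ?d * ?V / \<alpha>) * (\<integral>\<^sup>+i. emeasure (density lborel h) (ball (fst i) (snd i)) \<partial>count_space C)"
    by (intro nn_integral_cmult) auto
  also have "(\<integral>\<^sup>+i. emeasure (density lborel h) (ball (fst i) (snd i)) \<partial>count_space C)
      = emeasure (density lborel h) (\<Union>i\<in>C. ball (fst i) (snd i))"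
    using C(1,3) by (intro emeasure_UN_countable[symmetric])
      (auto simp: disjoint_family_on_def pairwise_def disjnt_def)
  also have "\<dots> \<le> emeasure (density lborel h) UNIV"
    by (intro emeasure_mono) auto
  also have "\<dots> = (\<integral>\<^sup>+y. h y \<partial>lborel)"
    by (subst emeasure_density) auto
  finally have "emeasure lborel ?W \<le> ennreal (5 ^ ?d * ?V / \<alpha>) * (\<integral>\<^sup>+y. h y \<partial>lborel)"
    by (simp add: mult_left_mono)
  then show ?thesis using C by (intro that[of ?W]) (auto simp: hl_const_def)
qed

section \<open>Measures with Fourier decay\<close>

text \<open>Compact support is recorded as a radius \<open>R\<close>. It enters the constants
  through the lower bound of the Gaussian on the support and through the size of the dilated support
  in the comparison with the Hardy-Littlewood function.\<close>

locale decaying_measure =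
  fixes \<mu> :: "'a::euclidean_space measure" and a b C\<^sub>0 R :: real
  assumes sets_mu [measurable_cong]: "sets \<mu> = sets borel"
    and finite_mu: "finite_measure \<mu>"
    and R_pos: "R > 0"
    and support: "emeasure \<mu> (- cball 0 R) = 0"
    and a_gt: "a > 1 / 2" and b_gt: "real DIM('a) - 1 < b" and b_le: "b \<le> real DIM('a)"
    and decay: "\<And>\<xi>. \<xi> \<noteq> 0 \<Longrightarrow> cmod (fourier_measure \<mu> \<xi>) \<le> C\<^sub>0 * norm \<xi> powr (- a)"
    and growth: "\<And>x r. r > 0 \<Longrightarrow> measure \<mu> (ball x r) \<le> C\<^sub>0 * r powr b"

sublocale decaying_measure \<subseteq> finite_measure \<mu>
  by (rule finite_mu)

section \<open>Low frequencies and the growth of balls\<close>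

context decaying_measure
begin

definition mass :: real where "mass = measure \<mu> UNIV"

lemma space_mu [simp]: "space \<mu> = UNIV"
  using sets_eq_imp_space_eq[OF sets_mu] by simp

lemma mass_nonneg [simp]: "mass \<ge> 0"
  by (simp add: mass_def)

lemma emeasure_mu_UNIV: "emeasure \<mu> UNIV = ennreal mass"
  by (simp add: mass_def emeasure_eq_measure)

lemma C0_nonneg: "C\<^sub>0 \<ge> 0"
proof -
  have "0 \<le> measure \<mu> (ball 0 1)" by simp
  also have "\<dots> \<le> C\<^sub>0 * 1 powr b" by (intro growth) simp
  finally show ?thesis by simp
qed

lemma AE_support: "AE y in \<mu>. norm y \<le> R"
  using support by (intro AE_I[of _ _ "- cball 0 R"]) (auto simp: sets_mu)

text \<open>Here s = \<sigma> / t is the relative smoothing scale and J the index of a Gaussian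
  layer. For s \<ge> 1 the total mass suffices as a bound of the minimum; for s < 1 the growth of
  balls gives s^b against s^(-d), and s^(b - d) \<le> \<epsilon>^(b - d) because b \<le> d.\<close>

lemma layer_bound:
  assumes s: "s \<ge> \<epsilon>" and e: "\<epsilon> > 0" "\<epsilon> \<le> 1" and J: "J \<ge> 1"
  shows "min mass (C\<^sub>0 * (s * J) powr b) * (R / s + J) ^ DIM('a)
    \<le> (mass + C\<^sub>0) * (R + 1) ^ DIM('a) * J ^ (2 * DIM('a)) * \<epsilon> powr (b - DIM('a))"
proof -
  let ?d = "DIM('a)"
  have s0: "s > 0" using s e by simp
  have RJ: "R + J \<le> (R + 1) * J" using R_pos J by (simp add: algebra_simps)
  have e1: "1 \<le> \<epsilon> powr (b - ?d)"
    using powr_mono2'[of "b - ?d" \<epsilon> 1] e b_le by (simp add: )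
  have Jd: "J ^ ?d \<le> J ^ (2 * ?d)" using J by (intro power_increasing) auto
  show ?thesis
  proof (cases "s \<ge> 1")
    case True
    have "R / s + J \<le> R + J" using True R_pos by (simp add: field_simps)
    then have "R / s + J \<le> (R + 1) * J" using RJ by simp
    moreover have "0 \<le> R / s + J" using R_pos s0 J by simp
    ultimately have "(R / s + J) ^ ?d \<le> ((R + 1) * J) ^ ?d" by (intro power_mono)
    then have "min mass (C\<^sub>0 * (s * J) powr b) * (R / s + J) ^ ?d \<le> mass * ((R + 1) * J) ^ ?d"
      using \<open>0 \<le> R / s + J\<close> by (intro mult_mono) auto
    also have "\<dots> = (mass * (R + 1) ^ ?d) * J ^ ?d * 1" by (simp add: power_mult_distrib)
    also have "\<dots> \<le> ((mass + C\<^sub>0) * (R + 1) ^ ?d) * J ^ (2 * ?d) * \<epsilon> powr (b - ?d)"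
      using R_pos C0_nonneg Jd e1 J by (intro mult_mono mult_nonneg_nonneg) auto
    finally show ?thesis .
  next
    case False
    then have s1: "s < 1" by simp
    have "R / s + J \<le> (R + J) / s" using s1 s0 J by (simp add: field_simps)
    also have "\<dots> \<le> (R + 1) * J / s" using RJ s0 by (intro divide_right_mono) auto
    finally have "(R / s + J) ^ ?d \<le> ((R + 1) * J / s) ^ ?d"
      using R_pos s0 J by (intro power_mono) auto
    then have "min mass (C\<^sub>0 * (s * J) powr b) * (R / s + J) ^ ?d \<le> (C\<^sub>0 * (s * J) powr b) * ((R + 1) * J / s) ^ ?d"
      using R_pos s0 J C0_nonneg by (intro mult_mono) auto
    also have "\<dots> = C\<^sub>0 * (R + 1) ^ ?d * (J powr b * J ^ ?d) * (s powr b / s ^ ?d)"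
      using s0 J by (simp add: powr_mult power_mult_distrib power_divide)
    also have "s powr b / s ^ ?d = s powr (b - ?d)"
      using s0 by (simp add: powr_diff powr_realpow)
    also have "C\<^sub>0 * (R + 1) ^ ?d * (J powr b * J ^ ?d) * s powr (b - ?d)
      \<le> (mass + C\<^sub>0) * (R + 1) ^ ?d * J ^ (2 * ?d) * \<epsilon> powr (b - ?d)"
    proof (intro mult_mono)
      have "J powr b \<le> J powr ?d" using J b_le by (intro powr_mono) auto
      then show "J powr b * J ^ ?d \<le> J ^ (2 * ?d)"
        using J by (simp add: powr_realpow mult_2 power_add)
      show "s powr (b - ?d) \<le> \<epsilon> powr (b - ?d)"
        using e s b_le by (intro powr_mono2') auto
    qed (use R_pos C0_nonneg J in auto)
    finally show ?thesis .
  qed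
qed

text \<open>exp (- pi j^2) \<le> exp (- 2 j) for natural j, while the polynomial costs only a
  multiple of exp j.\<close>

lemma layer_sum: "summable (\<lambda>j. exp (- pi * (real j)\<^sup>2) * (real j + 1) ^ k)"
proof -
  obtain C where C: "C \<ge> 0" "\<And>v::real. v \<ge> 0 \<Longrightarrow> (1 + v) powr real k \<le> C * exp (1 * v)"
    using powr_le_exp[of 1] by auto
  have "exp (- pi * (real j)\<^sup>2) * (real j + 1) ^ k \<le> C * (exp (-1)) ^ j" for j
  proof -
    have "real j \<le> (real j)\<^sup>2"
      by (cases j) (auto simp: power2_eq_square)
    then have "2 * real j \<le> pi * (real j)\<^sup>2"
      using pi_gt3 by (intro mult_mono) auto
    then have "exp (- pi * (real j)\<^sup>2) \<le> exp (- (2 * real j))" by simp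
    moreover have "(real j + 1) ^ k \<le> C * exp (real j)"
      using C(2)[of "real j"] by (simp add: powr_realpow add.commute)
    ultimately have "exp (- pi * (real j)\<^sup>2) * (real j + 1) ^ k \<le> exp (- (2 * real j)) * (C * exp (real j))"
      by (intro mult_mono) auto
    also have "\<dots> = C * exp (- real j)" by (simp add: exp_add[symmetric])
    also have "\<dots> = C * (exp (-1)) ^ j" by (simp add: exp_of_nat_mult[symmetric])
    finally show ?thesis .
  qed
  moreover have "summable (\<lambda>j. C * (exp (-1)) ^ j :: real)"
    by (rule summable_mult, rule summable_geometric) simp
  ultimately show ?thesis
    by (intro summable_comparison_test'[where N=0 and g="\<lambda>j. C * (exp (-1)) ^ j" and f="\<lambda>j. exp (- pi * (real j)\<^sup>2) * (real j + 1) ^ k"]) auto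
qed

text \<open>The Gaussian is cut into layers, each bounded by a multiple of the indicator of a ball
  around x. After exchanging the integrals, a layer asks for the \<mu>-measure of a ball of radius
  \<open>\<rho> j / t\<close> and vanishes for v outside the ball of radius
  \<open>t * R + \<rho> j\<close>; the first is controlled by the growth of balls, the second leads
  to the maximal function. Only \<epsilon> t \<le> \<sigma> is assumed, as \<sigma> will be one of
  several scales.\<close>

lemma low_frequency_bound:
  obtains C where "C \<ge> 0" and "\<And>h x t \<sigma> \<epsilon>. \<lbrakk>h \<in> borel_measurable borel; t > 0; \<epsilon> > 0; \<epsilon> \<le> 1; \<epsilon> * t \<le> \<sigma>\<rbrakk> \<Longrightarrow>
    (\<integral>\<^sup>+y. (\<integral>\<^sup>+v. h v * ennreal (gauss ((x - t *\<^sub>R y - v) /\<^sub>R \<sigma>) / \<sigma> ^ DIM('a)) \<partial>lborel) \<partial>\<mu>)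
      \<le> ennreal (C * \<epsilon> powr (b - DIM('a))) * hl_maximal h x"
proof -
  let ?d = "DIM('a)"
  define c where "c j = exp (- pi * (real j)\<^sup>2)" for j :: nat
  define B where "B j = (mass + C\<^sub>0) * (R + 1) ^ ?d * (real j + 1) ^ (2 * ?d)" for j :: nat
  have B0: "B j \<ge> 0" for j using R_pos C0_nonneg by (simp add: B_def)
  have summ: "summable (\<lambda>j. c j * B j)"
    using summable_mult[OF layer_sum, of "(mass + C\<^sub>0) * (R + 1) ^ ?d" "2 * ?d"]
    by (simp add: c_def B_def mult_ac)
  define C where "C = (\<Sum>j. c j * B j)"
  have C0: "C \<ge> 0" unfolding C_def using B0 summ by (intro suminf_nonneg) (auto simp: c_def)
  have main: "(\<integral>\<^sup>+y. (\<integral>\<^sup>+v. h v * ennreal (gauss ((x - t *\<^sub>R y - v) /\<^sub>R \<sigma>) / \<sigma> ^ ?d) \<partial>lborel) \<partial>\<mu>)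
      \<le> ennreal (C * \<epsilon> powr (b - ?d)) * hl_maximal h x"
    if h [measurable]: "h \<in> borel_measurable borel" and t: "t > 0" and e: "\<epsilon> > 0" "\<epsilon> \<le> 1" and st: "\<epsilon> * t \<le> \<sigma>" for h x t \<sigma> \<epsilon>
  proof -
    have s0: "\<sigma> > 0" using t e(1) st by (meson less_le_trans mult_pos_pos)
    interpret P: pair_sigma_finite \<mu> "lborel :: 'a measure" ..
    define \<rho> where "\<rho> j = \<sigma> * (real j + 1)" for j :: nat
    have rho0: "\<rho> j > 0" for j using s0 by (simp add: \<rho>_def)
    have [measurable]: "ball x r \<in> sets borel" for x :: 'a and r by simp
    \<comment> \<open>The value at distance w \<sigma> is controlled by the layer j = floor w, whose
      ball has radius (j + 1) \<sigma>.\<close>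
    have pt: "ennreal (gauss ((x - t *\<^sub>R y - v) /\<^sub>R \<sigma>) / \<sigma> ^ ?d)
      \<le> (\<Sum>j. ennreal (c j / \<sigma> ^ ?d) * indicator (ball x (\<rho> j)) (v + t *\<^sub>R y))" for y v
    proof -
      define w where "w = norm ((x - t *\<^sub>R y - v) /\<^sub>R \<sigma>)"
      define j where "j = nat \<lfloor>w\<rfloor>"
      have w0: "w \<ge> 0" by (simp add: w_def)
      have j1: "real j \<le> w" and j2: "w < real j + 1" using w0 by (auto simp: j_def)
      have "norm (x - t *\<^sub>R y - v) = \<sigma> * w"
        using s0 by (simp add: w_def)
      then have "dist x (v + t *\<^sub>R y) < \<rho> j"
        using j2 s0 by (simp add: \<rho>_def dist_norm diff_diff_add add.commute)
      then have in_ball: "v + t *\<^sub>R y \<in> ball x (\<rho> j)" by simp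
      have "(real j)\<^sup>2 \<le> w\<^sup>2" using j1 by (intro power_mono) auto
      then have "gauss ((x - t *\<^sub>R y - v) /\<^sub>R \<sigma>) \<le> c j"
        by (simp add: gauss_def c_def w_def)
      then have "ennreal (gauss ((x - t *\<^sub>R y - v) /\<^sub>R \<sigma>) / \<sigma> ^ ?d) \<le> ennreal (c j / \<sigma> ^ ?d)"
        using s0 by (intro ennreal_leI divide_right_mono) auto
      also have "\<dots> = (\<Sum>j\<in>{j}. ennreal (c j / \<sigma> ^ ?d) * indicator (ball x (\<rho> j)) (v + t *\<^sub>R y))"
        using in_ball by simp
      also have "\<dots> \<le> (\<Sum>j. ennreal (c j / \<sigma> ^ ?d) * indicator (ball x (\<rho> j)) (v + t *\<^sub>R y))"
        by (intro sum_le_suminf) auto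
      finally show ?thesis .
    qed
    have layer: "(\<integral>\<^sup>+y. (\<integral>\<^sup>+v. h v * indicator (ball x (\<rho> j)) (v + t *\<^sub>R y) \<partial>lborel) \<partial>\<mu>)
      \<le> ennreal (\<sigma> ^ ?d * (B j * \<epsilon> powr (b - ?d))) * hl_maximal h x" for j
    proof -
      define m where "m = min mass (C\<^sub>0 * (\<sigma> / t * (real j + 1)) powr b)"
      have m0: "m \<ge> 0" using C0_nonneg by (simp add: m_def)
      define r where "r = t * R + \<rho> j"
      have r0: "r > 0" using t R_pos rho0[of j] by (simp add: r_def add_pos_pos)
      \<comment> \<open>For v in the ball of radius r this is the minimum of mass and growth; for v
        outside it no point of the support of \<mu> can reach the ball of the layer.\<close>
      have inner: "(\<integral>\<^sup>+y. indicator (ball x (\<rho> j)) (v + t *\<^sub>R y) \<partial>\<mu>) \<le> ennreal m * indicator (ball x r) v" for v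
      proof -
        have eq: "(\<integral>\<^sup>+y. indicator (ball x (\<rho> j)) (v + t *\<^sub>R y) \<partial>\<mu>) = emeasure \<mu> (ball ((x - v) /\<^sub>R t) (\<rho> j / t))"
        proof -
          have "indicator (ball x (\<rho> j)) (v + t *\<^sub>R y) = (indicator (ball ((x - v) /\<^sub>R t) (\<rho> j / t)) y :: ennreal)" for y
          proof -
            have "x - (v + t *\<^sub>R y) = t *\<^sub>R ((x - v) /\<^sub>R t - y)"
              using t by (simp add: algebra_simps)
            then have "dist x (v + t *\<^sub>R y) = t * dist ((x - v) /\<^sub>R t) y"
              using t by (simp only: dist_norm norm_scaleR abs_of_pos)
            then have "dist x (v + t *\<^sub>R y) < \<rho> j \<longleftrightarrow> dist ((x - v) /\<^sub>R t) y < \<rho> j / t"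
              using t by (simp add: field_simps)
            then show ?thesis by (simp add: indicator_def)
          qed
          then show ?thesis by (simp add: sets_mu)
        qed
        show ?thesis
        proof (cases "v \<in> ball x r")
          case True
          have "measure \<mu> (ball ((x - v) /\<^sub>R t) (\<rho> j / t)) \<le> mass"
            unfolding mass_def by (intro finite_measure_mono) (auto simp: sets_mu)
          moreover have "measure \<mu> (ball ((x - v) /\<^sub>R t) (\<rho> j / t)) \<le> C\<^sub>0 * (\<rho> j / t) powr b"
            using rho0[of j] t by (intro growth) auto
          ultimately have "measure \<mu> (ball ((x - v) /\<^sub>R t) (\<rho> j / t)) \<le> m"
            by (simp add: m_def \<rho>_def)
          then show ?thesis using True by (simp add: eq emeasure_eq_measure ennreal_leI)
        next
          case False
          have "AE y in \<mu>. y \<notin> ball ((x - v) /\<^sub>R t) (\<rho> j / t)"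
            using AE_support
          proof eventually_elim
            case (elim y)
            show ?case
            proof
              assume "y \<in> ball ((x - v) /\<^sub>R t) (\<rho> j / t)"
              then have "norm ((x - v) /\<^sub>R t - y) < \<rho> j / t" by (simp add: dist_norm)
              then have "norm ((x - v) /\<^sub>R t) < \<rho> j / t + R"
                using elim norm_triangle_ineq2[of "(x - v) /\<^sub>R t" y] by linarith
              moreover have "norm ((x - v) /\<^sub>R t) = norm (x - v) / t"
                using t by (simp add: divide_inverse)
              ultimately have "norm (x - v) < (\<rho> j / t + R) * t"
                using t by (simp add: pos_divide_less_eq)
              then have "norm (x - v) < r"
                using t by (simp add: r_def distrib_left mult.commute)
              with False show False by (simp add: dist_norm)
            qed
          qed
          then have "emeasure \<mu> (ball ((x - v) /\<^sub>R t) (\<rho> j / t)) = 0"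
            by (subst (asm) AE_iff_measurable[of "ball ((x - v) /\<^sub>R t) (\<rho> j / t)"]) (auto simp: sets_mu)
          then show ?thesis by (simp add: eq)
        qed
      qed
      have "(\<integral>\<^sup>+y. (\<integral>\<^sup>+v. h v * indicator (ball x (\<rho> j)) (v + t *\<^sub>R y) \<partial>lborel) \<partial>\<mu>)
        = (\<integral>\<^sup>+v. (\<integral>\<^sup>+y. h v * indicator (ball x (\<rho> j)) (v + t *\<^sub>R y) \<partial>\<mu>) \<partial>lborel)"
        by (rule P.Fubini'[symmetric]) measurable
      also have "\<dots> = (\<integral>\<^sup>+v. h v * (\<integral>\<^sup>+y. indicator (ball x (\<rho> j)) (v + t *\<^sub>R y) \<partial>\<mu>) \<partial>lborel)"
        by (intro nn_integral_cong nn_integral_cmult) measurable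
      also have "\<dots> \<le> (\<integral>\<^sup>+v. h v * (ennreal m * indicator (ball x r) v) \<partial>lborel)"
        by (intro nn_integral_mono mult_left_mono inner) auto
      also have "\<dots> = ennreal m * (\<integral>\<^sup>+v. h v * indicator (ball x r) v \<partial>lborel)"
        by (subst nn_integral_cmult[symmetric]) (auto simp: mult_ac)
      also have "\<dots> \<le> ennreal m * (ennreal (r ^ ?d) * hl_maximal h x)"
        by (intro mult_left_mono ball_integral_le_hl_maximal r0) auto
      also have "\<dots> = ennreal (m * r ^ ?d) * hl_maximal h x"
        using m0 r0 by (simp add: ennreal_mult mult.assoc)
      also have "\<dots> \<le> ennreal (\<sigma> ^ ?d * (B j * \<epsilon> powr (b - ?d))) * hl_maximal h x"
      proof (intro mult_right_mono ennreal_leI)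
        \<comment> \<open>In units of \<sigma>, r is R / s + (j + 1) with s = \<sigma> / t, the form
          in which \<open>layer_bound\<close> is stated.\<close>
        have "r = \<sigma> * (R / (\<sigma> / t) + (real j + 1))"
          using s0 t by (simp add: r_def \<rho>_def field_simps)
        then have "m * r ^ ?d = \<sigma> ^ ?d * (m * (R / (\<sigma> / t) + (real j + 1)) ^ ?d)"
          by (simp add: power_mult_distrib)
        also have "\<dots> \<le> \<sigma> ^ ?d * (B j * \<epsilon> powr (b - ?d))"
          unfolding m_def B_def using s0 t e st
          by (intro mult_left_mono layer_bound) (auto simp: field_simps)
        finally show "m * r ^ ?d \<le> \<sigma> ^ ?d * (B j * \<epsilon> powr (b - ?d))" .
      qed auto
      finally show ?thesis .
    qed
    have "(\<integral>\<^sup>+y. (\<integral>\<^sup>+v. h v * ennreal (gauss ((x - t *\<^sub>R y - v) /\<^sub>R \<sigma>) / \<sigma> ^ ?d) \<partial>lborel) \<partial>\<mu>)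
      \<le> (\<integral>\<^sup>+y. (\<integral>\<^sup>+v. (\<Sum>j. h v * (ennreal (c j / \<sigma> ^ ?d) * indicator (ball x (\<rho> j)) (v + t *\<^sub>R y))) \<partial>lborel) \<partial>\<mu>)"
      unfolding ennreal_suminf_cmult by (intro nn_integral_mono mult_left_mono pt) auto
    also have "\<dots> = (\<Sum>j. \<integral>\<^sup>+y. (\<integral>\<^sup>+v. h v * (ennreal (c j / \<sigma> ^ ?d) * indicator (ball x (\<rho> j)) (v + t *\<^sub>R y)) \<partial>lborel) \<partial>\<mu>)"
      by (subst nn_integral_suminf, measurable)+
    also have "\<dots> = (\<Sum>j. ennreal (c j / \<sigma> ^ ?d) * (\<integral>\<^sup>+y. (\<integral>\<^sup>+v. h v * indicator (ball x (\<rho> j)) (v + t *\<^sub>R y) \<partial>lborel) \<partial>\<mu>))"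
    proof (intro arg_cong[where f=suminf] ext)
      fix j
      have "(\<integral>\<^sup>+y. (\<integral>\<^sup>+v. h v * (ennreal (c j / \<sigma> ^ ?d) * indicator (ball x (\<rho> j)) (v + t *\<^sub>R y)) \<partial>lborel) \<partial>\<mu>)
        = (\<integral>\<^sup>+y. (\<integral>\<^sup>+v. ennreal (c j / \<sigma> ^ ?d) * (h v * indicator (ball x (\<rho> j)) (v + t *\<^sub>R y)) \<partial>lborel) \<partial>\<mu>)"
        by (simp add: mult_ac)
      also have "\<dots> = (\<integral>\<^sup>+y. ennreal (c j / \<sigma> ^ ?d) * (\<integral>\<^sup>+v. h v * indicator (ball x (\<rho> j)) (v + t *\<^sub>R y) \<partial>lborel) \<partial>\<mu>)"
        by (intro nn_integral_cong nn_integral_cmult) measurable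
      also have "\<dots> = ennreal (c j / \<sigma> ^ ?d) * (\<integral>\<^sup>+y. (\<integral>\<^sup>+v. h v * indicator (ball x (\<rho> j)) (v + t *\<^sub>R y) \<partial>lborel) \<partial>\<mu>)"
        by (intro nn_integral_cmult) measurable
      finally show "(\<integral>\<^sup>+y. (\<integral>\<^sup>+v. h v * (ennreal (c j / \<sigma> ^ ?d) * indicator (ball x (\<rho> j)) (v + t *\<^sub>R y)) \<partial>lborel) \<partial>\<mu>)
        = ennreal (c j / \<sigma> ^ ?d) * (\<integral>\<^sup>+y. (\<integral>\<^sup>+v. h v * indicator (ball x (\<rho> j)) (v + t *\<^sub>R y) \<partial>lborel) \<partial>\<mu>)" .
    qed
    also have "\<dots> \<le> (\<Sum>j. ennreal (c j / \<sigma> ^ ?d) * (ennreal (\<sigma> ^ ?d * (B j * \<epsilon> powr (b - ?d))) * hl_maximal h x))"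
      by (intro suminf_le mult_left_mono layer) auto
    also have "\<dots> = (\<Sum>j. ennreal (c j * B j * \<epsilon> powr (b - ?d)) * hl_maximal h x)"
      using s0 B0 by (intro arg_cong[where f=suminf] ext)
        (simp add: mult.assoc[symmetric] ennreal_mult[symmetric] c_def)
    also have "\<dots> = (\<Sum>j. ennreal (c j * B j * \<epsilon> powr (b - ?d))) * hl_maximal h x"
      by (rule ennreal_suminf_multc)
    also have "(\<Sum>j. ennreal (c j * B j * \<epsilon> powr (b - ?d))) = ennreal (C * \<epsilon> powr (b - ?d))"
      unfolding C_def suminf_mult2[OF summ]
      using B0 summ by (intro suminf_ennreal2 summable_mult2) (auto simp: c_def)
    finally show ?thesis .
  qed
  show ?thesis by (rule that[OF C0 main])
qed

section \<open>The transform of the Gaussian-weighted measure\<close>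

abbreviation muhat :: "'a \<Rightarrow> complex" where "muhat \<equiv> fourier_measure \<mu>"

lemma muhat_eq: "muhat \<xi> = (\<integral>y. cnj (wave y \<xi>) \<partial>\<mu>)"
  unfolding fourier_measure_def
  unfolding wave_minus_left[symmetric]
  by (intro Bochner_Integration.integral_cong refl) (simp add: wave_def cis_conv_exp mult_ac)

lemma muhat_measurable [measurable]: "muhat \<in> borel_measurable borel"
  unfolding muhat_eq[abs_def] by measurable

lemma muhat_le_mass: "cmod (muhat \<xi>) \<le> mass"
  unfolding muhat_eq using integral_norm_bound[of \<mu> "\<lambda>y. cnj (wave y \<xi>)"] by (simp add: mass_def)

text \<open>\<open>nuhat\<close> is the Fourier transform of the weighted measure \<open>gauss \<cdot> \<mu>\<close>, and \<open>dnuhat\<close> its derivative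
  along the ray through \<open>\<xi>\<close>. The weight makes the decay of the transform pass to the derivative.\<close>

definition nuhat :: "'a \<Rightarrow> complex" where
  "nuhat z = (\<integral>\<eta>. muhat \<eta> * gauss (z - \<eta>) \<partial>lborel)"

definition dnuhat :: "real \<Rightarrow> 'a \<Rightarrow> complex" where
  "dnuhat t \<xi> = (\<integral>\<eta>. muhat \<eta> * of_real (- 2 * pi * ((t *\<^sub>R \<xi> - \<eta>) \<bullet> \<xi>) * gauss (t *\<^sub>R \<xi> - \<eta>)) \<partial>lborel)"

lemma nuhat_measurable [measurable]: "nuhat \<in> borel_measurable borel"
  unfolding nuhat_def by measurable

lemma dnuhat_measurable [measurable]:
  assumes [measurable]: "f \<in> borel_measurable M" "g \<in> borel_measurable M"
  shows "(\<lambda>x. dnuhat (f x) (g x)) \<in> borel_measurable M"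
  unfolding dnuhat_def by measurable

text \<open>Convolution with the Gaussian in frequency is multiplication by the Gaussian in space,
  because the Gaussian is its own transform. The convolution was made the definition since the decay
  is read off from it.\<close>

lemma nuhat_eq: "nuhat z = (\<integral>y. cnj (wave y z) * gauss y \<partial>\<mu>)"
proof -
  interpret P: pair_sigma_finite \<mu> "lborel :: 'a measure" ..
  have ig: "integrable lborel (\<lambda>\<eta>. gauss (z - \<eta>))"
    by (rule integrable_lborel_reflect) simp
  have "nuhat z = (\<integral>\<eta>. (\<integral>y. cnj (wave y \<eta>) * gauss (z - \<eta>) \<partial>\<mu>) \<partial>lborel)"
    unfolding nuhat_def muhat_eq by simp
  also have "\<dots> = (\<integral>y. (\<integral>\<eta>. cnj (wave y \<eta>) * gauss (z - \<eta>) \<partial>lborel) \<partial>\<mu>)"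
    by (rule P.Fubini_product_bound(2)[of _ "\<lambda>_. 1" "\<lambda>\<eta>. gauss (z - \<eta>)"])
       (auto simp: norm_mult ig)
  also have "\<dots> = (\<integral>y. cnj (wave y z) * gauss y \<partial>\<mu>)"
  proof (intro Bochner_Integration.integral_cong refl)
    fix y
    have "(\<integral>\<eta>. cnj (wave y \<eta>) * gauss (z - \<eta>) \<partial>lborel)
      = \<bar>-1\<bar> ^ DIM('a) *\<^sub>R (\<integral>w. cnj (wave y (z + (-1) *\<^sub>R w)) * gauss (z - (z + (-1) *\<^sub>R w)) \<partial>lborel)"
      by (rule integral_lborel_affine) auto
    also have "\<dots> = (\<integral>w. cnj (wave y z) * (gauss w *\<^sub>R wave w y) \<partial>lborel)"
      by (simp add: wave_commute[of y] wave_add[of _ "- _", simplified] wave_minus_left scaleR_conv_of_real mult_ac)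
    also have "\<dots> = cnj (wave y z) * gauss y"
      by (subst integral_mult_right_zero) (simp add: gauss_fourier)
    finally show "(\<integral>\<eta>. cnj (wave y \<eta>) * gauss (z - \<eta>) \<partial>lborel) = cnj (wave y z) * gauss y" .
  qed
  finally show ?thesis .
qed

lemma integrable_muhat_gauss:
  assumes k: "k \<ge> 0"
  shows "integrable lborel (\<lambda>\<eta>. cmod (muhat \<eta>) * ((1 + norm (z - \<eta>)) powr k * gauss (z - \<eta>)))"
proof (rule Bochner_Integration.integrable_bound)
  show "integrable lborel (\<lambda>\<eta>. mass * ((1 + norm (z - \<eta>)) powr k * gauss (z - \<eta>)))"
    using integrable_lborel_reflect[OF gauss_moment[OF k], of z] by simp
  show "AE \<eta> in lborel. norm (cmod (muhat \<eta>) * ((1 + norm (z - \<eta>)) powr k * gauss (z - \<eta>)))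
    \<le> norm (mass * ((1 + norm (z - \<eta>)) powr k * gauss (z - \<eta>)))"
    using muhat_le_mass by (intro AE_I2) (auto simp: abs_mult intro!: mult_right_mono)
qed measurable

text \<open>If |\<eta>| is at least |z - \<eta>|, then |\<eta>| \<ge> |z| / 2 and the decay of
  \<open>muhat\<close> applies; otherwise |z - \<eta>| \<ge> |z| / 2 and the Gaussian absorbs |z|^a.
  The extra weight of power 1 leaves room for the derivative of the Gaussian.\<close>

lemma muhat_gauss_decay:
  obtains C where "C \<ge> 0"
    "\<And>z. (\<integral>\<eta>. cmod (muhat \<eta>) * ((1 + norm (z - \<eta>)) powr 1 * gauss (z - \<eta>)) \<partial>lborel) \<le> C"
    "\<And>z. z \<noteq> 0 \<Longrightarrow> (\<integral>\<eta>. cmod (muhat \<eta>) * ((1 + norm (z - \<eta>)) powr 1 * gauss (z - \<eta>)) \<partial>lborel) \<le> C * norm z powr (- a)"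
proof -
  let ?G = "\<lambda>k w::'a. (1 + norm w) powr k * gauss w"
  have G0: "?G k w \<ge> 0" for k w by simp
  have iG: "k \<ge> 0 \<Longrightarrow> integrable lborel (\<lambda>\<eta>. ?G k (z - \<eta>))" for k z
    by (rule integrable_lborel_reflect[OF gauss_moment])
  define K where "K k = (\<integral>w. ?G k w \<partial>lborel)" for k
  have K0: "K k \<ge> 0" for k by (simp add: K_def)
  have KG: "(\<integral>\<eta>. ?G k (z - \<eta>) \<partial>lborel) = K k" for k z
    using integral_lborel_affine[of "?G k" "-1" z] by (simp add: K_def)
  define A where "A = 2 powr a * (C\<^sub>0 + mass)"
  have A0: "A \<ge> 0" using C0_nonneg by (simp add: A_def)
  define C where "C = mass * K 1 + A * K (a + 1)"
  have 1: "(\<integral>\<eta>. cmod (muhat \<eta>) * ?G 1 (z - \<eta>) \<partial>lborel) \<le> mass * K 1" for z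
  proof -
    have "(\<integral>\<eta>. cmod (muhat \<eta>) * ?G 1 (z - \<eta>) \<partial>lborel) \<le> (\<integral>\<eta>. mass * ?G 1 (z - \<eta>) \<partial>lborel)"
      using muhat_le_mass iG[of 1 z] integrable_muhat_gauss[of 1 z]
      by (intro integral_mono mult_right_mono) auto
    also have "\<dots> = mass * K 1"
      by (simp only: integral_mult_right_zero KG)
    finally show ?thesis .
  qed
  have pt: "cmod (muhat \<eta>) * norm z powr a \<le> A * (1 + norm (z - \<eta>)) powr a" for z \<eta> :: 'a
  proof -
    have zle: "norm z \<le> norm \<eta> + norm (z - \<eta>)"
      using norm_triangle_ineq[of \<eta> "z - \<eta>"] by simp
    have w1: "1 \<le> (1 + norm (z - \<eta>)) powr a" using a_gt by (intro ge_one_powr_ge_zero) auto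
    have w2: "norm (z - \<eta>) powr a \<le> (1 + norm (z - \<eta>)) powr a" using a_gt by (intro powr_mono2) auto
    show ?thesis
    proof (cases "norm (z - \<eta>) \<le> norm \<eta> \<and> \<eta> \<noteq> 0")
      case True
      then have "norm z \<le> 2 * norm \<eta>" using zle by linarith
      then have "norm z powr a \<le> (2 * norm \<eta>) powr a" using a_gt by (intro powr_mono2) auto
      then have "cmod (muhat \<eta>) * norm z powr a \<le> (C\<^sub>0 * norm \<eta> powr (- a)) * (2 * norm \<eta>) powr a"
        using decay[of \<eta>] True C0_nonneg by (intro mult_mono) auto
      also have "\<dots> = 2 powr a * C\<^sub>0 * 1"
        using True by (simp add: powr_mult powr_minus field_simps)
      also have "\<dots> \<le> A * (1 + norm (z - \<eta>)) powr a"
        using w1 C0_nonneg by (intro mult_mono) (auto simp: A_def)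
      finally show ?thesis .
    next
      case False
      then have "norm z \<le> 2 * norm (z - \<eta>)" using zle by auto
      then have "norm z powr a \<le> (2 * norm (z - \<eta>)) powr a" using a_gt by (intro powr_mono2) auto
      then have "cmod (muhat \<eta>) * norm z powr a \<le> mass * (2 * norm (z - \<eta>)) powr a"
        using muhat_le_mass by (intro mult_mono) auto
      also have "\<dots> = (2 powr a * mass) * norm (z - \<eta>) powr a"
        by (simp add: powr_mult)
      also have "\<dots> \<le> A * (1 + norm (z - \<eta>)) powr a"
        using w2 C0_nonneg by (intro mult_mono) (auto simp: A_def)
      finally show ?thesis .
    qed
  qed
  have 2: "(\<integral>\<eta>. cmod (muhat \<eta>) * ?G 1 (z - \<eta>) \<partial>lborel) \<le> A * K (a + 1) * norm z powr (- a)" if z: "z \<noteq> 0" for z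
  proof -
    have p: "norm z powr a > 0" "norm z powr (- a) = inverse (norm z powr a)" using z by (auto simp: powr_minus)
    have "(\<integral>\<eta>. cmod (muhat \<eta>) * ?G 1 (z - \<eta>) \<partial>lborel)
      \<le> (\<integral>\<eta>. (A * norm z powr (- a)) * ?G (a + 1) (z - \<eta>) \<partial>lborel)"
    proof (rule integral_mono)
      fix \<eta>
      have "cmod (muhat \<eta>) \<le> A * (1 + norm (z - \<eta>)) powr a * norm z powr (- a)"
      proof -
        have "cmod (muhat \<eta>) = (cmod (muhat \<eta>) * norm z powr a) * norm z powr (- a)"
          using p by simp
        also have "\<dots> \<le> (A * (1 + norm (z - \<eta>)) powr a) * norm z powr (- a)"
          by (intro mult_right_mono pt) auto
        finally show ?thesis .
      qed
      then have "cmod (muhat \<eta>) * ?G 1 (z - \<eta>) \<le> (A * (1 + norm (z - \<eta>)) powr a * norm z powr (- a)) * ?G 1 (z - \<eta>)"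
        by (intro mult_right_mono G0)
      also have "\<dots> = (A * norm z powr (- a)) * ?G (a + 1) (z - \<eta>)"
        by (simp add: powr_add add_pos_nonneg)
      finally show "cmod (muhat \<eta>) * ?G 1 (z - \<eta>) \<le> (A * norm z powr (- a)) * ?G (a + 1) (z - \<eta>)" .
    qed (use integrable_muhat_gauss[of 1 z] iG[of "a + 1" z] a_gt in auto)
    also have "\<dots> = A * K (a + 1) * norm z powr (- a)"
      by (simp only: integral_mult_right_zero KG) (simp only: mult_ac)
    finally show ?thesis .
  qed
  show ?thesis
  proof (rule that[of C])
    show "C \<ge> 0" using A0 K0 by (simp add: C_def)
    show "(\<integral>\<eta>. cmod (muhat \<eta>) * ?G 1 (z - \<eta>) \<partial>lborel) \<le> C" for z
      using 1[of z] A0 K0[of "a+1"] by (simp add: C_def add_increasing2)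
    show "(\<integral>\<eta>. cmod (muhat \<eta>) * ?G 1 (z - \<eta>) \<partial>lborel) \<le> C * norm z powr (- a)" if "z \<noteq> 0" for z
    proof -
      have "A * K (a + 1) * norm z powr (- a) \<le> C * norm z powr (- a)"
        using K0[of 1] by (intro mult_right_mono) (auto simp: C_def)
      with 2[OF that] show ?thesis by linarith
    qed
  qed
qed

text \<open>Both functions are dominated by the integral in \<open>muhat_gauss_decay\<close>:
  differentiating the Gaussian along the ray produces a factor of at most 2 pi |z - \<eta>| |\<xi>|.
  The bounds without decay serve integrability and the point \<xi> = 0.\<close>

lemma nuhat_bounds:
  obtains C where "C \<ge> 0" "\<And>z. cmod (nuhat z) \<le> C" "\<And>t \<xi>. cmod (dnuhat t \<xi>) \<le> C * norm \<xi>"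
    "\<And>z. z \<noteq> 0 \<Longrightarrow> cmod (nuhat z) \<le> C * norm z powr (- a)"
    "\<And>t \<xi>. t *\<^sub>R \<xi> \<noteq> 0 \<Longrightarrow> cmod (dnuhat t \<xi>) \<le> C * norm \<xi> * norm (t *\<^sub>R \<xi>) powr (- a)"
proof -
  obtain C where C: "C \<ge> 0"
    "\<And>z. (\<integral>\<eta>. cmod (muhat \<eta>) * ((1 + norm (z - \<eta>)) powr 1 * gauss (z - \<eta>)) \<partial>lborel) \<le> C"
    "\<And>z. z \<noteq> 0 \<Longrightarrow> (\<integral>\<eta>. cmod (muhat \<eta>) * ((1 + norm (z - \<eta>)) powr 1 * gauss (z - \<eta>)) \<partial>lborel) \<le> C * norm z powr (- a)"
    using muhat_gauss_decay by blast
  let ?I = "\<lambda>z. \<integral>\<eta>. cmod (muhat \<eta>) * ((1 + norm (z - \<eta>)) powr 1 * gauss (z - \<eta>)) \<partial>lborel"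
  have i: "integrable lborel (\<lambda>\<eta>. cmod (muhat \<eta>) * ((1 + norm (z - \<eta>)) powr 1 * gauss (z - \<eta>)))" for z
    by (intro integrable_muhat_gauss) simp
  have n: "cmod (nuhat z) \<le> ?I z" for z
  proof -
    have "cmod (nuhat z) \<le> (\<integral>\<eta>. cmod (muhat \<eta> * gauss (z - \<eta>)) \<partial>lborel)"
      unfolding nuhat_def by (rule integral_norm_bound)
    also have "\<dots> \<le> ?I z"
    proof (rule integral_mono_AE')
      show "AE \<eta> in lborel. cmod (muhat \<eta> * gauss (z - \<eta>)) \<le> cmod (muhat \<eta>) * ((1 + norm (z - \<eta>)) powr 1 * gauss (z - \<eta>))"
        by (intro AE_I2) (auto simp: norm_mult intro!: mult_left_mono mult_right_mono[of 1, simplified])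
    qed (use i in auto)
    finally show ?thesis .
  qed
  have d: "cmod (dnuhat t \<xi>) \<le> 2 * pi * norm \<xi> * ?I (t *\<^sub>R \<xi>)" for t \<xi>
  proof -
    let ?z = "t *\<^sub>R \<xi>"
    have "cmod (dnuhat t \<xi>) \<le> (\<integral>\<eta>. cmod (muhat \<eta> * of_real (- 2 * pi * ((?z - \<eta>) \<bullet> \<xi>) * gauss (?z - \<eta>))) \<partial>lborel)"
      unfolding dnuhat_def by (rule integral_norm_bound)
    also have "\<dots> \<le> (\<integral>\<eta>. (2 * pi * norm \<xi>) * (cmod (muhat \<eta>) * ((1 + norm (?z - \<eta>)) powr 1 * gauss (?z - \<eta>))) \<partial>lborel)"
    proof (rule integral_mono_AE')
      show "AE \<eta> in lborel. cmod (muhat \<eta> * of_real (- 2 * pi * ((?z - \<eta>) \<bullet> \<xi>) * gauss (?z - \<eta>)))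
        \<le> (2 * pi * norm \<xi>) * (cmod (muhat \<eta>) * ((1 + norm (?z - \<eta>)) powr 1 * gauss (?z - \<eta>)))"
      proof (rule AE_I2)
        fix \<eta>
        let ?g = "gauss (?z - \<eta>)" and ?m = "cmod (muhat \<eta>)"
        have "\<bar>(?z - \<eta>) \<bullet> \<xi>\<bar> \<le> norm (?z - \<eta>) * norm \<xi>" by (rule Cauchy_Schwarz_ineq2)
        also have "\<dots> \<le> (1 + norm (?z - \<eta>)) * norm \<xi>" by (intro mult_right_mono) auto
        finally have le: "\<bar>(?z - \<eta>) \<bullet> \<xi>\<bar> \<le> (1 + norm (?z - \<eta>)) * norm \<xi>" .
        have "cmod (muhat \<eta> * of_real (- 2 * pi * ((?z - \<eta>) \<bullet> \<xi>) * ?g)) = (2 * pi * ?m * ?g) * \<bar>(?z - \<eta>) \<bullet> \<xi>\<bar>"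
          by (simp only: norm_mult norm_of_real abs_mult) (simp add: mult_ac)
        also have "\<dots> \<le> (2 * pi * ?m * ?g) * ((1 + norm (?z - \<eta>)) * norm \<xi>)"
          using le by (intro mult_left_mono) auto
        also have "\<dots> = (2 * pi * norm \<xi>) * (?m * ((1 + norm (?z - \<eta>)) powr 1 * ?g))"
          by (simp add: mult_ac)
        finally show "cmod (muhat \<eta> * of_real (- 2 * pi * ((?z - \<eta>) \<bullet> \<xi>) * ?g))
          \<le> (2 * pi * norm \<xi>) * (?m * ((1 + norm (?z - \<eta>)) powr 1 * ?g))" .
      qed
    qed (use i[of ?z] in auto)
    also have "\<dots> = 2 * pi * norm \<xi> * ?I ?z"
      by (simp only: integral_mult_right_zero)
    finally show ?thesis .
  qed
  have p1: "1 \<le> 2 * pi" using pi_gt3 by simp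
  show ?thesis
  proof (rule that[of "2 * pi * C"])
    show "2 * pi * C \<ge> 0" using C(1) by simp
    show "cmod (nuhat z) \<le> 2 * pi * C" for z
      using n[of z] C(2)[of z] mult_right_mono[OF p1 C(1)] by linarith
    show "cmod (dnuhat t \<xi>) \<le> 2 * pi * C * norm \<xi>" for t \<xi>
    proof -
      have "2 * pi * norm \<xi> * ?I (t *\<^sub>R \<xi>) \<le> 2 * pi * norm \<xi> * C"
        by (intro mult_left_mono C(2)) auto
      also have "\<dots> = 2 * pi * C * norm \<xi>" by simp
      finally show ?thesis using d[of t \<xi>] by linarith
    qed
    show "cmod (nuhat z) \<le> 2 * pi * C * norm z powr (- a)" if "z \<noteq> 0" for z
    proof -
      have "C * norm z powr (- a) \<le> 2 * pi * C * norm z powr (- a)"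
        using mult_right_mono[OF p1 C(1)] by (intro mult_right_mono) auto
      then show ?thesis using n[of z] C(3)[OF that] by linarith
    qed
    show "cmod (dnuhat t \<xi>) \<le> 2 * pi * C * norm \<xi> * norm (t *\<^sub>R \<xi>) powr (- a)" if "t *\<^sub>R \<xi> \<noteq> 0" for t \<xi>
    proof -
      have "2 * pi * norm \<xi> * ?I (t *\<^sub>R \<xi>) \<le> 2 * pi * norm \<xi> * (C * norm (t *\<^sub>R \<xi>) powr (- a))"
        by (intro mult_left_mono C(3) that) auto
      also have "\<dots> = 2 * pi * C * norm \<xi> * norm (t *\<^sub>R \<xi>) powr (- a)" by simp
      finally show ?thesis using d[of t \<xi>] by linarith
    qed
  qed
qed

end

section \<open>Dyadic multipliers\<close>

text \<open>Serves the case where the majorant does not factor: in \<open>mult_FTC\<close> the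
  Gaussian in \<eta> is centred at \<tau> \<xi>, which moves with \<tau>, and only its integral over
  \<eta> is bounded uniformly.\<close>

lemma (in pair_sigma_finite) Fubini_iterated_bound:
  fixes f :: "'a \<Rightarrow> 'b \<Rightarrow> complex" and u :: "'a \<Rightarrow> real"
  assumes f [measurable]: "case_prod f \<in> borel_measurable (M1 \<Otimes>\<^sub>M M2)"
    and u: "integrable M1 u"
    and i: "\<And>x. x \<in> space M1 \<Longrightarrow> integrable M2 (\<lambda>y. f x y)"
    and le: "\<And>x. x \<in> space M1 \<Longrightarrow> (\<integral>y. cmod (f x y) \<partial>M2) \<le> u x"
  shows "(\<integral>y. (\<integral>x. f x y \<partial>M1) \<partial>M2) = (\<integral>x. (\<integral>y. f x y \<partial>M2) \<partial>M1)"
proof -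
  have "integrable (M1 \<Otimes>\<^sub>M M2) (case_prod f)"
  proof (rule Fubini_integrable)
    show "case_prod f \<in> borel_measurable (M1 \<Otimes>\<^sub>M M2)" by (fact f)
    show "AE x in M1. integrable M2 (\<lambda>y. case (x, y) of (x, y) \<Rightarrow> f x y)"
      using i by (intro AE_I2) auto
    show "integrable M1 (\<lambda>x. \<integral>y. norm (case (x, y) of (x, y) \<Rightarrow> f x y) \<partial>M2)"
    proof (rule Bochner_Integration.integrable_bound[OF u])
      show "(\<lambda>x. \<integral>y. norm (case (x, y) of (x, y) \<Rightarrow> f x y) \<partial>M2) \<in> borel_measurable M1"
        by measurable
      show "AE x in M1. norm (\<integral>y. norm (case (x, y) of (x, y) \<Rightarrow> f x y) \<partial>M2) \<le> norm (u x)"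
        using le by (intro AE_I2) (auto intro: order_trans[OF _ abs_ge_self])
    qed
  qed
  then show ?thesis by (rule Fubini_integral)
qed

text \<open>At \<open>u = pi \<epsilon>\<^sup>2 t\<^sup>2 |\<xi>|\<^sup>2\<close>, replacing \<open>\<epsilon>\<close> by \<open>\<epsilon>/2\<close> divides \<open>u\<close> by 4, so summing \<open>psi\<close> over
  \<open>\<epsilon>, \<epsilon>/2, \<epsilon>/4, \<dots>\<close> telescopes to the high frequency multiplier \<open>(1 - exp (- u)) ^ L\<close>. The power
  \<open>L\<close> makes \<open>psi\<close> vanish to order \<open>L\<close> at 0, which beats the decay exponent \<open>a\<close>.\<close>

definition psi :: "nat \<Rightarrow> real \<Rightarrow> real" where
  "psi L u = (1 - exp (- u)) ^ L - (1 - exp (- u / 4)) ^ L"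

definition dpsi :: "nat \<Rightarrow> real \<Rightarrow> real" where
  "dpsi L u = real L * ((1 - exp (- u)) ^ (L - 1) * exp (- u) - (1 - exp (- u / 4)) ^ (L - 1) * (exp (- u / 4) / 4))"

lemma psi_measurable [measurable]: "psi L \<in> borel_measurable borel"
  unfolding psi_def by measurable

lemma dpsi_measurable [measurable]: "dpsi L \<in> borel_measurable borel"
  unfolding dpsi_def by measurable

lemma psi_deriv: "(psi L has_real_derivative dpsi L u) (at u)"
  unfolding psi_def dpsi_def by (auto intro!: derivative_eq_intros simp: algebra_simps)

lemma isCont_dpsi: "isCont (dpsi L) u"
  unfolding dpsi_def by (intro continuous_intros) simp_all

lemma one_minus_exp_bounds:
  fixes u :: real assumes "u \<ge> 0"
  shows "0 \<le> 1 - exp (- u)" "1 - exp (- u) \<le> u" "1 - exp (- u) \<le> 1"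
  using exp_ge_add_one_self[of "- u"] assms by auto

text \<open>With A = 1 - exp (- u) and B = 1 - exp (- u / 4), the factorisation of A ^ L - B ^ L
  contains A - B, which supplies the decay exp (- u / 4), and L - 1 further factors of size at most
  u. Each of the two terms of the derivative carries the same exponential decay and L - 1 such
  factors.\<close>

lemma psi_bounds:
  assumes u: "u \<ge> 0" and L: "L \<ge> 1"
  shows "\<bar>psi L u\<bar> \<le> 1" and "\<bar>psi L u\<bar> \<le> real L * u ^ L * exp (- u / 4)"
    and "\<bar>dpsi L u\<bar> \<le> 2 * real L" and "\<bar>u * dpsi L u\<bar> \<le> 2 * real L * u ^ L * exp (- u / 4)"
proof -
  define A where "A = 1 - exp (- u)"
  define B where "B = 1 - exp (- u / 4)"
  have A: "0 \<le> A" "A \<le> u" "A \<le> 1" using one_minus_exp_bounds[OF u] by (auto simp: A_def)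
  have BA: "B \<le> A" using u by (simp add: A_def B_def)
  have B: "0 \<le> B" "B \<le> u" "B \<le> 1" using one_minus_exp_bounds[of "u / 4"] u BA A by (auto simp: B_def)
  have psi: "psi L u = A ^ L - B ^ L" by (simp add: psi_def A_def B_def)
  have AL: "A ^ L \<le> 1" "B ^ L \<le> A ^ L" "0 \<le> B ^ L" using A B BA by (auto intro: power_le_one power_mono)
  then show "\<bar>psi L u\<bar> \<le> 1" by (simp add: psi)
  have eAB: "A - B \<le> u * exp (- u / 4)"
  proof -
    have "A - B = exp (- u / 4) * (1 - exp (- (3 * u / 4)))"
      by (simp add: A_def B_def right_diff_distrib exp_add[symmetric])
    also have "\<dots> \<le> exp (- u / 4) * u"
      using one_minus_exp_bounds(2)[of "3 * u / 4"] u by (intro mult_left_mono) auto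
    finally show ?thesis by (simp add: mult.commute)
  qed
  have "A ^ L - B ^ L = (A - B) * (\<Sum>i<L. B ^ (L - Suc i) * A ^ i)"
    by (rule power_diff_sumr2)
  also have "\<dots> \<le> (u * exp (- u / 4)) * (real L * u ^ (L - 1))"
  proof (rule mult_mono)
    show "(\<Sum>i<L. B ^ (L - Suc i) * A ^ i) \<le> real L * u ^ (L - 1)"
    proof -
      have "(\<Sum>i<L. B ^ (L - Suc i) * A ^ i) \<le> (\<Sum>i<L. u ^ (L - 1))"
      proof (rule sum_mono)
        fix i assume "i \<in> {..<L}"
        then have e: "L - 1 = (L - Suc i) + i" by auto
        show "B ^ (L - Suc i) * A ^ i \<le> u ^ (L - 1)"
          unfolding e power_add using A B by (intro mult_mono power_mono) auto
      qed
      then show ?thesis by simp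
    qed
  qed (use A B u BA eAB in \<open>auto intro!: sum_nonneg\<close>)
  also have "\<dots> = real L * (u * u ^ (L - 1)) * exp (- u / 4)" by simp
  also have "u * u ^ (L - 1) = u ^ L" using L by (simp add: power_eq_if)
  finally show "\<bar>psi L u\<bar> \<le> real L * u ^ L * exp (- u / 4)" using AL by (simp add: psi)
  have dp: "dpsi L u = real L * (A ^ (L - 1) * exp (- u) - B ^ (L - 1) * (exp (- u / 4) / 4))"
    by (simp add: dpsi_def A_def B_def)
  have E: "exp (- u) \<le> exp (- u / 4)" "exp (- u / 4) \<le> 1" using u by auto
  \<comment> \<open>Used with v = 1 for the uniform bound and with v = u for the order of vanishing
    at 0.\<close>
  have key: "\<bar>dpsi L u\<bar> \<le> real L * (2 * v ^ (L - 1) * exp (- u / 4))" if v: "A \<le> v" for v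
  proof -
    have 1: "A ^ (L - 1) * exp (- u) \<le> v ^ (L - 1) * exp (- u / 4)"
      using A v E by (intro mult_mono power_mono) auto
    have 2: "B ^ (L - 1) * (exp (- u / 4) / 4) \<le> v ^ (L - 1) * exp (- u / 4)"
      using A B BA v by (intro mult_mono power_mono) auto
    have 3: "0 \<le> A ^ (L - 1) * exp (- u)" "0 \<le> B ^ (L - 1) * (exp (- u / 4) / 4)" using A B by auto
    have "\<bar>A ^ (L - 1) * exp (- u) - B ^ (L - 1) * (exp (- u / 4) / 4)\<bar> \<le> 2 * v ^ (L - 1) * exp (- u / 4)"
      using 1 2 3 by linarith
    then show ?thesis
      unfolding dp abs_mult by (intro mult_mono) auto
  qed
  show "\<bar>dpsi L u\<bar> \<le> 2 * real L"
  proof -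
    have "real L * (2 * 1 ^ (L - 1) * exp (- u / 4)) \<le> real L * (2 * 1)"
      using E by (intro mult_left_mono) auto
    then show ?thesis using key[OF A(3)] by simp
  qed
  have "\<bar>u * dpsi L u\<bar> \<le> u * (real L * (2 * u ^ (L - 1) * exp (- u / 4)))"
    unfolding abs_mult using key[OF A(2)] u by (intro mult_mono) auto
  also have "\<dots> = 2 * real L * (u * u ^ (L - 1)) * exp (- u / 4)" by simp
  also have "u * u ^ (L - 1) = u ^ L" using L by (simp add: power_eq_if)
  finally show "\<bar>u * dpsi L u\<bar> \<le> 2 * real L * u ^ L * exp (- u / 4)" .
qed

text \<open>The exponent is expanded as a polynomial in t, so that the derivative along the ray
  follows from the rules for polynomials.\<close>

lemma gauss_ray: "gauss (t *\<^sub>R \<xi> - \<eta>) = exp (- pi * (t\<^sup>2 * (\<xi> \<bullet> \<xi>) - 2 * t * (\<xi> \<bullet> \<eta>) + \<eta> \<bullet> \<eta>))"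
  unfolding gauss_def power2_norm_eq_inner
  by (simp add: inner_diff_left inner_diff_right inner_commute power2_eq_square algebra_simps)

lemma gauss_ray_deriv:
  "((\<lambda>t. gauss (t *\<^sub>R \<xi> - \<eta>)) has_real_derivative - 2 * pi * ((t *\<^sub>R \<xi> - \<eta>) \<bullet> \<xi>) * gauss (t *\<^sub>R \<xi> - \<eta>)) (at t)"
  unfolding gauss_ray
  by (auto intro!: derivative_eq_intros simp: inner_diff_left inner_commute algebra_simps power2_eq_square)

section \<open>Multipliers localised in frequency and their derivative in t\<close>

context decaying_measure
begin

text \<open>The multiplier of the average at time t, localised to frequencies of size about 1 /
  (\<delta> t).\<close>

definition mult :: "nat \<Rightarrow> real \<Rightarrow> real \<Rightarrow> 'a \<Rightarrow> complex" where
  "mult L \<delta> t \<xi> = nuhat (t *\<^sub>R \<xi>) * psi L (pi * \<delta>\<^sup>2 * t\<^sup>2 * (norm \<xi>)\<^sup>2)"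

definition dmult :: "nat \<Rightarrow> real \<Rightarrow> real \<Rightarrow> 'a \<Rightarrow> complex" where
  "dmult L \<delta> t \<xi> = dnuhat t \<xi> * psi L (pi * \<delta>\<^sup>2 * t\<^sup>2 * (norm \<xi>)\<^sup>2)
     + nuhat (t *\<^sub>R \<xi>) * (dpsi L (pi * \<delta>\<^sup>2 * t\<^sup>2 * (norm \<xi>)\<^sup>2) * (2 * pi * \<delta>\<^sup>2 * t * (norm \<xi>)\<^sup>2))"

lemma mult_measurable [measurable]:
  assumes [measurable]: "f \<in> borel_measurable M" "g \<in> borel_measurable M"
  shows "(\<lambda>x. mult L \<delta> (f x) (g x)) \<in> borel_measurable M"
  unfolding mult_def by measurable

lemma dmult_measurable [measurable]:
  assumes [measurable]: "f \<in> borel_measurable M" "g \<in> borel_measurable M"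
  shows "(\<lambda>x. dmult L \<delta> (f x) (g x)) \<in> borel_measurable M"
  unfolding dmult_def by measurable

lemma integrable_muhat_gauss0: "integrable lborel (\<lambda>\<eta>. muhat \<eta> * gauss (z - \<eta>))"
proof (rule Bochner_Integration.integrable_bound[OF integrable_muhat_gauss[of 0 z]])
  have "1 + norm (z - \<eta>) \<noteq> 0" for \<eta>
    using norm_ge_zero[of "z - \<eta>"] by linarith
  then show "AE \<eta> in lborel. norm (muhat \<eta> * gauss (z - \<eta>)) \<le> norm (cmod (muhat \<eta>) * ((1 + norm (z - \<eta>)) powr 0 * gauss (z - \<eta>)))"
    by (intro AE_I2) (simp add: norm_mult)
qed auto

lemma integrable_muhat_gauss1:
  "integrable lborel (\<lambda>\<eta>. muhat \<eta> * of_real (- 2 * pi * ((z - \<eta>) \<bullet> \<xi>) * gauss (z - \<eta>)))"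
proof (rule Bochner_Integration.integrable_bound)
  show "integrable lborel (\<lambda>\<eta>. (2 * pi * norm \<xi>) * (cmod (muhat \<eta>) * ((1 + norm (z - \<eta>)) powr 1 * gauss (z - \<eta>))))"
    using integrable_muhat_gauss[of 1 z] by simp
  show "AE \<eta> in lborel. norm (muhat \<eta> * of_real (- 2 * pi * ((z - \<eta>) \<bullet> \<xi>) * gauss (z - \<eta>)))
    \<le> norm ((2 * pi * norm \<xi>) * (cmod (muhat \<eta>) * ((1 + norm (z - \<eta>)) powr 1 * gauss (z - \<eta>))))"
  proof (rule AE_I2)
    fix \<eta>
    let ?g = "gauss (z - \<eta>)" and ?m = "cmod (muhat \<eta>)"
    have "\<bar>(z - \<eta>) \<bullet> \<xi>\<bar> \<le> norm (z - \<eta>) * norm \<xi>" by (rule Cauchy_Schwarz_ineq2)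
    also have "\<dots> \<le> (1 + norm (z - \<eta>)) * norm \<xi>" by (intro mult_right_mono) auto
    finally have le: "\<bar>(z - \<eta>) \<bullet> \<xi>\<bar> \<le> (1 + norm (z - \<eta>)) * norm \<xi>" .
    have "norm (muhat \<eta> * of_real (- 2 * pi * ((z - \<eta>) \<bullet> \<xi>) * ?g)) = (2 * pi * ?m * ?g) * \<bar>(z - \<eta>) \<bullet> \<xi>\<bar>"
      by (simp only: norm_mult norm_of_real abs_mult) (simp add: mult_ac)
    also have "\<dots> \<le> (2 * pi * ?m * ?g) * ((1 + norm (z - \<eta>)) * norm \<xi>)"
      using le by (intro mult_left_mono) auto
    also have "\<dots> = norm ((2 * pi * norm \<xi>) * (?m * ((1 + norm (z - \<eta>)) powr 1 * ?g)))"
      by (simp add: mult_ac)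
    finally show "norm (muhat \<eta> * of_real (- 2 * pi * ((z - \<eta>) \<bullet> \<xi>) * ?g))
      \<le> norm ((2 * pi * norm \<xi>) * (?m * ((1 + norm (z - \<eta>)) powr 1 * ?g)))" .
  qed
qed measurable

text \<open>The fundamental theorem is applied to the smooth integrand for each \<eta>, and then the
  two integrals are exchanged. Only this integrated form of the derivative is used later.\<close>

lemma mult_FTC:
  assumes st: "0 < s" "s \<le> t" and L: "L \<ge> 1"
  shows "mult L \<delta> t \<xi> - mult L \<delta> s \<xi> = (\<integral>\<tau>. indicator {s..t} \<tau> *\<^sub>R dmult L \<delta> \<tau> \<xi> \<partial>lborel)"
proof -
  define u where "u \<tau> = pi * \<delta>\<^sup>2 * \<tau>\<^sup>2 * (norm \<xi>)\<^sup>2" for \<tau>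
  define u' where "u' \<tau> = 2 * pi * \<delta>\<^sup>2 * \<tau> * (norm \<xi>)\<^sup>2" for \<tau>
  have u0: "u \<tau> \<ge> 0" for \<tau> by (simp add: u_def)
  have [measurable]: "u \<in> borel_measurable borel" "u' \<in> borel_measurable borel"
    unfolding u_def u'_def by measurable
  define g' where "g' \<tau> \<eta> = - 2 * pi * ((\<tau> *\<^sub>R \<xi> - \<eta>) \<bullet> \<xi>) * gauss (\<tau> *\<^sub>R \<xi> - \<eta>)" for \<tau> \<eta>
  define G where "G \<tau> \<eta> = gauss (\<tau> *\<^sub>R \<xi> - \<eta>) * psi L (u \<tau>)" for \<tau> \<eta>
  define G' where "G' \<tau> \<eta> = g' \<tau> \<eta> * psi L (u \<tau>) + gauss (\<tau> *\<^sub>R \<xi> - \<eta>) * (dpsi L (u \<tau>) * u' \<tau>)" for \<tau> \<eta>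
  have du: "(u has_real_derivative u' \<tau>) (at \<tau>)" for \<tau>
    unfolding u_def u'_def by (auto intro!: derivative_eq_intros)
  have cu: "isCont u \<tau>" "isCont u' \<tau>" for \<tau>
    unfolding u_def u'_def by (intro continuous_intros)+
  have FTC: "(\<integral>\<tau>. G' \<tau> \<eta> * indicator {s..t} \<tau> \<partial>lborel) = G t \<eta> - G s \<eta>" for \<eta>
  proof (rule integral_FTC_Icc_real[of s t "\<lambda>\<tau>. G \<tau> \<eta>" "\<lambda>\<tau>. G' \<tau> \<eta>"])
    fix \<tau>
    have dp: "((\<lambda>\<tau>. psi L (u \<tau>)) has_real_derivative dpsi L (u \<tau>) * u' \<tau>) (at \<tau>)"
      using DERIV_chain2[OF psi_deriv du] by simp
    show "DERIV (\<lambda>\<tau>. G \<tau> \<eta>) \<tau> :> G' \<tau> \<eta>"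
      unfolding G_def G'_def g'_def
      by (rule DERIV_cong[OF DERIV_mult[OF gauss_ray_deriv dp]]) (simp add: algebra_simps)
    have c1: "isCont (\<lambda>\<tau>. gauss (\<tau> *\<^sub>R \<xi> - \<eta>)) \<tau>"
      by (rule DERIV_isCont[OF gauss_ray_deriv])
    have c2: "isCont (\<lambda>\<tau>. psi L (u \<tau>)) \<tau>" by (rule DERIV_isCont[OF dp])
    have c3: "isCont (\<lambda>\<tau>. dpsi L (u \<tau>)) \<tau>" by (rule isCont_o2[OF cu(1) isCont_dpsi])
    show "isCont (\<lambda>\<tau>. G' \<tau> \<eta>) \<tau>"
      unfolding G'_def g'_def by (intro continuous_intros c1 c2 c3 cu)
  qed (use st in auto)
  have mG: "mult L \<delta> \<tau> \<xi> = (\<integral>\<eta>. muhat \<eta> * of_real (G \<tau> \<eta>) \<partial>lborel)" for \<tau>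
  proof -
    have "mult L \<delta> \<tau> \<xi> = (\<integral>\<eta>. (muhat \<eta> * gauss (\<tau> *\<^sub>R \<xi> - \<eta>)) * psi L (u \<tau>) \<partial>lborel)"
      by (subst integral_mult_left_zero) (simp add: mult_def nuhat_def u_def)
    then show ?thesis by (simp add: G_def mult.assoc)
  qed
  have iG: "integrable lborel (\<lambda>\<eta>. muhat \<eta> * of_real (G \<tau> \<eta>))" for \<tau>
  proof -
    have "integrable lborel (\<lambda>\<eta>. (muhat \<eta> * gauss (\<tau> *\<^sub>R \<xi> - \<eta>)) * psi L (u \<tau>))"
      using integrable_muhat_gauss0 by (intro integrable_mult_left) auto
    then show ?thesis by (simp add: G_def mult.assoc)
  qed
  have split: "muhat \<eta> * of_real (G' \<tau> \<eta>) = (muhat \<eta> * of_real (g' \<tau> \<eta>)) * psi L (u \<tau>)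
      + (muhat \<eta> * gauss (\<tau> *\<^sub>R \<xi> - \<eta>)) * (dpsi L (u \<tau>) * u' \<tau>)" for \<tau> \<eta>
    by (simp add: G'_def distrib_left mult.assoc)
  have i1: "integrable lborel (\<lambda>\<eta>. (muhat \<eta> * of_real (g' \<tau> \<eta>)) * psi L (u \<tau>))" for \<tau>
    unfolding g'_def using integrable_muhat_gauss1[of "\<tau> *\<^sub>R \<xi>" \<xi>] by (intro integrable_mult_left) auto
  have i2: "integrable lborel (\<lambda>\<eta>. (muhat \<eta> * gauss (\<tau> *\<^sub>R \<xi> - \<eta>)) * (dpsi L (u \<tau>) * u' \<tau>))" for \<tau>
    using integrable_muhat_gauss0[of "\<tau> *\<^sub>R \<xi>"] by (intro integrable_mult_left) auto
  have iG': "integrable lborel (\<lambda>\<eta>. muhat \<eta> * of_real (G' \<tau> \<eta>))" for \<tau>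
    unfolding split by (intro Bochner_Integration.integrable_add i1 i2)
  have dG: "dmult L \<delta> \<tau> \<xi> = (\<integral>\<eta>. muhat \<eta> * of_real (G' \<tau> \<eta>) \<partial>lborel)" for \<tau>
  proof -
    have "(\<integral>\<eta>. muhat \<eta> * of_real (G' \<tau> \<eta>) \<partial>lborel)
      = (\<integral>\<eta>. (muhat \<eta> * of_real (g' \<tau> \<eta>)) * psi L (u \<tau>) \<partial>lborel)
        + (\<integral>\<eta>. (muhat \<eta> * gauss (\<tau> *\<^sub>R \<xi> - \<eta>)) * (dpsi L (u \<tau>) * u' \<tau>) \<partial>lborel)"
      unfolding split by (intro Bochner_Integration.integral_add i1 i2)
    also have "\<dots> = dmult L \<delta> \<tau> \<xi>"
      unfolding integral_mult_left_zero
      by (simp only: dmult_def dnuhat_def nuhat_def g'_def u_def u'_def of_real_mult)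
    finally show ?thesis by simp
  qed
  obtain C where C: "C \<ge> 0"
    "\<And>z. (\<integral>\<eta>. cmod (muhat \<eta>) * ((1 + norm (z - \<eta>)) powr 1 * gauss (z - \<eta>)) \<partial>lborel) \<le> C"
    "\<And>z. z \<noteq> 0 \<Longrightarrow> (\<integral>\<eta>. cmod (muhat \<eta>) * ((1 + norm (z - \<eta>)) powr 1 * gauss (z - \<eta>)) \<partial>lborel) \<le> C * norm z powr (- a)"
    apply (rule muhat_gauss_decay)
    subgoal premises p by (rule p(1)[OF p(2-4)])
    done
  \<comment> \<open>On [s, t] the factor \<open>u'\<close> is at most its value at t, so one
    constant bounds the derivative of the integrand by a Gaussian with a linear weight.\<close>
  define K where "K = 2 * pi * norm \<xi> + 2 * real L * (2 * pi * \<delta>\<^sup>2 * t * (norm \<xi>)\<^sup>2)"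
  have K0: "K \<ge> 0" using st by (simp add: K_def)
  have ptb: "\<bar>G' \<tau> \<eta>\<bar> \<le> K * ((1 + norm (\<tau> *\<^sub>R \<xi> - \<eta>)) powr 1 * gauss (\<tau> *\<^sub>R \<xi> - \<eta>))" if \<tau>: "\<tau> \<in> {s..t}" for \<tau> \<eta>
  proof -
    let ?z = "\<tau> *\<^sub>R \<xi> - \<eta>"
    have "\<bar>?z \<bullet> \<xi>\<bar> \<le> norm ?z * norm \<xi>" by (rule Cauchy_Schwarz_ineq2)
    also have "\<dots> \<le> (1 + norm ?z) * norm \<xi>" by (intro mult_right_mono) auto
    finally have le: "\<bar>?z \<bullet> \<xi>\<bar> \<le> (1 + norm ?z) * norm \<xi>" .
    have 1: "\<bar>g' \<tau> \<eta> * psi L (u \<tau>)\<bar> \<le> (2 * pi * ((1 + norm ?z) * norm \<xi>) * gauss ?z) * 1"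
      unfolding g'_def abs_mult using le psi_bounds(1)[OF u0 L] by (intro mult_mono) auto
    have 2: "\<bar>gauss ?z * (dpsi L (u \<tau>) * u' \<tau>)\<bar> \<le> ((1 + norm ?z) * gauss ?z) * ((2 * real L) * (2 * pi * \<delta>\<^sup>2 * t * (norm \<xi>)\<^sup>2))"
      unfolding abs_mult
    proof (intro mult_mono)
      show "\<bar>gauss ?z\<bar> \<le> (1 + norm ?z) * gauss ?z" by (simp add: distrib_right)
      show "\<bar>dpsi L (u \<tau>)\<bar> \<le> 2 * real L" by (rule psi_bounds(3)[OF u0 L])
      show "\<bar>u' \<tau>\<bar> \<le> 2 * pi * \<delta>\<^sup>2 * t * (norm \<xi>)\<^sup>2"
        using \<tau> st by (simp add: u'_def abs_mult mult_left_mono mult_right_mono)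
    qed auto
    have "\<bar>G' \<tau> \<eta>\<bar> \<le> \<bar>g' \<tau> \<eta> * psi L (u \<tau>)\<bar> + \<bar>gauss ?z * (dpsi L (u \<tau>) * u' \<tau>)\<bar>"
      unfolding G'_def by (rule abs_triangle_ineq)
    also have "\<dots> \<le> (2 * pi * ((1 + norm ?z) * norm \<xi>) * gauss ?z) * 1 + ((1 + norm ?z) * gauss ?z) * ((2 * real L) * (2 * pi * \<delta>\<^sup>2 * t * (norm \<xi>)\<^sup>2))"
      by (intro add_mono 1 2)
    also have "\<dots> = K * ((1 + norm ?z) powr 1 * gauss ?z)"
      by (simp add: K_def algebra_simps)
    finally show ?thesis .
  qed
  have int_le: "(\<integral>\<eta>. cmod (muhat \<eta> * of_real (G' \<tau> \<eta> * indicator {s..t} \<tau>)) \<partial>lborel) \<le> K * C * indicator {s..t} \<tau>" for \<tau>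
  proof (cases "\<tau> \<in> {s..t}")
    case True
    have "(\<integral>\<eta>. cmod (muhat \<eta> * of_real (G' \<tau> \<eta>)) \<partial>lborel)
      \<le> (\<integral>\<eta>. K * (cmod (muhat \<eta>) * ((1 + norm (\<tau> *\<^sub>R \<xi> - \<eta>)) powr 1 * gauss (\<tau> *\<^sub>R \<xi> - \<eta>))) \<partial>lborel)"
    proof (rule integral_mono)
      show "integrable lborel (\<lambda>\<eta>. K * (cmod (muhat \<eta>) * ((1 + norm (\<tau> *\<^sub>R \<xi> - \<eta>)) powr 1 * gauss (\<tau> *\<^sub>R \<xi> - \<eta>))))"
        by (intro integrable_mult_right integrable_muhat_gauss) auto
      fix \<eta>
      have "cmod (muhat \<eta> * of_real (G' \<tau> \<eta>)) = cmod (muhat \<eta>) * \<bar>G' \<tau> \<eta>\<bar>"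
        by (simp add: norm_mult)
      also have "\<dots> \<le> cmod (muhat \<eta>) * (K * ((1 + norm (\<tau> *\<^sub>R \<xi> - \<eta>)) powr 1 * gauss (\<tau> *\<^sub>R \<xi> - \<eta>)))"
        by (intro mult_left_mono ptb True) auto
      finally show "cmod (muhat \<eta> * of_real (G' \<tau> \<eta>)) \<le> K * (cmod (muhat \<eta>) * ((1 + norm (\<tau> *\<^sub>R \<xi> - \<eta>)) powr 1 * gauss (\<tau> *\<^sub>R \<xi> - \<eta>)))"
        by (simp only: mult.left_commute)
    qed (use iG' in auto)
    also have "\<dots> \<le> K * C"
      unfolding integral_mult_right_zero by (intro mult_left_mono C(2) K0)
    finally show ?thesis using True by simp
  qed simp
  have "mult L \<delta> t \<xi> - mult L \<delta> s \<xi> = (\<integral>\<eta>. muhat \<eta> * of_real (G t \<eta>) - muhat \<eta> * of_real (G s \<eta>) \<partial>lborel)"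
    unfolding mG by (intro Bochner_Integration.integral_diff[symmetric] iG)
  also have "\<dots> = (\<integral>\<eta>. (\<integral>\<tau>. muhat \<eta> * of_real (G' \<tau> \<eta> * indicator {s..t} \<tau>) \<partial>lborel) \<partial>lborel)"
  proof (intro Bochner_Integration.integral_cong refl)
    fix \<eta>
    have "muhat \<eta> * of_real (G t \<eta>) - muhat \<eta> * of_real (G s \<eta>) = muhat \<eta> * of_real (\<integral>\<tau>. G' \<tau> \<eta> * indicator {s..t} \<tau> \<partial>lborel)"
      unfolding FTC by (simp add: right_diff_distrib)
    also have "\<dots> = (\<integral>\<tau>. muhat \<eta> * of_real (G' \<tau> \<eta> * indicator {s..t} \<tau>) \<partial>lborel)"
      by (simp only: integral_mult_right_zero Bochner_Integration.integral_complex_of_real)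
    finally show "muhat \<eta> * of_real (G t \<eta>) - muhat \<eta> * of_real (G s \<eta>) = (\<integral>\<tau>. muhat \<eta> * of_real (G' \<tau> \<eta> * indicator {s..t} \<tau>) \<partial>lborel)" .
  qed
  also have "\<dots> = (\<integral>\<tau>. (\<integral>\<eta>. muhat \<eta> * of_real (G' \<tau> \<eta> * indicator {s..t} \<tau>) \<partial>lborel) \<partial>lborel)"
  proof (rule lborel_pair.Fubini_iterated_bound[where u="\<lambda>\<tau>. K * C * indicator {s..t} \<tau>"])
    show "(\<lambda>(\<tau>, \<eta>). muhat \<eta> * of_real (G' \<tau> \<eta> * indicator {s..t} \<tau>)) \<in> borel_measurable (lborel \<Otimes>\<^sub>M lborel)"
      unfolding G'_def g'_def by measurable
    show "integrable lborel (\<lambda>\<tau>. K * C * indicator {s..t} \<tau>)"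
      by (intro integrable_mult_right integrable_real_indicator) (auto simp: emeasure_lborel_Icc_eq)
    show "integrable lborel (\<lambda>\<eta>. muhat \<eta> * of_real (G' \<tau> \<eta> * indicator {s..t} \<tau>))" for \<tau>
      using iG' by (cases "\<tau> \<in> {s..t}") auto
  qed (rule int_le)
  also have "\<dots> = (\<integral>\<tau>. indicator {s..t} \<tau> *\<^sub>R dmult L \<delta> \<tau> \<xi> \<partial>lborel)"
    by (intro Bochner_Integration.integral_cong refl) (auto simp: dG split: split_indicator)
  finally show ?thesis .
qed

end

context decaying_measure
begin

text \<open>Serves integrability only, so \<open>\<delta>\<close> stays fixed and the constant may
  depend on it and on \<open>t\<^sub>0\<close>. The power (1 + |\<xi>|)^2 comes from the factor
  |\<xi>|^2 in the derivative of the argument of \<open>psi\<close>.\<close>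

lemma mult_crude_bounds:
  assumes L: "L \<ge> 1" and t0: "t\<^sub>0 \<ge> 0"
  shows "\<exists>C\<ge>0. (\<forall>t \<xi>. cmod (mult L \<delta> t \<xi>) \<le> C) \<and>
    (\<forall>t \<xi>. 0 \<le> t \<longrightarrow> t \<le> t\<^sub>0 \<longrightarrow> cmod (dmult L \<delta> t \<xi>) \<le> C * (1 + norm \<xi>)\<^sup>2)"
proof -
  obtain C where C: "C \<ge> 0" "\<And>z. cmod (nuhat z) \<le> C" "\<And>t \<xi>. cmod (dnuhat t \<xi>) \<le> C * norm \<xi>"
    "\<And>z. z \<noteq> 0 \<Longrightarrow> cmod (nuhat z) \<le> C * norm z powr (- a)"
    "\<And>t \<xi>. t *\<^sub>R \<xi> \<noteq> 0 \<Longrightarrow> cmod (dnuhat t \<xi>) \<le> C * norm \<xi> * norm (t *\<^sub>R \<xi>) powr (- a)"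
    apply (rule nuhat_bounds)
    subgoal premises p by (rule p(1)[OF p(2-6)])
    done
  define K where "K = 1 + 2 * real L * (2 * pi * \<delta>\<^sup>2 * t\<^sub>0)"
  have K1: "K \<ge> 1" using t0 by (simp add: K_def)
  have u0: "0 \<le> pi * \<delta>\<^sup>2 * t\<^sup>2 * (norm \<xi>)\<^sup>2" for t and \<xi> :: 'a by simp
  have m: "cmod (mult L \<delta> t \<xi>) \<le> C" for t \<xi>
  proof -
    have "cmod (mult L \<delta> t \<xi>) \<le> C * 1"
      unfolding mult_def norm_mult norm_of_real using C psi_bounds(1)[OF u0 L] by (intro mult_mono) auto
    then show ?thesis by simp
  qed
  have d: "cmod (dmult L \<delta> t \<xi>) \<le> C * K * (1 + norm \<xi>)\<^sup>2" if t: "0 \<le> t" "t \<le> t\<^sub>0" for t \<xi>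
  proof -
    have n1: "norm \<xi> \<le> (1 + norm \<xi>)\<^sup>2" "(norm \<xi>)\<^sup>2 \<le> (1 + norm \<xi>)\<^sup>2"
      by (auto simp: power2_eq_square algebra_simps)
    have 1: "cmod (dnuhat t \<xi> * psi L (pi * \<delta>\<^sup>2 * t\<^sup>2 * (norm \<xi>)\<^sup>2)) \<le> (C * (1 + norm \<xi>)\<^sup>2) * 1"
      unfolding norm_mult norm_of_real
    proof (rule mult_mono)
      show "cmod (dnuhat t \<xi>) \<le> C * (1 + norm \<xi>)\<^sup>2"
        using C(3)[of t \<xi>] mult_left_mono[OF n1(1) C(1)] by linarith
    qed (use psi_bounds(1)[OF u0 L] C in auto)
    have 2: "cmod (nuhat (t *\<^sub>R \<xi>) * (dpsi L (pi * \<delta>\<^sup>2 * t\<^sup>2 * (norm \<xi>)\<^sup>2) * (2 * pi * \<delta>\<^sup>2 * t * (norm \<xi>)\<^sup>2)))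
      \<le> C * ((2 * real L) * (2 * pi * \<delta>\<^sup>2 * t\<^sub>0 * (1 + norm \<xi>)\<^sup>2))"
      unfolding of_real_mult[symmetric] norm_mult[of "nuhat _"] norm_of_real abs_mult[of "dpsi _ _"]
      using C t t0 n1 psi_bounds(3)[OF u0 L] by (intro mult_mono) (auto simp: abs_mult intro!: mult_mono)
    have "cmod (dmult L \<delta> t \<xi>) \<le> (C * (1 + norm \<xi>)\<^sup>2) * 1 + C * ((2 * real L) * (2 * pi * \<delta>\<^sup>2 * t\<^sub>0 * (1 + norm \<xi>)\<^sup>2))"
      unfolding dmult_def by (rule order_trans[OF norm_triangle_ineq add_mono[OF 1 2]])
    also have "\<dots> = C * K * (1 + norm \<xi>)\<^sup>2" by (simp add: K_def algebra_simps)
    finally show ?thesis .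
  qed
  have "C * K \<ge> 0" using C K1 by simp
  moreover have "cmod (mult L \<delta> t \<xi>) \<le> C * K" for t \<xi>
    using m[of t \<xi>] mult_left_mono[OF K1 C(1)] by linarith
  ultimately show ?thesis using d by (intro exI[of _ "C * K"]) auto
qed

text \<open>In the variable v = \<delta> t |\<xi>| the decay (t |\<xi>|)^(-2a) equals \<delta>^(2a)
  v^(-2a). Dividing by \<delta> gives the exponent 2a - 1, and what remains is an integral against
  dt / t, invariant under scaling and hence uniform in \<xi>. The weights 1 / (\<delta> t) and
  \<delta> t are those of the Sobolev inequality on an interval of length \<delta> t. The size of L
  lets the zero of \<open>psi\<close> at 0 compensate v^(-2a).\<close>

lemma multiplier_energy:
  assumes L: "real L \<ge> a + 1"
  shows "\<exists>C\<ge>0. \<forall>\<delta> \<xi>. 0 < \<delta> \<longrightarrow> \<delta> \<le> 1 \<longrightarrow>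
    (\<integral>\<^sup>+t. ennreal ((cmod (mult L \<delta> t \<xi>))\<^sup>2 / (\<delta> * t) + \<delta> * t * (cmod (dmult L \<delta> t \<xi>))\<^sup>2) * indicator {0<..} t \<partial>lborel)
      \<le> ennreal (C * \<delta> powr (2 * a - 1))"
proof -
  have L1: "L \<ge> 1" using L a_gt by linarith
  obtain C1 where C1: "C1 \<ge> 0" "\<And>z. cmod (nuhat z) \<le> C1" "\<And>t \<xi>. cmod (dnuhat t \<xi>) \<le> C1 * norm \<xi>"
    "\<And>z. z \<noteq> 0 \<Longrightarrow> cmod (nuhat z) \<le> C1 * norm z powr (- a)"
    "\<And>t \<xi>. t *\<^sub>R \<xi> \<noteq> 0 \<Longrightarrow> cmod (dnuhat t \<xi>) \<le> C1 * norm \<xi> * norm (t *\<^sub>R \<xi>) powr (- a)"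
    apply (rule nuhat_bounds)
    subgoal premises p by (rule p(1)[OF p(2-6)])
    done
  \<comment> \<open>The square of \<open>psi\<close> contributes v^(4L) and the decay v^(-2a); one
    factor v is set aside to form v exp (- v), and \<open>\<kappa>\<close> is the exponent left
    over.\<close>
  define \<kappa> where "\<kappa> = 4 * real L - 2 * a - 1"
  have k0: "\<kappa> \<ge> 0" using L a_gt by (simp add: \<kappa>_def)
  obtain C2 where C2: "C2 \<ge> 0" "\<And>v::real. v \<ge> 0 \<Longrightarrow> (1 + v) powr (\<kappa> + 2) \<le> C2 * exp (1 * v)"
    using powr_le_exp[of 1] by auto
  define C where "C = C1\<^sup>2 * (real L)\<^sup>2 * pi ^ (2 * L) * 17 * (C2 * exp 2)"
  have C0: "C \<ge> 0" using C2(1) by (simp add: C_def)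
  have vb: "v powr (4 * real L - 2 * a) * (1 + v)\<^sup>2 * exp (- pi * v\<^sup>2 / 2) \<le> C2 * exp 2 * (v * exp (- v))" if v: "v > 0" for v :: real
  proof -
    have "v powr (4 * real L - 2 * a) = v powr (1 + \<kappa>)" by (simp add: \<kappa>_def)
    also have "\<dots> = v * v powr \<kappa>" using v by (simp add: powr_add)
    finally have "v powr (4 * real L - 2 * a) * (1 + v)\<^sup>2 = v * (v powr \<kappa> * (1 + v) powr 2)"
      using v by simp
    also have "\<dots> \<le> v * ((1 + v) powr \<kappa> * (1 + v) powr 2)"
      using v k0 by (intro mult_left_mono mult_right_mono powr_mono2) auto
    also have "\<dots> = v * (1 + v) powr (\<kappa> + 2)" by (simp add: powr_add)
    also have "\<dots> \<le> v * (C2 * exp v)" using C2(2)[of v] v by (intro mult_left_mono) auto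
    finally have 1: "v powr (4 * real L - 2 * a) * (1 + v)\<^sup>2 \<le> v * (C2 * exp v)" .
    have "3 * v\<^sup>2 \<le> pi * v\<^sup>2" using pi_gt3 by (intro mult_right_mono) auto
    moreover have "0 \<le> 3 * v\<^sup>2 / 2 - 2 * v + 2"
    proof -
      have "3 * v\<^sup>2 / 2 - 2 * v + 2 = (v - 1)\<^sup>2 + v\<^sup>2 / 2 + 1" by (simp add: power2_eq_square algebra_simps)
      then show ?thesis using zero_le_power2[of "v - 1"] zero_le_power2[of v] by linarith
    qed
    ultimately have 2: "exp (- pi * v\<^sup>2 / 2) \<le> exp (2 - 2 * v)" by simp
    have "v powr (4 * real L - 2 * a) * (1 + v)\<^sup>2 * exp (- pi * v\<^sup>2 / 2) \<le> v * (C2 * exp v) * exp (2 - 2 * v)"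
      using v C2(1) by (intro mult_mono 1 2) auto
    also have "\<dots> = C2 * v * exp (v + (2 - 2 * v))" by (simp only: exp_add mult_ac)
    also have "v + (2 - 2 * v) = 2 + - v" by simp
    also have "C2 * v * exp (2 + - v) = C2 * exp 2 * (v * exp (- v))" by (simp only: exp_add mult_ac)
    finally show ?thesis .
  qed
  have main: "(cmod (mult L \<delta> t \<xi>))\<^sup>2 / (\<delta> * t) + \<delta> * t * (cmod (dmult L \<delta> t \<xi>))\<^sup>2
      \<le> C * \<delta> powr (2 * a - 1) * exponential_density (\<delta> * norm \<xi>) t"
    if d: "0 < \<delta>" "\<delta> \<le> 1" and t: "t > 0" and xi: "\<xi> \<noteq> 0" for \<delta> t \<xi>
  proof -
    define \<rho> where "\<rho> = t * norm \<xi>"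
    have r0: "\<rho> > 0" using t xi by (simp add: \<rho>_def)
    define v where "v = \<delta> * \<rho>"
    have v0: "v > 0" using r0 d by (simp add: v_def)
    define u where "u = pi * \<delta>\<^sup>2 * t\<^sup>2 * (norm \<xi>)\<^sup>2"
    have uv: "u = pi * v\<^sup>2" by (simp add: u_def v_def \<rho>_def power_mult_distrib)
    have u0: "u \<ge> 0" by (simp add: u_def)
    have nz: "t *\<^sub>R \<xi> \<noteq> 0" using t xi by simp
    have nr: "norm (t *\<^sub>R \<xi>) = \<rho>" using t by (simp add: \<rho>_def)
    \<comment> \<open>Bound for the multiplier itself. The scaled derivative t d/dt costs at most
      the factor \<rho> + 4, with \<rho> from \<open>dnuhat\<close> and 4 from
      \<open>dpsi\<close>.\<close>
    define E where "E = C1 * \<rho> powr (- a) * (real L * u ^ L * exp (- u / 4))"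
    have m: "cmod (mult L \<delta> t \<xi>) \<le> E"
      unfolding mult_def u_def[symmetric] norm_mult norm_of_real E_def
      using C1(4)[OF nz, unfolded nr] psi_bounds(2)[OF u0 L1] C1(1) by (intro mult_mono) auto
    have dm: "t * cmod (dmult L \<delta> t \<xi>) \<le> E * (\<rho> + 4)"
    proof -
      have 1: "t * cmod (dnuhat t \<xi> * psi L u) \<le> E * \<rho>"
      proof -
        have "t * cmod (dnuhat t \<xi> * psi L u) = (t * cmod (dnuhat t \<xi>)) * \<bar>psi L u\<bar>"
          by (simp add: norm_mult)
        also have "\<dots> \<le> (t * (C1 * norm \<xi> * norm (t *\<^sub>R \<xi>) powr (- a))) * (real L * u ^ L * exp (- u / 4))"
          using C1(5)[OF nz] psi_bounds(2)[OF u0 L1] C1(1) t by (intro mult_mono mult_left_mono) auto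
        also have "\<dots> = E * \<rho>" unfolding nr E_def by (simp add: \<rho>_def)
        finally show ?thesis .
      qed
      have 2: "t * cmod (nuhat (t *\<^sub>R \<xi>) * (dpsi L u * (2 * pi * \<delta>\<^sup>2 * t * (norm \<xi>)\<^sup>2))) \<le> E * 4"
      proof -
        have e: "t * (2 * pi * \<delta>\<^sup>2 * t * (norm \<xi>)\<^sup>2) = 2 * u"
          by (simp add: u_def power2_eq_square)
        have "t * cmod (nuhat (t *\<^sub>R \<xi>) * (dpsi L u * (2 * pi * \<delta>\<^sup>2 * t * (norm \<xi>)\<^sup>2)))
          = t * (cmod (nuhat (t *\<^sub>R \<xi>)) * (\<bar>dpsi L u\<bar> * (2 * pi * \<delta>\<^sup>2 * t * (norm \<xi>)\<^sup>2)))"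
          using t by (simp add: norm_mult norm_power abs_mult)
        also have "\<dots> = cmod (nuhat (t *\<^sub>R \<xi>)) * (\<bar>dpsi L u\<bar> * (t * (2 * pi * \<delta>\<^sup>2 * t * (norm \<xi>)\<^sup>2)))"
          by (simp only: mult_ac)
        also have "\<dots> = cmod (nuhat (t *\<^sub>R \<xi>)) * (2 * \<bar>u * dpsi L u\<bar>)"
          unfolding e using u0 by (simp add: abs_mult)
        also have "\<dots> \<le> (C1 * norm (t *\<^sub>R \<xi>) powr (- a)) * (2 * (2 * real L * u ^ L * exp (- u / 4)))"
          using C1(4)[OF nz] psi_bounds(4)[OF u0 L1] C1(1) by (intro mult_mono mult_left_mono) auto
        also have "\<dots> = E * 4" unfolding nr E_def by simp
        finally show ?thesis .
      qed
      have "t * cmod (dmult L \<delta> t \<xi>) \<le> t * (cmod (dnuhat t \<xi> * psi L u) + cmod (nuhat (t *\<^sub>R \<xi>) * (dpsi L u * (2 * pi * \<delta>\<^sup>2 * t * (norm \<xi>)\<^sup>2))))"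
        unfolding dmult_def u_def[symmetric] using t by (intro mult_left_mono norm_triangle_ineq) auto
      also have "\<dots> \<le> E * \<rho> + E * 4" unfolding distrib_left by (intro add_mono 1 2)
      finally show ?thesis by (simp add: distrib_left)
    qed
    have "\<delta> * t * (cmod (dmult L \<delta> t \<xi>))\<^sup>2 = (\<delta> * (t * cmod (dmult L \<delta> t \<xi>)))\<^sup>2 / (\<delta> * t)"
      using d t by (simp add: power2_eq_square field_simps)
    also have "\<dots> \<le> (\<delta> * (E * (\<rho> + 4)))\<^sup>2 / (\<delta> * t)"
      using d t dm by (intro divide_right_mono power_mono mult_left_mono) auto
    finally have "(cmod (mult L \<delta> t \<xi>))\<^sup>2 / (\<delta> * t) + \<delta> * t * (cmod (dmult L \<delta> t \<xi>))\<^sup>2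
      \<le> E\<^sup>2 / (\<delta> * t) + (\<delta> * (E * (\<rho> + 4)))\<^sup>2 / (\<delta> * t)"
      using m d t by (intro add_mono divide_right_mono power_mono) auto
    also have "\<dots> = E\<^sup>2 * (1 + (\<delta> * (\<rho> + 4))\<^sup>2) / (\<delta> * t)"
    proof -
      have e: "(\<delta> * (E * (\<rho> + 4)))\<^sup>2 = E\<^sup>2 * (\<delta> * (\<rho> + 4))\<^sup>2"
        by (simp only: power_mult_distrib mult_ac)
      show ?thesis unfolding e by (simp only: add_divide_distrib distrib_left mult_1_right)
    qed
    \<comment> \<open>17 = 1 + 16, from \<delta> (\<rho> + 4) \<le> 4 (1 + v), which uses \<delta>
      \<le> 1.\<close>
    also have "\<dots> \<le> E\<^sup>2 * (17 * (1 + v)\<^sup>2) / (\<delta> * t)"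
    proof (intro divide_right_mono mult_left_mono)
      have "\<delta> * (\<rho> + 4) \<le> 4 * (1 + v)" using d v0 by (simp add: v_def distrib_left)
      then have "(\<delta> * (\<rho> + 4))\<^sup>2 \<le> (4 * (1 + v))\<^sup>2" using d r0 by (intro power_mono) auto
      moreover have "1 \<le> (1 + v)\<^sup>2" using v0 by (simp add: power2_eq_square algebra_simps)
      moreover have "(4 * (1 + v))\<^sup>2 = 16 * (1 + v)\<^sup>2" by (simp only: power_mult_distrib) simp
      ultimately show "1 + (\<delta> * (\<rho> + 4))\<^sup>2 \<le> 17 * (1 + v)\<^sup>2" by linarith
    qed (use d t in auto)
    also have "E\<^sup>2 = C1\<^sup>2 * (real L)\<^sup>2 * pi ^ (2 * L) * \<delta> powr (2 * a) * (v powr (4 * real L - 2 * a) * exp (- pi * v\<^sup>2 / 2))"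
    proof -
      have r: "\<rho> = v / \<delta>" using d by (simp add: v_def)
      have 1: "(\<rho> powr (- a))\<^sup>2 = \<delta> powr (2 * a) * v powr (- (2 * a))"
      proof -
        have "(\<rho> powr (- a))\<^sup>2 = \<rho> powr (- a + - a)" by (simp only: power2_eq_square powr_add)
        also have "\<dots> = \<rho> powr (- (2 * a))" by simp
        also have "\<dots> = v powr (- (2 * a)) / \<delta> powr (- (2 * a))"
          unfolding r using v0 d by (intro powr_divide)
        also have "\<dots> = \<delta> powr (2 * a) * v powr (- (2 * a))"
          by (simp add: powr_minus divide_inverse)
        finally show ?thesis .
      qed
      have 2: "(u ^ L)\<^sup>2 = pi ^ (2 * L) * v powr (4 * real L)"
      proof -
        have "(u ^ L)\<^sup>2 = pi ^ (2 * L) * v ^ (4 * L)"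
          unfolding uv by (simp add: power_mult_distrib power_mult[symmetric] mult.commute)
        also have "v ^ (4 * L) = v powr (real (4 * L))" by (rule powr_realpow[OF v0, symmetric])
        finally show ?thesis by simp
      qed
      have 3: "(exp (- u / 4))\<^sup>2 = exp (- pi * v\<^sup>2 / 2)"
        unfolding uv by (simp add: power2_eq_square exp_add[symmetric])
      have 4: "v powr (4 * real L - 2 * a) = v powr (4 * real L) * v powr (- (2 * a))"
        by (simp add: powr_add[symmetric])
      show ?thesis
        unfolding E_def power_mult_distrib 1 2 3 4 by (simp only: mult_ac)
    qed
    also have "C1\<^sup>2 * (real L)\<^sup>2 * pi ^ (2 * L) * \<delta> powr (2 * a) * (v powr (4 * real L - 2 * a) * exp (- pi * v\<^sup>2 / 2)) * (17 * (1 + v)\<^sup>2) / (\<delta> * t)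
      = (C1\<^sup>2 * (real L)\<^sup>2 * pi ^ (2 * L) * 17 * \<delta> powr (2 * a) / (\<delta> * t)) * (v powr (4 * real L - 2 * a) * (1 + v)\<^sup>2 * exp (- pi * v\<^sup>2 / 2))"
      by simp
    also have "\<dots> \<le> (C1\<^sup>2 * (real L)\<^sup>2 * pi ^ (2 * L) * 17 * \<delta> powr (2 * a) / (\<delta> * t)) * (C2 * exp 2 * (v * exp (- v)))"
      using d t by (intro mult_left_mono vb v0) auto
    also have "\<dots> = C * (\<delta> powr (2 * a) / \<delta>) * (v / t * exp (- v))" by (simp add: C_def)
    also have "\<delta> powr (2 * a) / \<delta> = \<delta> powr (2 * a - 1)" using d by (simp add: powr_diff)
    also have "v / t * exp (- v) = exponential_density (\<delta> * norm \<xi>) t"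
      using t by (simp add: exponential_density_def v_def \<rho>_def mult_ac)
    finally show ?thesis .
  qed
  have fin: "(\<integral>\<^sup>+t. ennreal ((cmod (mult L \<delta> t \<xi>))\<^sup>2 / (\<delta> * t) + \<delta> * t * (cmod (dmult L \<delta> t \<xi>))\<^sup>2) * indicator {0<..} t \<partial>lborel)
      \<le> ennreal (C * \<delta> powr (2 * a - 1))" if d: "0 < \<delta>" "\<delta> \<le> 1" for \<delta> \<xi>
  proof (cases "\<xi> = 0")
    case True
    \<comment> \<open>At \<xi> = 0 both vanish, since \<open>psi\<close> is 0 there for L \<ge> 1
      and the remaining term carries the factor |\<xi>|^2. The exponential density used otherwise
      requires a positive rate.\<close>
    have "mult L \<delta> t 0 = 0" "dmult L \<delta> t 0 = 0" for t
      using C1(3)[of t 0] L1 by (auto simp: mult_def dmult_def psi_def power_0_left)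
    then show ?thesis using True by simp
  next
    case False
    have l: "\<delta> * norm \<xi> > 0" using False d by simp
    have "(\<integral>\<^sup>+t. ennreal ((cmod (mult L \<delta> t \<xi>))\<^sup>2 / (\<delta> * t) + \<delta> * t * (cmod (dmult L \<delta> t \<xi>))\<^sup>2) * indicator {0<..} t \<partial>lborel)
      \<le> (\<integral>\<^sup>+t. ennreal (C * \<delta> powr (2 * a - 1)) * ennreal (exponential_density (\<delta> * norm \<xi>) t) \<partial>lborel)"
    proof (rule nn_integral_mono)
      fix t :: real
      show "ennreal ((cmod (mult L \<delta> t \<xi>))\<^sup>2 / (\<delta> * t) + \<delta> * t * (cmod (dmult L \<delta> t \<xi>))\<^sup>2) * indicator {0<..} t
        \<le> ennreal (C * \<delta> powr (2 * a - 1)) * ennreal (exponential_density (\<delta> * norm \<xi>) t)"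
        using main[OF d _ False, of t] C0
        by (cases "t > 0") (auto simp: ennreal_mult'[symmetric] intro!: ennreal_leI)
    qed
    also have "\<dots> = ennreal (C * \<delta> powr (2 * a - 1)) * (\<integral>\<^sup>+t. ennreal (exponential_density (\<delta> * norm \<xi>) t) \<partial>lborel)"
      by (intro nn_integral_cmult) auto
    \<comment> \<open>The t-integral is the total mass of the exponential distribution of rate
      \<delta> |\<xi>|, hence 1 for every \<xi>.\<close>
    also have "(\<integral>\<^sup>+t. ennreal (exponential_density (\<delta> * norm \<xi>) t) \<partial>lborel) = 1"
      using prob_space.emeasure_space_1[OF prob_space_exponential_density[OF l]]
      by (simp add: emeasure_density)
    finally show ?thesis by simp
  qed
  show ?thesis using C0 fin by blast
qed

end

section \<open>The high frequency part\<close>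

lemma ennreal_power2_add_le: "(x + y)\<^sup>2 \<le> 2 * x\<^sup>2 + 2 * y\<^sup>2" for x y :: ennreal
proof (cases "x = \<infinity> \<or> y = \<infinity>")
  case True
  then show ?thesis by (auto simp: ennreal_mult_top power2_eq_square)
next
  case False
  then obtain u v where u: "u \<ge> 0" "x = ennreal u" and v: "v \<ge> 0" "y = ennreal v"
    by (metis ennreal_cases infinity_ennreal_def)
  have "(u + v)\<^sup>2 \<le> 2 * u\<^sup>2 + 2 * v\<^sup>2"
    using sum_squares_bound[of u v] by (simp add: power2_sum)
  then have "ennreal ((u + v)\<^sup>2) \<le> ennreal (2 * u\<^sup>2 + 2 * v\<^sup>2)" by (rule ennreal_leI)
  then show ?thesis using u v by (simp add: ennreal_plus ennreal_mult ennreal_power[symmetric])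
qed

section \<open>A single dyadic piece\<close>

context decaying_measure
begin

text \<open>The weight matches the growth of \<open>dmult\<close>, so that the frequency integrals
  and their interchanges with the t-integral converge absolutely.\<close>

definition admissible :: "('a \<Rightarrow> complex) \<Rightarrow> bool" where
  "admissible H \<longleftrightarrow> H \<in> borel_measurable borel \<and> integrable lborel (\<lambda>\<xi>. cmod (H \<xi>) * (1 + norm \<xi>)\<^sup>2)"

lemma admissible_integrable:
  assumes H: "admissible H" and w [measurable]: "w \<in> borel_measurable borel"
    and le: "\<And>\<xi>. cmod (w \<xi>) \<le> C * (1 + norm \<xi>)\<^sup>2"
  shows "integrable lborel (\<lambda>\<xi>. H \<xi> * w \<xi>)"
proof (rule Bochner_Integration.integrable_bound)
  have [measurable]: "H \<in> borel_measurable borel" using H by (simp add: admissible_def)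
  show "integrable lborel (\<lambda>\<xi>. C * (cmod (H \<xi>) * (1 + norm \<xi>)\<^sup>2))"
    using H by (intro integrable_mult_right) (simp add: admissible_def)
  show "(\<lambda>\<xi>. H \<xi> * w \<xi>) \<in> borel_measurable lborel" by measurable
  show "AE \<xi> in lborel. norm (H \<xi> * w \<xi>) \<le> norm (C * (cmod (H \<xi>) * (1 + norm \<xi>)\<^sup>2))"
  proof (rule AE_I2)
    fix \<xi>
    have "norm (H \<xi> * w \<xi>) \<le> cmod (H \<xi>) * (C * (1 + norm \<xi>)\<^sup>2)"
      unfolding norm_mult by (intro mult_left_mono le) auto
    also have "\<dots> = C * (cmod (H \<xi>) * (1 + norm \<xi>)\<^sup>2)" by simp
    finally show "norm (H \<xi> * w \<xi>) \<le> norm (C * (cmod (H \<xi>) * (1 + norm \<xi>)\<^sup>2))" by simp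
  qed
qed

text \<open>The part of the average at time t that belongs to the scale \<delta>, for a function
  with Fourier transform \<open>H\<close>.\<close>

definition piece :: "nat \<Rightarrow> real \<Rightarrow> ('a \<Rightarrow> complex) \<Rightarrow> real \<Rightarrow> 'a \<Rightarrow> complex" where
  "piece L \<delta> H t x = (\<integral>\<xi>. H \<xi> * mult L \<delta> t \<xi> * wave x \<xi> \<partial>lborel)"

definition dpiece :: "nat \<Rightarrow> real \<Rightarrow> ('a \<Rightarrow> complex) \<Rightarrow> real \<Rightarrow> 'a \<Rightarrow> complex" where
  "dpiece L \<delta> H t x = (\<integral>\<xi>. H \<xi> * dmult L \<delta> t \<xi> * wave x \<xi> \<partial>lborel)"

lemma piece_measurable [measurable]:
  assumes [measurable]: "H \<in> borel_measurable borel" "f \<in> borel_measurable M" "g \<in> borel_measurable M"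
  shows "(\<lambda>x. piece L \<delta> H (f x) (g x)) \<in> borel_measurable M"
    "(\<lambda>x. dpiece L \<delta> H (f x) (g x)) \<in> borel_measurable M"
  unfolding piece_def dpiece_def by measurable

lemma admissible_mult_integrable:
  assumes H: "admissible H" and L: "L \<ge> 1" and t: "t \<ge> 0"
  shows "integrable lborel (\<lambda>\<xi>. H \<xi> * mult L \<delta> t \<xi>)" "integrable lborel (\<lambda>\<xi>. H \<xi> * dmult L \<delta> t \<xi>)"
proof -
  obtain C where C: "C \<ge> 0" "\<And>t \<xi>. cmod (mult L \<delta> t \<xi>) \<le> C"
    "\<And>s \<xi>. 0 \<le> s \<Longrightarrow> s \<le> t \<Longrightarrow> cmod (dmult L \<delta> s \<xi>) \<le> C * (1 + norm \<xi>)\<^sup>2"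
    using mult_crude_bounds[OF L t] by blast
  have "1 \<le> (1 + norm \<xi>)\<^sup>2" for \<xi> :: 'a by (simp add: power2_eq_square algebra_simps)
  then have "C * 1 \<le> C * (1 + norm \<xi>)\<^sup>2" for \<xi> :: 'a using C(1) by (rule mult_left_mono)
  then have "cmod (mult L \<delta> t \<xi>) \<le> C * (1 + norm \<xi>)\<^sup>2" for \<xi>
    using C(2)[of t \<xi>] by (metis mult.right_neutral order_trans)
  then show "integrable lborel (\<lambda>\<xi>. H \<xi> * mult L \<delta> t \<xi>)"
    by (intro admissible_integrable[OF H]) auto
  show "integrable lborel (\<lambda>\<xi>. H \<xi> * dmult L \<delta> t \<xi>)"
    using C(3)[of t] t by (intro admissible_integrable[OF H]) auto
qed

lemma piece_FTC:
  assumes H: "admissible H" and L: "L \<ge> 1" and st: "0 < s" "s \<le> t"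
  shows "piece L \<delta> H t x - piece L \<delta> H s x = (\<integral>\<tau>. indicator {s..t} \<tau> *\<^sub>R dpiece L \<delta> H \<tau> x \<partial>lborel)"
proof -
  have [measurable]: "H \<in> borel_measurable borel" using H by (simp add: admissible_def)
  have t0: "t \<ge> 0" using st by simp
  obtain C where C: "C \<ge> 0" "\<And>t \<xi>. cmod (mult L \<delta> t \<xi>) \<le> C"
    "\<And>s \<xi>. 0 \<le> s \<Longrightarrow> s \<le> t \<Longrightarrow> cmod (dmult L \<delta> s \<xi>) \<le> C * (1 + norm \<xi>)\<^sup>2"
    using mult_crude_bounds[OF L t0] by blast
  have i: "integrable lborel (\<lambda>\<xi>. H \<xi> * mult L \<delta> \<tau> \<xi> * wave x \<xi>)" if "\<tau> \<ge> 0" for \<tau>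
    by (rule Bochner_Integration.integrable_bound[OF admissible_mult_integrable(1)[OF H L that]]) (auto simp: norm_mult)
  have "piece L \<delta> H t x - piece L \<delta> H s x = (\<integral>\<xi>. H \<xi> * mult L \<delta> t \<xi> * wave x \<xi> - H \<xi> * mult L \<delta> s \<xi> * wave x \<xi> \<partial>lborel)"
    unfolding piece_def using st by (intro Bochner_Integration.integral_diff[symmetric] i) auto
  also have "\<dots> = (\<integral>\<xi>. (\<integral>\<tau>. H \<xi> * wave x \<xi> * (indicator {s..t} \<tau> *\<^sub>R dmult L \<delta> \<tau> \<xi>) \<partial>lborel) \<partial>lborel)"
  proof (intro Bochner_Integration.integral_cong refl)
    fix \<xi>
    have "H \<xi> * mult L \<delta> t \<xi> * wave x \<xi> - H \<xi> * mult L \<delta> s \<xi> * wave x \<xi> = H \<xi> * wave x \<xi> * (mult L \<delta> t \<xi> - mult L \<delta> s \<xi>)"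
      by (simp add: algebra_simps)
    also have "\<dots> = (\<integral>\<tau>. H \<xi> * wave x \<xi> * (indicator {s..t} \<tau> *\<^sub>R dmult L \<delta> \<tau> \<xi>) \<partial>lborel)"
      unfolding mult_FTC[OF st L] by (rule integral_mult_right_zero[symmetric])
    finally show "H \<xi> * mult L \<delta> t \<xi> * wave x \<xi> - H \<xi> * mult L \<delta> s \<xi> * wave x \<xi>
      = (\<integral>\<tau>. H \<xi> * wave x \<xi> * (indicator {s..t} \<tau> *\<^sub>R dmult L \<delta> \<tau> \<xi>) \<partial>lborel)" .
  qed
  also have "\<dots> = (\<integral>\<tau>. (\<integral>\<xi>. H \<xi> * wave x \<xi> * (indicator {s..t} \<tau> *\<^sub>R dmult L \<delta> \<tau> \<xi>) \<partial>lborel) \<partial>lborel)"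
  proof (rule lborel_pair.Fubini_product_bound(2)[where u="\<lambda>\<tau>. C * indicator {s..t} \<tau>" and v="\<lambda>\<xi>. cmod (H \<xi>) * (1 + norm \<xi>)\<^sup>2"])
    show "(\<lambda>(\<tau>, \<xi>). H \<xi> * wave x \<xi> * (indicator {s..t} \<tau> *\<^sub>R dmult L \<delta> \<tau> \<xi>)) \<in> borel_measurable (lborel \<Otimes>\<^sub>M lborel)"
      by measurable
    show "integrable lborel (\<lambda>\<tau>. C * indicator {s..t} \<tau>)"
      by (intro integrable_mult_right integrable_real_indicator) (auto simp: emeasure_lborel_Icc_eq)
    show "integrable lborel (\<lambda>\<xi>. cmod (H \<xi>) * (1 + norm \<xi>)\<^sup>2)" using H by (simp add: admissible_def)
    fix \<tau> :: real and \<xi> :: 'a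
    show "cmod (H \<xi> * wave x \<xi> * (indicator {s..t} \<tau> *\<^sub>R dmult L \<delta> \<tau> \<xi>)) \<le> C * indicator {s..t} \<tau> * (cmod (H \<xi>) * (1 + norm \<xi>)\<^sup>2)"
    proof (cases "\<tau> \<in> {s..t}")
      case True
      then have "cmod (H \<xi>) * cmod (dmult L \<delta> \<tau> \<xi>) \<le> cmod (H \<xi>) * (C * (1 + norm \<xi>)\<^sup>2)"
        using st by (intro mult_left_mono C(3)) auto
      then show ?thesis using True by (simp add: norm_mult mult_ac)
    qed simp
  qed
  also have "\<dots> = (\<integral>\<tau>. indicator {s..t} \<tau> *\<^sub>R dpiece L \<delta> H \<tau> x \<partial>lborel)"
    by (intro Bochner_Integration.integral_cong refl)
       (auto simp: dpiece_def mult_ac split: split_indicator)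
  finally show ?thesis .
qed

text \<open>The right-hand side does not contain T, so it dominates the supremum over all T. On an
  interval of length l = \<delta> T starting at T, the value at T is at most the value at t plus the
  integral of the derivative; averaging over t and Cauchy-Schwarz give the weights 1 / l and l. The
  piece varies in t on the relative scale \<delta>, which makes this length the balanced
  choice.\<close>

lemma piece_sobolev:
  assumes H: "admissible H" and L: "L \<ge> 1" and d: "0 < \<delta>" "\<delta> \<le> 1" and T: "T > 0"
  shows "ennreal ((cmod (piece L \<delta> H T x))\<^sup>2) \<le>
    (\<integral>\<^sup>+t. (ennreal (4 / (\<delta> * t)) * ennreal ((cmod (piece L \<delta> H t x))\<^sup>2) + ennreal (4 * (\<delta> * t)) * ennreal ((cmod (dpiece L \<delta> H t x))\<^sup>2)) * indicator {0<..} t \<partial>lborel)"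
proof -
  have [measurable]: "H \<in> borel_measurable borel" using H by (simp add: admissible_def)
  define F where "F t = cmod (piece L \<delta> H t x)" for t
  define D where "D t = cmod (dpiece L \<delta> H t x)" for t
  have [measurable]: "F \<in> borel_measurable borel" "D \<in> borel_measurable borel"
    unfolding F_def D_def by measurable
  have FD0: "F t \<ge> 0" "D t \<ge> 0" for t by (auto simp: F_def D_def)
  define l where "l = \<delta> * T"
  have l0: "l > 0" using d T by (simp add: l_def)
  define I where "I = {T..T + l}"
  have [measurable]: "I \<in> sets borel" by (simp add: I_def)
  have lI: "(\<integral>\<^sup>+t. indicator I t \<partial>lborel) = ennreal l"
    using l0 by (simp add: I_def)
  define A where "A = (\<integral>\<^sup>+\<tau>. ennreal (D \<tau>) * indicator I \<tau> \<partial>lborel)"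
  define B where "B = (\<integral>\<^sup>+\<tau>. ennreal ((D \<tau>)\<^sup>2) * indicator I \<tau> \<partial>lborel)"
  have step: "ennreal (F T) \<le> ennreal (F t) + A" if t: "t \<in> I" for t
  proof -
    have "F T \<le> F t + cmod (piece L \<delta> H t x - piece L \<delta> H T x)"
      unfolding F_def by (metis add.commute norm_minus_commute norm_triangle_sub)
    then have "ennreal (F T) \<le> ennreal (F t) + ennreal (cmod (piece L \<delta> H t x - piece L \<delta> H T x))"
      using FD0 by (simp add: ennreal_plus[symmetric] ennreal_leI del: ennreal_plus)
    also have "ennreal (cmod (piece L \<delta> H t x - piece L \<delta> H T x)) \<le> A"
    proof -
      have TT: "T \<le> t" using t by (simp add: I_def)
      have "ennreal (cmod (piece L \<delta> H t x - piece L \<delta> H T x)) = ennreal (cmod (\<integral>\<tau>. indicator {T..t} \<tau> *\<^sub>R dpiece L \<delta> H \<tau> x \<partial>lborel))"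
        by (simp only: piece_FTC[OF H L T TT])
      also have "\<dots> \<le> (\<integral>\<^sup>+\<tau>. ennreal (cmod (indicator {T..t} \<tau> *\<^sub>R dpiece L \<delta> H \<tau> x)) \<partial>lborel)"
      proof (cases "integrable lborel (\<lambda>\<tau>. indicator {T..t} \<tau> *\<^sub>R dpiece L \<delta> H \<tau> x)")
        case True
        then show ?thesis by (rule integral_norm_bound_ennreal)
      qed (simp add: not_integrable_integral_eq)
      also have "\<dots> \<le> A"
        unfolding A_def using t by (intro nn_integral_mono) (auto simp: I_def D_def split: split_indicator)
      finally show ?thesis .
    qed
    finally show ?thesis by (simp add: add_left_mono)
  qed
  have AB: "A\<^sup>2 \<le> B * ennreal l"
  proof -
    have "A\<^sup>2 = (\<integral>\<^sup>+\<tau>. (ennreal (D \<tau>) * indicator I \<tau>) * indicator I \<tau> \<partial>lborel)\<^sup>2"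
      unfolding A_def by (intro arg_cong[where f="\<lambda>x. x\<^sup>2"] nn_integral_cong) (auto split: split_indicator)
    also have "\<dots> \<le> (\<integral>\<^sup>+\<tau>. (ennreal (D \<tau>) * indicator I \<tau>)\<^sup>2 \<partial>lborel) * (\<integral>\<^sup>+\<tau>. (indicator I \<tau>)\<^sup>2 \<partial>lborel)"
      by (intro Cauchy_Schwarz_nn_integral) measurable
    also have "(\<integral>\<^sup>+\<tau>. (ennreal (D \<tau>) * indicator I \<tau>)\<^sup>2 \<partial>lborel) = B"
      unfolding B_def using FD0 by (intro nn_integral_cong) (auto simp: ennreal_power split: split_indicator)
    also have "(\<integral>\<^sup>+\<tau>. (indicator I \<tau> :: ennreal)\<^sup>2 \<partial>lborel) = (\<integral>\<^sup>+t. indicator I t \<partial>lborel)"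
      by (intro nn_integral_cong) (auto split: split_indicator)
    finally show ?thesis by (simp only: lI)
  qed
  have sq: "ennreal ((F T)\<^sup>2) \<le> 2 * ennreal ((F t)\<^sup>2) + 2 * (B * ennreal l)" if t: "t \<in> I" for t
  proof -
    have "ennreal ((F T)\<^sup>2) = (ennreal (F T))\<^sup>2" using FD0 by (simp add: ennreal_power)
    also have "\<dots> \<le> (ennreal (F t) + A)\<^sup>2" by (intro power_mono step t) auto
    also have "\<dots> \<le> 2 * (ennreal (F t))\<^sup>2 + 2 * A\<^sup>2" by (rule ennreal_power2_add_le)
    also have "\<dots> \<le> 2 * (ennreal (F t))\<^sup>2 + 2 * (B * ennreal l)" by (intro add_left_mono mult_left_mono AB) auto
    finally show ?thesis using FD0 by (simp add: ennreal_power)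
  qed
  \<comment> \<open>1 is written as the average of the indicator of \<open>I\<close>, so that
    \<open>sq\<close> can be averaged over t.\<close>
  have "ennreal ((F T)\<^sup>2) = ennreal (1 / l) * (ennreal ((F T)\<^sup>2) * (\<integral>\<^sup>+t. indicator I t \<partial>lborel))"
    using l0 by (simp add: lI ennreal_mult[symmetric])
  also have "\<dots> = ennreal (1 / l) * (\<integral>\<^sup>+t. ennreal ((F T)\<^sup>2) * indicator I t \<partial>lborel)"
    by (subst nn_integral_cmult) auto
  also have "\<dots> \<le> ennreal (1 / l) * (\<integral>\<^sup>+t. 2 * ennreal ((F t)\<^sup>2) * indicator I t + 2 * (B * ennreal l) * indicator I t \<partial>lborel)"
    using sq by (intro mult_left_mono nn_integral_mono) (auto split: split_indicator)
  also have "\<dots> = ennreal (1 / l) * ((\<integral>\<^sup>+t. 2 * ennreal ((F t)\<^sup>2) * indicator I t \<partial>lborel) + 2 * (B * ennreal l) * ennreal l)"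
  proof -
    have 1: "(\<integral>\<^sup>+t. 2 * ennreal ((F t)\<^sup>2) * indicator I t + 2 * (B * ennreal l) * indicator I t \<partial>lborel)
      = (\<integral>\<^sup>+t. 2 * ennreal ((F t)\<^sup>2) * indicator I t \<partial>lborel) + (\<integral>\<^sup>+t. 2 * (B * ennreal l) * indicator I t \<partial>lborel)"
      by (intro nn_integral_add) measurable
    have 2: "(\<integral>\<^sup>+t. 2 * (B * ennreal l) * indicator I t \<partial>lborel) = 2 * (B * ennreal l) * (\<integral>\<^sup>+t. indicator I t \<partial>lborel)"
      by (intro nn_integral_cmult) measurable
    show ?thesis unfolding 1 2 lI ..
  qed
  also have "\<dots> = (\<integral>\<^sup>+t. ennreal (1 / l) * (2 * ennreal ((F t)\<^sup>2) * indicator I t) \<partial>lborel) + 2 * ennreal l * B"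
  proof -
    have "ennreal (1 / l) * (2 * (B * ennreal l) * ennreal l) = (ennreal (1 / l) * ennreal l) * (2 * ennreal l * B)"
      by (simp only: mult_ac)
    also have "ennreal (1 / l) * ennreal l = 1" using l0 by (simp add: ennreal_mult[symmetric])
    finally show ?thesis unfolding distrib_left by (subst nn_integral_cmult) auto
  qed
  also have "2 * ennreal l * B = (\<integral>\<^sup>+t. 2 * ennreal l * (ennreal ((D t)\<^sup>2) * indicator I t) \<partial>lborel)"
    unfolding B_def by (intro nn_integral_cmult[symmetric]) measurable
  also have "(\<integral>\<^sup>+t. ennreal (1 / l) * (2 * ennreal ((F t)\<^sup>2) * indicator I t) \<partial>lborel) + \<dots>
      = (\<integral>\<^sup>+t. ennreal (1 / l) * (2 * ennreal ((F t)\<^sup>2) * indicator I t) + 2 * ennreal l * (ennreal ((D t)\<^sup>2) * indicator I t) \<partial>lborel)"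
    by (intro nn_integral_add[symmetric]) measurable
  also have "\<dots> \<le> (\<integral>\<^sup>+t. (ennreal (4 / (\<delta> * t)) * ennreal ((F t)\<^sup>2) + ennreal (4 * (\<delta> * t)) * ennreal ((D t)\<^sup>2)) * indicator {0<..} t \<partial>lborel)"
  proof (rule nn_integral_mono)
    fix t :: real
    show "ennreal (1 / l) * (2 * ennreal ((F t)\<^sup>2) * indicator I t) + 2 * ennreal l * (ennreal ((D t)\<^sup>2) * indicator I t)
      \<le> (ennreal (4 / (\<delta> * t)) * ennreal ((F t)\<^sup>2) + ennreal (4 * (\<delta> * t)) * ennreal ((D t)\<^sup>2)) * indicator {0<..} t"
    proof (cases "t \<in> I")
      case True
      \<comment> \<open>\<delta> \<le> 1 keeps the interval inside [T, 2 T], so T and t are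
        interchangeable up to a factor 2.\<close>
      have "l \<le> T" using d T by (simp add: l_def)
      then have t: "t > 0" "T \<le> t" "t \<le> 2 * T" using True T by (auto simp: I_def)
      have "2 / l \<le> 4 / (\<delta> * t)" using t d T by (simp add: l_def field_simps)
      then have 1: "ennreal (1 / l) * 2 \<le> ennreal (4 / (\<delta> * t))"
        using l0 by (simp add: ennreal_mult'[symmetric] ennreal_leI flip: ennreal_numeral)
      have 2: "2 * ennreal l \<le> ennreal (4 * (\<delta> * t))"
      proof -
        have "2 * l \<le> 4 * (\<delta> * t)" using t d T by (simp add: l_def)
        then show ?thesis using l0 by (simp add: ennreal_mult'[symmetric] ennreal_leI flip: ennreal_numeral)
      qed
      have "ennreal (1 / l) * 2 * ennreal ((F t)\<^sup>2) + 2 * ennreal l * ennreal ((D t)\<^sup>2)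
        \<le> ennreal (4 / (\<delta> * t)) * ennreal ((F t)\<^sup>2) + ennreal (4 * (\<delta> * t)) * ennreal ((D t)\<^sup>2)"
        by (intro add_mono mult_right_mono 1 2) auto
      then show ?thesis using True t by (simp add: mult.assoc)
    qed simp
  qed
  finally show ?thesis by (simp only: F_def D_def)
qed

text \<open>The majorant V is the right-hand side of \<open>piece_sobolev\<close>. Its integral is
  estimated by exchanging x and t, applying Bessel's inequality for each t, exchanging \<xi> and t,
  and inserting \<open>multiplier_energy\<close>. Stating the bound through a measurable V keeps the
  supremum over uncountably many T outside the integral.\<close>

lemma dyadic_maximal:
  assumes L: "real L \<ge> a + 1"
  shows "\<exists>C\<ge>0. \<forall>\<delta> H. 0 < \<delta> \<longrightarrow> \<delta> \<le> 1 \<longrightarrow> admissible H \<longrightarrow>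
    (\<exists>V\<in>borel_measurable borel. (\<forall>T>0. \<forall>x. ennreal ((cmod (piece L \<delta> H T x))\<^sup>2) \<le> V x) \<and>
      (\<integral>\<^sup>+x. V x \<partial>lborel) \<le> ennreal (C * \<delta> powr (2 * a - 1)) * (\<integral>\<^sup>+\<xi>. ennreal ((cmod (H \<xi>))\<^sup>2) \<partial>lborel))"
proof -
  have L1: "L \<ge> 1" using L a_gt by linarith
  obtain C where C: "C \<ge> 0" "\<And>\<delta> \<xi>. 0 < \<delta> \<Longrightarrow> \<delta> \<le> 1 \<Longrightarrow>
    (\<integral>\<^sup>+t. ennreal ((cmod (mult L \<delta> t \<xi>))\<^sup>2 / (\<delta> * t) + \<delta> * t * (cmod (dmult L \<delta> t \<xi>))\<^sup>2) * indicator {0<..} t \<partial>lborel)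
      \<le> ennreal (C * \<delta> powr (2 * a - 1))"
    using multiplier_energy[OF L] by blast
  have main: "\<exists>V\<in>borel_measurable borel. (\<forall>T>0. \<forall>x. ennreal ((cmod (piece L \<delta> H T x))\<^sup>2) \<le> V x) \<and>
      (\<integral>\<^sup>+x. V x \<partial>lborel) \<le> ennreal (4 * C * \<delta> powr (2 * a - 1)) * (\<integral>\<^sup>+\<xi>. ennreal ((cmod (H \<xi>))\<^sup>2) \<partial>lborel)"
    if d: "0 < \<delta>" "\<delta> \<le> 1" and H: "admissible H" for \<delta> H
  proof -
    have [measurable]: "H \<in> borel_measurable borel" using H by (simp add: admissible_def)
    define P where "P t = ennreal (4 / (\<delta> * t))" for t
    define Q where "Q t = ennreal (4 * (\<delta> * t))" for t
    have [measurable]: "P \<in> borel_measurable borel" "Q \<in> borel_measurable borel"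
      unfolding P_def Q_def by measurable
    let ?V = "\<lambda>x. (\<integral>\<^sup>+t. (P t * ennreal ((cmod (piece L \<delta> H t x))\<^sup>2) + Q t * ennreal ((cmod (dpiece L \<delta> H t x))\<^sup>2)) * indicator {0<..} t \<partial>lborel)"
    have bes: "(\<integral>\<^sup>+x. ennreal ((cmod (piece L \<delta> H t x))\<^sup>2) \<partial>lborel) \<le> (\<integral>\<^sup>+\<xi>. ennreal ((cmod (H \<xi> * mult L \<delta> t \<xi>))\<^sup>2) \<partial>lborel)"
      "(\<integral>\<^sup>+x. ennreal ((cmod (dpiece L \<delta> H t x))\<^sup>2) \<partial>lborel) \<le> (\<integral>\<^sup>+\<xi>. ennreal ((cmod (H \<xi> * dmult L \<delta> t \<xi>))\<^sup>2) \<partial>lborel)"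
      if "t > 0" for t
      unfolding piece_def dpiece_def using that by (intro bessel admissible_mult_integrable H L1; simp)+
    have "(\<integral>\<^sup>+x. ?V x \<partial>lborel)
      = (\<integral>\<^sup>+t. (\<integral>\<^sup>+x. (P t * ennreal ((cmod (piece L \<delta> H t x))\<^sup>2) + Q t * ennreal ((cmod (dpiece L \<delta> H t x))\<^sup>2)) * indicator {0<..} t \<partial>lborel) \<partial>lborel)"
      by (rule lborel_pair.Fubini'[symmetric]) measurable
    also have "\<dots> = (\<integral>\<^sup>+t. (P t * (\<integral>\<^sup>+x. ennreal ((cmod (piece L \<delta> H t x))\<^sup>2) \<partial>lborel) + Q t * (\<integral>\<^sup>+x. ennreal ((cmod (dpiece L \<delta> H t x))\<^sup>2) \<partial>lborel)) * indicator {0<..} t \<partial>lborel)"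
      by (intro nn_integral_cong) (simp add: nn_integral_multc nn_integral_add nn_integral_cmult)
    also have "\<dots> \<le> (\<integral>\<^sup>+t. (P t * (\<integral>\<^sup>+\<xi>. ennreal ((cmod (H \<xi> * mult L \<delta> t \<xi>))\<^sup>2) \<partial>lborel) + Q t * (\<integral>\<^sup>+\<xi>. ennreal ((cmod (H \<xi> * dmult L \<delta> t \<xi>))\<^sup>2) \<partial>lborel)) * indicator {0<..} t \<partial>lborel)"
      using bes by (intro nn_integral_mono) (auto intro!: add_mono mult_left_mono split: split_indicator)
    also have "\<dots> = (\<integral>\<^sup>+t. (\<integral>\<^sup>+\<xi>. (P t * ennreal ((cmod (H \<xi> * mult L \<delta> t \<xi>))\<^sup>2) + Q t * ennreal ((cmod (H \<xi> * dmult L \<delta> t \<xi>))\<^sup>2)) * indicator {0<..} t \<partial>lborel) \<partial>lborel)"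
      by (intro nn_integral_cong) (simp add: nn_integral_multc nn_integral_add nn_integral_cmult)
    also have "\<dots> = (\<integral>\<^sup>+\<xi>. (\<integral>\<^sup>+t. (P t * ennreal ((cmod (H \<xi> * mult L \<delta> t \<xi>))\<^sup>2) + Q t * ennreal ((cmod (H \<xi> * dmult L \<delta> t \<xi>))\<^sup>2)) * indicator {0<..} t \<partial>lborel) \<partial>lborel)"
      by (rule lborel_pair.Fubini'[symmetric]) measurable
    also have "\<dots> = (\<integral>\<^sup>+\<xi>. (\<integral>\<^sup>+t. (4 * ennreal ((cmod (H \<xi>))\<^sup>2)) * (ennreal ((cmod (mult L \<delta> t \<xi>))\<^sup>2 / (\<delta> * t) + \<delta> * t * (cmod (dmult L \<delta> t \<xi>))\<^sup>2) * indicator {0<..} t) \<partial>lborel) \<partial>lborel)"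
    proof (intro nn_integral_cong)
      fix \<xi> :: 'a and t :: real
      show "(P t * ennreal ((cmod (H \<xi> * mult L \<delta> t \<xi>))\<^sup>2) + Q t * ennreal ((cmod (H \<xi> * dmult L \<delta> t \<xi>))\<^sup>2)) * indicator {0<..} t
        = (4 * ennreal ((cmod (H \<xi>))\<^sup>2)) * (ennreal ((cmod (mult L \<delta> t \<xi>))\<^sup>2 / (\<delta> * t) + \<delta> * t * (cmod (dmult L \<delta> t \<xi>))\<^sup>2) * indicator {0<..} t)"
      proof (cases "t > 0")
        case True
        let ?h = "cmod (H \<xi>)" and ?m = "cmod (mult L \<delta> t \<xi>)" and ?n = "cmod (dmult L \<delta> t \<xi>)"
        have dt: "\<delta> * t > 0" using d True by simp
        have "P t * ennreal ((cmod (H \<xi> * mult L \<delta> t \<xi>))\<^sup>2) + Q t * ennreal ((cmod (H \<xi> * dmult L \<delta> t \<xi>))\<^sup>2)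
          = ennreal (4 / (\<delta> * t) * (?h * ?m)\<^sup>2 + 4 * (\<delta> * t) * (?h * ?n)\<^sup>2)"
        proof -
          have "ennreal p * ennreal q + ennreal r * ennreal s = ennreal (p * q + r * s)"
            if "p \<ge> 0" "q \<ge> 0" "r \<ge> 0" "s \<ge> 0" for p q r s :: real
            using that by (simp add: ennreal_plus ennreal_mult)
          from this[of "4 / (\<delta> * t)" "(?h * ?m)\<^sup>2" "4 * (\<delta> * t)" "(?h * ?n)\<^sup>2"]
          show ?thesis using dt unfolding P_def Q_def norm_mult by simp
        qed
        also have "4 / (\<delta> * t) * (?h * ?m)\<^sup>2 + 4 * (\<delta> * t) * (?h * ?n)\<^sup>2 = 4 * ?h\<^sup>2 * (?m\<^sup>2 / (\<delta> * t) + \<delta> * t * ?n\<^sup>2)"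
          by (simp add: power_mult_distrib algebra_simps)
        also have "ennreal \<dots> = ennreal (4 * ?h\<^sup>2) * ennreal (?m\<^sup>2 / (\<delta> * t) + \<delta> * t * ?n\<^sup>2)"
          using dt by (intro ennreal_mult) (auto intro!: add_nonneg_nonneg)
        also have "ennreal (4 * ?h\<^sup>2) = 4 * ennreal (?h\<^sup>2)" by (simp add: ennreal_mult)
        finally show ?thesis using True by simp
      qed simp
    qed
    also have "\<dots> = (\<integral>\<^sup>+\<xi>. (4 * ennreal ((cmod (H \<xi>))\<^sup>2)) * (\<integral>\<^sup>+t. ennreal ((cmod (mult L \<delta> t \<xi>))\<^sup>2 / (\<delta> * t) + \<delta> * t * (cmod (dmult L \<delta> t \<xi>))\<^sup>2) * indicator {0<..} t \<partial>lborel) \<partial>lborel)"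
      by (intro nn_integral_cong nn_integral_cmult) measurable
    also have "\<dots> \<le> (\<integral>\<^sup>+\<xi>. (4 * ennreal ((cmod (H \<xi>))\<^sup>2)) * ennreal (C * \<delta> powr (2 * a - 1)) \<partial>lborel)"
      by (intro nn_integral_mono mult_left_mono C(2) d) auto
    also have "\<dots> = (\<integral>\<^sup>+\<xi>. ennreal (4 * C * \<delta> powr (2 * a - 1)) * ennreal ((cmod (H \<xi>))\<^sup>2) \<partial>lborel)"
      using C(1) by (intro nn_integral_cong) (simp add: ennreal_mult mult_ac)
    also have "\<dots> = ennreal (4 * C * \<delta> powr (2 * a - 1)) * (\<integral>\<^sup>+\<xi>. ennreal ((cmod (H \<xi>))\<^sup>2) \<partial>lborel)"
      by (intro nn_integral_cmult) measurable
    finally have "(\<integral>\<^sup>+x. ?V x \<partial>lborel) \<le> ennreal (4 * C * \<delta> powr (2 * a - 1)) * (\<integral>\<^sup>+\<xi>. ennreal ((cmod (H \<xi>))\<^sup>2) \<partial>lborel)" .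
    moreover have "?V \<in> borel_measurable borel" by measurable
    moreover have "ennreal ((cmod (piece L \<delta> H T x))\<^sup>2) \<le> ?V x" if "T > 0" for T x
      unfolding P_def Q_def by (rule piece_sobolev[OF H L1 d that])
    ultimately show ?thesis by (intro bexI[of _ ?V]) auto
  qed
  show ?thesis
  proof (intro exI[of _ "4 * C"] conjI allI impI)
    show "4 * C \<ge> 0" using C(1) by simp
  qed (rule main)
qed

end

section \<open>Summation over the dyadic scales\<close>

context decaying_measure
begin

text \<open>The pieces at \<delta> = \<epsilon> / 2 ^ j add up to the high frequency multiplier by
  telescoping. Their squared norms decay like \<epsilon>^(2a-1) q^(2j) with q < 1 because a > 1/2,
  and Cauchy-Schwarz with the weights q^j sums them at the price of one factor q^(-j).\<close>

lemma high_frequency_maximal: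
  assumes L: "real L \<ge> a + 1"
  shows "\<exists>C\<ge>0. \<forall>\<epsilon> H. 0 < \<epsilon> \<longrightarrow> \<epsilon> \<le> 1 \<longrightarrow> admissible H \<longrightarrow>
    (\<exists>V\<in>borel_measurable borel. (\<forall>T>0. \<forall>x. ennreal ((cmod (\<integral>\<xi>. H \<xi> * (nuhat (T *\<^sub>R \<xi>) *
        of_real ((1 - exp (- (pi * \<epsilon>\<^sup>2 * T\<^sup>2 * (norm \<xi>)\<^sup>2))) ^ L)) * wave x \<xi> \<partial>lborel))\<^sup>2) \<le> V x) \<and>
      (\<integral>\<^sup>+x. V x \<partial>lborel) \<le> ennreal (C * \<epsilon> powr (2 * a - 1)) * (\<integral>\<^sup>+\<xi>. ennreal ((cmod (H \<xi>))\<^sup>2) \<partial>lborel))"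
proof -
  have L1: "L \<ge> 1" using L a_gt by linarith
  obtain C where C: "C \<ge> 0" and dy: "\<forall>\<delta> H. 0 < \<delta> \<longrightarrow> \<delta> \<le> 1 \<longrightarrow> admissible H \<longrightarrow>
    (\<exists>V\<in>borel_measurable borel. (\<forall>T>0. \<forall>x. ennreal ((cmod (piece L \<delta> H T x))\<^sup>2) \<le> V x) \<and>
      (\<integral>\<^sup>+x. V x \<partial>lborel) \<le> ennreal (C * \<delta> powr (2 * a - 1)) * (\<integral>\<^sup>+\<xi>. ennreal ((cmod (H \<xi>))\<^sup>2) \<partial>lborel))"
    using dyadic_maximal[OF L] by blast
  \<comment> \<open>Square root of the ratio 2^(1 - 2a) of consecutive squared norms: half of the
    decay pays for the weights, the other half for convergence.\<close>
  define q where "q = 2 powr (- (2 * a - 1) / 2)"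
  have q: "0 < q" "q < 1" using a_gt powr_less_mono[of "- (2 * a - 1) / 2" 0 2] by (auto simp: q_def)
  define S where "S = 1 / (1 - q)"
  have S0: "S > 0" using q by (simp add: S_def)
  have qs: "(\<lambda>j. q ^ j) sums S" unfolding S_def using q by (intro geometric_sums) auto
  have main: "\<exists>V\<in>borel_measurable borel. (\<forall>T>0. \<forall>x. ennreal ((cmod (\<integral>\<xi>. H \<xi> * (nuhat (T *\<^sub>R \<xi>) *
        of_real ((1 - exp (- (pi * \<epsilon>\<^sup>2 * T\<^sup>2 * (norm \<xi>)\<^sup>2))) ^ L)) * wave x \<xi> \<partial>lborel))\<^sup>2) \<le> V x) \<and>
      (\<integral>\<^sup>+x. V x \<partial>lborel) \<le> ennreal (S * (C * S) * \<epsilon> powr (2 * a - 1)) * (\<integral>\<^sup>+\<xi>. ennreal ((cmod (H \<xi>))\<^sup>2) \<partial>lborel)"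
    if e: "0 < \<epsilon>" "\<epsilon> \<le> 1" and H: "admissible H" for \<epsilon> H
  proof -
    have [measurable]: "H \<in> borel_measurable borel" using H by (simp add: admissible_def)
    define N where "N = (\<integral>\<^sup>+\<xi>. ennreal ((cmod (H \<xi>))\<^sup>2) \<partial>lborel)"
    define \<delta> where "\<delta> j = \<epsilon> / 2 ^ j" for j :: nat
    have d: "0 < \<delta> j" "\<delta> j \<le> 1" for j
    proof -
      show "0 < \<delta> j" using e by (simp add: \<delta>_def)
      have "\<epsilon> \<le> 2 ^ j" using e one_le_power[of "2::real" j] by linarith
      then show "\<delta> j \<le> 1" by (simp add: \<delta>_def)
    qed
    have "\<forall>j. \<exists>V. V \<in> borel_measurable borel \<and> (\<forall>T>0. \<forall>x. ennreal ((cmod (piece L (\<delta> j) H T x))\<^sup>2) \<le> V x) \<and>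
      (\<integral>\<^sup>+x. V x \<partial>lborel) \<le> ennreal (C * \<delta> j powr (2 * a - 1)) * N"
      using dy d H unfolding N_def by blast
    then obtain V where Vm [measurable]: "\<And>j. V j \<in> borel_measurable borel"
      and Vle: "\<And>j T x. T > 0 \<Longrightarrow> ennreal ((cmod (piece L (\<delta> j) H T x))\<^sup>2) \<le> V j x"
      and Vint: "\<And>j. (\<integral>\<^sup>+x. V j x \<partial>lborel) \<le> ennreal (C * \<delta> j powr (2 * a - 1)) * N"
      by metis
    \<comment> \<open>Majorant of the squared sum, from |sum f_j|^2 \<le> (sum q^j) (sum q^(-j)
      |f_j|^2).\<close>
    define W where "W x = ennreal S * (\<Sum>j. ennreal (1 / q ^ j) * V j x)" for x
    have [measurable]: "W \<in> borel_measurable borel" unfolding W_def by measurable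
    have dj: "\<delta> j powr (2 * a - 1) = \<epsilon> powr (2 * a - 1) * (q ^ j)\<^sup>2" for j
    proof -
      have "(q ^ j)\<^sup>2 = q powr (real (2 * j))"
        using q by (subst powr_realpow) (auto simp: power_mult[symmetric] mult.commute)
      also have "\<dots> = 2 powr (- (2 * a - 1) * real j)" by (simp add: q_def powr_powr)
      also have "\<dots> = 1 / (2 ^ j) powr (2 * a - 1)"
        by (simp add: powr_realpow[symmetric] powr_powr powr_minus_divide[symmetric] algebra_simps)
      finally show ?thesis using e by (simp add: \<delta>_def powr_divide)
    qed
    have "(\<integral>\<^sup>+x. W x \<partial>lborel) = ennreal S * (\<Sum>j. ennreal (1 / q ^ j) * (\<integral>\<^sup>+x. V j x \<partial>lborel))"
      unfolding W_def by (subst nn_integral_cmult, measurable, subst nn_integral_suminf, measurable) (simp add: nn_integral_cmult)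
    also have "\<dots> \<le> ennreal S * (\<Sum>j. ennreal (1 / q ^ j) * (ennreal (C * \<delta> j powr (2 * a - 1)) * N))"
      by (intro mult_left_mono suminf_le Vint) auto
    also have "\<dots> = ennreal S * (\<Sum>j. ennreal (C * \<epsilon> powr (2 * a - 1) * q ^ j) * N)"
    proof -
      have "ennreal (1 / q ^ j) * (ennreal (C * \<delta> j powr (2 * a - 1)) * N) = ennreal (C * \<epsilon> powr (2 * a - 1) * q ^ j) * N" for j
      proof -
        have "1 / q ^ j * (C * \<delta> j powr (2 * a - 1)) = C * \<epsilon> powr (2 * a - 1) * q ^ j"
          unfolding dj using q by (simp add: power2_eq_square)
        then show ?thesis using q C by (simp add: mult.assoc[symmetric] ennreal_mult'[symmetric])
      qed
      then show ?thesis by simp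
    qed
    also have "\<dots> = ennreal S * ((\<Sum>j. ennreal (C * \<epsilon> powr (2 * a - 1) * q ^ j)) * N)"
      by (simp only: ennreal_suminf_multc)
    also have "(\<Sum>j. ennreal (C * \<epsilon> powr (2 * a - 1) * q ^ j)) = ennreal (C * \<epsilon> powr (2 * a - 1) * S)"
      using C q sums_mult[OF qs, of "C * \<epsilon> powr (2 * a - 1)"]
      by (intro suminf_ennreal_eq) auto
    also have "ennreal S * (ennreal (C * \<epsilon> powr (2 * a - 1) * S) * N) = ennreal (S * (C * S) * \<epsilon> powr (2 * a - 1)) * N"
    proof -
      have "ennreal (S * (C * S) * \<epsilon> powr (2 * a - 1)) = ennreal (S * (C * \<epsilon> powr (2 * a - 1) * S))"
        by (simp only: mult_ac)
      also have "\<dots> = ennreal S * ennreal (C * \<epsilon> powr (2 * a - 1) * S)"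
        using S0 C by (intro ennreal_mult) auto
      finally show ?thesis by (simp only: mult.assoc)
    qed
    finally have Wint: "(\<integral>\<^sup>+x. W x \<partial>lborel) \<le> ennreal (S * (C * S) * \<epsilon> powr (2 * a - 1)) * N" .
    have "ennreal ((cmod (\<integral>\<xi>. H \<xi> * (nuhat (T *\<^sub>R \<xi>) *
        of_real ((1 - exp (- (pi * \<epsilon>\<^sup>2 * T\<^sup>2 * (norm \<xi>)\<^sup>2))) ^ L)) * wave x \<xi> \<partial>lborel))\<^sup>2) \<le> W x" if T: "T > 0" for T x
    proof -
      define u where "u j \<xi> = pi * (\<delta> j)\<^sup>2 * T\<^sup>2 * (norm \<xi>)\<^sup>2" for j and \<xi> :: 'a
      have u0: "u j \<xi> \<ge> 0" for j \<xi> by (simp add: u_def)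
      have uS: "u (Suc j) \<xi> = u j \<xi> / 4" for j \<xi> by (simp add: u_def \<delta>_def power_divide power2_eq_square)
      define P where "P j \<xi> = (1 - exp (- u j \<xi>)) ^ L" for j \<xi>
      have P01: "0 \<le> P j \<xi>" "P j \<xi> \<le> 1" for j \<xi>
        using one_minus_exp_bounds[OF u0, of j \<xi>] by (auto simp: P_def intro: power_le_one)
      have [measurable]: "P j \<in> borel_measurable borel" for j unfolding P_def u_def by measurable
      have psiP: "psi L (u j \<xi>) = P j \<xi> - P (Suc j) \<xi>" for j \<xi>
        by (simp add: psi_def P_def uS)
      have tel: "(\<Sum>j<J. psi L (u j \<xi>)) = P 0 \<xi> - P J \<xi>" for J \<xi>
        unfolding psiP by (rule sum_lessThan_telescope')
      \<comment> \<open>The remainder after J pieces is the multiplier at scale \<epsilon> / 2 ^ J;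
        it tends to 0 pointwise since its argument does and L \<ge> 1.\<close>
      have Plim: "(\<lambda>J. P J \<xi>) \<longlonglongrightarrow> 0" for \<xi>
      proof -
        have "u J \<xi> = u 0 \<xi> * (1 / 4) ^ J" for J
          by (induction J) (auto simp: uS)
        then have uJ: "(\<lambda>J. u J \<xi>) = (\<lambda>J. u 0 \<xi> * (1 / 4) ^ J)" by (rule ext)
        have "(\<lambda>J. u 0 \<xi> * (1 / 4) ^ J) \<longlonglongrightarrow> u 0 \<xi> * 0"
          by (intro tendsto_mult tendsto_const LIMSEQ_realpow_zero) auto
        then have "(\<lambda>J. u J \<xi>) \<longlonglongrightarrow> 0" unfolding uJ by (simp only: mult_zero_right)
        then have "(\<lambda>J. (1 - exp (- u J \<xi>)) ^ L) \<longlonglongrightarrow> (1 - exp (- 0)) ^ L"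
          by (intro tendsto_intros)
        then show ?thesis using L1 by (simp add: P_def power_0_left)
      qed
      obtain K where K: "K \<ge> 0" "\<And>z. cmod (nuhat z) \<le> K" "\<And>t \<xi>. cmod (dnuhat t \<xi>) \<le> K * norm \<xi>"
        "\<And>z. z \<noteq> 0 \<Longrightarrow> cmod (nuhat z) \<le> K * norm z powr (- a)"
        "\<And>t \<xi>. t *\<^sub>R \<xi> \<noteq> 0 \<Longrightarrow> cmod (dnuhat t \<xi>) \<le> K * norm \<xi> * norm (t *\<^sub>R \<xi>) powr (- a)"
        apply (rule nuhat_bounds)
        subgoal premises p by (rule p(1)[OF p(2-6)])
        done
      define Gf where "Gf J \<xi> = H \<xi> * (nuhat (T *\<^sub>R \<xi>) * of_real (P 0 \<xi> - P J \<xi>)) * wave x \<xi>" for J \<xi>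
      have sumF: "(\<Sum>j<J. piece L (\<delta> j) H T x) = (\<integral>\<xi>. Gf J \<xi> \<partial>lborel)" for J
      proof -
        have "(\<Sum>j<J. piece L (\<delta> j) H T x) = (\<integral>\<xi>. (\<Sum>j<J. H \<xi> * mult L (\<delta> j) T \<xi> * wave x \<xi>) \<partial>lborel)"
          unfolding piece_def
        proof (intro Bochner_Integration.integral_sum[symmetric])
          fix j
          show "integrable lborel (\<lambda>\<xi>. H \<xi> * mult L (\<delta> j) T \<xi> * wave x \<xi>)"
            using T by (intro Bochner_Integration.integrable_bound[OF admissible_mult_integrable(1)[OF H L1, of T "\<delta> j"]]) (auto simp: norm_mult)
        qed
        also have "\<dots> = (\<integral>\<xi>. Gf J \<xi> \<partial>lborel)"
          unfolding Gf_def tel[symmetric] of_real_sum mult_def u_def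
          by (simp add: sum_distrib_left sum_distrib_right)
        finally show ?thesis .
      qed
      have "(\<lambda>J. \<integral>\<xi>. Gf J \<xi> \<partial>lborel) \<longlonglongrightarrow> (\<integral>\<xi>. H \<xi> * (nuhat (T *\<^sub>R \<xi>) * of_real (P 0 \<xi>)) * wave x \<xi> \<partial>lborel)"
      proof (rule integral_dominated_convergence[where w="\<lambda>\<xi>. K * (cmod (H \<xi>) * (1 + norm \<xi>)\<^sup>2)"])
        show "(\<lambda>\<xi>. H \<xi> * (nuhat (T *\<^sub>R \<xi>) * of_real (P 0 \<xi>)) * wave x \<xi>) \<in> borel_measurable lborel" by measurable
        show "Gf J \<in> borel_measurable lborel" for J unfolding Gf_def by measurable
        show "integrable lborel (\<lambda>\<xi>. K * (cmod (H \<xi>) * (1 + norm \<xi>)\<^sup>2))"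
          using H by (intro integrable_mult_right) (simp add: admissible_def)
        show "AE \<xi> in lborel. (\<lambda>J. Gf J \<xi>) \<longlonglongrightarrow> H \<xi> * (nuhat (T *\<^sub>R \<xi>) * of_real (P 0 \<xi>)) * wave x \<xi>"
        proof (rule AE_I2)
          fix \<xi>
          have "(\<lambda>J. H \<xi> * (nuhat (T *\<^sub>R \<xi>) * of_real (P 0 \<xi> - P J \<xi>)) * wave x \<xi>) \<longlonglongrightarrow> H \<xi> * (nuhat (T *\<^sub>R \<xi>) * of_real (P 0 \<xi> - 0)) * wave x \<xi>"
            by (intro tendsto_intros Plim)
          then show "(\<lambda>J. Gf J \<xi>) \<longlonglongrightarrow> H \<xi> * (nuhat (T *\<^sub>R \<xi>) * of_real (P 0 \<xi>)) * wave x \<xi>"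
            by (simp add: Gf_def)
        qed
        show "AE \<xi> in lborel. norm (Gf J \<xi>) \<le> K * (cmod (H \<xi>) * (1 + norm \<xi>)\<^sup>2)" for J
        proof (rule AE_I2)
          fix \<xi>
          have "\<bar>P 0 \<xi> - P J \<xi>\<bar> \<le> 1" using P01[of 0 \<xi>] P01[of J \<xi>] by linarith
          then have "cmod (nuhat (T *\<^sub>R \<xi>) * of_real (P 0 \<xi> - P J \<xi>)) \<le> K * 1"
            unfolding norm_mult norm_of_real using K by (intro mult_mono) auto
          moreover have "1 \<le> (1 + norm \<xi>)\<^sup>2" by (simp add: power2_eq_square algebra_simps)
          then have "K * 1 \<le> K * (1 + norm \<xi>)\<^sup>2" using K(1) by (rule mult_left_mono)
          ultimately have "cmod (nuhat (T *\<^sub>R \<xi>) * of_real (P 0 \<xi> - P J \<xi>)) \<le> K * (1 + norm \<xi>)\<^sup>2" by linarith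
          then have "cmod (H \<xi>) * cmod (nuhat (T *\<^sub>R \<xi>) * of_real (P 0 \<xi> - P J \<xi>)) \<le> cmod (H \<xi>) * (K * (1 + norm \<xi>)\<^sup>2)"
            by (intro mult_left_mono) auto
          then show "norm (Gf J \<xi>) \<le> K * (cmod (H \<xi>) * (1 + norm \<xi>)\<^sup>2)"
            unfolding Gf_def norm_mult[of _ "wave x \<xi>"] norm_mult[of "H \<xi>"] by (simp add: mult_ac)
        qed
      qed
      then have lim: "(\<lambda>J. ennreal ((cmod (\<Sum>j<J. piece L (\<delta> j) H T x))\<^sup>2)) \<longlonglongrightarrow>
          ennreal ((cmod (\<integral>\<xi>. H \<xi> * (nuhat (T *\<^sub>R \<xi>) * of_real (P 0 \<xi>)) * wave x \<xi> \<partial>lborel))\<^sup>2)"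
        unfolding sumF by (intro tendsto_intros tendsto_ennrealI)
      have "ennreal ((cmod (\<Sum>j<J. piece L (\<delta> j) H T x))\<^sup>2) \<le> W x" for J
      proof -
        let ?f = "\<lambda>j. cmod (piece L (\<delta> j) H T x)"
        have "(cmod (\<Sum>j<J. piece L (\<delta> j) H T x))\<^sup>2 \<le> (\<Sum>j<J. sqrt (q ^ j) * (?f j / sqrt (q ^ j)))\<^sup>2"
          using q by (intro power_mono order_trans[OF norm_sum]) auto
        also have "\<dots> \<le> (\<Sum>j<J. (sqrt (q ^ j))\<^sup>2) * (\<Sum>j<J. (?f j / sqrt (q ^ j))\<^sup>2)"
          by (rule Cauchy_Schwarz_ineq_sum)
        also have "\<dots> = (\<Sum>j<J. q ^ j) * (\<Sum>j<J. 1 / q ^ j * (?f j)\<^sup>2)"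
          using q by (simp add: power_divide)
        also have "\<dots> \<le> S * (\<Sum>j<J. 1 / q ^ j * (?f j)\<^sup>2)"
          using q qs by (intro mult_right_mono sum_nonneg) (auto simp: sums_iff intro!: sum_le_suminf)
        finally have "ennreal ((cmod (\<Sum>j<J. piece L (\<delta> j) H T x))\<^sup>2) \<le> ennreal (S * (\<Sum>j<J. 1 / q ^ j * (?f j)\<^sup>2))"
          by (rule ennreal_leI)
        also have "\<dots> = ennreal S * (\<Sum>j<J. ennreal (1 / q ^ j * (?f j)\<^sup>2))"
          using q S0 by (simp add: ennreal_mult' sum_ennreal sum_nonneg)
        also have "\<dots> = ennreal S * (\<Sum>j<J. ennreal (1 / q ^ j) * ennreal ((?f j)\<^sup>2))"
          using q by (intro arg_cong2[where f="(*)"] sum.cong refl ennreal_mult) auto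
        also have "\<dots> \<le> ennreal S * (\<Sum>j<J. ennreal (1 / q ^ j) * V j x)"
          by (intro mult_left_mono sum_mono Vle T) auto
        also have "\<dots> \<le> W x"
          unfolding W_def by (intro mult_left_mono sum_le_suminf) auto
        finally show ?thesis .
      qed
      then have "ennreal ((cmod (\<integral>\<xi>. H \<xi> * (nuhat (T *\<^sub>R \<xi>) * of_real (P 0 \<xi>)) * wave x \<xi> \<partial>lborel))\<^sup>2) \<le> W x"
        by (intro LIMSEQ_le_const2[OF lim]) auto
      then show ?thesis by (simp add: P_def u_def \<delta>_def)
    qed
    then show ?thesis using Wint unfolding N_def by (intro bexI[of _ W] conjI allI impI) simp_all
  qed
  show ?thesis
  proof (intro exI[of _ "S * (C * S)"] conjI allI impI)
    show "S * (C * S) \<ge> 0" using C S0 by simp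
  qed (rule main)
qed

end

section \<open>Weak type bounds for averages of indicator functions\<close>

context decaying_measure
begin

definition Uhat :: "'a set \<Rightarrow> 'a \<Rightarrow> complex" where
  "Uhat U \<xi> = (\<integral>v. indicator U v * cnj (wave v \<xi>) \<partial>lborel)"

text \<open>The average at time t, against the Gaussian-weighted measure, of the indicator of U
  after smoothing. The scale \<sigma> is absolute, not relative to t.\<close>

definition avg :: "'a set \<Rightarrow> real \<Rightarrow> real \<Rightarrow> 'a \<Rightarrow> real" where
  "avg U \<sigma> t x = (\<integral>y. (\<integral>v. indicator U v * (gauss ((x - t *\<^sub>R y - v) /\<^sub>R \<sigma>) / \<sigma> ^ DIM('a)) \<partial>lborel) * gauss y \<partial>\<mu>)"

context
  fixes U :: "'a set"
  assumes U [measurable]: "U \<in> sets borel" and Ufin: "emeasure lborel U < \<infinity>"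
begin

lemma iU: "integrable lborel (indicator U :: 'a \<Rightarrow> real)"
  using Ufin by (intro integrable_real_indicator) auto

lemma iUc: "integrable lborel (\<lambda>v. indicator U v :: complex)"
  by (rule Bochner_Integration.integrable_bound[OF iU]) (auto split: split_indicator)

lemma Uhat_measurable [measurable]: "Uhat U \<in> borel_measurable borel"
  unfolding Uhat_def by measurable

lemma Uhat_le: "cmod (Uhat U \<xi>) \<le> measure lborel U"
proof -
  have "cmod (Uhat U \<xi>) \<le> (\<integral>v. cmod (indicator U v * cnj (wave v \<xi>)) \<partial>lborel)"
    unfolding Uhat_def by (rule integral_norm_bound)
  also have "\<dots> = (\<integral>v. indicator U v \<partial>lborel)"
    by (intro Bochner_Integration.integral_cong refl) (auto simp: norm_mult split: split_indicator)
  finally show ?thesis by simp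
qed

text \<open>\<open>bessel\<close> is about integrals with \<open>wave\<close> itself; a reflection
  passes to the conjugate in \<open>Uhat\<close>.\<close>

lemma Uhat_L2: "(\<integral>\<^sup>+\<xi>. ennreal ((cmod (Uhat U \<xi>))\<^sup>2) \<partial>lborel) \<le> emeasure lborel U"
proof -
  let ?F = "\<lambda>x. \<integral>v. indicator U v * wave x v \<partial>lborel"
  have [measurable]: "?F \<in> borel_measurable borel" by measurable
  have "Uhat U \<xi> = ?F (0 - \<xi>)" for \<xi>
    unfolding Uhat_def by (simp add: wave_commute[of _ \<xi>] wave_minus_left)
  then have "(\<integral>\<^sup>+\<xi>. ennreal ((cmod (Uhat U \<xi>))\<^sup>2) \<partial>lborel) = (\<integral>\<^sup>+\<xi>. ennreal ((cmod (?F (0 - \<xi>)))\<^sup>2) \<partial>lborel)"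
    by simp
  also have "\<dots> = (\<integral>\<^sup>+x. ennreal ((cmod (?F x))\<^sup>2) \<partial>lborel)"
    by (rule nn_integral_lborel_reflect[of "\<lambda>x. ennreal ((cmod (?F x))\<^sup>2)" 0]) measurable
  also have "\<dots> \<le> (\<integral>\<^sup>+v. ennreal ((cmod (indicator U v))\<^sup>2) \<partial>lborel)"
    by (rule bessel[OF iUc])
  also have "\<dots> = (\<integral>\<^sup>+v. indicator U v \<partial>lborel)"
    by (intro nn_integral_cong) (auto split: split_indicator)
  finally show ?thesis by simp
qed

text \<open>The smoothing kernel is written as the transform of gauss (\<sigma> \<xi>), and the
  interchange with the v-integral produces \<open>Uhat\<close>. Absolute convergence in \<xi> comes
  from the Gaussian, in v from the finite measure of U.\<close>

lemma smooth_indicator_fourier: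
  assumes s: "\<sigma> > 0"
  shows "complex_of_real (\<integral>v. indicator U v * (gauss ((z - v) /\<^sub>R \<sigma>) / \<sigma> ^ DIM('a)) \<partial>lborel)
    = (\<integral>\<xi>. Uhat U \<xi> * of_real (gauss (\<sigma> *\<^sub>R \<xi>)) * wave z \<xi> \<partial>lborel)"
proof -
  have ig: "integrable lborel (\<lambda>\<xi>::'a. gauss (\<sigma> *\<^sub>R \<xi>))" using s by (intro gauss_scaled_integrable) auto
  have "complex_of_real (\<integral>v. indicator U v * (gauss ((z - v) /\<^sub>R \<sigma>) / \<sigma> ^ DIM('a)) \<partial>lborel)
    = (\<integral>v. complex_of_real (indicator U v * (gauss ((z - v) /\<^sub>R \<sigma>) / \<sigma> ^ DIM('a))) \<partial>lborel)"
    by (rule Bochner_Integration.integral_complex_of_real[symmetric])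
  also have "\<dots> = (\<integral>v. (\<integral>\<xi>. indicator U v * (gauss (\<sigma> *\<^sub>R \<xi>) *\<^sub>R wave (z - v) \<xi>) \<partial>lborel) \<partial>lborel)"
  proof (intro Bochner_Integration.integral_cong refl)
    fix v
    have "(\<integral>\<xi>. indicator U v * (gauss (\<sigma> *\<^sub>R \<xi>) *\<^sub>R wave (z - v) \<xi>) \<partial>lborel)
      = indicator U v * (\<integral>\<xi>. gauss (\<sigma> *\<^sub>R \<xi>) *\<^sub>R wave (z - v) \<xi> \<partial>lborel)"
      by (rule integral_mult_right_zero)
    also have "\<dots> = complex_of_real (indicator U v * (gauss ((z - v) /\<^sub>R \<sigma>) / \<sigma> ^ DIM('a)))"
      unfolding gauss_fourier_scaled[OF s] by (auto split: split_indicator)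
    finally show "complex_of_real (indicator U v * (gauss ((z - v) /\<^sub>R \<sigma>) / \<sigma> ^ DIM('a)))
      = (\<integral>\<xi>. indicator U v * (gauss (\<sigma> *\<^sub>R \<xi>) *\<^sub>R wave (z - v) \<xi>) \<partial>lborel)" by simp
  qed
  also have "\<dots> = (\<integral>\<xi>. (\<integral>v. indicator U v * (gauss (\<sigma> *\<^sub>R \<xi>) *\<^sub>R wave (z - v) \<xi>) \<partial>lborel) \<partial>lborel)"
    by (rule lborel_pair.Fubini_product_bound(2)[symmetric, OF _ iU ig]) (auto split: split_indicator)
  also have "\<dots> = (\<integral>\<xi>. Uhat U \<xi> * of_real (gauss (\<sigma> *\<^sub>R \<xi>)) * wave z \<xi> \<partial>lborel)"
  proof (intro Bochner_Integration.integral_cong refl)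
    fix \<xi>
    have "(\<integral>v. indicator U v * (gauss (\<sigma> *\<^sub>R \<xi>) *\<^sub>R wave (z - v) \<xi>) \<partial>lborel)
      = (\<integral>v. (indicator U v * cnj (wave v \<xi>)) * (of_real (gauss (\<sigma> *\<^sub>R \<xi>)) * wave z \<xi>) \<partial>lborel)"
      by (intro Bochner_Integration.integral_cong refl)
        (simp add: scaleR_conv_of_real wave_add[of z "- _", simplified] wave_minus_left mult_ac)
    also have "\<dots> = Uhat U \<xi> * (of_real (gauss (\<sigma> *\<^sub>R \<xi>)) * wave z \<xi>)"
      unfolding Uhat_def by (rule integral_mult_left_zero)
    finally show "(\<integral>v. indicator U v * (gauss (\<sigma> *\<^sub>R \<xi>) *\<^sub>R wave (z - v) \<xi>) \<partial>lborel)
      = Uhat U \<xi> * of_real (gauss (\<sigma> *\<^sub>R \<xi>)) * wave z \<xi>" by (simp add: mult.assoc)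
  qed
  finally show ?thesis .
qed

text \<open>Integrating the phase of x - t y against the weighted measure yields
  \<open>nuhat (t *\<^sub>R \<xi>)\<close>, so the average acts as a Fourier multiplier.\<close>

lemma avg_fourier:
  assumes s: "\<sigma> > 0"
  shows "complex_of_real (avg U \<sigma> t x) = (\<integral>\<xi>. Uhat U \<xi> * of_real (gauss (\<sigma> *\<^sub>R \<xi>)) * (nuhat (t *\<^sub>R \<xi>) * wave x \<xi>) \<partial>lborel)"
proof -
  interpret P: pair_sigma_finite \<mu> "lborel :: 'a measure" ..
  have ig: "integrable lborel (\<lambda>\<xi>::'a. measure lborel U * gauss (\<sigma> *\<^sub>R \<xi>))"
    using s by (intro integrable_mult_right gauss_scaled_integrable) auto
  let ?g = "\<lambda>y \<xi>. Uhat U \<xi> * of_real (gauss (\<sigma> *\<^sub>R \<xi>)) * wave (x - t *\<^sub>R y) \<xi> * of_real (gauss y)"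
  have "complex_of_real (avg U \<sigma> t x)
    = (\<integral>y. complex_of_real ((\<integral>v. indicator U v * (gauss ((x - t *\<^sub>R y - v) /\<^sub>R \<sigma>) / \<sigma> ^ DIM('a)) \<partial>lborel) * gauss y) \<partial>\<mu>)"
    unfolding avg_def by (rule Bochner_Integration.integral_complex_of_real[symmetric])
  also have "\<dots> = (\<integral>y. (\<integral>\<xi>. ?g y \<xi> \<partial>lborel) \<partial>\<mu>)"
    unfolding of_real_mult smooth_indicator_fourier[OF s] integral_mult_left_zero ..
  also have "\<dots> = (\<integral>\<xi>. (\<integral>y. ?g y \<xi> \<partial>\<mu>) \<partial>lborel)"
  proof (rule P.Fubini_product_bound(2)[symmetric, where u="\<lambda>_. 1" and v="\<lambda>\<xi>. measure lborel U * gauss (\<sigma> *\<^sub>R \<xi>)"])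
    show "(\<lambda>(y, \<xi>). ?g y \<xi>) \<in> borel_measurable (\<mu> \<Otimes>\<^sub>M lborel)" by measurable
    show "integrable \<mu> (\<lambda>_. 1 :: real)" by simp
    show "integrable lborel (\<lambda>\<xi>::'a. measure lborel U * gauss (\<sigma> *\<^sub>R \<xi>))" by (fact ig)
    fix y \<xi> :: 'a
    have "cmod (?g y \<xi>) = cmod (Uhat U \<xi>) * gauss (\<sigma> *\<^sub>R \<xi>) * gauss y"
      by (simp add: norm_mult)
    also have "\<dots> \<le> measure lborel U * gauss (\<sigma> *\<^sub>R \<xi>) * 1"
      using Uhat_le by (intro mult_mono) auto
    finally show "cmod (?g y \<xi>) \<le> 1 * (measure lborel U * gauss (\<sigma> *\<^sub>R \<xi>))" by simp
  qed
  also have "\<dots> = (\<integral>\<xi>. Uhat U \<xi> * of_real (gauss (\<sigma> *\<^sub>R \<xi>)) * (nuhat (t *\<^sub>R \<xi>) * wave x \<xi>) \<partial>lborel)"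
  proof (intro Bochner_Integration.integral_cong refl)
    fix \<xi>
    have w: "wave (x - t *\<^sub>R y) \<xi> = wave x \<xi> * cnj (wave y (t *\<^sub>R \<xi>))" for y
      using wave_add[of x "- (t *\<^sub>R y)" \<xi>] by (simp add: wave_minus_left) (simp add: wave_def)
    have "(\<integral>y. ?g y \<xi> \<partial>\<mu>) = (\<integral>y. (Uhat U \<xi> * of_real (gauss (\<sigma> *\<^sub>R \<xi>)) * wave x \<xi>) * (cnj (wave y (t *\<^sub>R \<xi>)) * of_real (gauss y)) \<partial>\<mu>)"
      unfolding w by (intro Bochner_Integration.integral_cong refl) (simp only: mult_ac)
    also have "\<dots> = (Uhat U \<xi> * of_real (gauss (\<sigma> *\<^sub>R \<xi>)) * wave x \<xi>) * nuhat (t *\<^sub>R \<xi>)"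
      unfolding nuhat_eq by (rule integral_mult_right_zero)
    finally show "(\<integral>y. ?g y \<xi> \<partial>\<mu>) = Uhat U \<xi> * of_real (gauss (\<sigma> *\<^sub>R \<xi>)) * (nuhat (t *\<^sub>R \<xi>) * wave x \<xi>)"
      by (simp only: mult_ac)
  qed
  finally show ?thesis .
qed

lemma smooth_indicator_nn:
  assumes s: "\<sigma> > 0"
  shows "ennreal (\<integral>v. indicator U v * (gauss ((z - v) /\<^sub>R \<sigma>) / \<sigma> ^ DIM('a)) \<partial>lborel)
    = (\<integral>\<^sup>+v. indicator U v * ennreal (gauss ((z - v) /\<^sub>R \<sigma>) / \<sigma> ^ DIM('a)) \<partial>lborel)"
proof -
  have "integrable lborel (\<lambda>v. (1 / \<sigma> ^ DIM('a)) * indicator U v :: real)"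
    by (intro integrable_mult_right iU)
  then have i: "integrable lborel (\<lambda>v. indicator U v * (gauss ((z - v) /\<^sub>R \<sigma>) / \<sigma> ^ DIM('a)))"
    by (rule Bochner_Integration.integrable_bound)
       (use s in \<open>auto split: split_indicator intro!: divide_right_mono\<close>)
  have "(\<integral>\<^sup>+v. indicator U v * ennreal (gauss ((z - v) /\<^sub>R \<sigma>) / \<sigma> ^ DIM('a)) \<partial>lborel)
    = (\<integral>\<^sup>+v. ennreal (indicator U v * (gauss ((z - v) /\<^sub>R \<sigma>) / \<sigma> ^ DIM('a))) \<partial>lborel)"
    by (intro nn_integral_cong) (auto split: split_indicator)
  also have "\<dots> = ennreal (\<integral>v. indicator U v * (gauss ((z - v) /\<^sub>R \<sigma>) / \<sigma> ^ DIM('a)) \<partial>lborel)"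
    using s by (intro nn_integral_eq_integral i) auto
  finally show ?thesis by simp
qed

lemma avg_nonneg: "\<sigma> > 0 \<Longrightarrow> avg U \<sigma> t x \<ge> 0"
  unfolding avg_def by (intro Bochner_Integration.integral_nonneg mult_nonneg_nonneg) auto

lemma avg_nn:
  assumes s: "\<sigma> > 0"
  shows "ennreal (avg U \<sigma> t x) = (\<integral>\<^sup>+y. (\<integral>\<^sup>+v. indicator U v * ennreal (gauss ((x - t *\<^sub>R y - v) /\<^sub>R \<sigma>) / \<sigma> ^ DIM('a)) \<partial>lborel) * ennreal (gauss y) \<partial>\<mu>)"
proof -
  let ?p = "\<lambda>z. \<integral>v. indicator U v * (gauss ((z - v) /\<^sub>R \<sigma>) / \<sigma> ^ DIM('a)) \<partial>lborel"
  have p0: "?p z \<ge> 0" for z using s by (intro Bochner_Integration.integral_nonneg) auto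
  have ple: "?p z \<le> measure lborel U / \<sigma> ^ DIM('a)" for z
  proof -
    have "?p z \<le> (\<integral>v. (1 / \<sigma> ^ DIM('a)) * indicator U v \<partial>lborel)"
      using s iU by (intro integral_mono_AE') (auto split: split_indicator intro!: AE_I2 divide_right_mono)
    also have "\<dots> = measure lborel U / \<sigma> ^ DIM('a)" by simp
    finally show ?thesis .
  qed
  have i: "integrable \<mu> (\<lambda>y. ?p (x - t *\<^sub>R y) * gauss y)"
  proof (rule Bochner_Integration.integrable_bound)
    show "integrable \<mu> (\<lambda>y. measure lborel U / \<sigma> ^ DIM('a))" by simp
    show "(\<lambda>y. ?p (x - t *\<^sub>R y) * gauss y) \<in> borel_measurable \<mu>" by measurable
    show "AE y in \<mu>. norm (?p (x - t *\<^sub>R y) * gauss y) \<le> norm (measure lborel U / \<sigma> ^ DIM('a))"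
    proof (rule AE_I2)
      fix y
      have "?p (x - t *\<^sub>R y) * gauss y \<le> measure lborel U / \<sigma> ^ DIM('a) * 1"
        using ple p0 s by (intro mult_mono) auto
      then show "norm (?p (x - t *\<^sub>R y) * gauss y) \<le> norm (measure lborel U / \<sigma> ^ DIM('a))"
        using p0[of "x - t *\<^sub>R y"] s by (simp add: abs_mult)
    qed
  qed
  have "ennreal (avg U \<sigma> t x) = (\<integral>\<^sup>+y. ennreal (?p (x - t *\<^sub>R y) * gauss y) \<partial>\<mu>)"
    unfolding avg_def using p0 by (intro nn_integral_eq_integral[symmetric] i AE_I2 mult_nonneg_nonneg) auto
  also have "\<dots> = (\<integral>\<^sup>+y. (\<integral>\<^sup>+v. indicator U v * ennreal (gauss ((x - t *\<^sub>R y - v) /\<^sub>R \<sigma>) / \<sigma> ^ DIM('a)) \<partial>lborel) * ennreal (gauss y) \<partial>\<mu>)"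
    by (intro nn_integral_cong) (simp only: smooth_indicator_nn[OF s, symmetric] ennreal_mult[OF p0 gauss_nonneg])
  finally show ?thesis .
qed

text \<open>\<open>Uhat\<close> is bounded by the measure of U; the Gaussian of the smoothing scale
  \<eta> is what makes the weighted frequency integral converge.\<close>

lemma admissible_Uhat:
  assumes e: "\<eta> > 0"
  shows "admissible (\<lambda>\<xi>. Uhat U \<xi> * of_real (gauss (\<eta> *\<^sub>R \<xi>)))"
  unfolding admissible_def
proof
  show "integrable lborel (\<lambda>\<xi>. cmod (Uhat U \<xi> * of_real (gauss (\<eta> *\<^sub>R \<xi>))) * (1 + norm \<xi>)\<^sup>2)"
  proof (rule Bochner_Integration.integrable_bound)
    have "integrable lborel (\<lambda>\<xi>::'a. (1 + norm (0 + \<eta> *\<^sub>R \<xi>)) powr 2 * gauss (0 + \<eta> *\<^sub>R \<xi>))"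
      using e by (intro integrable_lborel_affine[OF gauss_moment]) auto
    then show "integrable lborel (\<lambda>\<xi>::'a. (measure lborel U * (1 + 1 / \<eta>)\<^sup>2) * ((1 + norm (\<eta> *\<^sub>R \<xi>)) powr 2 * gauss (\<eta> *\<^sub>R \<xi>)))"
      by (intro integrable_mult_right) simp
    show "AE \<xi> in lborel. norm (cmod (Uhat U \<xi> * of_real (gauss (\<eta> *\<^sub>R \<xi>))) * (1 + norm \<xi>)\<^sup>2)
      \<le> norm ((measure lborel U * (1 + 1 / \<eta>)\<^sup>2) * ((1 + norm (\<eta> *\<^sub>R \<xi>)) powr 2 * gauss (\<eta> *\<^sub>R \<xi>)))"
    proof (rule AE_I2)
      fix \<xi> :: 'a
      have "1 + norm \<xi> \<le> (1 + 1 / \<eta>) * (1 + norm (\<eta> *\<^sub>R \<xi>))"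
        using e by (simp add: distrib_left distrib_right)
      then have "(1 + norm \<xi>)\<^sup>2 \<le> ((1 + 1 / \<eta>) * (1 + norm (\<eta> *\<^sub>R \<xi>)))\<^sup>2"
        by (intro power_mono) auto
      then have "(cmod (Uhat U \<xi>) * gauss (\<eta> *\<^sub>R \<xi>)) * (1 + norm \<xi>)\<^sup>2
        \<le> (measure lborel U * gauss (\<eta> *\<^sub>R \<xi>)) * ((1 + 1 / \<eta>) * (1 + norm (\<eta> *\<^sub>R \<xi>)))\<^sup>2"
        using Uhat_le by (intro mult_mono mult_right_mono) auto
      also have "\<dots> = (measure lborel U * (1 + 1 / \<eta>)\<^sup>2) * ((1 + norm (\<eta> *\<^sub>R \<xi>)) powr 2 * gauss (\<eta> *\<^sub>R \<xi>))"
        by (simp add: power_mult_distrib add_nonneg_nonneg)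
      finally show "norm (cmod (Uhat U \<xi> * of_real (gauss (\<eta> *\<^sub>R \<xi>))) * (1 + norm \<xi>)\<^sup>2)
        \<le> norm ((measure lborel U * (1 + 1 / \<eta>)\<^sup>2) * ((1 + norm (\<eta> *\<^sub>R \<xi>)) powr 2 * gauss (\<eta> *\<^sub>R \<xi>)))"
        by (simp add: norm_mult)
    qed
  qed measurable
qed measurable

text \<open>Multiplying gauss (\<eta> \<xi>) by the k-th power of E = exp (- pi \<epsilon>^2 t^2
  |\<xi>|^2) gives the Gaussian of scale sqrt (\<eta>^2 + k (\<epsilon> t)^2). Expanding (1 - E) ^ L
  and solving for the term k = 0 thus expresses the average by smoother averages and a high
  frequency remainder.\<close>

lemma avg_split:
  assumes e: "\<eta> > 0" and L: "L \<ge> 1"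
  shows "complex_of_real (avg U \<eta> t x)
    = (\<Sum>k=1..L. of_real (real (L choose k) * (- 1) ^ (k + 1)) * complex_of_real (avg U (sqrt (\<eta>\<^sup>2 + real k * (\<epsilon> * t)\<^sup>2)) t x))
    + (\<integral>\<xi>. Uhat U \<xi> * of_real (gauss (\<eta> *\<^sub>R \<xi>)) * (nuhat (t *\<^sub>R \<xi>) *
        of_real ((1 - exp (- (pi * \<epsilon>\<^sup>2 * t\<^sup>2 * (norm \<xi>)\<^sup>2))) ^ L)) * wave x \<xi> \<partial>lborel)"
proof -
  define \<sigma> where "\<sigma> k = sqrt (\<eta>\<^sup>2 + real k * (\<epsilon> * t)\<^sup>2)" for k
  have s0: "\<sigma> k > 0" for k using e by (simp add: \<sigma>_def add_pos_nonneg)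
  define c where "c k = real (L choose k) * (- 1) ^ (k + 1)" for k
  define E where "E \<xi> = exp (- (pi * \<epsilon>\<^sup>2 * t\<^sup>2 * (norm \<xi>)\<^sup>2))" for \<xi> :: 'a
  define B where "B \<xi> = Uhat U \<xi> * (nuhat (t *\<^sub>R \<xi>) * wave x \<xi>)" for \<xi>
  have [measurable]: "B \<in> borel_measurable borel" "E \<in> borel_measurable borel" unfolding B_def E_def by measurable
  have gk: "gauss (\<sigma> k *\<^sub>R \<xi>) = gauss (\<eta> *\<^sub>R \<xi>) * E \<xi> ^ k" for k \<xi>
    by (simp add: gauss_def E_def \<sigma>_def power_mult_distrib exp_add[symmetric] exp_of_nat_mult[symmetric] algebra_simps)
  \<comment> \<open>The term k = 0 of the binomial expansion is the 1 on the left; the sign (- 1) ^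
    (k + 1) in \<open>c\<close> comes from moving the other terms across.\<close>
  have binom: "1 = (\<Sum>k=1..L. c k * E \<xi> ^ k) + (1 - E \<xi>) ^ L" for \<xi>
  proof -
    have "(1 - E \<xi>) ^ L = (- E \<xi> + 1) ^ L" by simp
    also have "\<dots> = (\<Sum>k\<le>L. real (L choose k) * (- E \<xi>) ^ k * 1 ^ (L - k))" by (rule binomial_ring)
    also have "\<dots> = (\<Sum>k\<in>insert 0 {1..L}. real (L choose k) * (- E \<xi>) ^ k)"
      by (intro sum.cong) auto
    also have "\<dots> = 1 + (\<Sum>k=1..L. real (L choose k) * (- E \<xi>) ^ k)" by (subst sum.insert) auto
    also have "(\<Sum>k=1..L. real (L choose k) * (- E \<xi>) ^ k) = - (\<Sum>k=1..L. c k * E \<xi> ^ k)"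
      unfolding sum_negf[symmetric] by (intro sum.cong refl) (simp add: c_def power_minus[of "E \<xi>"])
    finally show ?thesis by simp
  qed
  obtain K where K: "K \<ge> 0" "\<And>z. cmod (nuhat z) \<le> K" "\<And>t \<xi>. cmod (dnuhat t \<xi>) \<le> K * norm \<xi>"
    "\<And>z. z \<noteq> 0 \<Longrightarrow> cmod (nuhat z) \<le> K * norm z powr (- a)"
    "\<And>t \<xi>. t *\<^sub>R \<xi> \<noteq> 0 \<Longrightarrow> cmod (dnuhat t \<xi>) \<le> K * norm \<xi> * norm (t *\<^sub>R \<xi>) powr (- a)"
    apply (rule nuhat_bounds)
    subgoal premises p by (rule p(1)[OF p(2-6)])
    done
  have E1: "0 \<le> E \<xi>" "E \<xi> \<le> 1" for \<xi> by (auto simp: E_def)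
  have i: "integrable lborel (\<lambda>\<xi>. B \<xi> * of_real (gauss (\<eta> *\<^sub>R \<xi>) * w \<xi>))"
    if [measurable]: "w \<in> borel_measurable borel" and w: "\<And>\<xi>. \<bar>w \<xi>\<bar> \<le> 1" for w :: "'a \<Rightarrow> real"
  proof (rule Bochner_Integration.integrable_bound)
    show "integrable lborel (\<lambda>\<xi>::'a. measure lborel U * K * gauss (\<eta> *\<^sub>R \<xi>))"
      using e by (intro integrable_mult_right gauss_scaled_integrable) auto
    show "AE \<xi> in lborel. norm (B \<xi> * of_real (gauss (\<eta> *\<^sub>R \<xi>) * w \<xi>)) \<le> norm (measure lborel U * K * gauss (\<eta> *\<^sub>R \<xi>))"
    proof (rule AE_I2)
      fix \<xi>
      have "norm (B \<xi> * of_real (gauss (\<eta> *\<^sub>R \<xi>) * w \<xi>)) = (cmod (Uhat U \<xi>) * cmod (nuhat (t *\<^sub>R \<xi>))) * (gauss (\<eta> *\<^sub>R \<xi>) * \<bar>w \<xi>\<bar>)"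
        by (simp add: B_def norm_mult)
      also have "\<dots> \<le> (measure lborel U * K) * (gauss (\<eta> *\<^sub>R \<xi>) * 1)"
        using Uhat_le K w by (intro mult_mono) auto
      finally show "norm (B \<xi> * of_real (gauss (\<eta> *\<^sub>R \<xi>) * w \<xi>)) \<le> norm (measure lborel U * K * gauss (\<eta> *\<^sub>R \<xi>))" using K(1) by simp
    qed
  qed measurable
  have iE: "integrable lborel (\<lambda>\<xi>. B \<xi> * of_real (gauss (\<eta> *\<^sub>R \<xi>) * E \<xi> ^ k))" for k
    using E1 by (intro i) (auto intro: power_le_one)
  have i2: "integrable lborel (\<lambda>\<xi>. B \<xi> * of_real (gauss (\<eta> *\<^sub>R \<xi>) * (1 - E \<xi>) ^ L))"
    using E1 by (intro i) (auto intro: power_le_one simp: power_abs[symmetric])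
  have "complex_of_real (avg U \<eta> t x) = (\<integral>\<xi>. B \<xi> * of_real (gauss (\<eta> *\<^sub>R \<xi>) * 1) \<partial>lborel)"
    unfolding avg_fourier[OF e] by (intro Bochner_Integration.integral_cong refl) (simp add: B_def mult_ac)
  also have "\<dots> = (\<integral>\<xi>. (\<Sum>k=1..L. of_real (c k) * (B \<xi> * of_real (gauss (\<eta> *\<^sub>R \<xi>) * E \<xi> ^ k)))
      + B \<xi> * of_real (gauss (\<eta> *\<^sub>R \<xi>) * (1 - E \<xi>) ^ L) \<partial>lborel)"
  proof (intro Bochner_Integration.integral_cong refl)
    fix \<xi>
    have "B \<xi> * of_real (gauss (\<eta> *\<^sub>R \<xi>) * 1) = B \<xi> * of_real (gauss (\<eta> *\<^sub>R \<xi>) * ((\<Sum>k=1..L. c k * E \<xi> ^ k) + (1 - E \<xi>) ^ L))"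
      by (subst binom[of \<xi>]) (rule refl)
    also have "\<dots> = (\<Sum>k=1..L. of_real (c k) * (B \<xi> * of_real (gauss (\<eta> *\<^sub>R \<xi>) * E \<xi> ^ k)))
      + B \<xi> * of_real (gauss (\<eta> *\<^sub>R \<xi>) * (1 - E \<xi>) ^ L)"
      by (simp add: distrib_left sum_distrib_left mult_ac)
    finally show "B \<xi> * of_real (gauss (\<eta> *\<^sub>R \<xi>) * 1) = \<dots>" .
  qed
  also have "\<dots> = (\<Sum>k=1..L. of_real (c k) * (\<integral>\<xi>. B \<xi> * of_real (gauss (\<eta> *\<^sub>R \<xi>) * E \<xi> ^ k) \<partial>lborel))
      + (\<integral>\<xi>. B \<xi> * of_real (gauss (\<eta> *\<^sub>R \<xi>) * (1 - E \<xi>) ^ L) \<partial>lborel)"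
    using iE i2 by (subst Bochner_Integration.integral_add) (auto intro!: Bochner_Integration.integrable_sum integrable_mult_right)
  also have "(\<Sum>k=1..L. of_real (c k) * (\<integral>\<xi>. B \<xi> * of_real (gauss (\<eta> *\<^sub>R \<xi>) * E \<xi> ^ k) \<partial>lborel))
    = (\<Sum>k=1..L. of_real (c k) * complex_of_real (avg U (\<sigma> k) t x))"
  proof (intro sum.cong refl arg_cong2[where f="(*)"])
    fix k
    show "(\<integral>\<xi>. B \<xi> * of_real (gauss (\<eta> *\<^sub>R \<xi>) * E \<xi> ^ k) \<partial>lborel) = complex_of_real (avg U (\<sigma> k) t x)"
      unfolding avg_fourier[OF s0] gk by (intro Bochner_Integration.integral_cong refl) (simp add: B_def mult_ac)
  qed
  also have "(\<integral>\<xi>. B \<xi> * of_real (gauss (\<eta> *\<^sub>R \<xi>) * (1 - E \<xi>) ^ L) \<partial>lborel)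
    = (\<integral>\<xi>. Uhat U \<xi> * of_real (gauss (\<eta> *\<^sub>R \<xi>)) * (nuhat (t *\<^sub>R \<xi>) *
        of_real ((1 - exp (- (pi * \<epsilon>\<^sup>2 * t\<^sup>2 * (norm \<xi>)\<^sup>2))) ^ L)) * wave x \<xi> \<partial>lborel)"
    unfolding B_def E_def by (intro Bochner_Integration.integral_cong refl) (simp only: of_real_mult mult_ac)
  finally show ?thesis by (simp only: c_def \<sigma>_def)
qed

end

text \<open>By \<open>avg_split\<close> the average is at most K times the Hardy-Littlewood function
  plus the modulus of the high frequency remainder. If it exceeds \<alpha>, one of the two reaches
  \<alpha> / 2: the first is handled by the weak (1,1) bound, the second by Chebyshev's inequality
  in L^2. The constant is free of \<eta>.\<close>

lemma weak_type_smooth: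
  "\<exists>C\<ge>0. \<forall>U\<in>sets borel. \<forall>\<epsilon> \<alpha> \<eta>. emeasure lborel U < \<infinity> \<longrightarrow> 0 < \<epsilon> \<longrightarrow> \<epsilon> \<le> 1 \<longrightarrow> 0 < \<alpha> \<longrightarrow> 0 < \<eta> \<longrightarrow>
    (\<exists>W\<in>sets borel. (\<forall>x t. 0 < t \<longrightarrow> \<alpha> < avg U \<eta> t x \<longrightarrow> x \<in> W) \<and>
      emeasure lborel W \<le> ennreal (C * (\<epsilon> powr (b - DIM('a)) / \<alpha> + \<epsilon> powr (2 * a - 1) / \<alpha>\<^sup>2)) * emeasure lborel U)"
proof -
  obtain L :: nat where L: "real L \<ge> a + 1" using real_arch_simple by blast
  have L1: "L \<ge> 1" using L a_gt by linarith
  obtain C1 where C1: "C1 \<ge> 0" and hi: "\<forall>\<epsilon> H. 0 < \<epsilon> \<longrightarrow> \<epsilon> \<le> 1 \<longrightarrow> admissible H \<longrightarrow>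
    (\<exists>V\<in>borel_measurable borel. (\<forall>T>0. \<forall>x. ennreal ((cmod (\<integral>\<xi>. H \<xi> * (nuhat (T *\<^sub>R \<xi>) *
        of_real ((1 - exp (- (pi * \<epsilon>\<^sup>2 * T\<^sup>2 * (norm \<xi>)\<^sup>2))) ^ L)) * wave x \<xi> \<partial>lborel))\<^sup>2) \<le> V x) \<and>
      (\<integral>\<^sup>+x. V x \<partial>lborel) \<le> ennreal (C1 * \<epsilon> powr (2 * a - 1)) * (\<integral>\<^sup>+\<xi>. ennreal ((cmod (H \<xi>))\<^sup>2) \<partial>lborel))"
    using high_frequency_maximal[OF L] by blast
  obtain C2 where C2: "C2 \<ge> 0" and lo: "\<And>h x t \<sigma> \<epsilon>. \<lbrakk>h \<in> borel_measurable borel; t > 0; \<epsilon> > 0; \<epsilon> \<le> 1; \<epsilon> * t \<le> \<sigma>\<rbrakk> \<Longrightarrow>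
    (\<integral>\<^sup>+y. (\<integral>\<^sup>+v. h v * ennreal (gauss ((x - t *\<^sub>R y - v) /\<^sub>R \<sigma>) / \<sigma> ^ DIM('a)) \<partial>lborel) \<partial>\<mu>)
      \<le> ennreal (C2 * \<epsilon> powr (b - DIM('a))) * hl_maximal h x"
    by (rule low_frequency_bound) blast
  \<comment> \<open>2 ^ L bounds the sum of the binomial coefficients. Adding 1 to \<open>C2\<close>
    keeps \<open>B\<close>, and with it \<open>K\<close>, positive, since \<open>\<beta>\<close>
    divides by \<open>K\<close>.\<close>
  define B where "B = 2 ^ L * (C2 + 1)"
  have B0: "B > 0" using C2 by (simp add: B_def add_nonneg_pos)
  define hc where "hc = hl_const TYPE('a)"
  have hc0: "hc \<ge> 0" by (simp add: hc_def)
  define C where "C = 2 * hc * B + 4 * C1"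
  have C0: "C \<ge> 0" using hc0 B0 C1 by (simp add: C_def)
  have main: "\<exists>W\<in>sets borel. (\<forall>x t. 0 < t \<longrightarrow> \<alpha> < avg U \<eta> t x \<longrightarrow> x \<in> W) \<and>
      emeasure lborel W \<le> ennreal (C * (\<epsilon> powr (b - DIM('a)) / \<alpha> + \<epsilon> powr (2 * a - 1) / \<alpha>\<^sup>2)) * emeasure lborel U"
    if U [measurable]: "U \<in> sets borel" and Uf: "emeasure lborel U < \<infinity>" and e: "0 < \<epsilon>" "\<epsilon> \<le> 1"
      and al: "0 < \<alpha>" and eta: "0 < \<eta>" for U \<epsilon> \<alpha> \<eta>
  proof -
    note UU = U Uf
    let ?H = "\<lambda>\<xi>. Uhat U \<xi> * of_real (gauss (\<eta> *\<^sub>R \<xi>))"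
    let ?d = "DIM('a)"
    define E where "E T x = (\<integral>\<xi>. ?H \<xi> * (nuhat (T *\<^sub>R \<xi>) *
        of_real ((1 - exp (- (pi * \<epsilon>\<^sup>2 * T\<^sup>2 * (norm \<xi>)\<^sup>2))) ^ L)) * wave x \<xi> \<partial>lborel)" for T x
    have "\<exists>V\<in>borel_measurable borel. (\<forall>T>0. \<forall>x. ennreal ((cmod (E T x))\<^sup>2) \<le> V x) \<and>
      (\<integral>\<^sup>+x. V x \<partial>lborel) \<le> ennreal (C1 * \<epsilon> powr (2 * a - 1)) * (\<integral>\<^sup>+\<xi>. ennreal ((cmod (?H \<xi>))\<^sup>2) \<partial>lborel)"
      unfolding E_def by (rule hi[rule_format, OF e admissible_Uhat[OF UU eta]])
    then obtain V where V [measurable]: "V \<in> borel_measurable borel"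
      and EV: "\<And>T x. T > 0 \<Longrightarrow> ennreal ((cmod (E T x))\<^sup>2) \<le> V x"
      and Vint: "(\<integral>\<^sup>+x. V x \<partial>lborel) \<le> ennreal (C1 * \<epsilon> powr (2 * a - 1)) * (\<integral>\<^sup>+\<xi>. ennreal ((cmod (?H \<xi>))\<^sup>2) \<partial>lborel)"
      by blast
    \<comment> \<open>The Gaussian factor is at most 1, which removes \<eta> from the L^2
      bound.\<close>
    have "(\<integral>\<^sup>+\<xi>. ennreal ((cmod (?H \<xi>))\<^sup>2) \<partial>lborel) \<le> (\<integral>\<^sup>+\<xi>. ennreal ((cmod (Uhat U \<xi>))\<^sup>2) \<partial>lborel)"
    proof (intro nn_integral_mono ennreal_leI power_mono)
      fix \<xi>
      have "cmod (?H \<xi>) = cmod (Uhat U \<xi>) * gauss (\<eta> *\<^sub>R \<xi>)" by (simp add: norm_mult)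
      also have "\<dots> \<le> cmod (Uhat U \<xi>) * 1" by (intro mult_left_mono) auto
      finally show "cmod (?H \<xi>) \<le> cmod (Uhat U \<xi>)" by simp
    qed auto
    also have "\<dots> \<le> emeasure lborel U" by (rule Uhat_L2[OF UU])
    finally have "ennreal (C1 * \<epsilon> powr (2 * a - 1)) * (\<integral>\<^sup>+\<xi>. ennreal ((cmod (?H \<xi>))\<^sup>2) \<partial>lborel)
      \<le> ennreal (C1 * \<epsilon> powr (2 * a - 1)) * emeasure lborel U"
      by (intro mult_left_mono) auto
    with Vint have Vint': "(\<integral>\<^sup>+x. V x \<partial>lborel) \<le> ennreal (C1 * \<epsilon> powr (2 * a - 1)) * emeasure lborel U"
      by (rule order_trans)
    define K where "K = B * \<epsilon> powr (b - ?d)"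
    have K0: "K > 0" using B0 e by (simp add: K_def)
    have pt: "ennreal (avg U \<eta> t x) \<le> ennreal K * hl_maximal (indicator U) x + ennreal (cmod (E t x))" if t: "t > 0" for t x
    proof -
      define \<sigma> where "\<sigma> k = sqrt (\<eta>\<^sup>2 + real k * (\<epsilon> * t)\<^sup>2)" for k
      have s0: "\<sigma> k > 0" for k using eta by (simp add: \<sigma>_def add_pos_nonneg)
      have sk: "\<epsilon> * t \<le> \<sigma> k" if "k \<ge> 1" for k
      proof -
        have "1 * (\<epsilon> * t)\<^sup>2 \<le> real k * (\<epsilon> * t)\<^sup>2" using that by (intro mult_right_mono) auto
        then have "(\<epsilon> * t)\<^sup>2 \<le> \<eta>\<^sup>2 + real k * (\<epsilon> * t)\<^sup>2" by (simp add: add_increasing)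
        then have "sqrt ((\<epsilon> * t)\<^sup>2) \<le> \<sigma> k" unfolding \<sigma>_def by (rule real_sqrt_le_mono)
        then show ?thesis using e t by simp
      qed
      have ak: "ennreal (avg U (\<sigma> k) t x) \<le> ennreal (C2 * \<epsilon> powr (b - ?d)) * hl_maximal (indicator U) x" if "k \<ge> 1" for k
      proof -
        \<comment> \<open>The Gaussian weight, at most 1, is dropped here, because the low frequency
          bound is about \<mu> itself.\<close>
        have "ennreal (avg U (\<sigma> k) t x) \<le> (\<integral>\<^sup>+y. (\<integral>\<^sup>+v. indicator U v * ennreal (gauss ((x - t *\<^sub>R y - v) /\<^sub>R \<sigma> k) / \<sigma> k ^ ?d) \<partial>lborel) * 1 \<partial>\<mu>)"
          unfolding avg_nn[OF UU s0] by (intro nn_integral_mono mult_left_mono) auto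
        also have "\<dots> \<le> ennreal (C2 * \<epsilon> powr (b - ?d)) * hl_maximal (indicator U) x"
          using lo[OF _ t e sk[OF that], of "indicator U" x] by simp
        finally show ?thesis .
      qed
      have "avg U \<eta> t x = cmod (complex_of_real (avg U \<eta> t x))"
        using avg_nonneg[OF UU eta] by simp
      also have "\<dots> \<le> cmod (\<Sum>k=1..L. of_real (real (L choose k) * (- 1) ^ (k + 1)) * complex_of_real (avg U (\<sigma> k) t x)) + cmod (E t x)"
        unfolding avg_split[OF UU eta L1, of t x \<epsilon>] E_def \<sigma>_def by (rule norm_triangle_ineq)
      also have "cmod (\<Sum>k=1..L. of_real (real (L choose k) * (- 1) ^ (k + 1)) * complex_of_real (avg U (\<sigma> k) t x))
        \<le> (\<Sum>k=1..L. real (L choose k) * avg U (\<sigma> k) t x)"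
        using avg_nonneg[OF UU s0]
        by (intro order_trans[OF norm_sum] sum_mono) (auto simp: norm_mult norm_power abs_mult power_abs)
      finally have "ennreal (avg U \<eta> t x) \<le> ennreal ((\<Sum>k=1..L. real (L choose k) * avg U (\<sigma> k) t x) + cmod (E t x))"
        by (simp add: ennreal_leI)
      also have "\<dots> = (\<Sum>k=1..L. ennreal (real (L choose k)) * ennreal (avg U (\<sigma> k) t x)) + ennreal (cmod (E t x))"
        using avg_nonneg[OF UU s0]
        by (simp add: ennreal_plus sum_nonneg sum_ennreal[symmetric] ennreal_mult)
      also have "(\<Sum>k=1..L. ennreal (real (L choose k)) * ennreal (avg U (\<sigma> k) t x))
        \<le> (\<Sum>k=1..L. ennreal (real (L choose k)) * (ennreal (C2 * \<epsilon> powr (b - ?d)) * hl_maximal (indicator U) x))"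
        by (intro sum_mono mult_left_mono ak) auto
      also have "\<dots> = (\<Sum>k=1..L. ennreal (real (L choose k))) * (ennreal (C2 * \<epsilon> powr (b - ?d)) * hl_maximal (indicator U) x)"
        by (rule sum_distrib_right[symmetric])
      also have "(\<Sum>k=1..L. ennreal (real (L choose k))) \<le> ennreal (2 ^ L)"
      proof -
        have "(\<Sum>k=1..L. real (L choose k)) \<le> (\<Sum>k\<le>L. real (L choose k))"
          by (intro sum_mono2) auto
        also have "\<dots> = 2 ^ L"
          using choose_row_sum[of L] by (metis of_nat_numeral of_nat_power of_nat_sum)
        finally show ?thesis by (simp add: sum_ennreal ennreal_leI)
      qed
      finally have "ennreal (avg U \<eta> t x) \<le> ennreal (2 ^ L) * (ennreal (C2 * \<epsilon> powr (b - ?d)) * hl_maximal (indicator U) x) + ennreal (cmod (E t x))"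
        by (simp add: mult_right_mono add_right_mono)
      also have "\<dots> = ennreal (2 ^ L * (C2 * \<epsilon> powr (b - ?d))) * hl_maximal (indicator U) x + ennreal (cmod (E t x))"
        using C2 by (simp add: mult.assoc[symmetric] ennreal_mult'[symmetric])
      also have "\<dots> \<le> ennreal K * hl_maximal (indicator U) x + ennreal (cmod (E t x))"
        using e by (intro add_right_mono mult_right_mono ennreal_leI) (auto simp: K_def B_def)
      finally show ?thesis .
    qed
    define \<beta> where "\<beta> = \<alpha> / (2 * K)"
    have b0: "\<beta> > 0" using al K0 by (simp add: \<beta>_def)
    obtain W1 where W1 [measurable]: "W1 \<in> sets borel" and W1s: "{x. hl_maximal (indicator U) x > ennreal \<beta>} \<subseteq> W1"
      and W1m: "emeasure lborel W1 \<le> ennreal (hc / \<beta>) * (\<integral>\<^sup>+y. indicator U y \<partial>lborel)"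
      unfolding hc_def by (rule hl_maximal_weak_type[of "indicator U", OF _ b0]) auto
    define W2 where "W2 = {x. V x \<ge> ennreal (\<alpha>\<^sup>2 / 4)}"
    have W2 [measurable]: "W2 \<in> sets borel" unfolding W2_def by measurable
    have cover: "x \<in> W1 \<union> W2" if t: "0 < t" and gt: "\<alpha> < avg U \<eta> t x" for x t
    proof (rule ccontr)
      assume "x \<notin> W1 \<union> W2"
      then have 1: "hl_maximal (indicator U) x \<le> ennreal \<beta>" and 2: "V x < ennreal (\<alpha>\<^sup>2 / 4)"
        using W1s by (auto simp: W2_def not_le not_less[symmetric])
      have "ennreal ((cmod (E t x))\<^sup>2) < ennreal (\<alpha>\<^sup>2 / 4)"
        using EV[OF t, of x] 2 by (rule order_le_less_trans)
      then have "(cmod (E t x))\<^sup>2 < (\<alpha> / 2)\<^sup>2" using al by (simp add: ennreal_less_iff power_divide)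
      then have 3: "cmod (E t x) < \<alpha> / 2" by (rule power_less_imp_less_base) (use al in simp)
      have "ennreal (avg U \<eta> t x) \<le> ennreal K * ennreal \<beta> + ennreal (cmod (E t x))"
        using pt[OF t, of x] mult_left_mono[OF 1, of "ennreal K"] by (meson add_right_mono order_trans zero_le)
      also have "\<dots> = ennreal (\<alpha> / 2 + cmod (E t x))"
        using K0 b0 al by (simp add: ennreal_mult'[symmetric] ennreal_plus[symmetric] \<beta>_def del: ennreal_plus)
      finally have "avg U \<eta> t x \<le> \<alpha> / 2 + cmod (E t x)"
        using al by (simp add: ennreal_le_iff del: ennreal_plus)
      then show False using gt 3 by linarith
    qed
    have "emeasure lborel W2 \<le> ennreal (4 / \<alpha>\<^sup>2) * (\<integral>\<^sup>+x. V x \<partial>lborel)"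
    proof -
      have "W2 = {x\<in>space lborel. 1 \<le> ennreal (4 / \<alpha>\<^sup>2) * V x} \<inter> UNIV"
      proof -
        have "ennreal (\<alpha>\<^sup>2 / 4) \<le> V x \<longleftrightarrow> 1 \<le> ennreal (4 / \<alpha>\<^sup>2) * V x" for x
        proof
          assume "ennreal (\<alpha>\<^sup>2 / 4) \<le> V x"
          then have "ennreal (4 / \<alpha>\<^sup>2) * ennreal (\<alpha>\<^sup>2 / 4) \<le> ennreal (4 / \<alpha>\<^sup>2) * V x" by (intro mult_left_mono) auto
          then show "1 \<le> ennreal (4 / \<alpha>\<^sup>2) * V x" using al by (simp add: ennreal_mult[symmetric])
        next
          assume "1 \<le> ennreal (4 / \<alpha>\<^sup>2) * V x"
          then have "ennreal (\<alpha>\<^sup>2 / 4) * 1 \<le> ennreal (\<alpha>\<^sup>2 / 4) * (ennreal (4 / \<alpha>\<^sup>2) * V x)" by (intro mult_left_mono) auto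
          then show "ennreal (\<alpha>\<^sup>2 / 4) \<le> V x" using al by (simp add: mult.assoc[symmetric] ennreal_mult[symmetric])
        qed
        then show ?thesis by (simp add: W2_def)
      qed
      then have "emeasure lborel W2 \<le> ennreal (4 / \<alpha>\<^sup>2) * (\<integral>\<^sup>+x. V x * indicator UNIV x \<partial>lborel)"
        using nn_integral_Markov_inequality[of V UNIV lborel "ennreal (4 / \<alpha>\<^sup>2)"] by simp
      then show ?thesis by simp
    qed
    also have "\<dots> \<le> ennreal (4 / \<alpha>\<^sup>2) * (ennreal (C1 * \<epsilon> powr (2 * a - 1)) * emeasure lborel U)"
      by (intro mult_left_mono Vint') auto
    finally have W2m: "emeasure lborel W2 \<le> ennreal (4 / \<alpha>\<^sup>2 * (C1 * \<epsilon> powr (2 * a - 1))) * emeasure lborel U"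
      using C1 by (simp add: mult.assoc[symmetric] ennreal_mult'[symmetric])
    have "emeasure lborel (W1 \<union> W2) \<le> emeasure lborel W1 + emeasure lborel W2"
      by (intro emeasure_subadditive) auto
    also have "\<dots> \<le> ennreal (hc / \<beta>) * emeasure lborel U + ennreal (4 / \<alpha>\<^sup>2 * (C1 * \<epsilon> powr (2 * a - 1))) * emeasure lborel U"
      using W1m W2m by (intro add_mono) auto
    also have "\<dots> = ennreal (hc / \<beta> + 4 / \<alpha>\<^sup>2 * (C1 * \<epsilon> powr (2 * a - 1))) * emeasure lborel U"
      using hc0 b0 C1 by (subst ennreal_plus) (auto simp: distrib_right)
    also have "\<dots> \<le> ennreal (C * (\<epsilon> powr (b - ?d) / \<alpha> + \<epsilon> powr (2 * a - 1) / \<alpha>\<^sup>2)) * emeasure lborel U"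
    proof (intro mult_right_mono ennreal_leI)
      have "hc / \<beta> = 2 * hc * B * (\<epsilon> powr (b - ?d) / \<alpha>)" by (simp add: \<beta>_def K_def)
      also have "\<dots> \<le> C * (\<epsilon> powr (b - ?d) / \<alpha>)" using C1 al by (intro mult_right_mono) (auto simp: C_def)
      finally have 1: "hc / \<beta> \<le> C * (\<epsilon> powr (b - ?d) / \<alpha>)" .
      have "4 / \<alpha>\<^sup>2 * (C1 * \<epsilon> powr (2 * a - 1)) = 4 * C1 * (\<epsilon> powr (2 * a - 1) / \<alpha>\<^sup>2)" by simp
      also have "\<dots> \<le> C * (\<epsilon> powr (2 * a - 1) / \<alpha>\<^sup>2)" using hc0 B0 by (intro mult_right_mono) (auto simp: C_def)
      finally show "hc / \<beta> + 4 / \<alpha>\<^sup>2 * (C1 * \<epsilon> powr (2 * a - 1)) \<le> C * (\<epsilon> powr (b - ?d) / \<alpha> + \<epsilon> powr (2 * a - 1) / \<alpha>\<^sup>2)"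
        using 1 by (simp only: distrib_left add_mono)
    qed auto
    finally show ?thesis using cover by (intro bexI[of _ "W1 \<union> W2"]) auto
  qed
  show ?thesis
    using main C0 by blast
qed

end

text \<open>A supremum of nonnegative integrals, with the dilation moved into the argument. It is
  defined for every h and x, so it can majorise \<open>maximal_function\<close> before integrability
  is known.\<close>

definition positive_maximal :: "'a::euclidean_space measure \<Rightarrow> ('a \<Rightarrow> ennreal) \<Rightarrow> 'a \<Rightarrow> ennreal" where
  "positive_maximal \<mu> h x = (SUP t\<in>{0<..}. \<integral>\<^sup>+y. h (x - t *\<^sub>R y) \<partial>\<mu>)"

text \<open>Lower semicontinuity, the property of open sets on which the applications of Fatou's
  lemma rest.\<close>

lemma indicator_open_le_liminf:
  fixes U :: "'a::topological_space set"
  assumes "open U" "X \<longlonglongrightarrow> x"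
  shows "(indicator U x :: ennreal) \<le> liminf (\<lambda>n. indicator U (X n))"
proof (cases "x \<in> U")
  case True
  then have "\<forall>\<^sub>F n in sequentially. X n \<in> U"
    using assms topological_tendstoD by blast
  then have "\<forall>\<^sub>F n in sequentially. (1::ennreal) \<le> indicator U (X n)"
    by eventually_elim simp
  then have "1 \<le> liminf (\<lambda>n. indicator U (X n) :: ennreal)"
    by (rule Liminf_bounded)
  then show ?thesis using True by simp
qed simp

text \<open>The points that lie in W k for all large k form an increasing union of sets, each
  contained in some W n.\<close>

lemma emeasure_eventually_le:
  fixes W :: "nat \<Rightarrow> 'a set"
  assumes W: "\<And>n. W n \<in> sets M" and le: "\<And>n. emeasure M (W n) \<le> B"
  shows "emeasure M (\<Union>n. \<Inter>k\<in>{n..}. W k) \<le> B" "(\<Union>n. \<Inter>k\<in>{n..}. W k) \<in> sets M"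
proof -
  have s: "(\<Inter>k\<in>{n..}. W k) \<in> sets M" for n :: nat
    using W by (intro sets.countable_INT') auto
  then show "(\<Union>n. \<Inter>k\<in>{n..}. W k) \<in> sets M" by auto
  have "emeasure M (\<Union>n. \<Inter>k\<in>{n..}. W k) = (SUP n. emeasure M (\<Inter>k\<in>{n..}. W k))"
    using s by (intro SUP_emeasure_incseq[symmetric]) (auto simp: incseq_def)
  also have "\<dots> \<le> B"
  proof (rule SUP_least)
    fix n
    have "emeasure M (\<Inter>k\<in>{n..}. W k) \<le> emeasure M (W n)" using W by (intro emeasure_mono) auto
    then show "emeasure M (\<Inter>k\<in>{n..}. W k) \<le> B" using le[of n] by (rule order_trans)
  qed
  finally show "emeasure M (\<Union>n. \<Inter>k\<in>{n..}. W k) \<le> B" .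
qed

section \<open>Removal of the smoothing and of the Gaussian weight\<close>

context decaying_measure
begin

lemma positive_maximal_le_mass:
  assumes "\<And>z. h z \<le> c"
  shows "positive_maximal \<mu> h x \<le> c * ennreal mass"
  unfolding positive_maximal_def
proof (rule SUP_least)
  fix t :: real
  have "(\<integral>\<^sup>+y. h (x - t *\<^sub>R y) \<partial>\<mu>) \<le> (\<integral>\<^sup>+y. c \<partial>\<mu>)"
    using assms by (intro nn_integral_mono) auto
  then show "(\<integral>\<^sup>+y. h (x - t *\<^sub>R y) \<partial>\<mu>) \<le> c * ennreal mass"
    by (simp add: emeasure_mu_UNIV)
qed

text \<open>The smoothing scale tends to 0 along 1 / (n + 1). Since U is open, its indicator is at
  most the lower limit of its smoothings at every point, and by Fatou's lemma this passes to the
  averages; a large average therefore puts x into all but finitely many of the sets W n. For a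
  general Borel set the pointwise inequality could fail on a null set that the dilates
  charge.\<close>

lemma weak_type_open_gauss:
  "\<exists>C\<ge>0. \<forall>U. \<forall>\<epsilon> \<alpha>. open U \<longrightarrow> emeasure lborel U < \<infinity> \<longrightarrow> 0 < \<epsilon> \<longrightarrow> \<epsilon> \<le> 1 \<longrightarrow> 0 < \<alpha> \<longrightarrow>
    (\<exists>W\<in>sets borel. (\<forall>x t. 0 < t \<longrightarrow> ennreal \<alpha> < (\<integral>\<^sup>+y. indicator U (x - t *\<^sub>R y) * ennreal (gauss y) \<partial>\<mu>) \<longrightarrow> x \<in> W) \<and>
      emeasure lborel W \<le> ennreal (C * (\<epsilon> powr (b - DIM('a)) / \<alpha> + \<epsilon> powr (2 * a - 1) / \<alpha>\<^sup>2)) * emeasure lborel U)"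
proof -
  obtain C where C: "C \<ge> 0" and smooth: "\<forall>U\<in>sets borel. \<forall>\<epsilon> \<alpha> \<eta>. emeasure lborel U < \<infinity> \<longrightarrow> 0 < \<epsilon> \<longrightarrow> \<epsilon> \<le> 1 \<longrightarrow> 0 < \<alpha> \<longrightarrow> 0 < \<eta> \<longrightarrow>
    (\<exists>W\<in>sets borel. (\<forall>x t. 0 < t \<longrightarrow> \<alpha> < avg U \<eta> t x \<longrightarrow> x \<in> W) \<and>
      emeasure lborel W \<le> ennreal (C * (\<epsilon> powr (b - DIM('a)) / \<alpha> + \<epsilon> powr (2 * a - 1) / \<alpha>\<^sup>2)) * emeasure lborel U)"
    using weak_type_smooth by blast
  have main: "\<exists>W\<in>sets borel. (\<forall>x t. 0 < t \<longrightarrow> ennreal \<alpha> < (\<integral>\<^sup>+y. indicator U (x - t *\<^sub>R y) * ennreal (gauss y) \<partial>\<mu>) \<longrightarrow> x \<in> W) \<and>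
      emeasure lborel W \<le> ennreal (C * (\<epsilon> powr (b - DIM('a)) / \<alpha> + \<epsilon> powr (2 * a - 1) / \<alpha>\<^sup>2)) * emeasure lborel U"
    if U: "open U" and Uf: "emeasure lborel U < \<infinity>" and e: "0 < \<epsilon>" "\<epsilon> \<le> 1" and al: "0 < \<alpha>" for U \<epsilon> \<alpha>
  proof -
    have [measurable]: "U \<in> sets borel" using U by simp
    define B where "B = ennreal (C * (\<epsilon> powr (b - DIM('a)) / \<alpha> + \<epsilon> powr (2 * a - 1) / \<alpha>\<^sup>2)) * emeasure lborel U"
    define \<eta> where "\<eta> n = 1 / (real n + 1)" for n :: nat
    have e0: "\<eta> n > 0" for n by (simp add: \<eta>_def)
    have elim: "\<eta> \<longlonglongrightarrow> 0"
      unfolding \<eta>_def using LIMSEQ_inverse_real_of_nat by (simp add: inverse_eq_divide add.commute)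
    have "\<forall>n. \<exists>W\<in>sets borel. (\<forall>x t. 0 < t \<longrightarrow> \<alpha> < avg U (\<eta> n) t x \<longrightarrow> x \<in> W) \<and> emeasure lborel W \<le> B"
    proof
      fix n
      show "\<exists>W\<in>sets borel. (\<forall>x t. 0 < t \<longrightarrow> \<alpha> < avg U (\<eta> n) t x \<longrightarrow> x \<in> W) \<and> emeasure lborel W \<le> B"
        unfolding B_def by (rule smooth[rule_format, OF _ Uf e al e0[of n]]) simp
    qed
    then obtain W where W: "\<And>n. W n \<in> sets borel" "\<And>n x t. 0 < t \<Longrightarrow> \<alpha> < avg U (\<eta> n) t x \<Longrightarrow> x \<in> W n"
      "\<And>n. emeasure lborel (W n) \<le> B"
      by metis
    let ?W = "\<Union>n. \<Inter>k\<in>{n..}. W k"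
    define p where "p n z = (\<integral>\<^sup>+v. indicator U v * ennreal (gauss ((z - v) /\<^sub>R \<eta> n) / \<eta> n ^ DIM('a)) \<partial>lborel)" for n and z :: 'a
    have [measurable]: "p n \<in> borel_measurable borel" for n unfolding p_def by measurable
    \<comment> \<open>After the substitution v = z - \<eta> w the Gaussian no longer depends on n,
      so the limit acts on U alone.\<close>
    have p_eq: "p n z = (\<integral>\<^sup>+w. indicator U (z - \<eta> n *\<^sub>R w) * ennreal (gauss w) \<partial>lborel)" for n z
    proof -
      have "p n z = ennreal (\<bar>- \<eta> n\<bar> ^ DIM('a)) * (\<integral>\<^sup>+w. indicator U (z + (- \<eta> n) *\<^sub>R w) * ennreal (gauss ((z - (z + (- \<eta> n) *\<^sub>R w)) /\<^sub>R \<eta> n) / \<eta> n ^ DIM('a)) \<partial>lborel)"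
        unfolding p_def using e0[of n] by (intro nn_integral_lborel_affine) auto
      also have "\<dots> = (\<integral>\<^sup>+w. ennreal (\<bar>- \<eta> n\<bar> ^ DIM('a)) * (indicator U (z + (- \<eta> n) *\<^sub>R w) * ennreal (gauss ((z - (z + (- \<eta> n) *\<^sub>R w)) /\<^sub>R \<eta> n) / \<eta> n ^ DIM('a))) \<partial>lborel)"
        by (intro nn_integral_cmult[symmetric]) measurable
      also have "\<dots> = (\<integral>\<^sup>+w. indicator U (z - \<eta> n *\<^sub>R w) * ennreal (gauss w) \<partial>lborel)"
        using e0[of n] by (intro nn_integral_cong) (auto simp: ennreal_mult'[symmetric] split: split_indicator)
      finally show ?thesis .
    qed
    have p_lim: "indicator U z \<le> liminf (\<lambda>n. p n z)" for z
    proof -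
      have "indicator U z = (\<integral>\<^sup>+w. indicator U z * ennreal (gauss (w::'a)) \<partial>lborel)"
        by (subst nn_integral_cmult) auto
      also have "\<dots> \<le> (\<integral>\<^sup>+w. liminf (\<lambda>n. indicator U (z - \<eta> n *\<^sub>R w) * ennreal (gauss w)) \<partial>lborel)"
      proof (rule nn_integral_mono)
        fix w :: 'a
        have "(\<lambda>n. z - \<eta> n *\<^sub>R w) \<longlonglongrightarrow> z - 0 *\<^sub>R w" by (intro tendsto_intros elim)
        then have lim: "(\<lambda>n. z - \<eta> n *\<^sub>R w) \<longlonglongrightarrow> z" by simp
        show "indicator U z * ennreal (gauss w) \<le> liminf (\<lambda>n. indicator U (z - \<eta> n *\<^sub>R w) * ennreal (gauss w))"
        proof (cases "z \<in> U")
          case True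
          then have "\<forall>\<^sub>F n in sequentially. z - \<eta> n *\<^sub>R w \<in> U"
            using U lim topological_tendstoD by blast
          then have "\<forall>\<^sub>F n in sequentially. ennreal (gauss w) \<le> indicator U (z - \<eta> n *\<^sub>R w) * ennreal (gauss w)"
            by eventually_elim simp
          then have "ennreal (gauss w) \<le> liminf (\<lambda>n. indicator U (z - \<eta> n *\<^sub>R w) * ennreal (gauss w))"
            by (rule Liminf_bounded)
          then show ?thesis using True by simp
        qed simp
      qed
      also have "\<dots> \<le> liminf (\<lambda>n. p n z)"
        unfolding p_eq by (intro nn_integral_liminf) measurable
      finally show ?thesis .
    qed
    have "x \<in> ?W" if t: "0 < t" and gt: "ennreal \<alpha> < (\<integral>\<^sup>+y. indicator U (x - t *\<^sub>R y) * ennreal (gauss y) \<partial>\<mu>)" for x t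
    proof -
      let ?\<nu> = "density \<mu> (\<lambda>y. ennreal (gauss y))"
      have dens: "(\<integral>\<^sup>+y. f y \<partial>?\<nu>) = (\<integral>\<^sup>+y. f y * ennreal (gauss y) \<partial>\<mu>)" if "f \<in> borel_measurable borel" for f :: "'a \<Rightarrow> ennreal"
        using that by (subst nn_integral_density) (auto simp: mult.commute cong: measurable_cong_sets)
      have "(\<integral>\<^sup>+y. indicator U (x - t *\<^sub>R y) * ennreal (gauss y) \<partial>\<mu>) = (\<integral>\<^sup>+y. indicator U (x - t *\<^sub>R y) \<partial>?\<nu>)"
        by (rule dens[symmetric]) measurable
      also have "\<dots> \<le> (\<integral>\<^sup>+y. liminf (\<lambda>n. p n (x - t *\<^sub>R y)) \<partial>?\<nu>)"
        by (intro nn_integral_mono p_lim)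
      also have "\<dots> \<le> liminf (\<lambda>n. \<integral>\<^sup>+y. p n (x - t *\<^sub>R y) \<partial>?\<nu>)"
        by (intro nn_integral_liminf) measurable
      also have "\<dots> = liminf (\<lambda>n. \<integral>\<^sup>+y. p n (x - t *\<^sub>R y) * ennreal (gauss y) \<partial>\<mu>)"
        by (subst dens) measurable
      also have "\<dots> = liminf (\<lambda>n. ennreal (avg U (\<eta> n) t x))"
        unfolding p_def using Uf e0 by (simp add: avg_nn)
      finally have "ennreal \<alpha> < liminf (\<lambda>n. ennreal (avg U (\<eta> n) t x))"
        using gt by (rule order_less_le_trans[rotated])
      then have "\<forall>\<^sub>F n in sequentially. ennreal \<alpha> < ennreal (avg U (\<eta> n) t x)"
        by (rule less_LiminfD)
      then have "\<forall>\<^sub>F n in sequentially. x \<in> W n"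
        using al by (elim eventually_mono) (intro W(2)[OF t], simp add: ennreal_less_iff)
      then show "x \<in> ?W" by (auto simp: eventually_sequentially)
    qed
    moreover have "emeasure lborel ?W \<le> B"
      using W by (intro emeasure_eventually_le) auto
    moreover have "?W \<in> sets borel" using emeasure_eventually_le(2)[of W lborel] W by auto
    ultimately show ?thesis unfolding B_def by (intro bexI[of _ ?W]) auto
  qed
  show ?thesis using main C by blast
qed

definition p_crit :: real where "p_crit = critical_exponent DIM('a) a b"

text \<open>The first form is the exponent that the low frequency term produces after the choice of
  \<epsilon>, the second that of the high frequency term; their agreement is the balance behind the
  critical exponent.\<close>

lemma p_crit_eq: "p_crit = 1 + (DIM('a) - b) / (DIM('a) - b + 2 * a - 1)"
  "p_crit = 2 - (2 * a - 1) / (DIM('a) - b + 2 * a - 1)"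
proof -
  have "DIM('a) - b + 2 * a - 1 \<noteq> 0" using a_gt b_le by linarith
  then show "p_crit = 1 + (DIM('a) - b) / (DIM('a) - b + 2 * a - 1)"
    "p_crit = 2 - (2 * a - 1) / (DIM('a) - b + 2 * a - 1)"
    by (simp_all add: p_crit_def critical_exponent_def field_simps)
qed

lemma p_crit_ge_1: "p_crit \<ge> 1"
  unfolding p_crit_eq(1) using a_gt b_le by (auto intro!: divide_nonneg_nonneg)

text \<open>For fixed t the average is lower semicontinuous in x by Fatou's lemma. The union over
  all t > 0 is then open although uncountable, which settles measurability of the maximal function
  of an open set.\<close>

lemma open_superlevel:
  assumes U: "open U"
  shows "open {x. positive_maximal \<mu> (indicator U) x > \<alpha>}"
proof -
  have [measurable]: "U \<in> sets borel" using U by simp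
  have o: "open {x. (\<integral>\<^sup>+y. indicator U (x - t *\<^sub>R y) \<partial>\<mu>) > \<alpha>}" for t
  proof -
    have "closed {x. (\<integral>\<^sup>+y. indicator U (x - t *\<^sub>R y) \<partial>\<mu>) \<le> \<alpha>}"
      unfolding closed_sequential_limits
    proof (intro allI impI)
      fix X x assume "(\<forall>n. X n \<in> {x. (\<integral>\<^sup>+y. indicator U (x - t *\<^sub>R y) \<partial>\<mu>) \<le> \<alpha>}) \<and> X \<longlonglongrightarrow> x"
      then have le: "\<And>n. (\<integral>\<^sup>+y. indicator U (X n - t *\<^sub>R y) \<partial>\<mu>) \<le> \<alpha>" and lim: "X \<longlonglongrightarrow> x" by auto
      have "(\<integral>\<^sup>+y. indicator U (x - t *\<^sub>R y) \<partial>\<mu>) \<le> (\<integral>\<^sup>+y. liminf (\<lambda>n. indicator U (X n - t *\<^sub>R y)) \<partial>\<mu>)"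
        by (intro nn_integral_mono indicator_open_le_liminf U tendsto_intros lim)
      also have "\<dots> \<le> liminf (\<lambda>n. \<integral>\<^sup>+y. indicator U (X n - t *\<^sub>R y) \<partial>\<mu>)"
        by (intro nn_integral_liminf) measurable
      also have "\<dots> \<le> liminf (\<lambda>n::nat. \<alpha>)"
        using le by (intro Liminf_mono) auto
      finally show "x \<in> {x. (\<integral>\<^sup>+y. indicator U (x - t *\<^sub>R y) \<partial>\<mu>) \<le> \<alpha>}" by (simp add: Liminf_const)
    qed
    moreover have "{x. (\<integral>\<^sup>+y. indicator U (x - t *\<^sub>R y) \<partial>\<mu>) > \<alpha>} = - {x. (\<integral>\<^sup>+y. indicator U (x - t *\<^sub>R y) \<partial>\<mu>) \<le> \<alpha>}"
      by auto
    ultimately show ?thesis by (simp add: open_closed)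
  qed
  have "{x. positive_maximal \<mu> (indicator U) x > \<alpha>} = (\<Union>t\<in>{0<..}. {x. (\<integral>\<^sup>+y. indicator U (x - t *\<^sub>R y) \<partial>\<mu>) > \<alpha>})"
    by (auto simp: positive_maximal_def less_SUP_iff)
  then show ?thesis using o by auto
qed

lemma positive_maximal_indicator_measurable:
  assumes "open U"
  shows "positive_maximal \<mu> (indicator U) \<in> borel_measurable borel"
  by (rule borel_measurableI_greater) (use open_superlevel[OF assms] in \<open>auto intro: borel_open\<close>)

text \<open>With \<epsilon>^D proportional to \<alpha>, where D = d - b + 2a - 1, both terms of the
  weak type bound become multiples of \<alpha>^(-p). The proportionality factor 1 / mass gives
  \<epsilon> \<le> 1 in the whole range that matters, since the maximal function of an indicator
  never exceeds the mass.\<close>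

lemma restricted_weak_type:
  "\<exists>C\<ge>0. \<forall>U \<alpha>. open U \<longrightarrow> 0 < \<alpha> \<longrightarrow>
    emeasure lborel {x. positive_maximal \<mu> (indicator U) x > ennreal \<alpha>} \<le> ennreal (C * \<alpha> powr (- p_crit)) * emeasure lborel U"
proof -
  obtain C where C: "C \<ge> 0" and op: "\<forall>U. \<forall>\<epsilon> \<alpha>. open U \<longrightarrow> emeasure lborel U < \<infinity> \<longrightarrow> 0 < \<epsilon> \<longrightarrow> \<epsilon> \<le> 1 \<longrightarrow> 0 < \<alpha> \<longrightarrow>
    (\<exists>W\<in>sets borel. (\<forall>x t. 0 < t \<longrightarrow> ennreal \<alpha> < (\<integral>\<^sup>+y. indicator U (x - t *\<^sub>R y) * ennreal (gauss y) \<partial>\<mu>) \<longrightarrow> x \<in> W) \<and>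
      emeasure lborel W \<le> ennreal (C * (\<epsilon> powr (b - DIM('a)) / \<alpha> + \<epsilon> powr (2 * a - 1) / \<alpha>\<^sup>2)) * emeasure lborel U)"
    using weak_type_open_gauss by blast
  \<comment> \<open>Lower bound of the Gaussian on the support; replacing the weighted measure by
    \<mu> costs the level g \<alpha> instead of \<alpha>.\<close>
  define g where "g = exp (- pi * R\<^sup>2)"
  have g: "0 < g" by (simp add: g_def)
  define D where "D = DIM('a) - b + 2 * a - 1"
  have D0: "D > 0" using a_gt b_le by (simp add: D_def)
  \<comment> \<open>The summand 1 makes \<open>C'\<close> positive, which the case of infinite
    measure of U relies on.\<close>
  define C' where "C' = C * (mass powr ((DIM('a) - b) / D) / g + mass powr (- (2 * a - 1) / D) / g\<^sup>2) + 1"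
  have C'0: "C' > 0" using C g by (auto simp: C'_def intro!: add_nonneg_pos mult_nonneg_nonneg add_nonneg_nonneg divide_nonneg_nonneg)
  have main: "emeasure lborel {x. positive_maximal \<mu> (indicator U) x > ennreal \<alpha>} \<le> ennreal (C' * \<alpha> powr (- p_crit)) * emeasure lborel U"
    if U: "open U" and al: "0 < \<alpha>" for U \<alpha>
  proof (cases "\<alpha> < mass")
    case False
    have "positive_maximal \<mu> (indicator U) x \<le> ennreal \<alpha>" for x
    proof -
      have "positive_maximal \<mu> (indicator U) x \<le> 1 * ennreal mass"
        by (rule positive_maximal_le_mass) (simp add: indicator_def)
      also have "\<dots> \<le> ennreal \<alpha>" using False by (simp add: ennreal_leI)
      finally show ?thesis .
    qed
    then have "{x. positive_maximal \<mu> (indicator U) x > ennreal \<alpha>} = {}" by (auto simp: not_less)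
    then show ?thesis by simp
  next
    case m: True
    show ?thesis
    proof (cases "emeasure lborel U < \<infinity>")
      case False
      then have i: "emeasure lborel U = top" by (metis infinity_ennreal_def less_top)
      show ?thesis using C'0 al by (simp add: i ennreal_mult_top)
    next
      case Uf: True
      have [measurable]: "U \<in> sets borel" using U by simp
      define \<epsilon> where "\<epsilon> = (\<alpha> / mass) powr (1 / D)"
      have r: "0 < \<alpha> / mass" "\<alpha> / mass \<le> 1" using al m by auto
      have e: "0 < \<epsilon>" "\<epsilon> \<le> 1"
        using r D0 by (auto simp: \<epsilon>_def intro!: powr_le1)
      have ga: "0 < g * \<alpha>" using g al by simp
      obtain W where W: "W \<in> sets borel" "\<And>x t. 0 < t \<Longrightarrow> ennreal (g * \<alpha>) < (\<integral>\<^sup>+y. indicator U (x - t *\<^sub>R y) * ennreal (gauss y) \<partial>\<mu>) \<Longrightarrow> x \<in> W"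
        "emeasure lborel W \<le> ennreal (C * (\<epsilon> powr (b - DIM('a)) / (g * \<alpha>) + \<epsilon> powr (2 * a - 1) / (g * \<alpha>)\<^sup>2)) * emeasure lborel U"
        using op[rule_format, OF U Uf e ga] by blast
      have sub: "{x. positive_maximal \<mu> (indicator U) x > ennreal \<alpha>} \<subseteq> W"
      proof
        fix x assume "x \<in> {x. positive_maximal \<mu> (indicator U) x > ennreal \<alpha>}"
        then obtain t where t: "t > 0" and gt: "(\<integral>\<^sup>+y. indicator U (x - t *\<^sub>R y) \<partial>\<mu>) > ennreal \<alpha>"
          by (auto simp: positive_maximal_def less_SUP_iff)
        let ?I = "\<integral>\<^sup>+y. indicator U (x - t *\<^sub>R y) \<partial>\<mu>"
        have "ennreal g * ?I = (\<integral>\<^sup>+y. ennreal g * indicator U (x - t *\<^sub>R y) \<partial>\<mu>)"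
          by (intro nn_integral_cmult[symmetric]) measurable
        also have "\<dots> \<le> (\<integral>\<^sup>+y. indicator U (x - t *\<^sub>R y) * ennreal (gauss y) \<partial>\<mu>)"
        proof (rule nn_integral_mono_AE)
          show "AE y in \<mu>. ennreal g * indicator U (x - t *\<^sub>R y) \<le> indicator U (x - t *\<^sub>R y) * ennreal (gauss y)"
            using AE_support
          proof eventually_elim
            case (elim y)
            have "(norm y)\<^sup>2 \<le> R\<^sup>2" using elim by (intro power_mono) auto
            then have "g \<le> gauss y" by (simp add: g_def gauss_def)
            then show ?case by (auto split: split_indicator intro: ennreal_leI)
          qed
        qed
        finally have le: "ennreal g * ?I \<le> (\<integral>\<^sup>+y. indicator U (x - t *\<^sub>R y) * ennreal (gauss y) \<partial>\<mu>)" .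
        have "ennreal (g * \<alpha>) < (\<integral>\<^sup>+y. indicator U (x - t *\<^sub>R y) * ennreal (gauss y) \<partial>\<mu>)"
        proof (rule ccontr)
          assume "\<not> ?thesis"
          then have "ennreal g * ?I \<le> ennreal (g * \<alpha>)" using le by (simp add: not_less)
          then have "ennreal (1 / g) * (ennreal g * ?I) \<le> ennreal (1 / g) * ennreal (g * \<alpha>)"
            by (intro mult_left_mono) auto
          then have "?I \<le> ennreal \<alpha>"
            using g al by (simp add: mult.assoc[symmetric] ennreal_mult[symmetric])
          with gt show False by simp
        qed
        then show "x \<in> W" by (rule W(2)[OF t])
      qed
      have "emeasure lborel {x. positive_maximal \<mu> (indicator U) x > ennreal \<alpha>} \<le> emeasure lborel W"
        using sub W(1) by (intro emeasure_mono) auto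
      also note W(3)
      also have "ennreal (C * (\<epsilon> powr (b - DIM('a)) / (g * \<alpha>) + \<epsilon> powr (2 * a - 1) / (g * \<alpha>)\<^sup>2)) * emeasure lborel U
        \<le> ennreal (C' * \<alpha> powr (- p_crit)) * emeasure lborel U"
      proof (intro mult_right_mono ennreal_leI)
        have m0: "mass > 0" using m al by simp
        have pd: "(\<alpha> / mass) powr c = mass powr (- c) * \<alpha> powr c" for c
          using al m0 by (subst powr_divide) (auto simp: powr_minus field_simps)
        have 1: "\<epsilon> powr (b - DIM('a)) / (g * \<alpha>) = (mass powr ((DIM('a) - b) / D) / g) * \<alpha> powr (- p_crit)"
        proof -
          have "\<epsilon> powr (b - DIM('a)) = (\<alpha> / mass) powr (- ((DIM('a) - b) / D))"
            unfolding \<epsilon>_def powr_powr by (rule arg_cong[where f="\<lambda>z. (\<alpha> / mass) powr z"]) (simp add: minus_divide_left)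
          also have "\<dots> = mass powr ((DIM('a) - b) / D) * \<alpha> powr (- ((DIM('a) - b) / D))"
            by (simp only: pd minus_minus)
          finally have x: "\<epsilon> powr (b - DIM('a)) = mass powr ((DIM('a) - b) / D) * \<alpha> powr (- ((DIM('a) - b) / D))" .
          have "\<alpha> powr (- p_crit) = \<alpha> powr (- ((DIM('a) - b) / D)) * \<alpha> powr (- 1)"
            unfolding powr_add[symmetric] p_crit_eq(1) D_def by (simp add: algebra_simps)
          also have "\<alpha> powr (- 1) = 1 / \<alpha>" using al by (simp add: powr_minus_divide)
          finally show ?thesis unfolding x by simp
        qed
        have 2: "\<epsilon> powr (2 * a - 1) / (g * \<alpha>)\<^sup>2 = (mass powr (- (2 * a - 1) / D) / g\<^sup>2) * \<alpha> powr (- p_crit)"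
        proof -
          have "\<epsilon> powr (2 * a - 1) = (\<alpha> / mass) powr ((2 * a - 1) / D)"
            unfolding \<epsilon>_def powr_powr by simp
          also have "\<dots> = mass powr (- (2 * a - 1) / D) * \<alpha> powr ((2 * a - 1) / D)"
            by (simp only: pd minus_divide_left)
          finally have x: "\<epsilon> powr (2 * a - 1) = mass powr (- (2 * a - 1) / D) * \<alpha> powr ((2 * a - 1) / D)" .
          have "\<alpha> powr (- p_crit) = \<alpha> powr ((2 * a - 1) / D) * \<alpha> powr (- 2)"
            unfolding powr_add[symmetric] p_crit_eq(2) D_def by simp
          also have "\<alpha> powr (- 2) = 1 / \<alpha>\<^sup>2" using al by (simp add: powr_minus_divide)
          finally show ?thesis unfolding x by (simp add: power_mult_distrib)
        qed
        have "0 \<le> 1 * \<alpha> powr (- p_crit)" by simp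
        then show "C * (\<epsilon> powr (b - DIM('a)) / (g * \<alpha>) + \<epsilon> powr (2 * a - 1) / (g * \<alpha>)\<^sup>2) \<le> C' * \<alpha> powr (- p_crit)"
          unfolding 1 2 C'_def by (simp add: distrib_right distrib_left mult.assoc)
      qed auto
      finally show ?thesis .
    qed
  qed
  show ?thesis using main C'0 by (intro exI[of _ C'] conjI allI impI) auto
qed

end

section \<open>Weak type bounds for sums of indicator functions\<close>

lemma ennpowr_ennreal: "x \<ge> 0 \<Longrightarrow> ennpowr (ennreal x) r = ennreal (x powr r)"
  by (simp add: ennpowr_def)

lemma ennpowr_top [simp]: "ennpowr top r = top"
  by (simp add: ennpowr_def)

lemma ennpowr_0 [simp]: "ennpowr 0 r = 0"
  by (simp add: ennpowr_def)

lemma ennpowr_mono: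
  assumes "u \<le> v" "r \<ge> 0"
  shows "ennpowr u r \<le> ennpowr v r"
proof (cases v)
  case (real y)
  then obtain x where x: "u = ennreal x" "x \<ge> 0"
    using assms by (cases u) (auto simp: top_unique)
  then have "x \<le> y" using assms real by (simp add: ennreal_le_iff)
  then show ?thesis
    using x real assms by (simp add: ennpowr_ennreal ennreal_leI powr_mono2)
qed simp

lemma ennpowr_mult:
  shows "ennpowr (u * v) r = ennpowr u r * ennpowr v r"
proof (cases u)
  case (real x)
  show ?thesis
  proof (cases v)
    case (real y)
    with \<open>u = ennreal x\<close> \<open>0 \<le> x\<close> show ?thesis
      by (simp add: ennreal_mult[symmetric] ennpowr_ennreal powr_mult)
  next
    case top
    with \<open>u = ennreal x\<close> \<open>0 \<le> x\<close> show ?thesis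
      by (cases "x = 0") (auto simp: ennreal_mult_top ennpowr_ennreal)
  qed
next
  case top
  show ?thesis
  proof (cases v)
    case (real y)
    with top show ?thesis
      by (cases "y = 0") (auto simp: ennreal_top_mult ennpowr_ennreal)
  qed (simp add: top)
qed

lemma ennpowr_1 [simp]: "ennpowr u 1 = u"
  by (cases u) (auto simp: ennpowr_ennreal)

text \<open>u + v is at most twice the larger summand, and 2 ^ r \<le> 2.\<close>

lemma ennpowr_add_le:
  assumes "0 \<le> r" "r \<le> 1"
  shows "ennpowr (u + v) r \<le> 2 * (ennpowr u r + ennpowr v r)"
proof -
  have "ennpowr (x + y) r \<le> 2 * ennpowr y r" if "x \<le> y" for x y
  proof -
    have "x + y \<le> ennreal 2 * y" using that by (simp add: mult_2 add_right_mono)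
    then have "ennpowr (x + y) r \<le> ennpowr (ennreal 2 * y) r" using assms by (intro ennpowr_mono)
    also have "\<dots> = ennreal (2 powr r) * ennpowr y r" by (simp only: ennpowr_mult) (simp add: ennpowr_ennreal del: ennreal_numeral)
    also have "\<dots> \<le> ennreal (2 powr 1) * ennpowr y r"
      using assms by (intro mult_right_mono ennreal_leI powr_mono) auto
    finally show ?thesis by simp
  qed
  from this[of u v] this[of v u] show ?thesis
    by (cases "u \<le> v") (auto simp: distrib_left add.commute intro: order_trans add_increasing add_increasing2)
qed

lemma ennreal_le_suminf: "(f j :: ennreal) \<le> (\<Sum>i. f i)"
  using sum_le_suminf[of f "{j}"] by simp

text \<open>Step majorants. The sets \<open>U i\<close> will be open covers of dyadic superlevel
  sets, chosen independently of each other and therefore not assumed to be nested.\<close>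

definition layers :: "(nat \<Rightarrow> real) \<Rightarrow> (nat \<Rightarrow> 'a set) \<Rightarrow> 'a \<Rightarrow> ennreal" where
  "layers e U x = (\<Sum>i. ennreal (e i) * indicator (U i) x)"

lemma layers_measurable [measurable]:
  assumes "\<And>i. open (U i)"
  shows "layers e U \<in> borel_measurable borel"
proof -
  have [measurable]: "U i \<in> sets borel" for i using assms by simp
  show ?thesis unfolding layers_def by measurable
qed

text \<open>j + 1 is the least exponent m with v \<le> 2 ^ m \<tau>, which is not 0 as v > \<tau>.
  The strict lower bound fits strict superlevel sets.\<close>

lemma dyadic_sum_bound:
  fixes v \<tau> :: real
  assumes t: "\<tau> > 0" and v: "v > \<tau>"
  obtains j :: nat where "2 ^ j * \<tau> < v" "v \<le> 2 ^ (j + 1) * \<tau>"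
proof -
  obtain n :: nat where n: "v / \<tau> < 2 ^ n" using real_arch_pow[of 2 "v / \<tau>"] by auto
  define m where "m = (LEAST n. v / \<tau> \<le> 2 ^ n)"
  have m: "v / \<tau> \<le> 2 ^ m" unfolding m_def by (rule LeastI[of _ n]) (use n in simp)
  have "m \<noteq> 0" using m t v by (intro notI) (simp add: field_simps)
  then obtain j where j: "m = Suc j" by (cases m) auto
  have "\<not> v / \<tau> \<le> 2 ^ j" using not_less_Least[of j "\<lambda>n. v / \<tau> \<le> 2 ^ n"] j by (simp add: m_def)
  then have "2 ^ j * \<tau> < v" using t by (simp add: field_simps)
  moreover have "v \<le> 2 ^ (j + 1) * \<tau>" using m j t by (simp add: field_simps)
  ultimately show ?thesis by (rule that)
qed

context decaying_measure
begin

lemma positive_maximal_layers_le: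
  assumes U: "\<And>i. open (U i)"
  shows "positive_maximal \<mu> (layers e U) x \<le> (\<Sum>i. ennreal (e i) * positive_maximal \<mu> (indicator (U i)) x)"
  unfolding positive_maximal_def
proof (rule SUP_least)
  fix t :: real assume t: "t \<in> {0<..}"
  have [measurable]: "U i \<in> sets borel" for i using U by simp
  have "(\<integral>\<^sup>+y. layers e U (x - t *\<^sub>R y) \<partial>\<mu>) = (\<Sum>i. \<integral>\<^sup>+y. ennreal (e i) * indicator (U i) (x - t *\<^sub>R y) \<partial>\<mu>)"
    unfolding layers_def by (intro nn_integral_suminf) measurable
  also have "\<dots> = (\<Sum>i. ennreal (e i) * (\<integral>\<^sup>+y. indicator (U i) (x - t *\<^sub>R y) \<partial>\<mu>))"
    by (intro arg_cong[where f=suminf] ext nn_integral_cmult) measurable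
  also have "\<dots> \<le> (\<Sum>i. ennreal (e i) * (SUP t\<in>{0<..}. \<integral>\<^sup>+y. indicator (U i) (x - t *\<^sub>R y) \<partial>\<mu>))"
    using t by (intro suminf_le mult_left_mono SUP_upper) auto
  finally show "(\<integral>\<^sup>+y. layers e U (x - t *\<^sub>R y) \<partial>\<mu>) \<le> (\<Sum>i. ennreal (e i) * (SUP t\<in>{0<..}. \<integral>\<^sup>+y. indicator (U i) (x - t *\<^sub>R y) \<partial>\<mu>))" .
qed

text \<open>Kolmogorov's inequality, which makes weak \<open>L\<^sup>p\<close> normable for \<open>p > 1\<close>.\<close>

lemma integral_positive_maximal_le:
  assumes p1: "p_crit > 1"
  shows "\<exists>C>0. \<forall>U A. open U \<longrightarrow> A \<in> sets borel \<longrightarrow> emeasure lborel A < \<infinity> \<longrightarrow>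
    (\<integral>\<^sup>+x. positive_maximal \<mu> (indicator U) x * indicator A x \<partial>lborel)
      \<le> ennreal (C * measure lborel A powr (1 - 1 / p_crit)) * ennpowr (emeasure lborel U) (1 / p_crit)"
proof -
  let ?p = p_crit
  obtain C0 where C0: "C0 \<ge> 0" and rw: "\<forall>U \<alpha>. open U \<longrightarrow> 0 < \<alpha> \<longrightarrow>
    emeasure lborel {x. positive_maximal \<mu> (indicator U) x > ennreal \<alpha>} \<le> ennreal (C0 * \<alpha> powr (- p_crit)) * emeasure lborel U"
    using restricted_weak_type by blast
  \<comment> \<open>Ratio of the dyadic tail sum; it is below 1 because p > 1.\<close>
  define r where "r = 2 powr (1 - ?p)"
  have r: "0 < r" "r < 1" using p1 powr_less_mono[of "1 - ?p" 0 2] by (auto simp: r_def)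
  have rs: "(\<lambda>j. r ^ j) sums (1 / (1 - r))" using r by (intro geometric_sums) auto
  define C1 where "C1 = 2 * C0 / (1 - r)"
  have C10: "C1 \<ge> 0" using C0 r by (simp add: C1_def)
  \<comment> \<open>Values up to \<tau> contribute at most \<tau> times the measure of A; larger
    values are summed dyadically over all of space, where the restricted weak type bound
    applies.\<close>
  have split: "(\<integral>\<^sup>+x. positive_maximal \<mu> (indicator U) x * indicator A x \<partial>lborel) \<le> ennreal (\<tau> * m + C1 * u * \<tau> powr (1 - ?p))"
    if U: "open U" and A [measurable]: "A \<in> sets borel" and m: "emeasure lborel A = ennreal m" "m \<ge> 0"
      and u: "emeasure lborel U = ennreal u" "u \<ge> 0" and t: "\<tau> > 0" for U A m u \<tau>
  proof -
    let ?f = "positive_maximal \<mu> (indicator U)"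
    have [measurable]: "?f \<in> borel_measurable borel" by (rule positive_maximal_indicator_measurable[OF U])
    have ffin: "?f x < top" for x
    proof -
      have "?f x \<le> 1 * ennreal mass" by (rule positive_maximal_le_mass) (auto split: split_indicator)
      also have "\<dots> < top" by simp
      finally show ?thesis .
    qed
    have pt: "?f x \<le> ennreal \<tau> + (\<Sum>j. ennreal (2 ^ (j + 1) * \<tau>) * indicator {x. ?f x > ennreal (2 ^ j * \<tau>)} x)" for x
    proof -
      obtain v where v: "?f x = ennreal v" "v \<ge> 0" using ffin[of x] by (cases "?f x") auto
      show ?thesis
      proof (cases "v \<le> \<tau>")
        case True
        then show ?thesis using v by (simp add: ennreal_leI add_increasing2)
      next
        case False
        then obtain j where j: "2 ^ j * \<tau> < v" "v \<le> 2 ^ (j + 1) * \<tau>" using dyadic_sum_bound[OF t, of v] by auto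
        have "?f x \<le> ennreal (2 ^ (j + 1) * \<tau>) * indicator {x. ?f x > ennreal (2 ^ j * \<tau>)} x"
          using v j t by (simp add: ennreal_leI ennreal_less_iff)
        also have "\<dots> \<le> (\<Sum>j. ennreal (2 ^ (j + 1) * \<tau>) * indicator {x. ?f x > ennreal (2 ^ j * \<tau>)} x)"
          by (rule ennreal_le_suminf)
        finally show ?thesis by (simp add: add_increasing)
      qed
    qed
    have "(\<integral>\<^sup>+x. ?f x * indicator A x \<partial>lborel) \<le>
      (\<integral>\<^sup>+x. ennreal \<tau> * indicator A x + (\<Sum>j. ennreal (2 ^ (j + 1) * \<tau>) * indicator {x. ?f x > ennreal (2 ^ j * \<tau>)} x) \<partial>lborel)"
      using pt by (intro nn_integral_mono) (auto split: split_indicator)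
    also have "\<dots> = (\<integral>\<^sup>+x. ennreal \<tau> * indicator A x \<partial>lborel) + (\<integral>\<^sup>+x. (\<Sum>j. ennreal (2 ^ (j + 1) * \<tau>) * indicator {x. ?f x > ennreal (2 ^ j * \<tau>)} x) \<partial>lborel)"
      by (intro nn_integral_add) measurable
    also have "(\<integral>\<^sup>+x. ennreal \<tau> * indicator A x \<partial>lborel) = ennreal \<tau> * ennreal m"
      by (simp add: nn_integral_cmult_indicator m)
    also have "(\<integral>\<^sup>+x. (\<Sum>j. ennreal (2 ^ (j + 1) * \<tau>) * indicator {x. ?f x > ennreal (2 ^ j * \<tau>)} x) \<partial>lborel)
      = (\<Sum>j. \<integral>\<^sup>+x. ennreal (2 ^ (j + 1) * \<tau>) * indicator {x. ?f x > ennreal (2 ^ j * \<tau>)} x \<partial>lborel)"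
      by (intro nn_integral_suminf) measurable
    also have "\<dots> = (\<Sum>j. ennreal (2 ^ (j + 1) * \<tau>) * emeasure lborel {x. ?f x > ennreal (2 ^ j * \<tau>)})"
      by (intro arg_cong[where f=suminf] ext nn_integral_cmult_indicator) measurable
    also have "\<dots> \<le> (\<Sum>j. ennreal (2 ^ (j + 1) * \<tau>) * (ennreal (C0 * (2 ^ j * \<tau>) powr (- ?p)) * ennreal u))"
      using rw U t u by (intro suminf_le mult_left_mono) auto
    also have "\<dots> = (\<Sum>j. ennreal (2 * C0 * u * \<tau> powr (1 - ?p) * r ^ j))"
    proof (intro arg_cong[where f=suminf] ext)
      fix j :: nat
      have "(2 ^ j * \<tau>) powr (1 - ?p) = r ^ j * \<tau> powr (1 - ?p)"
      proof -
        have "(2 ^ j :: real) powr (1 - ?p) = (2 powr real j) powr (1 - ?p)" by (simp add: powr_realpow)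
        also have "\<dots> = (2 powr (1 - ?p)) powr real j" by (simp add: powr_powr mult.commute)
        also have "\<dots> = r ^ j" unfolding r_def by (rule powr_realpow) simp
        finally show ?thesis using t by (simp add: powr_mult)
      qed
      moreover have "(2 ^ j * \<tau>) powr (1 - ?p) = (2 ^ j * \<tau>) * (2 ^ j * \<tau>) powr (- ?p)"
        using t by (simp add: powr_diff powr_minus divide_inverse)
      ultimately have e: "(2 ^ j * \<tau>) * (2 ^ j * \<tau>) powr (- ?p) = r ^ j * \<tau> powr (1 - ?p)" by simp
      have "2 ^ (j + 1) * \<tau> * (C0 * (2 ^ j * \<tau>) powr (- ?p) * u) = 2 * C0 * u * ((2 ^ j * \<tau>) * (2 ^ j * \<tau>) powr (- ?p))"
        by (simp only: power_add power_one_right mult_ac)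
      then have "2 ^ (j + 1) * \<tau> * (C0 * (2 ^ j * \<tau>) powr (- ?p) * u) = 2 * C0 * u * (r ^ j * \<tau> powr (1 - ?p))"
        unfolding e .
      then show "ennreal (2 ^ (j + 1) * \<tau>) * (ennreal (C0 * (2 ^ j * \<tau>) powr (- ?p)) * ennreal u) = ennreal (2 * C0 * u * \<tau> powr (1 - ?p) * r ^ j)"
        using C0 t u(2) by (simp only: ennreal_mult[symmetric] mult_nonneg_nonneg powr_ge_zero zero_le_power zero_le_numeral less_imp_le) (simp only: mult_ac)
    qed
    also have "\<dots> = ennreal (C1 * u * \<tau> powr (1 - ?p))"
      using C0 u r sums_mult[OF rs, of "2 * C0 * u * \<tau> powr (1 - ?p)"]
      by (intro suminf_ennreal_eq) (auto simp: C1_def)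
    also have "ennreal \<tau> * ennreal m + ennreal (C1 * u * \<tau> powr (1 - ?p)) = ennreal (\<tau> * m + C1 * u * \<tau> powr (1 - ?p))"
      using t m C10 u by (simp add: ennreal_mult ennreal_plus)
    finally show ?thesis by simp
  qed
  have main: "(\<integral>\<^sup>+x. positive_maximal \<mu> (indicator U) x * indicator A x \<partial>lborel)
      \<le> ennreal ((1 + C1) * measure lborel A powr (1 - 1 / ?p)) * ennpowr (emeasure lborel U) (1 / ?p)"
    if U: "open U" and A [measurable]: "A \<in> sets borel" and Af: "emeasure lborel A < \<infinity>" for U A
  proof (cases "measure lborel A = 0")
    case True
    then have "emeasure lborel A = 0" using Af by (simp add: emeasure_eq_ennreal_measure less_top)
    then have "AE x in lborel. x \<notin> A" by (auto intro!: AE_not_in)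
    then have "AE x in lborel. positive_maximal \<mu> (indicator U) x * indicator A x = 0"
      by eventually_elim simp
    then have "(\<integral>\<^sup>+x. positive_maximal \<mu> (indicator U) x * indicator A x \<partial>lborel) = (\<integral>\<^sup>+x. 0 \<partial>(lborel :: 'a measure))"
      by (rule nn_integral_cong_AE)
    then show ?thesis by simp
  next
    case False
    define m where "m = measure lborel A"
    have m: "m > 0" using False by (simp add: m_def zero_less_measure_iff)
    have mA: "emeasure lborel A = ennreal m" unfolding m_def using Af by (intro emeasure_eq_ennreal_measure) auto
    show ?thesis
    proof (cases "emeasure lborel U")
      case top
      have "(1 + C1) * m powr (1 - 1 / ?p) > 0" using m C10 by simp
      then show ?thesis unfolding m_def[symmetric] using top m C10 by (simp add: ennreal_mult_top)
    next
      case (real u)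
      show ?thesis
      proof (cases "u = 0")
        case True
        \<comment> \<open>For u = 0 the balanced threshold would be 0, so arbitrarily small
          thresholds e / m are used instead.\<close>
        have eps: "(\<integral>\<^sup>+x. positive_maximal \<mu> (indicator U) x * indicator A x \<partial>lborel) \<le> 0 + ennreal e" if "e > 0" for e
        proof -
          have "0 < e / m" using that m by simp
          from split[OF U A mA _ real(2) _ this] m True show ?thesis by simp
        qed
        have "(\<integral>\<^sup>+x. positive_maximal \<mu> (indicator U) x * indicator A x \<partial>lborel) \<le> 0"
          by (rule ennreal_le_epsilon) (rule eps)
        then show ?thesis by simp
      next
        case False
        then have u: "u > 0" using real by simp
        \<comment> \<open>The threshold at which \<tau> m and u \<tau>^(1-p) are equal.\<close>
        define \<tau> where "\<tau> = (u / m) powr (1 / ?p)"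
        have t: "\<tau> > 0" using u m by (simp add: \<tau>_def)
        have up: "u = u powr (1 / ?p) * u powr (1 - 1 / ?p)" using u by (simp add: powr_add[symmetric])
        have mp: "m = m powr (1 / ?p) * m powr (1 - 1 / ?p)" using m by (simp add: powr_add[symmetric])
        have t': "\<tau> = u powr (1 / ?p) / m powr (1 / ?p)" unfolding \<tau>_def by (simp only: powr_divide)
        have 1: "\<tau> * m = u powr (1 / ?p) * m powr (1 - 1 / ?p)"
          unfolding t' using m by (subst (2) mp) simp
        have 2: "u * \<tau> powr (1 - ?p) = u powr (1 / ?p) * m powr (1 - 1 / ?p)"
        proof -
          have "\<tau> powr (1 - ?p) = (u / m) powr (1 / ?p - 1)"
            unfolding \<tau>_def powr_powr using p1 by (simp add: field_simps)
          also have "\<dots> = (m / u) powr (1 - 1 / ?p)"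
          proof -
            have "(u / m) powr (1 / ?p - 1) = (u / m) powr (- (1 - 1 / ?p))" by simp
            also have "\<dots> = inverse ((u / m) powr (1 - 1 / ?p))" by (rule powr_minus)
            also have "\<dots> = (m / u) powr (1 - 1 / ?p)" using u m by (simp add: powr_divide)
            finally show ?thesis .
          qed
          also have "\<dots> = m powr (1 - 1 / ?p) / u powr (1 - 1 / ?p)" by (simp only: powr_divide)
          finally show ?thesis using u by (subst up) simp
        qed
        have "(\<integral>\<^sup>+x. positive_maximal \<mu> (indicator U) x * indicator A x \<partial>lborel) \<le> ennreal (\<tau> * m + C1 * (u * \<tau> powr (1 - ?p)))"
          using split[OF U A mA _ real(2) real(1) t] m by (simp add: mult.assoc)
        also have "\<tau> * m + C1 * (u * \<tau> powr (1 - ?p)) = ((1 + C1) * m powr (1 - 1 / ?p)) * u powr (1 / ?p)"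
          unfolding 1 2 by (simp add: algebra_simps)
        also have "ennreal \<dots> = ennreal ((1 + C1) * m powr (1 - 1 / ?p)) * ennreal (u powr (1 / ?p))"
          using C10 by (intro ennreal_mult) auto
        finally show ?thesis using real by (simp add: m_def ennpowr_ennreal)
      qed
    qed
  qed
  show ?thesis
    using main C10 by (intro exI[of _ "1 + C1"] conjI allI impI) auto
qed

text \<open>Each summand is the size of one layer in L^(p,1), up to a constant.\<close>

definition layer_norm :: "(nat \<Rightarrow> real) \<Rightarrow> (nat \<Rightarrow> 'a set) \<Rightarrow> ennreal" where
  "layer_norm e U = (\<Sum>i. ennreal (e i) * ennpowr (emeasure lborel (U i)) (1 / p_crit))"

text \<open>Integrals over a set A add up over the layers, which measures of superlevel sets do not.
  For A inside the superlevel set, of measure m, this gives \<alpha> m \<le> C m^(1 - 1/p) N with N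
  the layer norm, and dividing by m^(1 - 1/p) yields the weak type bound.\<close>

lemma weak_type_layers_gt_1:
  assumes p1: "p_crit > 1"
  shows "\<exists>C>0. \<forall>U e \<alpha>. (\<forall>i. open (U i)) \<longrightarrow> 0 < \<alpha> \<longrightarrow>
    (\<exists>W\<in>sets borel. {x. positive_maximal \<mu> (layers e U) x > ennreal \<alpha>} \<subseteq> W \<and>
      emeasure lborel W \<le> ennpowr (ennreal (C / \<alpha>) * layer_norm e U) p_crit)"
proof -
  let ?p = p_crit
  obtain C where C: "C > 0" and kol: "\<forall>U A. open U \<longrightarrow> A \<in> sets borel \<longrightarrow> emeasure lborel A < \<infinity> \<longrightarrow>
    (\<integral>\<^sup>+x. positive_maximal \<mu> (indicator U) x * indicator A x \<partial>lborel)
      \<le> ennreal (C * measure lborel A powr (1 - 1 / p_crit)) * ennpowr (emeasure lborel U) (1 / p_crit)"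
    using integral_positive_maximal_le[OF p1] by blast
  have main: "\<exists>W\<in>sets borel. {x. positive_maximal \<mu> (layers e U) x > ennreal \<alpha>} \<subseteq> W \<and>
      emeasure lborel W \<le> ennpowr (ennreal (C / \<alpha>) * layer_norm e U) ?p"
    if U: "\<forall>i. open (U i)" and al: "0 < \<alpha>" for U e \<alpha>
  proof -
    define G where "G x = (\<Sum>i. ennreal (e i) * positive_maximal \<mu> (indicator (U i)) x)" for x
    have [measurable]: "positive_maximal \<mu> (indicator (U i)) \<in> borel_measurable borel" for i
      using U by (intro positive_maximal_indicator_measurable) auto
    have [measurable]: "G \<in> borel_measurable borel" unfolding G_def by measurable
    let ?W = "{x. G x > ennreal \<alpha>}"
    have sub: "{x. positive_maximal \<mu> (layers e U) x > ennreal \<alpha>} \<subseteq> ?W"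
      using positive_maximal_layers_le[of U e] U by (auto simp: G_def intro: order_less_le_trans)
    have [measurable]: "?W \<in> sets borel" by measurable
    \<comment> \<open>Intersecting with balls makes the measure finite, so that the division is
      legitimate; the balls then exhaust the space.\<close>
    have An: "emeasure lborel (?W \<inter> ball 0 (real n)) \<le> ennpowr (ennreal (C / \<alpha>) * layer_norm e U) ?p" for n
    proof -
      let ?A = "?W \<inter> ball 0 (real n)"
      have [measurable]: "?A \<in> sets borel" by (intro sets.Int) auto
      have Af: "emeasure lborel ?A < \<infinity>"
        using emeasure_mono[of ?A "ball 0 (real n)" lborel] emeasure_lborel_ball_finite[of 0 "real n"]
        by (auto intro: order_le_less_trans)
      define m where "m = measure lborel ?A"
      have m0: "m \<ge> 0" by (simp add: m_def)
      have mA: "emeasure lborel ?A = ennreal m" unfolding m_def using Af by (intro emeasure_eq_ennreal_measure) auto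
      have "ennreal \<alpha> * ennreal m = (\<integral>\<^sup>+x. ennreal \<alpha> * indicator ?A x \<partial>lborel)"
        by (subst nn_integral_cmult_indicator) (auto simp: mA)
      also have "\<dots> \<le> (\<integral>\<^sup>+x. G x * indicator ?A x \<partial>lborel)"
        by (intro nn_integral_mono) (auto split: split_indicator)
      also have "\<dots> = (\<integral>\<^sup>+x. (\<Sum>i. ennreal (e i) * (positive_maximal \<mu> (indicator (U i)) x * indicator ?A x)) \<partial>lborel)"
        unfolding G_def by (simp only: ennreal_suminf_multc[symmetric] mult.assoc)
      also have "\<dots> = (\<Sum>i. \<integral>\<^sup>+x. ennreal (e i) * (positive_maximal \<mu> (indicator (U i)) x * indicator ?A x) \<partial>lborel)"
        by (intro nn_integral_suminf) measurable
      also have "\<dots> = (\<Sum>i. ennreal (e i) * (\<integral>\<^sup>+x. positive_maximal \<mu> (indicator (U i)) x * indicator ?A x \<partial>lborel))"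
        by (intro arg_cong[where f=suminf] ext nn_integral_cmult) measurable
      also have "\<dots> \<le> (\<Sum>i. ennreal (e i) * (ennreal (C * m powr (1 - 1 / ?p)) * ennpowr (emeasure lborel (U i)) (1 / ?p)))"
        unfolding m_def using kol U Af by (intro suminf_le mult_left_mono) auto
      also have "\<dots> = (\<Sum>i. ennreal (C * m powr (1 - 1 / ?p)) * (ennreal (e i) * ennpowr (emeasure lborel (U i)) (1 / ?p)))"
        by (simp only: mult_ac)
      also have "\<dots> = ennreal (C * m powr (1 - 1 / ?p)) * layer_norm e U"
        unfolding layer_norm_def by (rule ennreal_suminf_cmult)
      finally have le: "ennreal \<alpha> * ennreal m \<le> ennreal (C * m powr (1 - 1 / ?p)) * layer_norm e U" .
      show ?thesis
      proof (cases "m = 0")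
        case True
        then show ?thesis by (simp add: mA)
      next
        case False
        then have m: "m > 0" using m0 by simp
        have mp: "m = m powr (1 / ?p) * m powr (1 - 1 / ?p)" using m by (simp add: powr_add[symmetric])
        have k: "m powr (1 - 1 / ?p) > 0" using m by simp
        have "ennreal (m powr (1 / ?p)) = ennreal (1 / (\<alpha> * m powr (1 - 1 / ?p))) * (ennreal \<alpha> * ennreal m)"
          using al k m by (subst mp) (simp add: ennreal_mult[symmetric])
        also have "\<dots> \<le> ennreal (1 / (\<alpha> * m powr (1 - 1 / ?p))) * (ennreal (C * m powr (1 - 1 / ?p)) * layer_norm e U)"
          by (intro mult_left_mono le) auto
        also have "\<dots> = ennreal (C / \<alpha>) * layer_norm e U"
          using al k C by (simp add: mult.assoc[symmetric] ennreal_mult[symmetric])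
        finally have "ennpowr (ennreal (m powr (1 / ?p))) ?p \<le> ennpowr (ennreal (C / \<alpha>) * layer_norm e U) ?p"
          using p1 by (intro ennpowr_mono) auto
        then show ?thesis using m p1 by (simp add: ennpowr_ennreal powr_powr mA)
      qed
    qed
    have "emeasure lborel ?W = emeasure lborel (\<Union>n. ?W \<inter> ball 0 (real n))"
    proof (rule arg_cong[where f="emeasure lborel"], safe)
      fix x assume "ennreal \<alpha> < G x"
      obtain n where "norm x < real n" using reals_Archimedean2 by blast
      then show "x \<in> (\<Union>n. ?W \<inter> ball 0 (real n))" using \<open>ennreal \<alpha> < G x\<close> by auto
    qed
    also have "\<dots> = (SUP n. emeasure lborel (?W \<inter> ball 0 (real n)))"
      by (intro SUP_emeasure_incseq[symmetric]) (auto simp: incseq_def intro!: sets.Int)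
    also have "\<dots> \<le> ennpowr (ennreal (C / \<alpha>) * layer_norm e U) ?p"
      by (intro SUP_least An)
    finally show ?thesis using sub by (intro bexI[of _ ?W]) auto
  qed
  show ?thesis using main C by (intro exI[of _ C] conjI allI impI) auto
qed

end

section \<open>The exponent 1 and the passage to general functions\<close>

context decaying_measure
begin

text \<open>The indicator of V, averaged over balls of radius s and integrated against \<mu>, is by
  Fubini an integral over V of \<mu>-measures of balls divided by their volume; for b = d the growth
  bound is a multiple of that volume. Openness of V makes the averages equal 1 at each point of V
  once s is small, and Fatou's lemma concludes.\<close>

lemma emeasure_le_lborel:
  assumes b: "b = DIM('a)"
  shows "\<exists>K\<ge>0. \<forall>V. open V \<longrightarrow> emeasure \<mu> V \<le> ennreal K * emeasure lborel V"
proof -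
  define c where "c = measure lborel (ball (0::'a) 1)"
  have c: "c > 0" unfolding c_def by (rule content_ball_pos) simp
  have main: "emeasure \<mu> V \<le> ennreal (C\<^sub>0 / c) * emeasure lborel V" if V: "open V" for V
  proof -
    have [measurable]: "V \<in> sets borel" using V by simp
    define s where "s n = 1 / (real n + 1)" for n :: nat
    have s0: "s n > 0" for n by (simp add: s_def)
    have slim: "s \<longlonglongrightarrow> 0"
      unfolding s_def using LIMSEQ_inverse_real_of_nat by (simp add: inverse_eq_divide add.commute)
    have [measurable]: "ball 0 (s n) \<in> sets (borel :: 'a measure)" for n by simp
    define k where "k n = c * s n ^ DIM('a)" for n
    have k0: "k n > 0" for n using c s0 by (simp add: k_def)
    define f where "f n y = ennreal (1 / k n) * (\<integral>\<^sup>+v. indicator V v * indicator (ball 0 (s n)) (v - y) \<partial>lborel)" for n and y :: 'a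
    have [measurable]: "f n \<in> borel_measurable borel" for n unfolding f_def by measurable
    have one: "indicator V y \<le> liminf (\<lambda>n. f n y)" for y
    proof (cases "y \<in> V")
      case True
      then obtain e where e: "e > 0" "ball y e \<subseteq> V" using V open_contains_ball by blast
      have "\<forall>\<^sub>F n in sequentially. s n < e" using slim e(1) by (rule order_tendstoD)
      then have "\<forall>\<^sub>F n in sequentially. 1 \<le> f n y"
      proof eventually_elim
        case (elim n)
        have "ball y (s n) \<subseteq> V" using e elim by auto
        moreover have "v - y \<in> ball 0 (s n) \<longleftrightarrow> v \<in> ball y (s n)" for v
          by (simp add: dist_norm norm_minus_commute)
        ultimately have eq: "indicator V v * indicator (ball 0 (s n)) (v - y) = (indicator (ball y (s n)) v :: ennreal)" for v
          by (auto simp: indicator_def simp del: mem_ball)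
        have "(\<integral>\<^sup>+v. indicator V v * indicator (ball 0 (s n)) (v - y) \<partial>lborel) = emeasure lborel (ball y (s n))"
          unfolding eq by simp
        also have "\<dots> = ennreal (measure lborel (ball y (s n)))"
          using emeasure_lborel_ball_finite[of y "s n"] by (intro emeasure_eq_ennreal_measure) auto
        also have "measure lborel (ball y (s n)) = k n"
          using s0[of n] unfolding k_def c_def by (subst content_ball_conv_unit_ball) auto
        finally show ?case using k0[of n] by (simp add: f_def ennreal_mult[symmetric])
      qed
      then have "1 \<le> liminf (\<lambda>n. f n y)" by (rule Liminf_bounded)
      then show ?thesis using True by simp
    qed simp
    interpret P: pair_sigma_finite \<mu> "lborel :: 'a measure" ..
    have int: "(\<integral>\<^sup>+y. f n y \<partial>\<mu>) \<le> ennreal (C\<^sub>0 / c) * emeasure lborel V" for n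
    proof -
      have "(\<integral>\<^sup>+y. f n y \<partial>\<mu>) = ennreal (1 / k n) * (\<integral>\<^sup>+y. (\<integral>\<^sup>+v. indicator V v * indicator (ball 0 (s n)) (v - y) \<partial>lborel) \<partial>\<mu>)"
        unfolding f_def by (intro nn_integral_cmult) measurable
      also have "(\<integral>\<^sup>+y. (\<integral>\<^sup>+v. indicator V v * indicator (ball 0 (s n)) (v - y) \<partial>lborel) \<partial>\<mu>)
        = (\<integral>\<^sup>+v. (\<integral>\<^sup>+y. indicator V v * indicator (ball 0 (s n)) (v - y) \<partial>\<mu>) \<partial>lborel)"
        by (rule P.Fubini'[symmetric]) measurable
      also have "\<dots> \<le> (\<integral>\<^sup>+v. ennreal (C\<^sub>0 * s n ^ DIM('a)) * indicator V v \<partial>lborel)"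
      proof (rule nn_integral_mono)
        fix v :: 'a
        have "(\<integral>\<^sup>+y. indicator V v * indicator (ball 0 (s n)) (v - y) \<partial>\<mu>) = indicator V v * (\<integral>\<^sup>+y. indicator (ball 0 (s n)) (v - y) \<partial>\<mu>)"
          by (intro nn_integral_cmult) measurable
        also have "(\<integral>\<^sup>+y. indicator (ball 0 (s n)) (v - y) \<partial>\<mu>) = (\<integral>\<^sup>+y. indicator (ball v (s n)) y \<partial>\<mu>)"
        proof (rule nn_integral_cong)
          fix y
          have "v - y \<in> ball 0 (s n) \<longleftrightarrow> y \<in> ball v (s n)"
            by (metis dist_0_norm dist_norm mem_ball)
          then show "indicator (ball 0 (s n)) (v - y) = (indicator (ball v (s n)) y :: ennreal)"
            by (simp only: indicator_def)
        qed
        also have "\<dots> = ennreal (measure \<mu> (ball v (s n)))"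
          by (simp add: sets_mu emeasure_eq_measure)
        also have "\<dots> \<le> ennreal (C\<^sub>0 * s n ^ DIM('a))"
          using growth[OF s0[of n], of v] s0[of n] unfolding b by (intro ennreal_leI) (simp add: powr_realpow)
        finally show "(\<integral>\<^sup>+y. indicator V v * indicator (ball 0 (s n)) (v - y) \<partial>\<mu>) \<le> ennreal (C\<^sub>0 * s n ^ DIM('a)) * indicator V v"
          by (simp add: mult.commute mult_left_mono mult_right_mono)
      qed
      also have "\<dots> = ennreal (C\<^sub>0 * s n ^ DIM('a)) * emeasure lborel V" by (intro nn_integral_cmult_indicator) auto
      also have "ennreal (1 / k n) * (ennreal (C\<^sub>0 * s n ^ DIM('a)) * emeasure lborel V) = ennreal (C\<^sub>0 / c) * emeasure lborel V"
      proof -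
        have "1 / k n * (C\<^sub>0 * s n ^ DIM('a)) = C\<^sub>0 / c" using c s0[of n] by (simp add: k_def)
        then show ?thesis using k0[of n] C0_nonneg s0[of n] by (simp add: mult.assoc[symmetric] ennreal_mult'[symmetric])
      qed
      finally show ?thesis by (simp add: mult_left_mono)
    qed
    have "emeasure \<mu> V = (\<integral>\<^sup>+y. indicator V y \<partial>\<mu>)" by (simp add: sets_mu)
    also have "\<dots> \<le> (\<integral>\<^sup>+y. liminf (\<lambda>n. f n y) \<partial>\<mu>)" by (intro nn_integral_mono one)
    also have "\<dots> \<le> liminf (\<lambda>n. \<integral>\<^sup>+y. f n y \<partial>\<mu>)" by (intro nn_integral_liminf) measurable
    also have "\<dots> \<le> liminf (\<lambda>n::nat. ennreal (C\<^sub>0 / c) * emeasure lborel V)"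
      using int by (intro Liminf_mono always_eventually) auto
    finally show ?thesis by (simp add: Liminf_const)
  qed
  show ?thesis using main C0_nonneg c by (intro exI[of _ "C\<^sub>0 / c"] conjI allI impI) auto
qed

text \<open>The tail sum behind Kolmogorov's inequality diverges at p = 1. But p = 1 means b = d, so
  every average is at most a constant times a Lebesgue average over a ball of radius t (R + 1), and
  the weak (1,1) bound applies to the whole sum of layers at once.\<close>

lemma weak_type_layers_1:
  assumes p1: "p_crit = 1"
  shows "\<exists>C>0. \<forall>U e \<alpha>. (\<forall>i. open (U i)) \<longrightarrow> 0 < \<alpha> \<longrightarrow>
    (\<exists>W\<in>sets borel. {x. positive_maximal \<mu> (layers e U) x > ennreal \<alpha>} \<subseteq> W \<and>
      emeasure lborel W \<le> ennpowr (ennreal (C / \<alpha>) * layer_norm e U) p_crit)"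
proof -
  let ?d = "DIM('a)"
  have b: "b = ?d"
  proof -
    have "?d - b + 2 * a - 1 > 0" using a_gt b_le by linarith
    moreover have "(?d - b) / (?d - b + 2 * a - 1) = 0" using p1 p_crit_eq(1) by linarith
    ultimately show ?thesis by simp
  qed
  obtain K where K: "K \<ge> 0" and mu: "\<forall>V. open V \<longrightarrow> emeasure \<mu> V \<le> ennreal K * emeasure lborel V"
    using emeasure_le_lborel[OF b] by blast
  define K' where "K' = K * (R + 1) ^ ?d + 1"
  have K': "K' > 0" using K R_pos by (simp add: K'_def add_nonneg_pos)
  define C where "C = hl_const TYPE('a) * K' + 1"
  have C: "C > 0" using K' by (simp add: C_def add_nonneg_pos)
  have dom: "positive_maximal \<mu> (layers e U) x \<le> ennreal K' * hl_maximal (layers e U) x" if U: "\<forall>i. open (U i)" for U e x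
    unfolding positive_maximal_def
  proof (rule SUP_least)
    fix t :: real assume "t \<in> {0<..}"
    then have t: "t > 0" by simp
    have [measurable]: "U i \<in> sets borel" for i using U by simp
    have [measurable]: "layers e U \<in> borel_measurable borel" using U by (intro layers_measurable) auto
    \<comment> \<open>R + 1 instead of R, so that an open ball contains the closed ball carrying
      \<mu>.\<close>
    let ?B = "ball (0::'a) (R + 1)" and ?r = "t * (R + 1)"
    have r: "?r > 0" using t R_pos by simp
    have [measurable]: "?B \<in> sets borel" "ball x ?r \<in> sets borel" by simp_all
    have each: "(\<integral>\<^sup>+y. indicator (U i) (x - t *\<^sub>R y) \<partial>\<mu>) \<le> ennreal K * (\<integral>\<^sup>+y. indicator (U i) (x - t *\<^sub>R y) * indicator ?B y \<partial>lborel)" for i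
    proof -
      let ?V = "(\<lambda>y. x - t *\<^sub>R y) -` U i \<inter> ?B"
      have Vo: "open ?V" using U by (intro open_Int open_vimage continuous_intros) auto
      have "(\<integral>\<^sup>+y. indicator (U i) (x - t *\<^sub>R y) \<partial>\<mu>) = (\<integral>\<^sup>+y. indicator ?V y \<partial>\<mu>)"
      proof (rule nn_integral_cong_AE)
        show "AE y in \<mu>. indicator (U i) (x - t *\<^sub>R y) = (indicator ?V y :: ennreal)"
          using AE_support by eventually_elim (auto split: split_indicator)
      qed
      also have "\<dots> = emeasure \<mu> ?V" using Vo by (intro nn_integral_indicator) (simp add: sets_mu)
      also have "\<dots> \<le> ennreal K * emeasure lborel ?V" using mu Vo by blast
      also have "emeasure lborel ?V = (\<integral>\<^sup>+y. indicator ?V y \<partial>lborel)" using Vo by simp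
      also have "\<dots> = (\<integral>\<^sup>+y. indicator (U i) (x - t *\<^sub>R y) * indicator ?B y \<partial>lborel)"
        by (intro nn_integral_cong) (auto split: split_indicator)
      finally show ?thesis .
    qed
    have "(\<integral>\<^sup>+y. layers e U (x - t *\<^sub>R y) \<partial>\<mu>) = (\<Sum>i. \<integral>\<^sup>+y. ennreal (e i) * indicator (U i) (x - t *\<^sub>R y) \<partial>\<mu>)"
      unfolding layers_def by (intro nn_integral_suminf) measurable
    also have "\<dots> = (\<Sum>i. ennreal (e i) * (\<integral>\<^sup>+y. indicator (U i) (x - t *\<^sub>R y) \<partial>\<mu>))"
      by (intro arg_cong[where f=suminf] ext nn_integral_cmult) measurable
    also have "\<dots> \<le> (\<Sum>i. ennreal (e i) * (ennreal K * (\<integral>\<^sup>+y. indicator (U i) (x - t *\<^sub>R y) * indicator ?B y \<partial>lborel)))"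
      by (intro suminf_le mult_left_mono each) auto
    also have "\<dots> = (\<Sum>i. ennreal K * (\<integral>\<^sup>+y. ennreal (e i) * indicator (U i) (x - t *\<^sub>R y) * indicator ?B y \<partial>lborel))"
    proof (intro arg_cong[where f=suminf] ext)
      fix i
      have "(\<integral>\<^sup>+y. ennreal (e i) * indicator (U i) (x - t *\<^sub>R y) * indicator ?B y \<partial>lborel)
        = ennreal (e i) * (\<integral>\<^sup>+y. indicator (U i) (x - t *\<^sub>R y) * indicator ?B y \<partial>lborel)"
        unfolding mult.assoc by (intro nn_integral_cmult) measurable
      then show "ennreal (e i) * (ennreal K * (\<integral>\<^sup>+y. indicator (U i) (x - t *\<^sub>R y) * indicator ?B y \<partial>lborel))
        = ennreal K * (\<integral>\<^sup>+y. ennreal (e i) * indicator (U i) (x - t *\<^sub>R y) * indicator ?B y \<partial>lborel)"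
        by (simp only: mult_ac)
    qed
    also have "\<dots> = ennreal K * (\<integral>\<^sup>+y. (\<Sum>i. ennreal (e i) * indicator (U i) (x - t *\<^sub>R y) * indicator ?B y) \<partial>lborel)"
    proof -
      have "(\<integral>\<^sup>+y. (\<Sum>i. ennreal (e i) * indicator (U i) (x - t *\<^sub>R y) * indicator ?B y) \<partial>lborel)
        = (\<Sum>i. \<integral>\<^sup>+y. ennreal (e i) * indicator (U i) (x - t *\<^sub>R y) * indicator ?B y \<partial>lborel)"
        by (intro nn_integral_suminf) measurable
      then show ?thesis by (simp only: ennreal_suminf_cmult)
    qed
    also have "(\<integral>\<^sup>+y. (\<Sum>i. ennreal (e i) * indicator (U i) (x - t *\<^sub>R y) * indicator ?B y) \<partial>lborel)
      = (\<integral>\<^sup>+y. layers e U (x - t *\<^sub>R y) * indicator (ball x ?r) (x - t *\<^sub>R y) \<partial>lborel)"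
    proof (rule nn_integral_cong)
      fix y :: 'a
      have "indicator ?B y = (indicator (ball x ?r) (x - t *\<^sub>R y) :: ennreal)"
        using t by (auto simp: dist_norm split: split_indicator)
      then show "(\<Sum>i. ennreal (e i) * indicator (U i) (x - t *\<^sub>R y) * indicator ?B y) = layers e U (x - t *\<^sub>R y) * indicator (ball x ?r) (x - t *\<^sub>R y)"
        unfolding layers_def by (simp only: ennreal_suminf_multc)
    qed
    also have "\<dots> = ennreal (1 / t ^ ?d) * (\<integral>\<^sup>+v. layers e U v * indicator (ball x ?r) v \<partial>lborel)"
    proof -
      have "(\<integral>\<^sup>+v. layers e U v * indicator (ball x ?r) v \<partial>lborel)
        = ennreal (\<bar>- t\<bar> ^ ?d) * (\<integral>\<^sup>+y. layers e U (x + (- t) *\<^sub>R y) * indicator (ball x ?r) (x + (- t) *\<^sub>R y) \<partial>lborel)"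
        using t by (intro nn_integral_lborel_affine) auto
      then show ?thesis using t by (simp add: mult.assoc[symmetric] ennreal_mult[symmetric])
    qed
    also have "ennreal K * (ennreal (1 / t ^ ?d) * (\<integral>\<^sup>+v. layers e U v * indicator (ball x ?r) v \<partial>lborel))
      \<le> ennreal K * (ennreal (1 / t ^ ?d) * (ennreal (?r ^ ?d) * hl_maximal (layers e U) x))"
      by (intro mult_left_mono ball_integral_le_hl_maximal r) auto
    also have "\<dots> = ennreal (K * (R + 1) ^ ?d) * hl_maximal (layers e U) x"
      using K t R_pos by (simp add: mult.assoc[symmetric] ennreal_mult'[symmetric] power_mult_distrib)
    also have "\<dots> \<le> ennreal K' * hl_maximal (layers e U) x"
      by (intro mult_right_mono ennreal_leI) (auto simp: K'_def)
    finally show "(\<integral>\<^sup>+y. layers e U (x - t *\<^sub>R y) \<partial>\<mu>) \<le> ennreal K' * hl_maximal (layers e U) x" .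
  qed
  have main: "\<exists>W\<in>sets borel. {x. positive_maximal \<mu> (layers e U) x > ennreal \<alpha>} \<subseteq> W \<and>
      emeasure lborel W \<le> ennpowr (ennreal (C / \<alpha>) * layer_norm e U) p_crit"
    if U: "\<forall>i. open (U i)" and al: "0 < \<alpha>" for U e \<alpha>
  proof -
    have [measurable]: "U i \<in> sets borel" for i using U by simp
    have lm [measurable]: "layers e U \<in> borel_measurable borel" using U by (intro layers_measurable) auto
    define \<beta> where "\<beta> = \<alpha> / K'"
    have b0: "\<beta> > 0" using al K' by (simp add: \<beta>_def)
    obtain W where W: "W \<in> sets borel" "{x. hl_maximal (layers e U) x > ennreal \<beta>} \<subseteq> W"
      "emeasure lborel W \<le> ennreal (hl_const TYPE('a) / \<beta>) * (\<integral>\<^sup>+y. layers e U y \<partial>lborel)"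
      by (rule hl_maximal_weak_type[OF lm b0]) auto
    have sub: "{x. positive_maximal \<mu> (layers e U) x > ennreal \<alpha>} \<subseteq> W"
    proof
      fix x assume "x \<in> {x. positive_maximal \<mu> (layers e U) x > ennreal \<alpha>}"
      then have gt: "positive_maximal \<mu> (layers e U) x > ennreal \<alpha>" by simp
      show "x \<in> W"
      proof (rule ccontr)
        assume "x \<notin> W"
        then have "hl_maximal (layers e U) x \<le> ennreal \<beta>" using W(2) by (metis CollectI linorder_not_less subsetD)
        then have "ennreal K' * hl_maximal (layers e U) x \<le> ennreal K' * ennreal \<beta>" by (intro mult_left_mono) auto
        also have "\<dots> = ennreal \<alpha>" using K' al by (simp add: \<beta>_def ennreal_mult[symmetric])
        finally show False using dom[OF U, of e x] gt by (meson leD order_trans)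
      qed
    qed
    have "(\<integral>\<^sup>+y. layers e U y \<partial>lborel) = layer_norm e U"
      unfolding layers_def layer_norm_def p1
      by (subst nn_integral_suminf) (auto simp: nn_integral_cmult_indicator)
    then have "emeasure lborel W \<le> ennreal (hl_const TYPE('a) / \<beta>) * layer_norm e U" using W(3) by simp
    also have "\<dots> \<le> ennreal (C / \<alpha>) * layer_norm e U"
      using al K' by (intro mult_right_mono ennreal_leI) (auto simp: \<beta>_def C_def divide_right_mono)
    finally have "emeasure lborel W \<le> ennpowr (ennreal (C / \<alpha>) * layer_norm e U) p_crit" by (simp add: p1)
    then show ?thesis using W(1) sub by blast
  qed
  show ?thesis using main C by (intro exI[of _ C] conjI allI impI) auto
qed

lemma weak_type_layers:
  "\<exists>C>0. \<forall>U e \<alpha>. (\<forall>i. open (U i)) \<longrightarrow> 0 < \<alpha> \<longrightarrow>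
    (\<exists>W\<in>sets borel. {x. positive_maximal \<mu> (layers e U) x > ennreal \<alpha>} \<subseteq> W \<and>
      emeasure lborel W \<le> ennpowr (ennreal (C / \<alpha>) * layer_norm e U) p_crit)"
  using weak_type_layers_1 weak_type_layers_gt_1 p_crit_ge_1 by (metis less_eq_real_def)

text \<open>Discretised L^(p,1) quasinorm of the part of F above the height c.\<close>

definition level_norm :: "('a \<Rightarrow> real) \<Rightarrow> real \<Rightarrow> ennreal" where
  "level_norm F c = (\<Sum>i. ennreal (2 ^ i * c) * ennpowr (emeasure lebesgue {x. F x > 2 ^ i * c}) (1 / p_crit))"

text \<open>Outer regularity replaces the superlevel sets by open ones, so the majorant holds at
  every point and not only almost everywhere. The factor 4 is 2 for taking the upper end 2 ^ (i + 1)
  c of each dyadic range, times 2 from \<open>ennpowr_add_le\<close>.\<close>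

lemma level_cover:
  assumes F: "F \<in> borel_measurable lebesgue" and c: "c > 0" and t: "\<tau> > 0"
  obtains U where "\<And>i. open (U i)" "\<And>i. {x. F x > 2 ^ i * c} \<subseteq> U i"
    "layer_norm (\<lambda>i. 2 ^ (i + 1) * c) U \<le> 4 * level_norm F c + ennreal \<tau>"
    "\<And>x. F x > c \<Longrightarrow> ennreal (F x) \<le> layers (\<lambda>i. 2 ^ (i + 1) * c) U x"
proof -
  let ?p = p_crit
  have p0: "?p > 0" using p_crit_ge_1 by linarith
  define e where "e i = 2 ^ (i + 1) * c" for i :: nat
  have e0: "e i > 0" for i using c by (simp add: e_def)
  \<comment> \<open>Solves \<open>e i * 2 * k i = \<tau> / 2 ^ (i + 1)\<close>, so the errors add up
    to \<tau>; its p-th power is the excess measure allowed for the i-th cover.\<close>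
  define k where "k i = \<tau> / (e i * 2 * 2 ^ (i + 1))" for i :: nat
  have k0: "k i > 0" for i using t e0 by (simp add: k_def)
  define S where "S i = {x. F x > 2 ^ i * c}" for i :: nat
  have S: "S i \<in> sets lebesgue" for i
    unfolding S_def using measurable_sets[OF F, of "{2 ^ i * c<..}"] by (simp add: vimage_def)
  have "\<exists>U. open U \<and> S i \<subseteq> U \<and> emeasure lborel U \<le> emeasure lebesgue (S i) + ennreal (k i powr ?p)" for i
  proof -
    have "k i powr ?p > 0" using k0[of i] by simp
    then obtain T where T: "open T" "S i \<subseteq> T" "(T - S i) \<in> lmeasurable" "emeasure lebesgue (T - S i) < ennreal (k i powr ?p)"
      using sets_lebesgue_outer_open[OF S] by blast
    have "emeasure lborel T = emeasure lebesgue T" using T(1) by simp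
    also have "\<dots> = emeasure lebesgue (S i \<union> (T - S i))" using T(2) by (intro arg_cong[where f="emeasure lebesgue"]) auto
    also have "\<dots> \<le> emeasure lebesgue (S i) + emeasure lebesgue (T - S i)"
      using S T by (intro emeasure_subadditive) auto
    also have "\<dots> \<le> emeasure lebesgue (S i) + ennreal (k i powr ?p)"
      using T(4) by (intro add_left_mono) auto
    finally show ?thesis using T by blast
  qed
  then obtain U where U: "\<And>i. open (U i)" "\<And>i. S i \<subseteq> U i" "\<And>i. emeasure lborel (U i) \<le> emeasure lebesgue (S i) + ennreal (k i powr ?p)"
    by metis
  show ?thesis
  proof (rule that[OF U(1)])
    show "{x. F x > 2 ^ i * c} \<subseteq> U i" for i using U(2)[of i] by (simp add: S_def)
    have lay: "ennreal (e i) * ennpowr (emeasure lborel (U i)) (1 / ?p) \<le> 4 * (ennreal (2 ^ i * c) * ennpowr (emeasure lebesgue (S i)) (1 / ?p)) + ennreal (\<tau> * (1 / 2) ^ Suc i)" for i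
    proof -
      have "ennpowr (emeasure lborel (U i)) (1 / ?p) \<le> ennpowr (emeasure lebesgue (S i) + ennreal (k i powr ?p)) (1 / ?p)"
        using U(3) p0 by (intro ennpowr_mono) auto
      also have "\<dots> \<le> 2 * (ennpowr (emeasure lebesgue (S i)) (1 / ?p) + ennpowr (ennreal (k i powr ?p)) (1 / ?p))"
        using p_crit_ge_1 by (intro ennpowr_add_le) auto
      also have "ennpowr (ennreal (k i powr ?p)) (1 / ?p) = ennreal (k i)"
        using k0[of i] p0 by (simp add: ennpowr_ennreal powr_powr)
      finally have "ennreal (e i) * ennpowr (emeasure lborel (U i)) (1 / ?p)
        \<le> ennreal (e i) * (2 * (ennpowr (emeasure lebesgue (S i)) (1 / ?p) + ennreal (k i)))"
        by (intro mult_left_mono) auto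
      also have "\<dots> = (ennreal (e i) * 2) * ennpowr (emeasure lebesgue (S i)) (1 / ?p) + ennreal (e i) * 2 * ennreal (k i)"
        by (simp only: distrib_left mult.assoc)
      also have "ennreal (e i) * 2 = 4 * ennreal (2 ^ i * c)"
        using c by (simp add: e_def ennreal_mult'[symmetric] mult_ac flip: ennreal_numeral)
      also have "4 * ennreal (2 ^ i * c) * ennreal (k i) = ennreal (\<tau> * (1 / 2) ^ Suc i)"
        using c k0[of i] by (simp add: ennreal_mult'[symmetric] k_def e_def power_divide flip: ennreal_numeral)
      finally show ?thesis by (simp only: mult.assoc)
    qed
    have "layer_norm e U \<le> (\<Sum>i. 4 * (ennreal (2 ^ i * c) * ennpowr (emeasure lebesgue (S i)) (1 / ?p)) + ennreal (\<tau> * (1 / 2) ^ Suc i))"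
      unfolding layer_norm_def by (intro suminf_le lay) auto
    also have "\<dots> = 4 * level_norm F c + (\<Sum>i. ennreal (\<tau> * (1 / 2) ^ Suc i))"
      unfolding level_norm_def S_def by (subst suminf_add[symmetric]) (auto simp: mult_ac)
    also have "(\<Sum>i. ennreal (\<tau> * (1 / 2) ^ Suc i)) = ennreal \<tau>"
      using t sums_mult[OF power_half_series, of \<tau>] by (intro suminf_ennreal_eq) auto
    finally show "layer_norm (\<lambda>i. 2 ^ (i + 1) * c) U \<le> 4 * level_norm F c + ennreal \<tau>" by (simp add: e_def[abs_def])
    show "ennreal (F x) \<le> layers (\<lambda>i. 2 ^ (i + 1) * c) U x" if gt: "F x > c" for x
    proof -
      obtain j where j: "2 ^ j * c < F x" "F x \<le> 2 ^ (j + 1) * c" by (rule dyadic_sum_bound[OF c gt])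
      have "x \<in> U j" using U(2)[of j] j by (auto simp: S_def)
      then have "ennreal (F x) \<le> ennreal (2 ^ (j + 1) * c) * indicator (U j) x" using j by (simp add: ennreal_leI)
      also have "\<dots> \<le> layers (\<lambda>i. 2 ^ (i + 1) * c) U x"
        unfolding layers_def by (rule ennreal_le_suminf)
      finally show ?thesis .
    qed
  qed
qed

lemma space_dilate [simp]: "space (dilate t \<mu>) = UNIV" and sets_dilate [measurable_cong, simp]: "sets (dilate t \<mu>) = sets borel"
  by (auto simp: dilate_def)

lemma nn_integral_dilate:
  assumes [measurable]: "h \<in> borel_measurable borel"
  shows "(\<integral>\<^sup>+z. h z \<partial>dilate t \<mu>) = (\<integral>\<^sup>+y. h (t *\<^sub>R y) \<partial>\<mu>)"
  unfolding dilate_def by (intro nn_integral_distr) measurable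

text \<open>The bound |f| \<le> h is required at every point, because the dilates of \<mu> may
  charge Lebesgue-null sets. Where the average does not exist its value is 0 by convention and the
  inequality is trivial.\<close>

lemma maximal_function_le:
  assumes h [measurable]: "h \<in> borel_measurable borel" and le: "\<And>x. ennreal (cmod (f x)) \<le> h x"
  shows "maximal_function \<mu> f x \<le> positive_maximal \<mu> h x"
  unfolding maximal_function_def positive_maximal_def
proof (rule SUP_mono)
  fix t :: real assume t: "t \<in> {0<..}"
  have "ennreal (cmod (Defs.convolution f (dilate t \<mu>) x)) \<le> (\<integral>\<^sup>+z. ennreal (cmod (f (x - z))) \<partial>completion (dilate t \<mu>))"
    unfolding Defs.convolution_def
  proof (cases "integrable (completion (dilate t \<mu>)) (\<lambda>z. f (x - z))")
    case True
    then show "ennreal (cmod (\<integral>z. f (x - z) \<partial>completion (dilate t \<mu>))) \<le> (\<integral>\<^sup>+z. ennreal (cmod (f (x - z))) \<partial>completion (dilate t \<mu>))"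
      by (rule integral_norm_bound_ennreal)
  qed (simp add: not_integrable_integral_eq)
  also have "\<dots> \<le> (\<integral>\<^sup>+z. h (x - z) \<partial>completion (dilate t \<mu>))" by (intro nn_integral_mono le)
  also have "\<dots> = (\<integral>\<^sup>+z. h (x - z) \<partial>dilate t \<mu>)" by (rule nn_integral_completion)
  also have "\<dots> = (\<integral>\<^sup>+y. h (x - t *\<^sub>R y) \<partial>\<mu>)" by (intro nn_integral_dilate) measurable
  finally show "\<exists>t'\<in>{0<..}. ennreal (cmod (Defs.convolution f (dilate t \<mu>) x)) \<le> (\<integral>\<^sup>+y. h (x - t' *\<^sub>R y) \<partial>\<mu>)"
    using t by blast
qed

lemma positive_maximal_add_le:
  assumes [measurable]: "h \<in> borel_measurable borel"
  shows "positive_maximal \<mu> (\<lambda>x. c + h x) x \<le> c * ennreal mass + positive_maximal \<mu> h x"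
  unfolding positive_maximal_def
proof (rule SUP_least)
  fix t :: real assume t: "t \<in> {0<..}"
  have "(\<integral>\<^sup>+y. c + h (x - t *\<^sub>R y) \<partial>\<mu>) = c * ennreal mass + (\<integral>\<^sup>+y. h (x - t *\<^sub>R y) \<partial>\<mu>)"
    by (subst nn_integral_add) (auto simp: emeasure_mu_UNIV)
  also have "\<dots> \<le> c * ennreal mass + (SUP t\<in>{0<..}. \<integral>\<^sup>+y. h (x - t *\<^sub>R y) \<partial>\<mu>)"
    using t by (intro add_left_mono SUP_upper)
  finally show "(\<integral>\<^sup>+y. c + h (x - t *\<^sub>R y) \<partial>\<mu>) \<le> c * ennreal mass + (SUP t\<in>{0<..}. \<integral>\<^sup>+y. h (x - t *\<^sub>R y) \<partial>\<mu>)" .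
qed

text \<open>The part of f below c averages to at most c times the mass; the part above is dominated
  by layers whose norm is the level norm up to a constant and the error \<tau> of the open
  covers.\<close>

lemma weak_type_level:
  "\<exists>C>0. \<forall>f c \<alpha> \<tau>. f \<in> borel_measurable lebesgue \<longrightarrow> 0 < c \<longrightarrow> 0 < \<alpha> \<longrightarrow> 0 < \<tau> \<longrightarrow>
    (\<exists>W\<in>sets borel. {x. maximal_function \<mu> f x > ennreal (c * mass + \<alpha>)} \<subseteq> W \<and>
      emeasure lborel W \<le> ennpowr (ennreal (C / \<alpha>) * (level_norm (\<lambda>x. cmod (f x)) c + ennreal \<tau>)) p_crit)"
proof -
  obtain C where C: "C > 0" and wk: "\<forall>U e \<alpha>. (\<forall>i. open (U i)) \<longrightarrow> 0 < \<alpha> \<longrightarrow>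
    (\<exists>W\<in>sets borel. {x. positive_maximal \<mu> (layers e U) x > ennreal \<alpha>} \<subseteq> W \<and>
      emeasure lborel W \<le> ennpowr (ennreal (C / \<alpha>) * layer_norm e U) p_crit)"
    using weak_type_layers by blast
  have main: "\<exists>W\<in>sets borel. {x. maximal_function \<mu> f x > ennreal (c * mass + \<alpha>)} \<subseteq> W \<and>
      emeasure lborel W \<le> ennpowr (ennreal (4 * C / \<alpha>) * (level_norm (\<lambda>x. cmod (f x)) c + ennreal \<tau>)) p_crit"
    if f [measurable]: "f \<in> borel_measurable lebesgue" and c: "0 < c" and al: "0 < \<alpha>" and t: "0 < \<tau>" for f c \<alpha> \<tau>
  proof -
    let ?F = "\<lambda>x. cmod (f x)" and ?e = "\<lambda>i. 2 ^ (i + 1) * c"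
    have Fm: "?F \<in> borel_measurable lebesgue" by measurable
    obtain U where U: "\<And>i. open (U i)" "\<And>i. {x. ?F x > 2 ^ i * c} \<subseteq> U i"
      "layer_norm ?e U \<le> 4 * level_norm ?F c + ennreal \<tau>" "\<And>x. ?F x > c \<Longrightarrow> ennreal (?F x) \<le> layers ?e U x"
      by (rule level_cover[OF Fm c t]) blast
    have [measurable]: "layers ?e U \<in> borel_measurable borel" using U by (intro layers_measurable)
    have le: "ennreal (?F x) \<le> ennreal c + layers ?e U x" for x
      using U(4)[of x] by (cases "?F x > c") (auto simp: add_increasing add_increasing2 ennreal_leI)
    have "\<exists>W\<in>sets borel. {x. positive_maximal \<mu> (layers ?e U) x > ennreal \<alpha>} \<subseteq> W \<and>
      emeasure lborel W \<le> ennpowr (ennreal (C / \<alpha>) * layer_norm ?e U) p_crit"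
      by (rule wk[rule_format, OF U(1) al])
    then obtain W where W: "W \<in> sets borel" "{x. positive_maximal \<mu> (layers ?e U) x > ennreal \<alpha>} \<subseteq> W"
      "emeasure lborel W \<le> ennpowr (ennreal (C / \<alpha>) * layer_norm ?e U) p_crit"
      by blast
    have "{x. maximal_function \<mu> f x > ennreal (c * mass + \<alpha>)} \<subseteq> {x. positive_maximal \<mu> (layers ?e U) x > ennreal \<alpha>}"
    proof (rule Collect_mono, rule impI, rule ccontr)
      fix x assume gt: "maximal_function \<mu> f x > ennreal (c * mass + \<alpha>)" and "\<not> positive_maximal \<mu> (layers ?e U) x > ennreal \<alpha>"
      then have l: "positive_maximal \<mu> (layers ?e U) x \<le> ennreal \<alpha>" by simp
      have "maximal_function \<mu> f x \<le> positive_maximal \<mu> (\<lambda>x. ennreal c + layers ?e U x) x"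
        by (intro maximal_function_le le) measurable
      also have "\<dots> \<le> ennreal c * ennreal mass + positive_maximal \<mu> (layers ?e U) x"
        by (intro positive_maximal_add_le) measurable
      also have "\<dots> \<le> ennreal c * ennreal mass + ennreal \<alpha>" by (intro add_left_mono l)
      also have "\<dots> = ennreal (c * mass + \<alpha>)" using c al by (simp add: ennreal_mult ennreal_plus)
      finally show False using gt by simp
    qed
    with W(2) have "{x. maximal_function \<mu> f x > ennreal (c * mass + \<alpha>)} \<subseteq> W" by blast
    moreover have "ennpowr (ennreal (C / \<alpha>) * layer_norm ?e U) p_crit
      \<le> ennpowr (ennreal (4 * C / \<alpha>) * (level_norm ?F c + ennreal \<tau>)) p_crit"
    proof (rule ennpowr_mono)
      have "layer_norm ?e U \<le> 4 * (level_norm ?F c + ennreal \<tau>)"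
      proof -
        have "1 * ennreal \<tau> \<le> 4 * ennreal \<tau>" by (intro mult_right_mono) auto
        then show ?thesis using U(3) by (auto simp: distrib_left intro: order_trans add_left_mono)
      qed
      then have "ennreal (C / \<alpha>) * layer_norm ?e U \<le> ennreal (C / \<alpha>) * (4 * (level_norm ?F c + ennreal \<tau>))"
        by (intro mult_left_mono) auto
      also have "\<dots> = ennreal (4 * C / \<alpha>) * (level_norm ?F c + ennreal \<tau>)"
        using C al by (simp add: mult.assoc[symmetric] ennreal_mult'[symmetric] mult.commute flip: ennreal_numeral)
      finally show "ennreal (C / \<alpha>) * layer_norm ?e U \<le> ennreal (4 * C / \<alpha>) * (level_norm ?F c + ennreal \<tau>)" .
    qed (use p_crit_ge_1 in simp)
    ultimately show ?thesis using W(1,3) by (intro bexI[of _ W]) auto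
  qed
  show ?thesis using main C by (intro exI[of _ "4 * C"] conjI allI impI) auto
qed

end

section \<open>Existence of the averages and measurability of the maximal function\<close>

text \<open>Preimages under f and g differ inside a null set, all of whose subsets are measurable
  for the completion.\<close>

lemma borel_measurable_completion_AE_eq:
  assumes g: "g \<in> borel_measurable M" and ae: "AE x in M. f x = g x"
  shows "f \<in> borel_measurable (completion M)"
proof (rule measurableI)
  fix A :: "'b set" assume A: "A \<in> sets borel"
  obtain Z where Z: "{x \<in> space M. \<not> f x = g x} \<subseteq> Z" "emeasure M Z = 0" "Z \<in> sets M"
    using ae by (rule AE_E)
  have "f -` A \<inter> space (completion M) = (g -` A \<inter> space M - Z) \<union> (f -` A \<inter> space M \<inter> Z)"
    using Z(1) by auto
  moreover have "g -` A \<inter> space M - Z \<in> sets M" using g A Z by (intro sets.Diff measurable_sets) auto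
  ultimately show "f -` A \<inter> space (completion M) \<in> sets (completion M)"
    using Z by (intro sets_completionI[of _ "g -` A \<inter> space M - Z" "f -` A \<inter> space M \<inter> Z" Z]) (auto simp: null_sets_def)
qed simp

context decaying_measure
begin

lemma finite_measure_dilate: "finite_measure (dilate t \<mu>)"
  unfolding dilate_def by (intro finite_measure_distr) measurable

lemma AE_dilate: "t > 0 \<Longrightarrow> AE z in dilate t \<mu>. norm z \<le> t * R"
proof -
  assume t: "t > 0"
  have "AE y in \<mu>. norm (t *\<^sub>R y) \<le> t * R"
    using AE_support by eventually_elim (use t in simp)
  then show ?thesis unfolding dilate_def by (subst AE_distr_iff) auto
qed

lemma continuous_convolution:
  fixes g :: "'a \<Rightarrow> complex"
  assumes g: "continuous_on UNIV g" and B: "\<And>x. cmod (g x) \<le> B"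
  shows "continuous_on UNIV (\<lambda>x. Defs.convolution g (dilate t \<mu>) x)"
proof -
  have [measurable]: "g \<in> borel_measurable borel" using g by (rule borel_measurable_continuous_onI)
  have eq: "Defs.convolution g (dilate t \<mu>) x = (\<integral>y. g (x - t *\<^sub>R y) \<partial>\<mu>)" for x
    by (rule convolution_dilate[OF sets_mu]) measurable
  show ?thesis
    unfolding eq continuous_on_sequentially
  proof (intro allI impI ballI)
    fix X :: "nat \<Rightarrow> 'a" and x assume "(\<forall>n. X n \<in> UNIV) \<and> X \<longlonglongrightarrow> x"
    then have X: "X \<longlonglongrightarrow> x" by simp
    have "(\<lambda>n. \<integral>y. g (X n - t *\<^sub>R y) \<partial>\<mu>) \<longlonglongrightarrow> (\<integral>y. g (x - t *\<^sub>R y) \<partial>\<mu>)"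
    proof (rule integral_dominated_convergence[where w="\<lambda>_. B"])
      show "AE y in \<mu>. (\<lambda>n. g (X n - t *\<^sub>R y)) \<longlonglongrightarrow> g (x - t *\<^sub>R y)"
      proof (rule AE_I2)
        fix y
        have lim: "(\<lambda>n. X n - t *\<^sub>R y) \<longlonglongrightarrow> x - t *\<^sub>R y" by (intro tendsto_intros X)
        have "isCont g (x - t *\<^sub>R y)" using g by (simp add: continuous_on_eq_continuous_at)
        then show "(\<lambda>n. g (X n - t *\<^sub>R y)) \<longlonglongrightarrow> g (x - t *\<^sub>R y)"
          by (rule isCont_tendsto_compose[OF _ lim])
      qed
    qed (use B in auto)
    then show "((\<lambda>x. \<integral>y. g (x - t *\<^sub>R y) \<partial>\<mu>) \<circ> X) \<longlonglongrightarrow> (\<integral>y. g (x - t *\<^sub>R y) \<partial>\<mu>)" by (simp add: o_def)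
  qed
qed

text \<open>For t \<le> T the average at x only sees the ball of radius |x| + T R around 0, so an
  approximation of f on one large ball serves all these t at once.\<close>

definition local_maximal :: "real \<Rightarrow> ('a \<Rightarrow> complex) \<Rightarrow> 'a \<Rightarrow> ennreal" where
  "local_maximal T f x = (SUP t\<in>{0<..T}. ennreal (cmod (Defs.convolution f (dilate t \<mu>) x)))"

lemma maximal_function_eq: "maximal_function \<mu> f x = (SUP n. local_maximal (real n) f x)"
  unfolding maximal_function_def local_maximal_def
proof (rule antisym; rule SUP_least)
  fix t :: real assume t: "t \<in> {0<..}"
  obtain n where n: "t \<le> real n" using real_arch_simple by blast
  have "ennreal (cmod (Defs.convolution f (dilate t \<mu>) x)) \<le> (SUP t\<in>{0<..real n}. ennreal (cmod (Defs.convolution f (dilate t \<mu>) x)))"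
    using t n by (intro SUP_upper) auto
  also have "\<dots> \<le> (SUP n. SUP t\<in>{0<..real n}. ennreal (cmod (Defs.convolution f (dilate t \<mu>) x)))"
    by (intro SUP_upper) simp
  finally show "ennreal (cmod (Defs.convolution f (dilate t \<mu>) x)) \<le> (SUP n. SUP t\<in>{0<..real n}. ennreal (cmod (Defs.convolution f (dilate t \<mu>) x)))" .
next
  fix n :: nat
  show "(SUP t\<in>{0<..real n}. ennreal (cmod (Defs.convolution f (dilate t \<mu>) x))) \<le> (SUP t\<in>{0<..}. ennreal (cmod (Defs.convolution f (dilate t \<mu>) x)))"
    by (intro SUP_subset_mono) auto
qed

text \<open>Each average is continuous in x, and the superlevel set of the supremum is a union of
  open sets.\<close>

lemma local_maximal_measurable:
  fixes g :: "'a \<Rightarrow> complex"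
  assumes g: "continuous_on UNIV g" and B: "\<And>x. cmod (g x) \<le> B"
  shows "local_maximal T g \<in> borel_measurable borel"
proof (rule borel_measurableI_greater)
  fix c :: ennreal
  have o: "open {x. c < ennreal (cmod (Defs.convolution g (dilate t \<mu>) x))}" for t
  proof -
    have "continuous_on UNIV (\<lambda>x. ennreal (cmod (Defs.convolution g (dilate t \<mu>) x)))"
      by (intro continuous_on_ennreal continuous_on_norm continuous_convolution[OF g B])
    then have "open ((\<lambda>x. ennreal (cmod (Defs.convolution g (dilate t \<mu>) x))) -` {c<..})"
      by (intro open_vimage) auto
    then show ?thesis by (simp add: vimage_def)
  qed
  have "{x. c < local_maximal T g x} = (\<Union>t\<in>{0<..T}. {x. c < ennreal (cmod (Defs.convolution g (dilate t \<mu>) x))})"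
    by (auto simp: local_maximal_def less_SUP_iff)
  then have "open {x. c < local_maximal T g x}" using o by auto
  then show "{x \<in> space borel. c < local_maximal T g x} \<in> sets borel" by simp
qed

text \<open>Raising c by the factor 2 ^ K removes the first K terms of a convergent series.\<close>

lemma level_norm_tail:
  assumes fin: "level_norm F c < \<infinity>" and k: "\<kappa> > 0"
  shows "\<exists>K::nat. level_norm F (2 ^ K * c) \<le> ennreal \<kappa>"
proof -
  define A where "A i = ennreal (2 ^ i * c) * ennpowr (emeasure lebesgue {x. F x > 2 ^ i * c}) (1 / p_crit)" for i :: nat
  define B where "B i = enn2real (A i)" for i
  have B0: "B i \<ge> 0" for i by (simp add: B_def)
  have "(\<Sum>i. A i) < \<infinity>" using fin by (simp add: level_norm_def A_def)
  moreover have "A i \<le> (\<Sum>i. A i)" for i by (rule ennreal_le_suminf)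
  ultimately have AB: "A i = ennreal (B i)" for i
    unfolding B_def by (metis ennreal_enn2real infinity_ennreal_def order_le_less_trans)
  have sB: "summable B"
    using \<open>(\<Sum>i. A i) < \<infinity>\<close> B0 unfolding AB by (intro summable_suminf_not_top) auto
  obtain N where N: "\<forall>n\<ge>N. norm (\<Sum>i. B (i + n)) < \<kappa>" using suminf_exist_split[OF k sB] by blast
  have "level_norm F (2 ^ N * c) = (\<Sum>i. A (i + N))"
    unfolding level_norm_def A_def by (simp add: power_add mult.assoc)
  also have "\<dots> = ennreal (\<Sum>i. B (i + N))"
    unfolding AB using B0 sB by (intro suminf_ennreal2 summable_ignore_initial_segment) auto
  also have "\<dots> \<le> ennreal \<kappa>" using N by (intro ennreal_leI) (auto simp: abs_less_iff less_imp_le)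
  finally show ?thesis by blast
qed

lemma positive_maximal_le_3:
  assumes [measurable]: "h\<^sub>1 \<in> borel_measurable borel" "V \<in> sets borel"
  shows "positive_maximal \<mu> (\<lambda>z. h\<^sub>1 z + c\<^sub>1 + c\<^sub>2 * indicator V z) x
    \<le> positive_maximal \<mu> h\<^sub>1 x + c\<^sub>1 * ennreal mass + c\<^sub>2 * positive_maximal \<mu> (indicator V) x"
  unfolding positive_maximal_def
proof (rule SUP_least)
  fix t :: real assume t: "t \<in> {0<..}"
  have "(\<integral>\<^sup>+y. h\<^sub>1 (x - t *\<^sub>R y) + c\<^sub>1 + c\<^sub>2 * indicator V (x - t *\<^sub>R y) \<partial>\<mu>)
    = (\<integral>\<^sup>+y. h\<^sub>1 (x - t *\<^sub>R y) + c\<^sub>1 \<partial>\<mu>) + (\<integral>\<^sup>+y. c\<^sub>2 * indicator V (x - t *\<^sub>R y) \<partial>\<mu>)"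
    by (intro nn_integral_add) measurable
  also have "(\<integral>\<^sup>+y. h\<^sub>1 (x - t *\<^sub>R y) + c\<^sub>1 \<partial>\<mu>) = (\<integral>\<^sup>+y. h\<^sub>1 (x - t *\<^sub>R y) \<partial>\<mu>) + c\<^sub>1 * ennreal mass"
    by (subst nn_integral_add) (auto simp: emeasure_mu_UNIV)
  also have "(\<integral>\<^sup>+y. c\<^sub>2 * indicator V (x - t *\<^sub>R y) \<partial>\<mu>) = c\<^sub>2 * (\<integral>\<^sup>+y. indicator V (x - t *\<^sub>R y) \<partial>\<mu>)"
    by (intro nn_integral_cmult) measurable
  finally show "(\<integral>\<^sup>+y. h\<^sub>1 (x - t *\<^sub>R y) + c\<^sub>1 + c\<^sub>2 * indicator V (x - t *\<^sub>R y) \<partial>\<mu>)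
    \<le> (SUP t\<in>{0<..}. \<integral>\<^sup>+y. h\<^sub>1 (x - t *\<^sub>R y) \<partial>\<mu>) + c\<^sub>1 * ennreal mass + c\<^sub>2 * (SUP t\<in>{0<..}. \<integral>\<^sup>+y. indicator V (x - t *\<^sub>R y) \<partial>\<mu>)"
    using t by (auto intro!: add_mono mult_left_mono SUP_upper2[of t])
qed

text \<open>A measurable function is an almost everywhere limit of continuous ones; on a ball this
  gives convergence in measure, and the exceptional set is enclosed in an open set by outer
  regularity.\<close>

lemma continuous_approximation:
  fixes F :: "'a \<Rightarrow> complex"
  assumes F: "F \<in> borel_measurable lebesgue" and M: "M > 0" "\<And>x. cmod (F x) \<le> M"
    and d: "\<delta> > 0" and k: "\<kappa> > 0"
  shows "\<exists>g V. continuous_on UNIV g \<and> (\<forall>x. cmod (g x) \<le> M) \<and> open V \<and> emeasure lborel V \<le> ennreal \<kappa> \<and>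
    (\<forall>x\<in>ball 0 r. x \<notin> V \<longrightarrow> cmod (F x - g x) \<le> \<delta>)"
proof -
  have "F measurable_on UNIV" by (rule lebesgue_measurable_imp_measurable_on[OF F]) simp
  then obtain N g where N: "negligible N" and g: "\<And>n. continuous_on UNIV (g n)" and lim: "\<And>x. x \<notin> N \<Longrightarrow> (\<lambda>n. g n x) \<longlonglongrightarrow> F x"
    by (auto simp: measurable_on_def)
  \<comment> \<open>Radial retraction onto the disc of radius M; it keeps the approximants bounded
    by M without changing their limit.\<close>
  define \<phi> where "\<phi> z = (M / max M (cmod z)) *\<^sub>R z" for z :: complex
  have \<phi>c: "continuous_on UNIV \<phi>"
    unfolding \<phi>_def using M(1) by (intro continuous_intros) (auto simp: max_def)
  have \<phi>b: "cmod (\<phi> z) \<le> M" for z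
    using M(1) by (auto simp: \<phi>_def max_def field_simps)
  have \<phi>id: "\<phi> z = z" if "cmod z \<le> M" for z using that M(1) by (simp add: \<phi>_def max_def)
  define G where "G n x = \<phi> (g n x)" for n x
  have Gc: "continuous_on UNIV (G n)" for n
    unfolding G_def using continuous_on_compose2[OF \<phi>c g] by simp
  have [measurable]: "G n \<in> borel_measurable borel" for n using Gc by (rule borel_measurable_continuous_onI)
  have GF: "(\<lambda>n. G n x) \<longlonglongrightarrow> F x" if "x \<notin> N" for x
  proof -
    have "isCont \<phi> (F x)" using \<phi>c by (simp add: continuous_on_eq_continuous_at)
    then have "(\<lambda>n. \<phi> (g n x)) \<longlonglongrightarrow> \<phi> (F x)" by (rule isCont_tendsto_compose[OF _ lim[OF that]])
    then show ?thesis using \<phi>id[OF M(2)] by (simp add: G_def)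
  qed
  define E where "E n = {x\<in>ball 0 r. \<delta> < cmod (F x - G n x)}" for n
  note [measurable] = F
  have [measurable]: "G n \<in> borel_measurable lebesgue" for n by (simp add: measurable_completion)
  have [measurable]: "E n \<in> sets lebesgue" for n
  proof -
    have "E n = ball 0 r \<inter> {x\<in>space lebesgue. \<delta> < cmod (F x - G n x)}" by (auto simp: E_def)
    moreover have "ball 0 r \<in> sets (lebesgue :: 'a measure)" by simp
    moreover have "{x\<in>space lebesgue. \<delta> < cmod (F x - G n x)} \<in> sets lebesgue" by measurable
    ultimately show ?thesis by (simp only: sets.Int)
  qed
  have "(\<lambda>n. \<integral>\<^sup>+x. indicator (E n) x \<partial>lebesgue) \<longlonglongrightarrow> (\<integral>\<^sup>+x. 0 \<partial>(lebesgue :: 'a measure))"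
  proof (rule nn_integral_dominated_convergence[where w="indicator (ball 0 r)"])
    show "(\<integral>\<^sup>+x. indicator (ball 0 r) x \<partial>(lebesgue :: 'a measure)) < \<infinity>"
      using emeasure_lborel_ball_finite[of "0::'a" r] by simp
    show "AE x in lebesgue. indicator (E j) x \<le> (indicator (ball 0 r) x :: ennreal)" for j
      by (intro AE_I2) (auto simp: E_def split: split_indicator)
    have "AE x in lebesgue. x \<notin> N" using N by (intro AE_not_in) (simp add: negligible_iff_null_sets)
    then show "AE x in lebesgue. (\<lambda>n. indicator (E n) x :: ennreal) \<longlonglongrightarrow> 0"
    proof eventually_elim
      case (elim x)
      have "(\<lambda>n. F x - G n x) \<longlonglongrightarrow> F x - F x" by (intro tendsto_intros GF elim)
      then have "(\<lambda>n. cmod (F x - G n x)) \<longlonglongrightarrow> 0" by (simp add: tendsto_norm_zero)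
      then have "\<forall>\<^sub>F n in sequentially. cmod (F x - G n x) < \<delta>" using d by (rule order_tendstoD)
      then have "\<forall>\<^sub>F n in sequentially. (indicator (E n) x :: ennreal) = 0"
        by eventually_elim (auto simp: E_def)
      then show ?case by (rule tendsto_eventually)
    qed
    show "indicator (ball 0 r) \<in> borel_measurable (lebesgue :: 'a measure)" by (intro borel_measurable_indicator) simp
  qed auto
  then have "(\<lambda>n. emeasure lebesgue (E n)) \<longlonglongrightarrow> 0" by simp
  then have "\<forall>\<^sub>F n in sequentially. emeasure lebesgue (E n) < ennreal (\<kappa> / 2)"
    using k by (intro order_tendstoD) auto
  then obtain n where n: "emeasure lebesgue (E n) < ennreal (\<kappa> / 2)"
    by (meson eventually_False_sequentially eventually_mono)
  have "\<kappa> / 2 > 0" using k by simp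
  then obtain T where T: "open T" "E n \<subseteq> T" "(T - E n) \<in> lmeasurable" "emeasure lebesgue (T - E n) < ennreal (\<kappa> / 2)"
    using sets_lebesgue_outer_open[of "E n" "\<kappa> / 2"] by auto
  have "emeasure lborel T = emeasure lebesgue (E n \<union> (T - E n))"
    using T by (simp add: Un_absorb1)
  also have "\<dots> \<le> emeasure lebesgue (E n) + emeasure lebesgue (T - E n)"
    using T by (intro emeasure_subadditive) auto
  also have "\<dots> \<le> ennreal (\<kappa> / 2) + ennreal (\<kappa> / 2)" using n T(4) by (intro add_mono) auto
  also have "\<dots> = ennreal \<kappa>" using k by (simp add: ennreal_plus[symmetric] del: ennreal_plus)
  finally have "emeasure lborel T \<le> ennreal \<kappa>" .
  moreover have "cmod (F x - G n x) \<le> \<delta>" if "x \<in> ball 0 r" "x \<notin> T" for x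
    using that T(2) by (auto simp: E_def not_less[symmetric])
  ultimately show ?thesis
    using Gc[of n] T(1) \<phi>b by (intro exI[of _ "G n"] exI[of _ T]) (auto simp: G_def)
qed

text \<open>f differs from g by its part above a large height M, dominated by layers of small norm,
  by an error \<open>\<delta>'\<close>, and by at most 2 M on the open set V. Each of the three
  contributes at most \<delta> / 3 to the maximal function, outside two exceptional sets of measure
  at most \<delta> / 2.\<close>

lemma maximal_approximation:
  fixes f :: "'a \<Rightarrow> complex"
  assumes f [measurable]: "f \<in> borel_measurable lebesgue" and c: "c > 0"
    and fin: "level_norm (\<lambda>x. cmod (f x)) c < \<infinity>" and d: "\<delta> > 0"
  shows "\<exists>g h W B. continuous_on UNIV g \<and> (\<forall>x. cmod (g x) \<le> B) \<and> h \<in> borel_measurable borel \<and>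
    (\<forall>x\<in>ball 0 r. ennreal (cmod (f x - g x)) \<le> h x) \<and> W \<in> sets borel \<and>
    {x. positive_maximal \<mu> h x > ennreal \<delta>} \<subseteq> W \<and> emeasure lborel W \<le> ennreal \<delta>"
proof -
  let ?p = p_crit
  have p0: "?p > 0" using p_crit_ge_1 by linarith
  obtain C where C: "C > 0" and wk: "\<forall>U e \<alpha>. (\<forall>i. open (U i)) \<longrightarrow> 0 < \<alpha> \<longrightarrow>
    (\<exists>W\<in>sets borel. {x. positive_maximal \<mu> (layers e U) x > ennreal \<alpha>} \<subseteq> W \<and>
      emeasure lborel W \<le> ennpowr (ennreal (C / \<alpha>) * layer_norm e U) p_crit)"
    using weak_type_layers by blast
  obtain C0 where C0: "C0 \<ge> 0" and rw: "\<forall>U \<alpha>. open U \<longrightarrow> 0 < \<alpha> \<longrightarrow>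
    emeasure lborel {x. positive_maximal \<mu> (indicator U) x > ennreal \<alpha>} \<le> ennreal (C0 * \<alpha> powr (- p_crit)) * emeasure lborel U"
    using restricted_weak_type by blast
  \<comment> \<open>Chosen so that 3 C / \<delta> times 5 \<kappa> equals (\<delta> / 2)^(1/p); the
    5 is the factor 4 of \<open>level_cover\<close> plus 1 for its error term.\<close>
  define \<kappa> where "\<kappa> = (\<delta> / 2) powr (1 / ?p) * \<delta> / (15 * C)"
  have k: "\<kappa> > 0" using d C by (simp add: \<kappa>_def)
  obtain K :: nat where K: "level_norm (\<lambda>x. cmod (f x)) (2 ^ K * c) \<le> ennreal \<kappa>"
    using level_norm_tail[OF fin k] by blast
  define M where "M = 2 ^ K * c"
  have M: "M > 0" using c by (simp add: M_def)
  let ?e = "\<lambda>i. 2 ^ (i + 1) * M"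
  have Fm: "(\<lambda>x. cmod (f x)) \<in> borel_measurable lebesgue" by measurable
  obtain U where U: "\<And>i. open (U i)" "\<And>i. {x. cmod (f x) > 2 ^ i * M} \<subseteq> U i"
    "layer_norm ?e U \<le> 4 * level_norm (\<lambda>x. cmod (f x)) M + ennreal \<kappa>" "\<And>x. cmod (f x) > M \<Longrightarrow> ennreal (cmod (f x)) \<le> layers ?e U x"
    by (rule level_cover[OF Fm M k]) blast
  have Um [measurable]: "layers ?e U \<in> borel_measurable borel" using U by (intro layers_measurable)
  have UN: "layer_norm ?e U \<le> ennreal (5 * \<kappa>)"
  proof -
    have "layer_norm ?e U \<le> 4 * ennreal \<kappa> + ennreal \<kappa>"
      by (rule order_trans[OF U(3)]) (intro add_right_mono mult_left_mono, use K in \<open>simp_all add: M_def\<close>)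
    also have "\<dots> = ennreal (4 * \<kappa> + \<kappa>)"
    proof -
      have "ennreal (4 * \<kappa> + \<kappa>) = ennreal (4 * \<kappa>) + ennreal \<kappa>" using k by (intro ennreal_plus) auto
      also have "ennreal (4 * \<kappa>) = ennreal 4 * ennreal \<kappa>" using k by (intro ennreal_mult) auto
      finally show ?thesis by simp
    qed
    also have "4 * \<kappa> + \<kappa> = 5 * \<kappa>" by simp
    finally show ?thesis .
  qed
  have d3: "\<delta> / 3 > 0" using d by simp
  have "\<exists>W\<in>sets borel. {x. positive_maximal \<mu> (layers ?e U) x > ennreal (\<delta> / 3)} \<subseteq> W \<and>
      emeasure lborel W \<le> ennpowr (ennreal (C / (\<delta> / 3)) * layer_norm ?e U) p_crit"
    by (rule wk[rule_format, OF U(1) d3])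
  then obtain W1 where W1: "W1 \<in> sets borel" "{x. positive_maximal \<mu> (layers ?e U) x > ennreal (\<delta> / 3)} \<subseteq> W1"
    "emeasure lborel W1 \<le> ennpowr (ennreal (C / (\<delta> / 3)) * layer_norm ?e U) p_crit"
    by blast
  have W1m: "emeasure lborel W1 \<le> ennreal (\<delta> / 2)"
  proof -
    have "ennpowr (ennreal (C / (\<delta> / 3)) * layer_norm ?e U) ?p \<le> ennpowr (ennreal (C / (\<delta> / 3)) * ennreal (5 * \<kappa>)) ?p"
      using p0 by (intro ennpowr_mono mult_left_mono UN) auto
    also have "ennreal (C / (\<delta> / 3)) * ennreal (5 * \<kappa>) = ennreal ((\<delta> / 2) powr (1 / ?p))"
      using C d k by (simp add: ennreal_mult[symmetric] \<kappa>_def)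
    also have "ennpowr \<dots> ?p = ennreal (\<delta> / 2)" using d p0 by (simp add: ennpowr_ennreal powr_powr)
    finally show ?thesis using W1(3) by (rule order_trans[rotated])
  qed
  define F where "F x = (if cmod (f x) \<le> M then f x else 0)" for x
  have Fm': "F \<in> borel_measurable lebesgue" unfolding F_def by measurable
  have FM: "cmod (F x) \<le> M" for x using M by (simp add: F_def)
  define \<delta>' where "\<delta>' = \<delta> / (3 * (mass + 1))"
  have mp: "mass + 1 > 0" using mass_nonneg by linarith
  have d': "\<delta>' > 0" using d mp by (simp add: \<delta>'_def)
  \<comment> \<open>Gives 2 M \<beta> = \<delta> / 3; the set V is then taken so small that the
    restricted weak type bound at level \<beta> yields measure at most \<delta> / 2.\<close>
  define \<beta> where "\<beta> = \<delta> / (6 * M)"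
  have b0: "\<beta> > 0" using d M by (simp add: \<beta>_def)
  define Q where "Q = C0 * \<beta> powr (- ?p) + 1"
  have Q: "Q > 0" using C0 by (simp add: Q_def add_nonneg_pos)
  have kq: "\<delta> / (2 * Q) > 0" using d Q by simp
  obtain g V where g: "continuous_on UNIV g" "\<forall>x. cmod (g x) \<le> M" and V: "open V" "emeasure lborel V \<le> ennreal (\<delta> / (2 * Q))"
    and gV: "\<forall>x\<in>ball 0 r. x \<notin> V \<longrightarrow> cmod (F x - g x) \<le> \<delta>'"
    using continuous_approximation[OF Fm' M FM d' kq, of r] by blast
  have [measurable]: "V \<in> sets borel" using V by simp
  define W2 where "W2 = {x. positive_maximal \<mu> (indicator V) x > ennreal \<beta>}"
  have W2: "W2 \<in> sets borel" unfolding W2_def using open_superlevel[OF V(1)] by (rule borel_open)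
  have W2m: "emeasure lborel W2 \<le> ennreal (\<delta> / 2)"
  proof -
    have "emeasure lborel W2 \<le> ennreal (C0 * \<beta> powr (- ?p)) * emeasure lborel V"
      unfolding W2_def using rw V(1) b0 by blast
    also have "\<dots> \<le> ennreal Q * ennreal (\<delta> / (2 * Q))" by (intro mult_mono V(2) ennreal_leI) (auto simp: Q_def)
    also have "\<dots> = ennreal (\<delta> / 2)" using Q d by (simp add: ennreal_mult[symmetric])
    finally show ?thesis .
  qed
  define h where "h x = layers ?e U x + ennreal \<delta>' + ennreal (2 * M) * indicator V x" for x
  have hm: "h \<in> borel_measurable borel" unfolding h_def by measurable
  have fh: "ennreal (cmod (f x - g x)) \<le> h x" if x: "x \<in> ball 0 r" for x
  proof -
    have 1: "ennreal (cmod (f x - F x)) \<le> layers ?e U x" using U(4)[of x] by (auto simp: F_def not_le)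
    have 2: "ennreal (cmod (F x - g x)) \<le> ennreal \<delta>' + ennreal (2 * M) * indicator V x"
    proof (cases "x \<in> V")
      case True
      have "cmod (F x - g x) \<le> 2 * M" using norm_triangle_ineq4[of "F x" "g x"] FM[of x] g(2)[rule_format, of x] by linarith
      then show ?thesis using True d' by (simp add: add_increasing ennreal_leI)
    next
      case False
      then show ?thesis using gV x by (simp add: ennreal_leI)
    qed
    have "cmod (f x - g x) \<le> cmod (f x - F x) + cmod (F x - g x)" by (rule norm_diff_triangle_ineq[of "f x" "F x" "F x" "g x", simplified])
    then have "ennreal (cmod (f x - g x)) \<le> ennreal (cmod (f x - F x)) + ennreal (cmod (F x - g x))"
      by (simp add: ennreal_plus[symmetric] ennreal_leI del: ennreal_plus)
    also have "\<dots> \<le> layers ?e U x + (ennreal \<delta>' + ennreal (2 * M) * indicator V x)" by (intro add_mono 1 2)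
    finally show ?thesis by (simp add: h_def add.assoc)
  qed
  have sub: "{x. positive_maximal \<mu> h x > ennreal \<delta>} \<subseteq> W1 \<union> W2"
  proof (rule subsetI, rule ccontr)
    fix x assume gt: "x \<in> {x. positive_maximal \<mu> h x > ennreal \<delta>}" and n: "x \<notin> W1 \<union> W2"
    have 1: "positive_maximal \<mu> (layers ?e U) x \<le> ennreal (\<delta> / 3)"
      using n W1(2) by (metis CollectI UnI1 linorder_not_less subsetD)
    have 2: "positive_maximal \<mu> (indicator V) x \<le> ennreal \<beta>"
      using n unfolding W2_def by (metis (mono_tags, lifting) CollectI UnI2 linorder_not_less)
    have "positive_maximal \<mu> h x \<le> positive_maximal \<mu> (layers ?e U) x + ennreal \<delta>' * ennreal mass + ennreal (2 * M) * positive_maximal \<mu> (indicator V) x"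
      unfolding h_def by (rule positive_maximal_le_3) measurable
    also have "\<dots> \<le> ennreal (\<delta> / 3) + ennreal \<delta>' * ennreal mass + ennreal (2 * M) * ennreal \<beta>"
      by (intro add_mono mult_left_mono 1 2 order_refl) auto
    also have "\<dots> = ennreal (\<delta> / 3 + \<delta>' * mass + 2 * M * \<beta>)"
      using d d' M b0 by (simp add: ennreal_mult ennreal_plus)
    also have "\<dots> \<le> ennreal \<delta>"
    proof (rule ennreal_leI)
      have "\<delta>' * mass \<le> \<delta>' * (mass + 1)" using d' by (intro mult_left_mono) auto
      also have "\<dots> = \<delta> / 3"
      proof -
        have "\<delta> / (3 * q) * q = \<delta> / 3" if "q > 0" for q :: real using that by simp
        from this[OF mp] show ?thesis by (simp only: \<delta>'_def)
      qed
      finally have "\<delta>' * mass \<le> \<delta> / 3" .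
      moreover have "2 * M * \<beta> = \<delta> / 3" using M by (simp add: \<beta>_def)
      ultimately show "\<delta> / 3 + \<delta>' * mass + 2 * M * \<beta> \<le> \<delta>" by linarith
    qed
    finally show False using gt by simp
  qed
  have "emeasure lborel (W1 \<union> W2) \<le> emeasure lborel W1 + emeasure lborel W2"
    using W1(1) W2 by (intro emeasure_subadditive) auto
  also have "\<dots> \<le> ennreal (\<delta> / 2) + ennreal (\<delta> / 2)" by (intro add_mono W1m W2m)
  also have "\<dots> = ennreal \<delta>" using d by (simp add: ennreal_plus[symmetric] del: ennreal_plus)
  finally have Wm: "emeasure lborel (W1 \<union> W2) \<le> ennreal \<delta>" .
  have "continuous_on UNIV g \<and> (\<forall>x. cmod (g x) \<le> M) \<and> h \<in> borel_measurable borel \<and>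
    (\<forall>x\<in>ball 0 r. ennreal (cmod (f x - g x)) \<le> h x) \<and> W1 \<union> W2 \<in> sets borel \<and>
    {x. positive_maximal \<mu> h x > ennreal \<delta>} \<subseteq> W1 \<union> W2 \<and> emeasure lborel (W1 \<union> W2) \<le> ennreal \<delta>"
    using g hm fh W1(1) W2 sub Wm by (intro conjI ballI) (simp_all add: sets.Un)
  then show ?thesis by blast
qed

end

section \<open>Pointwise convergence of the averages\<close>

context decaying_measure
begin

text \<open>At a point x where the maximal functions of the majorants h n are eventually below
  2^(-n), these majorants have summable averages, so the continuous g n converge to f around x
  almost everywhere for the dilated measure. This makes f (x - z) measurable for the completion, and
  the averages of f and g n differ by at most that of h n.\<close>

lemma convolution_approx:
  fixes f :: "'a \<Rightarrow> complex" and g :: "nat \<Rightarrow> 'a \<Rightarrow> complex"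
  assumes g: "\<And>n. continuous_on UNIV (g n)" and B: "\<And>n x. cmod (g n x) \<le> B n"
    and h [measurable]: "\<And>n. h n \<in> borel_measurable borel"
    and fg: "\<And>n x. x \<in> ball 0 (real n) \<Longrightarrow> ennreal (cmod (f x - g n x)) \<le> h n x"
    and hx: "\<And>n. n \<ge> n\<^sub>0 \<Longrightarrow> positive_maximal \<mu> (h n) x \<le> ennreal ((1 / 2) ^ n)"
    and t: "t > 0" and n1: "n\<^sub>0 \<le> n\<^sub>1" "norm x + t * R < real n\<^sub>1"
  shows "convolution_exists f (dilate t \<mu>) x"
    and "\<And>n. n \<ge> n\<^sub>1 \<Longrightarrow> cmod (Defs.convolution f (dilate t \<mu>) x - Defs.convolution (g n) (dilate t \<mu>) x) \<le> (1 / 2) ^ n"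
proof -
  let ?\<nu> = "dilate t \<mu>"
  interpret nu: finite_measure ?\<nu> by (rule finite_measure_dilate)
  have [measurable]: "g n \<in> borel_measurable borel" for n using g by (rule borel_measurable_continuous_onI)
  \<comment> \<open>Only z with |z| \<le> t R matter, and then x - z lies in the ball on which g n
    approximates f.\<close>
  have near: "AE z in ?\<nu>. \<forall>n\<ge>n\<^sub>1. ennreal (cmod (f (x - z) - g n (x - z))) \<le> h n (x - z)"
    using AE_dilate[OF t]
  proof eventually_elim
    case (elim z)
    show ?case
    proof (intro allI impI fg)
      fix n assume n: "n\<^sub>1 \<le> n"
      have "norm (x - z) \<le> norm x + norm z" by (rule norm_triangle_ineq4)
      then have "norm (x - z) < real n" using elim n1(2) n by linarith
      then show "x - z \<in> ball 0 (real n)" by simp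
    qed
  qed
  have hint: "(\<integral>\<^sup>+z. h n (x - z) \<partial>?\<nu>) \<le> ennreal ((1 / 2) ^ n)" if n: "n \<ge> n\<^sub>1" for n
  proof -
    have "(\<integral>\<^sup>+z. h n (x - z) \<partial>?\<nu>) = (\<integral>\<^sup>+y. h n (x - t *\<^sub>R y) \<partial>\<mu>)" by (intro nn_integral_dilate) measurable
    also have "\<dots> \<le> positive_maximal \<mu> (h n) x"
      unfolding positive_maximal_def using t by (intro SUP_upper) auto
    also have "\<dots> \<le> ennreal ((1 / 2) ^ n)" using n n1 by (intro hx) auto
    finally show ?thesis .
  qed
  have "(\<integral>\<^sup>+z. (\<Sum>k. h (k + n\<^sub>1) (x - z)) \<partial>?\<nu>) = (\<Sum>k. \<integral>\<^sup>+z. h (k + n\<^sub>1) (x - z) \<partial>?\<nu>)"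
    by (intro nn_integral_suminf) measurable
  also have "\<dots> \<le> (\<Sum>k. ennreal ((1 / 2) ^ (k + n\<^sub>1)))" by (intro suminf_le hint) auto
  also have "\<dots> < \<infinity>"
  proof -
    have s: "summable (\<lambda>k. (1 / 2 :: real) ^ (k + n\<^sub>1))"
      by (rule summable_ignore_initial_segment) (rule summable_geometric, simp)
    have "(\<Sum>k. ennreal ((1 / 2) ^ (k + n\<^sub>1))) = ennreal (\<Sum>k. (1 / 2) ^ (k + n\<^sub>1))"
      by (rule suminf_ennreal2[OF _ s]) simp
    then show ?thesis by simp
  qed
  finally have "(\<integral>\<^sup>+z. (\<Sum>k. h (k + n\<^sub>1) (x - z)) \<partial>?\<nu>) \<noteq> \<infinity>" by simp
  then have "AE z in ?\<nu>. (\<Sum>k. h (k + n\<^sub>1) (x - z)) \<noteq> \<infinity>"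
    by (intro nn_integral_PInf_AE) measurable
  \<comment> \<open>Finiteness of the sum forces the majorants, hence the differences f - g n, to
    tend to 0.\<close>
  then have glim: "AE z in ?\<nu>. f (x - z) = lim (\<lambda>k. g (k + n\<^sub>1) (x - z))"
    using near
  proof eventually_elim
    case (elim z)
    define A where "A k = h (k + n\<^sub>1) (x - z)" for k
    define a where "a k = enn2real (A k)" for k
    have fin: "(\<Sum>k. A k) < \<infinity>" using elim(1) by (simp add: A_def less_top)
    have "A k \<le> (\<Sum>k. A k)" for k by (rule ennreal_le_suminf)
    then have Aa: "A k = ennreal (a k)" for k
      unfolding a_def using fin by (metis ennreal_enn2real infinity_ennreal_def order_le_less_trans)
    have a0: "a k \<ge> 0" for k by (simp add: a_def)
    have "summable a" using fin a0 unfolding Aa by (intro summable_suminf_not_top) auto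
    then have alim: "a \<longlonglongrightarrow> 0" by (rule summable_LIMSEQ_zero)
    have nb: "norm (g (k + n\<^sub>1) (x - z) - f (x - z)) \<le> a k" for k
    proof -
      have "ennreal (cmod (f (x - z) - g (k + n\<^sub>1) (x - z))) \<le> ennreal (a k)"
        using elim(2)[rule_format, of "k + n\<^sub>1"] by (simp add: Aa[symmetric] A_def)
      then show ?thesis using a0 by (simp add: ennreal_le_iff norm_minus_commute)
    qed
    have "(\<lambda>k. g (k + n\<^sub>1) (x - z) - f (x - z)) \<longlonglongrightarrow> 0"
      by (rule Lim_null_comparison[OF always_eventually[OF allI[OF nb]] alim])
    then have "(\<lambda>k. g (k + n\<^sub>1) (x - z)) \<longlonglongrightarrow> f (x - z)" by (rule LIM_zero_cancel)
    then show "f (x - z) = lim (\<lambda>k. g (k + n\<^sub>1) (x - z))" by (rule limI[symmetric])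
  qed
  have fm [measurable]: "(\<lambda>z. f (x - z)) \<in> borel_measurable (completion ?\<nu>)"
    by (rule borel_measurable_completion_AE_eq[OF _ glim]) measurable
  have "(\<integral>\<^sup>+z. ennreal (cmod (f (x - z))) \<partial>?\<nu>) \<le> (\<integral>\<^sup>+z. ennreal (B n\<^sub>1) + h n\<^sub>1 (x - z) \<partial>?\<nu>)"
  proof (rule nn_integral_mono_AE)
    show "AE z in ?\<nu>. ennreal (cmod (f (x - z))) \<le> ennreal (B n\<^sub>1) + h n\<^sub>1 (x - z)"
      using near
    proof eventually_elim
      case (elim z)
      have "cmod (f (x - z)) \<le> cmod (g n\<^sub>1 (x - z)) + cmod (f (x - z) - g n\<^sub>1 (x - z))"
        by (metis norm_triangle_sub)
      then have "ennreal (cmod (f (x - z))) \<le> ennreal (cmod (g n\<^sub>1 (x - z))) + ennreal (cmod (f (x - z) - g n\<^sub>1 (x - z)))"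
        by (simp add: ennreal_plus[symmetric] ennreal_leI del: ennreal_plus)
      also have "\<dots> \<le> ennreal (B n\<^sub>1) + h n\<^sub>1 (x - z)"
        using elim by (intro add_mono ennreal_leI B) auto
      finally show ?case .
    qed
  qed
  also have "\<dots> = ennreal (B n\<^sub>1) * emeasure ?\<nu> UNIV + (\<integral>\<^sup>+z. h n\<^sub>1 (x - z) \<partial>?\<nu>)"
    by (subst nn_integral_add) auto
  also have "\<dots> < \<infinity>"
  proof -
    have "emeasure ?\<nu> UNIV < top" by (simp add: nu.emeasure_eq_measure)
    moreover have "(\<integral>\<^sup>+z. h n\<^sub>1 (x - z) \<partial>?\<nu>) < top" using hint[of n\<^sub>1] by (rule order_le_less_trans) auto
    ultimately show ?thesis by (simp add: ennreal_mult_less_top)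
  qed
  finally have fi: "integrable (completion ?\<nu>) (\<lambda>z. f (x - z))"
    by (intro integrableI_bounded fm) (simp add: nn_integral_completion)
  then show "convolution_exists f ?\<nu> x" by (simp add: convolution_exists_def)
  fix n assume n: "n \<ge> n\<^sub>1"
  have "integrable ?\<nu> (\<lambda>z. g n (x - z))"
    by (rule nu.integrable_const_bound[where B="B n"]) (use B in auto)
  then have gi: "integrable (completion ?\<nu>) (\<lambda>z. g n (x - z))"
    by (subst integrable_completion) auto
  have "Defs.convolution f ?\<nu> x - Defs.convolution (g n) ?\<nu> x = (\<integral>z. f (x - z) - g n (x - z) \<partial>completion ?\<nu>)"
    unfolding Defs.convolution_def by (rule Bochner_Integration.integral_diff[OF fi gi, symmetric])
  then have "ennreal (cmod (Defs.convolution f ?\<nu> x - Defs.convolution (g n) ?\<nu> x)) \<le> (\<integral>\<^sup>+z. ennreal (cmod (f (x - z) - g n (x - z))) \<partial>completion ?\<nu>)"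
    using integral_norm_bound_ennreal[OF Bochner_Integration.integrable_diff[OF fi gi]] by simp
  also have "\<dots> = (\<integral>\<^sup>+z. ennreal (cmod (f (x - z) - g n (x - z))) \<partial>?\<nu>)" by (rule nn_integral_completion)
  also have "\<dots> \<le> (\<integral>\<^sup>+z. h n (x - z) \<partial>?\<nu>)"
  proof (rule nn_integral_mono_AE)
    show "AE z in ?\<nu>. ennreal (cmod (f (x - z) - g n (x - z))) \<le> h n (x - z)"
      using near by eventually_elim (use n in auto)
  qed
  also have "\<dots> \<le> ennreal ((1 / 2) ^ n)" by (rule hint[OF n])
  finally show "cmod (Defs.convolution f ?\<nu> x - Defs.convolution (g n) ?\<nu> x) \<le> (1 / 2) ^ n"
    by (simp add: ennreal_le_iff)
qed

lemma local_maximal_le: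
  assumes "\<And>t. 0 < t \<Longrightarrow> t \<le> T \<Longrightarrow> cmod (Defs.convolution f (dilate t \<mu>) x - Defs.convolution g (dilate t \<mu>) x) \<le> e" and e: "e \<ge> 0"
  shows "local_maximal T f x \<le> local_maximal T g x + ennreal e"
  unfolding local_maximal_def
proof (rule SUP_least)
  fix t assume t: "t \<in> {0<..T}"
  let ?u = "Defs.convolution f (dilate t \<mu>) x" and ?v = "Defs.convolution g (dilate t \<mu>) x"
  have "cmod ?u \<le> cmod ?v + cmod (?u - ?v)" by (metis norm_triangle_sub)
  also have "\<dots> \<le> cmod ?v + e" using assms(1)[of t] t by auto
  finally have "ennreal (cmod ?u) \<le> ennreal (cmod ?v) + ennreal e"
    using e by (simp add: ennreal_plus[symmetric] ennreal_leI del: ennreal_plus)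
  also have "\<dots> \<le> (SUP t\<in>{0<..T}. ennreal (cmod (Defs.convolution g (dilate t \<mu>) x))) + ennreal e"
    using t by (intro add_right_mono SUP_upper)
  finally show "ennreal (cmod ?u) \<le> (SUP t\<in>{0<..T}. ennreal (cmod (Defs.convolution g (dilate t \<mu>) x))) + ennreal e" .
qed

text \<open>Closeness is expressed by two additive inequalities because the values may be infinite,
  where a difference carries no information.\<close>

lemma liminf_eqI_ennreal:
  fixes u :: "nat \<Rightarrow> ennreal"
  assumes "\<And>n. n \<ge> N \<Longrightarrow> l \<le> u n + ennreal ((1 / 2) ^ n)" "\<And>n. n \<ge> N \<Longrightarrow> u n \<le> l + ennreal ((1 / 2) ^ n)"
  shows "liminf u = l"
proof (rule antisym)
  have small: "\<exists>M\<ge>N. \<forall>n\<ge>M. ennreal ((1 / 2) ^ n) \<le> ennreal e" if e: "e > 0" for e :: real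
  proof -
    have "(\<lambda>n. (1 / 2 :: real) ^ n) \<longlonglongrightarrow> 0" by (rule LIMSEQ_realpow_zero) auto
    then have "\<forall>\<^sub>F n in sequentially. (1 / 2 :: real) ^ n < e" using e by (rule order_tendstoD)
    then obtain M where "\<forall>n\<ge>M. (1 / 2 :: real) ^ n < e" by (auto simp: eventually_sequentially)
    then show ?thesis
      by (intro exI[of _ "max M N"] conjI allI impI ennreal_leI[OF less_imp_le]) auto
  qed
  show "liminf u \<le> l"
  proof (rule ennreal_le_epsilon)
    fix e :: real assume "e > 0"
    then obtain M where M: "M \<ge> N" "\<forall>n\<ge>M. ennreal ((1 / 2) ^ n) \<le> ennreal e" using small by blast
    have "liminf u \<le> liminf (\<lambda>n::nat. l + ennreal e)"
    proof (rule Liminf_mono)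
      show "\<forall>\<^sub>F n in sequentially. u n \<le> l + ennreal e"
        unfolding eventually_sequentially
      proof (intro exI[of _ M] allI impI)
        fix n assume n: "M \<le> n"
        have "u n \<le> l + ennreal ((1 / 2) ^ n)" using n M(1) by (intro assms(2)) auto
        also have "\<dots> \<le> l + ennreal e" using M(2) n by (intro add_left_mono) auto
        finally show "u n \<le> l + ennreal e" .
      qed
    qed
    then show "liminf u \<le> l + ennreal e" by (simp add: Liminf_const)
  qed
  show "l \<le> liminf u"
  proof (rule ennreal_le_epsilon)
    fix e :: real assume "e > 0"
    then obtain M where M: "M \<ge> N" "\<forall>n\<ge>M. ennreal ((1 / 2) ^ n) \<le> ennreal e" using small by blast
    have "l - ennreal e \<le> liminf u"
    proof (rule Liminf_bounded)
      show "\<forall>\<^sub>F n in sequentially. l - ennreal e \<le> u n"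
        unfolding eventually_sequentially
      proof (intro exI[of _ M] allI impI)
        fix n assume n: "M \<le> n"
        have "l \<le> u n + ennreal ((1 / 2) ^ n)" using n M(1) by (intro assms(1)) auto
        also have "\<dots> \<le> u n + ennreal e" using M(2) n by (intro add_left_mono) auto
        finally show "l - ennreal e \<le> u n" by (simp add: ennreal_minus_le_iff add.commute)
      qed
    qed
    then show "l \<le> liminf u + ennreal e" by (simp add: ennreal_minus_le_iff add.commute)
  qed
qed

text \<open>Borel-Cantelli for exceptional sets of measure at most 2^(-n): almost every x lies
  outside all but finitely many of them, and this one null set serves every t. At the other points
  the truncated maximal function of f is the limit of those of g n, which are Borel; letting T grow
  gives \<open>maximal_function\<close>.\<close>

lemma convolution_exists_and_measurable:
  fixes f :: "'a \<Rightarrow> complex"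
  assumes f: "f \<in> borel_measurable lebesgue" and c: "c > 0"
    and fin: "level_norm (\<lambda>x. cmod (f x)) c < \<infinity>"
  shows "AE x in lebesgue. \<forall>t>0. convolution_exists f (dilate t \<mu>) x"
    and "maximal_function \<mu> f \<in> borel_measurable lebesgue"
proof -
  define Q where "Q n g h W B \<longleftrightarrow> continuous_on UNIV g \<and> (\<forall>x. cmod (g x) \<le> B) \<and> h \<in> borel_measurable borel \<and>
    (\<forall>x\<in>ball 0 (real n). ennreal (cmod (f x - g x)) \<le> h x) \<and> W \<in> sets borel \<and>
    {x. positive_maximal \<mu> h x > ennreal ((1 / 2) ^ n)} \<subseteq> W \<and> emeasure lborel W \<le> ennreal ((1 / 2) ^ n)"
    for n :: nat and g :: "'a \<Rightarrow> complex" and h W B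
  have "\<forall>n. \<exists>g h W B. Q n g h W B"
    unfolding Q_def using maximal_approximation[OF f c fin] by (intro allI) simp
  then obtain g h W B where Q: "\<And>n. Q n (g n) (h n) (W n) (B n)" by metis
  have g: "continuous_on UNIV (g n)" and B: "cmod (g n x) \<le> B n" and h: "h n \<in> borel_measurable borel"
    and fg: "x \<in> ball 0 (real n) \<Longrightarrow> ennreal (cmod (f x - g n x)) \<le> h n x" and W: "W n \<in> sets borel"
    and hW: "{x. positive_maximal \<mu> (h n) x > ennreal ((1 / 2) ^ n)} \<subseteq> W n" and Wm: "emeasure lborel (W n) \<le> ennreal ((1 / 2) ^ n)"
    for n x using Q[of n] by (auto simp: Q_def)
  have good: "AE x in lborel. \<exists>n\<^sub>0. \<forall>n\<ge>n\<^sub>0. positive_maximal \<mu> (h n) x \<le> ennreal ((1 / 2) ^ n)"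
  proof -
    have "AE x in lborel. eventually (\<lambda>n. x \<in> space lborel - W n) sequentially"
    proof (rule borel_cantelli_AE1)
      show "W n \<in> sets lborel" for n using W by simp
      show "emeasure lborel (W n) < \<infinity>" for n using Wm[of n] by (rule order_le_less_trans) simp
      have "measure lborel (W n) \<le> (1 / 2) ^ n" for n
        unfolding measure_def using Wm[of n] by (intro enn2real_leI) auto
      then show "summable (\<lambda>n. measure lborel (W n))"
        by (intro summable_comparison_test'[where g="\<lambda>n. (1 / 2 :: real) ^ n" and N=0 and f="\<lambda>n. measure lborel (W n)"] summable_geometric) auto
    qed
    then show ?thesis
    proof eventually_elim
      case (elim x)
      then obtain n\<^sub>0 where n0: "\<And>n. n \<ge> n\<^sub>0 \<Longrightarrow> x \<notin> W n" by (auto simp: eventually_sequentially)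
      have "positive_maximal \<mu> (h n) x \<le> ennreal ((1 / 2) ^ n)" if "n \<ge> n\<^sub>0" for n
        using n0[OF that] hW[of n] by (metis CollectI linorder_not_less subsetD)
      then show ?case by blast
    qed
  qed
  have ex: "AE x in lborel. \<forall>t>0. convolution_exists f (dilate t \<mu>) x"
    using good
  proof eventually_elim
    case (elim x)
    then obtain n\<^sub>0 where n0: "\<And>n. n \<ge> n\<^sub>0 \<Longrightarrow> positive_maximal \<mu> (h n) x \<le> ennreal ((1 / 2) ^ n)" by blast
    show ?case
    proof (intro allI impI)
      fix t :: real assume t: "t > 0"
      obtain m where m: "norm x + t * R < real m" using reals_Archimedean2 by blast
      have "norm x + t * R < real (max n\<^sub>0 m)" using m by linarith
      then show "convolution_exists f (dilate t \<mu>) x"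
        by (intro convolution_approx(1)[where g=g and h=h and B=B and n\<^sub>0=n\<^sub>0 and n\<^sub>1="max n\<^sub>0 m"] g B h fg n0 t) auto
    qed
  qed
  then show "AE x in lebesgue. \<forall>t>0. convolution_exists f (dilate t \<mu>) x" by (rule AE_completion)
  have loc: "local_maximal T f \<in> borel_measurable lebesgue" for T
  proof (rule borel_measurable_completion_AE_eq)
    show "(\<lambda>x. liminf (\<lambda>n. local_maximal T (g n) x)) \<in> borel_measurable lborel"
      using local_maximal_measurable[OF g B] by (intro borel_measurable_liminf) simp
    show "AE x in lborel. local_maximal T f x = liminf (\<lambda>n. local_maximal T (g n) x)"
      using good
    proof eventually_elim
      case (elim x)
      then obtain n\<^sub>0 where n0: "\<And>n. n \<ge> n\<^sub>0 \<Longrightarrow> positive_maximal \<mu> (h n) x \<le> ennreal ((1 / 2) ^ n)" by blast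
      obtain m where m: "norm x + T * R < real m" using reals_Archimedean2 by blast
      define n\<^sub>1 where "n\<^sub>1 = max n\<^sub>0 m"
      have n1: "n\<^sub>0 \<le> n\<^sub>1" by (simp add: n\<^sub>1_def)
      have cl: "cmod (Defs.convolution f (dilate t \<mu>) x - Defs.convolution (g n) (dilate t \<mu>) x) \<le> (1 / 2) ^ n"
        if t: "0 < t" "t \<le> T" and n: "n \<ge> n\<^sub>1" for t n
      proof -
        have "t * R \<le> T * R" using t R_pos by (intro mult_right_mono) auto
        then have lt: "norm x + t * R < real n\<^sub>1" using m unfolding n\<^sub>1_def by linarith
        show ?thesis
          by (rule convolution_approx(2)[where g=g and h=h and B=B and n\<^sub>0=n\<^sub>0 and n\<^sub>1=n\<^sub>1, OF g B h fg n0 t(1) n1 lt n])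
      qed
      have "liminf (\<lambda>n. local_maximal T (g n) x) = local_maximal T f x"
      proof (rule liminf_eqI_ennreal[where N=n\<^sub>1])
        fix n assume n: "n \<ge> n\<^sub>1"
        show "local_maximal T f x \<le> local_maximal T (g n) x + ennreal ((1 / 2) ^ n)"
          using cl n by (intro local_maximal_le) auto
        show "local_maximal T (g n) x \<le> local_maximal T f x + ennreal ((1 / 2) ^ n)"
          using cl n by (intro local_maximal_le) (auto simp: norm_minus_commute)
      qed
      then show ?case by simp
    qed
  qed
  have "(\<lambda>x. SUP n. local_maximal (real n) f x) \<in> borel_measurable lebesgue"
    using loc by (intro borel_measurable_SUP) auto
  then show "maximal_function \<mu> f \<in> borel_measurable lebesgue"
    by (simp add: maximal_function_eq[abs_def])
qed

end

section \<open>Strong type bounds\<close>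

text \<open>Licenses the exchange of integrals against \<open>lebesgue\<close> in the layer cake
  formula.\<close>

lemma sigma_finite_lebesgue: "sigma_finite_measure (lebesgue :: 'a::euclidean_space measure)"
proof
  show "\<exists>A. countable A \<and> A \<subseteq> sets lebesgue \<and> \<Union> A = space lebesgue \<and> (\<forall>a\<in>A. emeasure lebesgue (a::'a set) \<noteq> \<infinity>)"
  proof (intro exI conjI)
    show "countable (range (\<lambda>n::nat. ball (0::'a) (real n)))" by simp
    show "range (\<lambda>n::nat. ball (0::'a) (real n)) \<subseteq> sets lebesgue" by auto
    show "\<Union> (range (\<lambda>n::nat. ball (0::'a) (real n))) = space lebesgue"
      using reals_Archimedean2 by auto
    show "\<forall>a\<in>range (\<lambda>n::nat. ball (0::'a) (real n)). emeasure lebesgue a \<noteq> \<infinity>"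
      using emeasure_lborel_ball_finite by (auto simp: less_top[symmetric])
  qed
qed

text \<open>For finite u an elementary integral, with the endpoints discarded as a null set; for
  infinite u the integral exceeds every natural number by comparison with finite endpoints.\<close>

lemma nn_integral_powr_up_to:
  fixes p :: real
  assumes p: "p > 0"
  shows "(\<integral>\<^sup>+s. ennreal (p * s powr (p - 1)) * (if ennreal s < u then 1 else 0) * indicator {0<..} s \<partial>lborel) = ennpowr u p"
proof -
  have fin: "(\<integral>\<^sup>+s. ennreal (p * s powr (p - 1)) * (if ennreal s < ennreal g then 1 else 0) * indicator {0<..} s \<partial>lborel) = ennreal (g powr p)"
    if g: "g \<ge> 0" for g
  proof -
    have "((\<lambda>s. s powr (p - 1)) has_integral (g powr (p - 1 + 1) / (p - 1 + 1))) {0..g}"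
      using p g by (intro has_integral_powr_from_0) auto
    then have "((\<lambda>s. p * s powr (p - 1)) has_integral (p * (g powr (p - 1 + 1) / (p - 1 + 1)))) {0..g}"
      by (rule has_integral_mult_right)
    then have hi: "((\<lambda>s. p * s powr (p - 1)) has_integral (g powr p)) {0..g}" using p by simp
    have "(\<integral>\<^sup>+s. ennreal (p * s powr (p - 1)) * indicator {0..g} s \<partial>lborel) = ennreal (g powr p)"
      using p by (intro nn_integral_has_integral_lebesgue'[OF _ hi]) auto
    moreover have "(\<integral>\<^sup>+s. ennreal (p * s powr (p - 1)) * indicator {0..g} s \<partial>lborel)
      = (\<integral>\<^sup>+s. ennreal (p * s powr (p - 1)) * (if ennreal s < ennreal g then 1 else 0) * indicator {0<..} s \<partial>lborel)"
    proof (rule nn_integral_cong_AE)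
      have "AE s in lborel. s \<noteq> (0::real) \<and> s \<noteq> g"
        using AE_lborel_singleton[of "0::real"] AE_lborel_singleton[of g] by eventually_elim simp
      then show "AE s in lborel. ennreal (p * s powr (p - 1)) * indicator {0..g} s
        = ennreal (p * s powr (p - 1)) * (if ennreal s < ennreal g then 1 else 0) * indicator {0<..} s"
        by eventually_elim (use g in \<open>auto simp: ennreal_less_iff split: split_indicator\<close>)
    qed
    ultimately show ?thesis by simp
  qed
  show ?thesis
  proof (cases u)
    case (real g)
    then show ?thesis using fin[of g] by (simp add: ennpowr_ennreal)
  next
    case top
    let ?I = "\<integral>\<^sup>+s. ennreal (p * s powr (p - 1)) * (if ennreal s < u then 1 else 0) * indicator {0<..} s \<partial>lborel"
    have "ennreal (real n) \<le> ?I" for n :: nat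
    proof (cases "n = 0")
      case False
      have "ennreal (real n) = ennreal ((real n powr (1 / p)) powr p)" using p False by (simp add: powr_powr)
      also have "\<dots> = (\<integral>\<^sup>+s. ennreal (p * s powr (p - 1)) * (if ennreal s < ennreal (real n powr (1 / p)) then 1 else 0) * indicator {0<..} s \<partial>lborel)"
        by (rule fin[symmetric]) simp
      also have "\<dots> \<le> ?I" unfolding top by (intro nn_integral_mono mult_right_mono mult_left_mono) auto
      finally show ?thesis .
    qed simp
    then have big: "ennreal (real n) \<le> ?I" for n :: nat .
    have "?I = top"
    proof (rule ccontr)
      assume "?I \<noteq> top"
      then obtain v where v: "v \<ge> 0" "?I = ennreal v" by (cases ?I) auto
      obtain n :: nat where "v < real n" using reals_Archimedean2 by blast
      with big[of n] v show False by (simp add: ennreal_le_iff)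
    qed
    then show ?thesis using top by simp
  qed
qed

lemma layer_cake:
  fixes G :: "'a::euclidean_space \<Rightarrow> ennreal"
  assumes G [measurable]: "G \<in> borel_measurable lebesgue" and p: "p > 0"
  shows "(\<integral>\<^sup>+s. ennreal (p * s powr (p - 1)) * emeasure lebesgue {x. G x > ennreal s} * indicator {0<..} s \<partial>lborel)
    = (\<integral>\<^sup>+x. ennpowr (G x) p \<partial>lebesgue)"
proof -
  interpret sigma_finite_measure "lebesgue :: 'a measure" by (rule sigma_finite_lebesgue)
  interpret P: pair_sigma_finite "lborel :: real measure" "lebesgue :: 'a measure" ..
  let ?k = "\<lambda>s x. ennreal (p * s powr (p - 1)) * (if ennreal s < G x then 1 else 0) * indicator {0<..} s"
  have "(\<integral>\<^sup>+s. ennreal (p * s powr (p - 1)) * emeasure lebesgue {x. G x > ennreal s} * indicator {0<..} s \<partial>lborel)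
    = (\<integral>\<^sup>+s. (\<integral>\<^sup>+x. ?k s x \<partial>lebesgue) \<partial>lborel)"
  proof (rule nn_integral_cong)
    fix s :: real
    have [measurable]: "{x. G x > ennreal s} \<in> sets lebesgue"
    proof -
      have "{x\<in>space lebesgue. G x > ennreal s} \<in> sets lebesgue" by measurable
      then show ?thesis by simp
    qed
    have "(\<integral>\<^sup>+x. ?k s x \<partial>lebesgue) = (\<integral>\<^sup>+x. (ennreal (p * s powr (p - 1)) * indicator {0<..} s) * indicator {x. G x > ennreal s} x \<partial>lebesgue)"
      by (intro nn_integral_cong) (auto simp: indicator_def)
    also have "\<dots> = (ennreal (p * s powr (p - 1)) * indicator {0<..} s) * emeasure lebesgue {x. G x > ennreal s}"
      by (rule nn_integral_cmult_indicator) measurable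
    finally show "ennreal (p * s powr (p - 1)) * emeasure lebesgue {x. G x > ennreal s} * indicator {0<..} s = (\<integral>\<^sup>+x. ?k s x \<partial>lebesgue)"
      by (simp only: mult_ac)
  qed
  also have "\<dots> = (\<integral>\<^sup>+x. (\<integral>\<^sup>+s. ?k s x \<partial>lborel) \<partial>lebesgue)"
    by (rule P.Fubini'[symmetric]) measurable
  also have "\<dots> = (\<integral>\<^sup>+x. ennpowr (G x) p \<partial>lebesgue)"
    by (intro nn_integral_cong nn_integral_powr_up_to p)
  finally show ?thesis .
qed

context decaying_measure
begin

text \<open>The part of \<open>f\<close> at height \<open>2\<^sup>i \<alpha>\<close> is allowed the geometrically
  decreasing share \<open>(1 - q) q\<^sup>i \<alpha> / 2\<close> of the level \<open>\<alpha>\<close>.\<close>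

lemma distributional_inequality:
  assumes q: "0 < q" "q < 1"
  shows "\<exists>C\<ge>0. \<forall>f \<alpha>. f \<in> borel_measurable lebesgue \<longrightarrow> 0 < \<alpha> \<longrightarrow>
    emeasure lebesgue {x. maximal_function \<mu> f x > ennreal \<alpha>}
      \<le> (\<Sum>i. ennreal (C * (2 / q) powr (real i * p_crit)) * emeasure lebesgue {x. cmod (f x) > 2 ^ i * (\<alpha> / (2 * (mass + 1)))})"
proof -
  let ?p = p_crit
  obtain C0 where C0: "C0 \<ge> 0" and rw: "\<forall>U \<alpha>. open U \<longrightarrow> 0 < \<alpha> \<longrightarrow>
    emeasure lborel {x. positive_maximal \<mu> (indicator U) x > ennreal \<alpha>} \<le> ennreal (C0 * \<alpha> powr (- p_crit)) * emeasure lborel U"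
    using restricted_weak_type by blast
  define m where "m = mass + 1"
  have m: "m > 0" using mass_nonneg by (simp add: m_def add_nonneg_pos)
  define C where "C = C0 * ((1 - q) * m / 2) powr (- ?p)"
  have C: "C \<ge> 0" using C0 by (simp add: C_def)
  \<comment> \<open>The height of layer i is 2 ^ (i + 1) c with c = \<alpha> / (2 m), so its
    contribution is (\<alpha> / 2) (1 - q) q ^ i. These add up to \<alpha> / 2, and the other half
    of \<alpha> covers the values of f below c.\<close>
  define \<beta> where "\<beta> i = (1 - q) * m / 2 * (q / 2) ^ i" for i :: nat
  have b0: "\<beta> i > 0" for i using q m by (simp add: \<beta>_def)
  define \<kappa> where "\<kappa> i = C * (2 / q) powr (real i * ?p)" for i :: nat
  have k0: "\<kappa> i \<ge> 0" for i using C by (simp add: \<kappa>_def)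
  have kb: "C0 * \<beta> i powr (- ?p) = \<kappa> i" for i
  proof -
    have "\<beta> i powr (- ?p) = ((1 - q) * m / 2) powr (- ?p) * ((q / 2) ^ i) powr (- ?p)"
      unfolding \<beta>_def using q m by (intro powr_mult)
    also have "((q / 2) ^ i) powr (- ?p) = (2 / q) powr (real i * ?p)"
    proof -
      have "((q / 2) ^ i) powr (- ?p) = ((q / 2) powr real i) powr (- ?p)" using q by (simp add: powr_realpow)
      also have "\<dots> = (q / 2) powr (- (real i * ?p))" by (simp add: powr_powr)
      also have "\<dots> = inverse ((q / 2) powr (real i * ?p))" by (rule powr_minus)
      also have "\<dots> = (2 / q) powr (real i * ?p)" using q by (simp add: powr_divide)
      finally show ?thesis .
    qed
    finally show ?thesis by (simp add: \<kappa>_def C_def)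
  qed
  have main: "emeasure lebesgue {x. maximal_function \<mu> f x > ennreal \<alpha>}
      \<le> (\<Sum>i. ennreal (\<kappa> i) * emeasure lebesgue {x. cmod (f x) > 2 ^ i * (\<alpha> / (2 * m))})"
    if f [measurable]: "f \<in> borel_measurable lebesgue" and al: "0 < \<alpha>" for f \<alpha>
  proof (rule ennreal_le_epsilon)
    fix \<tau> :: real assume t: "0 < \<tau>"
    define c where "c = \<alpha> / (2 * m)"
    have c: "c > 0" using al m by (simp add: c_def)
    define S where "S i = {x. cmod (f x) > 2 ^ i * c}" for i :: nat
    have S: "S i \<in> sets lebesgue" for i
    proof -
      have "{x\<in>space lebesgue. cmod (f x) > 2 ^ i * c} \<in> sets lebesgue" by measurable
      then show ?thesis by (simp add: S_def)
    qed
    \<comment> \<open>Ensures \<kappa> i \<delta> i \<le> \<tau> / 2 ^ (i + 1), so the open covers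
      cost at most \<tau> in total; the 1 in the denominator avoids division by 0.\<close>
    define \<delta> where "\<delta> i = \<tau> * (1 / 2) ^ Suc i / (\<kappa> i + 1)" for i :: nat
    have d0: "\<delta> i > 0" for i using t k0[of i] by (simp add: \<delta>_def)
    have "\<exists>U. open U \<and> S i \<subseteq> U \<and> emeasure lborel U \<le> emeasure lebesgue (S i) + ennreal (\<delta> i)" for i
    proof -
      obtain T where T: "open T" "S i \<subseteq> T" "(T - S i) \<in> lmeasurable" "emeasure lebesgue (T - S i) < ennreal (\<delta> i)"
        using sets_lebesgue_outer_open[OF S d0] by blast
      have "emeasure lborel T = emeasure lebesgue (S i \<union> (T - S i))"
        using T by (simp add: Un_absorb1)
      also have "\<dots> \<le> emeasure lebesgue (S i) + emeasure lebesgue (T - S i)"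
        using S T by (intro emeasure_subadditive) auto
      also have "\<dots> \<le> emeasure lebesgue (S i) + ennreal (\<delta> i)"
        using T(4) by (intro add_left_mono) auto
      finally show ?thesis using T by blast
    qed
    then obtain U where U: "\<And>i. open (U i)" "\<And>i. S i \<subseteq> U i" "\<And>i. emeasure lborel (U i) \<le> emeasure lebesgue (S i) + ennreal (\<delta> i)"
      by metis
    let ?e = "\<lambda>i. 2 ^ (i + 1) * c"
    have [measurable]: "layers ?e U \<in> borel_measurable borel" using U by (intro layers_measurable)
    have le: "ennreal (cmod (f x)) \<le> ennreal c + layers ?e U x" for x
    proof (cases "cmod (f x) > c")
      case True
      obtain j where j: "2 ^ j * c < cmod (f x)" "cmod (f x) \<le> 2 ^ (j + 1) * c" by (rule dyadic_sum_bound[OF c True])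
      have "x \<in> U j" using U(2)[of j] j by (auto simp: S_def)
      then have "ennreal (cmod (f x)) \<le> ennreal (2 ^ (j + 1) * c) * indicator (U j) x" using j by (simp add: ennreal_leI)
      also have "\<dots> \<le> layers ?e U x" unfolding layers_def by (rule ennreal_le_suminf)
      finally show ?thesis by (simp add: add_increasing)
    qed (simp add: add_increasing2 ennreal_leI)
    define V where "V i = {x. positive_maximal \<mu> (indicator (U i)) x > ennreal (\<beta> i)}" for i
    have V: "V i \<in> sets borel" for i unfolding V_def using open_superlevel[OF U(1)] by (rule borel_open)
    have sub: "{x. maximal_function \<mu> f x > ennreal \<alpha>} \<subseteq> (\<Union>i. V i)"
    proof (rule subsetI, rule ccontr)
      fix x assume gt: "x \<in> {x. maximal_function \<mu> f x > ennreal \<alpha>}" and n: "x \<notin> (\<Union>i. V i)"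
      have sm: "positive_maximal \<mu> (indicator (U i)) x \<le> ennreal (\<beta> i)" for i using n by (auto simp: V_def not_less)
      have "positive_maximal \<mu> (layers ?e U) x \<le> (\<Sum>i. ennreal (?e i) * positive_maximal \<mu> (indicator (U i)) x)"
        by (rule positive_maximal_layers_le[OF U(1)])
      also have "\<dots> \<le> (\<Sum>i. ennreal (?e i) * ennreal (\<beta> i))" by (intro suminf_le mult_left_mono sm) auto
      also have "\<dots> = (\<Sum>i. ennreal (\<alpha> / 2 * (1 - q) * q ^ i))"
      proof (intro arg_cong[where f=suminf] ext)
        fix i :: nat
        have "?e i * \<beta> i = (2 * c * m * (1 - q) / 2) * (2 ^ i * (q / 2) ^ i)" by (simp add: \<beta>_def)
        also have "(2 ^ i * (q / 2) ^ i) = q ^ i" by (simp add: power_mult_distrib[symmetric])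
        also have "2 * c * m * (1 - q) / 2 = \<alpha> / 2 * (1 - q)" using m by (simp add: c_def)
        finally have eqn: "?e i * \<beta> i = \<alpha> / 2 * (1 - q) * q ^ i" .
        have "ennreal (?e i) * ennreal (\<beta> i) = ennreal (?e i * \<beta> i)"
          using c less_imp_le[OF b0[of i]] by (intro ennreal_mult[symmetric]) auto
        then show "ennreal (?e i) * ennreal (\<beta> i) = ennreal (\<alpha> / 2 * (1 - q) * q ^ i)" by (simp only: eqn)
      qed
      also have "\<dots> = ennreal (\<alpha> / 2)"
      proof (rule suminf_ennreal_eq)
        show "0 \<le> \<alpha> / 2 * (1 - q) * q ^ i" for i using al q by simp
        have "(\<lambda>i. q ^ i) sums (1 / (1 - q))" using q by (intro geometric_sums) auto
        then have "(\<lambda>i. \<alpha> / 2 * (1 - q) * q ^ i) sums (\<alpha> / 2 * (1 - q) * (1 / (1 - q)))" by (rule sums_mult)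
        moreover have "\<alpha> / 2 * (1 - q) * (1 / (1 - q)) = \<alpha> / 2" using q by (simp add: field_simps)
        ultimately show "(\<lambda>i. \<alpha> / 2 * (1 - q) * q ^ i) sums (\<alpha> / 2)" by (simp only:)
      qed
      finally have lay: "positive_maximal \<mu> (layers ?e U) x \<le> ennreal (\<alpha> / 2)" .
      have "maximal_function \<mu> f x \<le> positive_maximal \<mu> (\<lambda>x. ennreal c + layers ?e U x) x"
        by (intro maximal_function_le le) measurable
      also have "\<dots> \<le> ennreal c * ennreal mass + positive_maximal \<mu> (layers ?e U) x"
        by (intro positive_maximal_add_le) measurable
      also have "\<dots> \<le> ennreal c * ennreal mass + ennreal (\<alpha> / 2)" by (rule add_left_mono[OF lay])
      also have "\<dots> = ennreal (c * mass + \<alpha> / 2)" using c al by (simp add: ennreal_mult ennreal_plus)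
      also have "\<dots> \<le> ennreal \<alpha>"
      proof (rule ennreal_leI)
        have "c * mass \<le> c * m" using c by (intro mult_left_mono) (auto simp: m_def)
        also have "\<dots> = \<alpha> / 2" using m by (simp add: c_def)
        finally show "c * mass + \<alpha> / 2 \<le> \<alpha>" by simp
      qed
      finally show False using gt by simp
    qed
    have "emeasure lebesgue {x. maximal_function \<mu> f x > ennreal \<alpha>} \<le> emeasure lebesgue (\<Union>i. V i)"
      using sub V by (intro emeasure_mono) auto
    also have "\<dots> = emeasure lborel (\<Union>i. V i)" using V by (subst emeasure_completion) auto
    also have "\<dots> \<le> (\<Sum>i. emeasure lborel (V i))" using V by (intro emeasure_subadditive_countably) auto
    also have "\<dots> \<le> (\<Sum>i. ennreal (\<kappa> i) * (emeasure lebesgue (S i) + ennreal (\<delta> i)))"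
    proof (intro suminf_le)
      fix i
      have "emeasure lborel (V i) \<le> ennreal (\<kappa> i) * emeasure lborel (U i)"
        unfolding V_def kb[symmetric] using rw U(1) b0 by blast
      also have "\<dots> \<le> ennreal (\<kappa> i) * (emeasure lebesgue (S i) + ennreal (\<delta> i))" by (intro mult_left_mono U(3)) auto
      finally show "emeasure lborel (V i) \<le> ennreal (\<kappa> i) * (emeasure lebesgue (S i) + ennreal (\<delta> i))" .
    qed auto
    also have "\<dots> \<le> (\<Sum>i. ennreal (\<kappa> i) * emeasure lebesgue (S i) + ennreal (\<tau> * (1 / 2) ^ Suc i))"
    proof (intro suminf_le)
      fix i
      have kn: "\<kappa> i + 1 \<noteq> 0" using k0[of i] by linarith
      have "\<kappa> i * \<delta> i \<le> (\<kappa> i + 1) * \<delta> i" using d0[of i] by (intro mult_right_mono) auto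
      also have "\<dots> = \<tau> * (1 / 2) ^ Suc i" unfolding \<delta>_def by (simp only: times_divide_eq_right nonzero_mult_div_cancel_left[OF kn])
      finally have "ennreal (\<kappa> i) * ennreal (\<delta> i) \<le> ennreal (\<tau> * (1 / 2) ^ Suc i)"
        using k0[of i] d0[of i] by (simp add: ennreal_mult[symmetric] ennreal_leI)
      then show "ennreal (\<kappa> i) * (emeasure lebesgue (S i) + ennreal (\<delta> i)) \<le> ennreal (\<kappa> i) * emeasure lebesgue (S i) + ennreal (\<tau> * (1 / 2) ^ Suc i)"
        unfolding distrib_left by (intro add_left_mono)
    qed auto
    also have "\<dots> = (\<Sum>i. ennreal (\<kappa> i) * emeasure lebesgue (S i)) + (\<Sum>i. ennreal (\<tau> * (1 / 2) ^ Suc i))"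
      by (intro suminf_add[symmetric]) auto
    also have "(\<Sum>i. ennreal (\<tau> * (1 / 2) ^ Suc i)) = ennreal \<tau>"
      using t sums_mult[OF power_half_series, of \<tau>] by (intro suminf_ennreal_eq) auto
    finally show "emeasure lebesgue {x. maximal_function \<mu> f x > ennreal \<alpha>}
      \<le> (\<Sum>i. ennreal (\<kappa> i) * emeasure lebesgue {x. cmod (f x) > 2 ^ i * (\<alpha> / (2 * m))}) + ennreal \<tau>"
      by (simp only: S_def c_def)
  qed
  show ?thesis
  proof (intro exI[of _ C] conjI allI impI)
    fix f :: "'a \<Rightarrow> complex" and \<alpha> assume f: "f \<in> borel_measurable lebesgue" and a: "(0::real) < \<alpha>"
    show "emeasure lebesgue {x. maximal_function \<mu> f x > ennreal \<alpha>}
      \<le> (\<Sum>i. ennreal (C * (2 / q) powr (real i * p_crit)) * emeasure lebesgue {x. cmod (f x) > 2 ^ i * (\<alpha> / (2 * (mass + 1)))})"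
      using main[OF f a] by (simp only: \<kappa>_def m_def)
  qed (rule C)
qed

text \<open>The distributional inequality is integrated against p s^(p-1) ds. In the i-th term,
  scaling by m / 2 ^ i produces the integral of |f|^p with a coefficient that decays geometrically,
  since p exceeds the critical exponent. Measurability of the maximal function is assumed because
  the layer cake formula is applied to it.\<close>

lemma strong_type:
  assumes p: "p > p_crit"
  shows "\<exists>C\<ge>0. \<forall>f. f \<in> borel_measurable lebesgue \<longrightarrow> maximal_function \<mu> f \<in> borel_measurable lebesgue \<longrightarrow>
    (\<integral>\<^sup>+x. ennpowr (maximal_function \<mu> f x) p \<partial>lebesgue) \<le> ennreal C * (\<integral>\<^sup>+x. ennpowr (ennreal (cmod (f x))) p \<partial>lebesgue)"
proof -
  let ?p = p_crit
  have p0: "?p > 0" "p > 0" using p_crit_ge_1 p by linarith+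
  \<comment> \<open>Makes (2 / q)^(p_c) equal to 2^(p_c + (p - p_c) / 2), with p_c the critical
    exponent: half of the gap p - p_c is spent on the shares of the level, and the other half is
    left for convergence with ratio \<open>\<rho>\<close>.\<close>
  define q where "q = 2 powr (- (p - ?p) / (2 * ?p))"
  have q: "0 < q" "q < 1"
    using p p0 powr_less_mono[of "- (p - ?p) / (2 * ?p)" 0 2] by (auto simp: q_def divide_neg_pos)
  obtain C where C: "C \<ge> 0" and di: "\<forall>f \<alpha>. f \<in> borel_measurable lebesgue \<longrightarrow> 0 < \<alpha> \<longrightarrow>
    emeasure lebesgue {x. maximal_function \<mu> f x > ennreal \<alpha>}
      \<le> (\<Sum>i. ennreal (C * (2 / q) powr (real i * p_crit)) * emeasure lebesgue {x. cmod (f x) > 2 ^ i * (\<alpha> / (2 * (mass + 1)))})"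
    using distributional_inequality[OF q] by blast
  define m where "m = 2 * (mass + 1)"
  have m: "m > 0" using mass_nonneg by (simp add: m_def add_nonneg_pos)
  define \<kappa> where "\<kappa> i = C * (2 / q) powr (real i * ?p)" for i :: nat
  have k0: "\<kappa> i \<ge> 0" for i using C by (simp add: \<kappa>_def)
  define \<rho> where "\<rho> = 2 powr (- (p - ?p) / 2)"
  have r: "0 < \<rho>" "\<rho> < 1" using p powr_less_mono[of "- (p - ?p) / 2" 0 2] by (auto simp: \<rho>_def)
  define C' where "C' = C * m powr p * (1 / (1 - \<rho>))"
  have C': "C' \<ge> 0" using C r by (simp add: C'_def)
  have ratio: "\<kappa> i * (m / 2 ^ i) powr p = C * m powr p * \<rho> ^ i" for i
  proof -
    have 1: "(2 / q) powr (real i * ?p) = 2 powr (real i * (?p + (p - ?p) / 2))"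
    proof -
      have e: "1 - (- (p - ?p) / (2 * ?p)) = 1 + (p - ?p) / (2 * ?p)" by (simp only: minus_divide_left[symmetric] diff_minus_eq_add)
      have "2 / q = 2 powr 1 / 2 powr (- (p - ?p) / (2 * ?p))" by (simp only: q_def powr_one zero_le_numeral)
      also have "\<dots> = 2 powr (1 - (- (p - ?p) / (2 * ?p)))" by (rule powr_diff[symmetric])
      finally have "2 / q = 2 powr (1 + (p - ?p) / (2 * ?p))" by (simp only: e)
      then have "(2 / q) powr (real i * ?p) = 2 powr ((1 + (p - ?p) / (2 * ?p)) * (real i * ?p))" by (simp only: powr_powr)
      also have "(1 + (p - ?p) / (2 * ?p)) * (real i * ?p) = real i * (?p + (p - ?p) / 2)"
      proof -
        have "(1 + x / (2 * y)) * (z * y) = z * (y + x / 2)" if "y > 0" for x y z :: real using that by (simp add: field_simps)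
        then show ?thesis using p0(1) by blast
      qed
      finally show ?thesis .
    qed
    have 2: "(m / 2 ^ i) powr p = m powr p * 2 powr (- (real i * p))"
    proof -
      have "(m / 2 ^ i) powr p = m powr p / (2 ^ i) powr p" by (rule powr_divide)
      also have "(2 ^ i :: real) powr p = (2 powr real i) powr p" by (simp add: powr_realpow)
      also have "\<dots> = 2 powr (real i * p)" by (rule powr_powr)
      finally show ?thesis by (simp add: powr_minus divide_inverse)
    qed
    have 3: "2 powr (real i * (?p + (p - ?p) / 2)) * 2 powr (- (real i * p)) = \<rho> ^ i"
    proof -
      have "2 powr (real i * (?p + (p - ?p) / 2)) * 2 powr (- (real i * p)) = 2 powr ((- (p - ?p) / 2) * real i)"
      proof -
        have "z * (y + (x - y) / 2) + - (z * x) = (- (x - y) / 2) * z" for x y z :: real by (simp add: field_simps)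
        then show ?thesis unfolding powr_add[symmetric] by (simp only:)
      qed
      also have "\<dots> = \<rho> powr real i" by (simp only: \<rho>_def powr_powr)
      also have "\<dots> = \<rho> ^ i" by (rule powr_realpow[OF r(1)])
      finally show ?thesis .
    qed
    show ?thesis unfolding \<kappa>_def 1 2 3[symmetric] by (simp only: mult_ac)
  qed
  have main: "(\<integral>\<^sup>+x. ennpowr (maximal_function \<mu> f x) p \<partial>lebesgue) \<le> ennreal C' * (\<integral>\<^sup>+x. ennpowr (ennreal (cmod (f x))) p \<partial>lebesgue)"
    if f [measurable]: "f \<in> borel_measurable lebesgue" and Mf [measurable]: "maximal_function \<mu> f \<in> borel_measurable lebesgue" for f
  proof -
    let ?w = "\<lambda>s. ennreal (p * s powr (p - 1))"
    \<comment> \<open>Multiplying |f| by m / 2 ^ i moves the i-th superlevel set to the level s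
      itself, where the layer cake formula applies.\<close>
    define G where "G i x = ennreal (m / 2 ^ i) * ennreal (cmod (f x))" for i :: nat and x
    have Gm [measurable]: "G i \<in> borel_measurable lebesgue" for i unfolding G_def by measurable
    have GS: "{x. cmod (f x) > 2 ^ i * (s / m)} = {x. G i x > ennreal s}" if s: "s > 0" for i s
    proof (rule Collect_cong)
      fix x
      have "G i x = ennreal (m / 2 ^ i * cmod (f x))" unfolding G_def using m by (intro ennreal_mult[symmetric]) auto
      then have "G i x > ennreal s \<longleftrightarrow> s < m / 2 ^ i * cmod (f x)" using s by (simp add: ennreal_less_iff)
      then show "cmod (f x) > 2 ^ i * (s / m) \<longleftrightarrow> G i x > ennreal s" using m by (simp add: field_simps)
    qed
    have em [measurable]: "(\<lambda>s. emeasure lebesgue {x. G i x > ennreal s}) \<in> borel_measurable borel" for i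
    proof -
      interpret sigma_finite_measure "lebesgue :: 'a measure" by (rule sigma_finite_lebesgue)
      have "(\<lambda>s. \<integral>\<^sup>+x. (if ennreal s < G i x then 1 else 0) \<partial>lebesgue) \<in> borel_measurable borel" by measurable
      moreover have "emeasure lebesgue {x. G i x > ennreal s} = (\<integral>\<^sup>+x. (if ennreal s < G i x then 1 else 0) \<partial>lebesgue)" for s
      proof -
        have "{x\<in>space lebesgue. G i x > ennreal s} \<in> sets lebesgue" by measurable
        then have "emeasure lebesgue {x. G i x > ennreal s} = (\<integral>\<^sup>+x. indicator {x. G i x > ennreal s} x \<partial>lebesgue)" by simp
        then show ?thesis by (simp add: indicator_def of_bool_def)
      qed
      ultimately show ?thesis by simp
    qed
    have "(\<integral>\<^sup>+x. ennpowr (maximal_function \<mu> f x) p \<partial>lebesgue)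
      = (\<integral>\<^sup>+s. ?w s * emeasure lebesgue {x. maximal_function \<mu> f x > ennreal s} * indicator {0<..} s \<partial>lborel)"
      by (rule layer_cake[OF Mf p0(2), symmetric])
    also have "\<dots> \<le> (\<integral>\<^sup>+s. (\<Sum>i. ennreal (\<kappa> i) * (?w s * emeasure lebesgue {x. G i x > ennreal s} * indicator {0<..} s)) \<partial>lborel)"
    proof (rule nn_integral_mono)
      fix s :: real
      show "?w s * emeasure lebesgue {x. maximal_function \<mu> f x > ennreal s} * indicator {0<..} s
        \<le> (\<Sum>i. ennreal (\<kappa> i) * (?w s * emeasure lebesgue {x. G i x > ennreal s} * indicator {0<..} s))"
      proof (cases "s > 0")
        case True
        have "?w s * emeasure lebesgue {x. maximal_function \<mu> f x > ennreal s} \<le> ?w s * (\<Sum>i. ennreal (\<kappa> i) * emeasure lebesgue {x. cmod (f x) > 2 ^ i * (s / m)})"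
          unfolding \<kappa>_def m_def using di f True by (intro mult_left_mono) auto
        also have "\<dots> = (\<Sum>i. ennreal (\<kappa> i) * (?w s * emeasure lebesgue {x. G i x > ennreal s}))"
          unfolding GS[OF True] ennreal_suminf_cmult[symmetric] by (simp only: mult_ac)
        finally show ?thesis using True by simp
      qed simp
    qed
    also have "\<dots> = (\<Sum>i. ennreal (\<kappa> i) * (\<integral>\<^sup>+s. ?w s * emeasure lebesgue {x. G i x > ennreal s} * indicator {0<..} s \<partial>lborel))"
      by (subst nn_integral_suminf) (auto simp: nn_integral_cmult)
    also have "\<dots> = (\<Sum>i. ennreal (\<kappa> i) * (\<integral>\<^sup>+x. ennpowr (G i x) p \<partial>lebesgue))"
      by (simp only: layer_cake[OF Gm p0(2)])
    also have "\<dots> = (\<Sum>i. ennreal (C * m powr p * \<rho> ^ i) * (\<integral>\<^sup>+x. ennpowr (ennreal (cmod (f x))) p \<partial>lebesgue))"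
    proof (intro arg_cong[where f=suminf] ext)
      fix i
      have "(\<integral>\<^sup>+x. ennpowr (G i x) p \<partial>lebesgue) = ennreal ((m / 2 ^ i) powr p) * (\<integral>\<^sup>+x. ennpowr (ennreal (cmod (f x))) p \<partial>lebesgue)"
        unfolding G_def ennpowr_mult using m by (subst nn_integral_cmult[symmetric]) (auto simp: ennpowr_ennreal)
      then show "ennreal (\<kappa> i) * (\<integral>\<^sup>+x. ennpowr (G i x) p \<partial>lebesgue) = ennreal (C * m powr p * \<rho> ^ i) * (\<integral>\<^sup>+x. ennpowr (ennreal (cmod (f x))) p \<partial>lebesgue)"
        unfolding ratio[symmetric] using k0[of i] by (simp add: ennreal_mult mult.assoc)
    qed
    also have "\<dots> = (\<Sum>i. ennreal (C * m powr p * \<rho> ^ i)) * (\<integral>\<^sup>+x. ennpowr (ennreal (cmod (f x))) p \<partial>lebesgue)"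
      by (rule ennreal_suminf_multc)
    also have "(\<Sum>i. ennreal (C * m powr p * \<rho> ^ i)) = ennreal C'"
    proof (rule suminf_ennreal_eq)
      show "0 \<le> C * m powr p * \<rho> ^ i" for i using C r by simp
      have "(\<lambda>i. \<rho> ^ i) sums (1 / (1 - \<rho>))" using r by (intro geometric_sums) auto
      then show "(\<lambda>i. C * m powr p * \<rho> ^ i) sums C'" unfolding C'_def by (rule sums_mult)
    qed
    finally show ?thesis .
  qed
  show ?thesis using main C' by (intro exI[of _ C'] conjI allI impI) auto
qed

end

section \<open>Lebesgue and Lorentz norms\<close>

context decaying_measure
begin

text \<open>Chebyshev's inequality bounds the i-th term by a multiple of 2^(i (1 - p / p_c)), with
  p_c the critical exponent; this is a convergent geometric series. In other words, the part of an
  L^p function above height 1 lies in L^(p_c,1).\<close>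

lemma level_norm_finite_if_Lp:
  assumes p: "p > p_crit" and F [measurable]: "F \<in> borel_measurable lebesgue" and F0: "\<And>x. F x \<ge> 0"
    and fin: "(\<integral>\<^sup>+x. ennpowr (ennreal (F x)) p \<partial>lebesgue) < \<infinity>"
  shows "level_norm F 1 < \<infinity>"
proof -
  let ?p = p_crit
  have p0: "?p > 0" "p > 0" using p_crit_ge_1 p by linarith+
  obtain v where v: "v \<ge> 0" "(\<integral>\<^sup>+x. ennpowr (ennreal (F x)) p \<partial>lebesgue) = ennreal v"
    using fin by (cases "\<integral>\<^sup>+x. ennpowr (ennreal (F x)) p \<partial>lebesgue") auto
  define k :: "nat \<Rightarrow> real" where "k i = (2 ^ i) powr p" for i
  have k: "k i > 0" for i by (simp add: k_def)
  define \<rho> where "\<rho> = 2 powr (1 - p / ?p)"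
  have "1 - p / ?p < 0" using p p0 by (simp add: field_simps)
  then have r: "0 < \<rho>" "\<rho> < 1" using powr_less_mono[of "1 - p / ?p" 0 2] by (auto simp: \<rho>_def)
  have D: "emeasure lebesgue {x. F x > 2 ^ i * 1} \<le> ennreal (v / k i)" for i :: nat
  proof -
    let ?S = "{x. F x > 2 ^ i * 1}"
    have "{x\<in>space lebesgue. F x > 2 ^ i * 1} \<in> sets lebesgue" by measurable
    then have S: "?S \<in> sets lebesgue" by simp
    have "ennreal (k i) * emeasure lebesgue ?S = (\<integral>\<^sup>+x. ennreal (k i) * indicator ?S x \<partial>lebesgue)"
      using S by (rule nn_integral_cmult_indicator[symmetric])
    also have "\<dots> \<le> (\<integral>\<^sup>+x. ennpowr (ennreal (F x)) p \<partial>lebesgue)"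
    proof (rule nn_integral_mono)
      fix x
      show "ennreal (k i) * indicator ?S x \<le> ennpowr (ennreal (F x)) p"
      proof (cases "x \<in> ?S")
        case True
        then have "k i \<le> F x powr p" unfolding k_def using p0 by (intro powr_mono2) auto
        then show ?thesis using True F0[of x] by (simp add: ennpowr_ennreal ennreal_leI)
      qed simp
    qed
    finally have le: "ennreal (k i) * emeasure lebesgue ?S \<le> ennreal v" by (simp only: v)
    have "emeasure lebesgue ?S = ennreal (1 / k i) * (ennreal (k i) * emeasure lebesgue ?S)"
      using k[of i] by (simp add: mult.assoc[symmetric] ennreal_mult[symmetric])
    also have "\<dots> \<le> ennreal (1 / k i) * ennreal v" by (intro mult_left_mono le) auto
    also have "\<dots> = ennreal (1 / k i * v)" using k[of i] v by (intro ennreal_mult[symmetric]) auto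
    finally show ?thesis by simp
  qed
  have tm: "2 ^ i * (v / k i) powr (1 / ?p) = v powr (1 / ?p) * \<rho> ^ i" for i :: nat
  proof -
    have 1: "k i powr (1 / ?p) = 2 powr (real i * p / ?p)"
      unfolding k_def powr_realpow[OF zero_less_numeral, symmetric] powr_powr by simp
    have "2 ^ i / k i powr (1 / ?p) = 2 powr real i / 2 powr (real i * p / ?p)"
      unfolding 1 powr_realpow[OF zero_less_numeral, symmetric] ..
    also have "\<dots> = 2 powr (real i - real i * p / ?p)" by (rule powr_diff[symmetric])
    also have "real i - real i * p / ?p = (1 - p / ?p) * real i" by (simp add: algebra_simps)
    also have "2 powr ((1 - p / ?p) * real i) = \<rho> powr real i" by (simp only: \<rho>_def powr_powr)
    also have "\<dots> = \<rho> ^ i" by (rule powr_realpow[OF r(1)])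
    finally have 2: "2 ^ i / k i powr (1 / ?p) = \<rho> ^ i" .
    have "2 ^ i * (v / k i) powr (1 / ?p) = v powr (1 / ?p) * (2 ^ i / k i powr (1 / ?p))"
      unfolding powr_divide by simp
    then show ?thesis by (simp only: 2)
  qed
  have "level_norm F 1 \<le> (\<Sum>i. ennreal (v powr (1 / ?p) * \<rho> ^ i))"
    unfolding level_norm_def
  proof (intro suminf_le)
    fix i :: nat
    have "ennpowr (emeasure lebesgue {x. F x > 2 ^ i * 1}) (1 / ?p) \<le> ennpowr (ennreal (v / k i)) (1 / ?p)"
      using p0 by (intro ennpowr_mono D) auto
    also have "\<dots> = ennreal ((v / k i) powr (1 / ?p))" using v k[of i] by (intro ennpowr_ennreal) auto
    finally have "ennreal (2 ^ i * 1) * ennpowr (emeasure lebesgue {x. F x > 2 ^ i * 1}) (1 / ?p) \<le> ennreal (2 ^ i * 1) * ennreal ((v / k i) powr (1 / ?p))"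
      by (intro mult_left_mono) auto
    also have "\<dots> = ennreal (2 ^ i * 1 * (v / k i) powr (1 / ?p))" by (intro ennreal_mult[symmetric]) auto
    finally show "ennreal (2 ^ i * 1) * ennpowr (emeasure lebesgue {x. F x > 2 ^ i * 1}) (1 / ?p) \<le> ennreal (v powr (1 / ?p) * \<rho> ^ i)"
      by (simp only: mult_1_right tm)
  qed auto
  also have "\<dots> = ennreal (v powr (1 / ?p) * (1 / (1 - \<rho>)))"
  proof (rule suminf_ennreal_eq)
    show "0 \<le> v powr (1 / ?p) * \<rho> ^ i" for i using r by simp
    have "(\<lambda>i. \<rho> ^ i) sums (1 / (1 - \<rho>))" using r by (intro geometric_sums) auto
    then show "(\<lambda>i. v powr (1 / ?p) * \<rho> ^ i) sums (v powr (1 / ?p) * (1 / (1 - \<rho>)))" by (rule sums_mult)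
  qed
  also have "\<dots> < \<infinity>" by simp
  finally show ?thesis .
qed

text \<open>An almost everywhere bound for f does not by itself bound its averages, since the
  dilates may charge the exceptional null set. Instead the level norm vanishes above the essential
  bound b, so the weak type bound with arbitrarily small \<tau> shows that the maximal function
  exceeds (b + \<delta>) mass + \<delta> only on a null set.\<close>

lemma essentially_bounded:
  fixes f :: "'a \<Rightarrow> complex"
  assumes f [measurable]: "f \<in> borel_measurable lebesgue" and fin: "esssup lebesgue (\<lambda>x. ennreal (cmod (f x))) < \<infinity>"
  shows "AE x in lebesgue. \<forall>t>0. convolution_exists f (dilate t \<mu>) x"
    and "maximal_function \<mu> f \<in> borel_measurable lebesgue"
    and "esssup lebesgue (maximal_function \<mu> f) \<le> ennreal mass * esssup lebesgue (\<lambda>x. ennreal (cmod (f x)))"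
proof -
  have p0: "p_crit > 0" using p_crit_ge_1 by linarith
  obtain b where b: "b \<ge> 0" "esssup lebesgue (\<lambda>x. ennreal (cmod (f x))) = ennreal b"
    using fin by (cases "esssup lebesgue (\<lambda>x. ennreal (cmod (f x)))") auto
  have "AE x in lebesgue. ennreal (cmod (f x)) \<le> esssup lebesgue (\<lambda>x. ennreal (cmod (f x)))"
    by (rule esssup_AE)
  then have bd: "AE x in lebesgue. cmod (f x) \<le> b" unfolding b by eventually_elim (use b in simp)
  have zero: "level_norm (\<lambda>x. cmod (f x)) c = 0" if c: "c > 0" "c \<ge> b" for c
  proof -
    have "emeasure lebesgue {x. cmod (f x) > 2 ^ i * c} = 0" for i :: nat
    proof -
      have "1 * c \<le> 2 ^ i * c" using c by (intro mult_right_mono) auto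
      then have "b \<le> 2 ^ i * c" using c by linarith
      then have "AE x in lebesgue. \<not> cmod (f x) > 2 ^ i * c" using bd by auto
      from emeasure_eq_0_AE[OF this] show ?thesis by simp
    qed
    then show ?thesis by (simp add: level_norm_def)
  qed
  have bp: "b + 1 > 0" "b + 1 \<ge> b" using b by auto
  have lf: "level_norm (\<lambda>x. cmod (f x)) (b + 1) < \<infinity>" using zero[OF bp] by simp
  show "AE x in lebesgue. \<forall>t>0. convolution_exists f (dilate t \<mu>) x" by (rule convolution_exists_and_measurable(1)[OF f bp(1) lf])
  show M [measurable]: "maximal_function \<mu> f \<in> borel_measurable lebesgue" by (rule convolution_exists_and_measurable(2)[OF f bp(1) lf])
  obtain C where C: "C > 0" and wk: "\<forall>f c \<alpha> \<tau>. f \<in> borel_measurable lebesgue \<longrightarrow> 0 < c \<longrightarrow> 0 < \<alpha> \<longrightarrow> 0 < \<tau> \<longrightarrow>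
    (\<exists>W\<in>sets borel. {x. maximal_function \<mu> f x > ennreal (c * mass + \<alpha>)} \<subseteq> W \<and>
      emeasure lborel W \<le> ennpowr (ennreal (C / \<alpha>) * (level_norm (\<lambda>x. cmod (f x)) c + ennreal \<tau>)) p_crit)"
    using weak_type_level by blast
  have ae: "AE x in lebesgue. maximal_function \<mu> f x \<le> ennreal ((b + \<delta>) * mass + \<delta>)" if d: "\<delta> > 0" for \<delta>
  proof -
    let ?S = "{x. maximal_function \<mu> f x > ennreal ((b + \<delta>) * mass + \<delta>)}"
    have c: "0 < b + \<delta>" "b + \<delta> \<ge> b" using b d by auto
    have "emeasure lebesgue ?S \<le> 0 + ennreal e" if e: "e > 0" for e
    proof -
      \<comment> \<open>Makes the weak type bound equal to e, as the level norm is 0.\<close>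
      define \<tau> where "\<tau> = \<delta> / C * e powr (1 / p_crit)"
      have t: "\<tau> > 0" using C d e by (simp add: \<tau>_def)
      have "\<exists>W\<in>sets borel. ?S \<subseteq> W \<and>
        emeasure lborel W \<le> ennpowr (ennreal (C / \<delta>) * (level_norm (\<lambda>x. cmod (f x)) (b + \<delta>) + ennreal \<tau>)) p_crit"
        by (rule wk[rule_format, OF f c(1) d t])
      then obtain W where W: "W \<in> sets borel" "?S \<subseteq> W"
        "emeasure lborel W \<le> ennpowr (ennreal (C / \<delta>) * (level_norm (\<lambda>x. cmod (f x)) (b + \<delta>) + ennreal \<tau>)) p_crit"
        by blast
      have ct: "C / \<delta> * \<tau> = e powr (1 / p_crit)" using C d by (simp add: \<tau>_def)
      have "ennreal (C / \<delta>) * (level_norm (\<lambda>x. cmod (f x)) (b + \<delta>) + ennreal \<tau>) = ennreal (C / \<delta> * \<tau>)"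
        unfolding zero[OF c] add_0_left using C d t by (intro ennreal_mult[symmetric]) auto
      also have "ennpowr (ennreal (C / \<delta> * \<tau>)) p_crit = ennreal e"
        unfolding ct using e p0 by (simp add: ennpowr_ennreal powr_powr)
      finally have We: "emeasure lborel W \<le> ennreal e" using W(3) by simp
      have "emeasure lebesgue ?S \<le> emeasure lebesgue W" using W by (intro emeasure_mono) auto
      also have "\<dots> = emeasure lborel W" using W by simp
      finally show ?thesis using We by simp
    qed
    then have "emeasure lebesgue ?S \<le> 0" by (rule ennreal_le_epsilon)
    then have "emeasure lebesgue ?S = 0" by simp
    moreover have "{x\<in>space lebesgue. maximal_function \<mu> f x > ennreal ((b + \<delta>) * mass + \<delta>)} \<in> sets lebesgue" by measurable
    ultimately have "?S \<in> null_sets lebesgue" by (intro null_setsI) simp_all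
    from AE_not_in[OF this] show ?thesis by eventually_elim (simp add: not_less)
  qed
  \<comment> \<open>Countably many values of \<delta>, tending to 0, keep the exceptional set
    null.\<close>
  have "AE x in lebesgue. \<forall>n. maximal_function \<mu> f x \<le> ennreal ((b + inverse (real (Suc n))) * mass + inverse (real (Suc n)))"
    unfolding AE_all_countable by (intro allI ae) simp
  then have "AE x in lebesgue. maximal_function \<mu> f x \<le> ennreal (mass * b)"
  proof eventually_elim
    case (elim x)
    show ?case
    proof (rule ennreal_le_epsilon)
      fix e :: real assume e: "0 < e"
      have m: "mass + 1 > 0" by (simp add: add_nonneg_pos)
      obtain n where n: "inverse (real (Suc n)) < e / (mass + 1)" using reals_Archimedean[of "e / (mass + 1)"] e m by auto
      define h where "h = inverse (real (Suc n))"
      have h: "h * (mass + 1) < e" using n m by (simp add: h_def pos_less_divide_eq)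
      have "maximal_function \<mu> f x \<le> ennreal ((b + h) * mass + h)" using elim by (simp only: h_def)
      also have "(b + h) * mass + h = mass * b + h * (mass + 1)" by (simp add: algebra_simps)
      also have "ennreal (mass * b + h * (mass + 1)) \<le> ennreal (mass * b + e)" using h by (intro ennreal_leI) simp
      also have "\<dots> = ennreal (mass * b) + ennreal e" using b e by (intro ennreal_plus) auto
      finally show "maximal_function \<mu> f x \<le> ennreal (mass * b) + ennreal e" .
    qed
  qed
  then have "esssup lebesgue (maximal_function \<mu> f) \<le> ennreal (mass * b)" by (intro esssup_I M)
  then show "esssup lebesgue (maximal_function \<mu> f) \<le> ennreal mass * esssup lebesgue (\<lambda>x. ennreal (cmod (f x)))"
    unfolding b using b by (simp add: ennreal_mult)
qed

text \<open>Infinite p is separate because the norm is then an essential supremum. For finite p the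
  level norm at height 1 is finite, which supplies existence and measurability before
  \<open>strong_type\<close> is applied.\<close>

lemma maximal_function_Lp:
  assumes p: "p > ennreal p_crit"
  shows "\<exists>C::real. \<forall>f\<in>Lp_space p.
    (AE x in lebesgue. \<forall>t>0. convolution_exists f (dilate t \<mu>) x) \<and>
    maximal_function \<mu> f \<in> borel_measurable lebesgue \<and>
    Lp_norm p (maximal_function \<mu> f) \<le> ennreal C * Lp_norm p (\<lambda>x. ennreal (cmod (f x)))"
proof (cases p)
  case top
  show ?thesis
  proof (intro exI[of _ mass] ballI)
    fix f :: "'a \<Rightarrow> complex" assume "f \<in> Lp_space p"
    then have f: "f \<in> borel_measurable lebesgue" "esssup lebesgue (\<lambda>x. ennreal (cmod (f x))) < \<infinity>"
      using top by (auto simp: Lp_space_def Lp_norm_def)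
    show "(AE x in lebesgue. \<forall>t>0. convolution_exists f (dilate t \<mu>) x) \<and>
      maximal_function \<mu> f \<in> borel_measurable lebesgue \<and>
      Lp_norm p (maximal_function \<mu> f) \<le> ennreal mass * Lp_norm p (\<lambda>x. ennreal (cmod (f x)))"
      using essentially_bounded[OF f] top by (simp add: Lp_norm_def)
  qed
next
  case (real r)
  have r: "r > p_crit" using p real p_crit_ge_1 by (simp add: ennreal_less_iff)
  then have r0: "r > 0" using p_crit_ge_1 by linarith
  have norm: "Lp_norm p G = ennpowr (\<integral>\<^sup>+x. ennpowr (G x) r \<partial>lebesgue) (1 / r)" for G :: "'a \<Rightarrow> ennreal"
    using real by (simp add: Lp_norm_def)
  obtain C where C: "C \<ge> 0" and st: "\<forall>f. f \<in> borel_measurable lebesgue \<longrightarrow> maximal_function \<mu> f \<in> borel_measurable lebesgue \<longrightarrow>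
    (\<integral>\<^sup>+x. ennpowr (maximal_function \<mu> f x) r \<partial>lebesgue) \<le> ennreal C * (\<integral>\<^sup>+x. ennpowr (ennreal (cmod (f x))) r \<partial>lebesgue)"
    using strong_type[OF r] by blast
  show ?thesis
  proof (intro exI[of _ "C powr (1 / r)"] ballI)
    fix f :: "'a \<Rightarrow> complex" assume fL: "f \<in> Lp_space p"
    then have f [measurable]: "f \<in> borel_measurable lebesgue" by (simp add: Lp_space_def)
    let ?I = "\<integral>\<^sup>+x. ennpowr (ennreal (cmod (f x))) r \<partial>lebesgue"
    have "ennpowr ?I (1 / r) < \<infinity>" using fL by (simp add: Lp_space_def norm)
    then have I: "?I < \<infinity>" by (cases ?I) auto
    have lf: "level_norm (\<lambda>x. cmod (f x)) 1 < \<infinity>"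
      by (rule level_norm_finite_if_Lp[OF r _ _ I]) auto
    note em = convolution_exists_and_measurable[OF f zero_less_one lf]
    have "Lp_norm p (maximal_function \<mu> f) \<le> ennpowr (ennreal C * ?I) (1 / r)"
      unfolding norm using st f em(2) r0 by (intro ennpowr_mono) auto
    also have "\<dots> = ennreal (C powr (1 / r)) * Lp_norm p (\<lambda>x. ennreal (cmod (f x)))"
      unfolding norm ennpowr_mult using C by (simp add: ennpowr_ennreal)
    finally show "(AE x in lebesgue. \<forall>t>0. convolution_exists f (dilate t \<mu>) x) \<and>
      maximal_function \<mu> f \<in> borel_measurable lebesgue \<and>
      Lp_norm p (maximal_function \<mu> f) \<le> ennreal (C powr (1 / r)) * Lp_norm p (\<lambda>x. ennreal (cmod (f x)))"
      using em by blast
  qed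
qed

text \<open>A level 2 ^ i c whose superlevel set has measure above s lies below every finite u
  competing in the infimum. Halving makes the sum of all dyadic levels below u at most u.\<close>

lemma dyadic_sum_le_rearrangement:
  assumes F [measurable]: "F \<in> borel_measurable lebesgue" and c: "c > 0"
  shows "(\<Sum>i. ennreal (2 ^ i * c / 2) * (if ennreal s < emeasure lebesgue {x. F x > 2 ^ i * c} then 1 else 0))
    \<le> decreasing_rearrangement (\<lambda>x. ennreal (F x)) s"
  unfolding decreasing_rearrangement_def
proof (rule Inf_greatest)
  fix u assume "u \<in> {u. emeasure lebesgue {x. ennreal (F x) > u} \<le> ennreal s}"
  then have u: "emeasure lebesgue {x. ennreal (F x) > u} \<le> ennreal s" by simp
  show "(\<Sum>i. ennreal (2 ^ i * c / 2) * (if ennreal s < emeasure lebesgue {x. F x > 2 ^ i * c} then 1 else 0)) \<le> u"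
  proof (cases u)
    case (real g)
    have imp: "2 ^ i * c < g" if less: "ennreal s < emeasure lebesgue {x. F x > 2 ^ i * c}" for i :: nat
    proof (rule ccontr)
      assume "\<not> 2 ^ i * c < g"
      then have sub: "{x. F x > 2 ^ i * c} \<subseteq> {x. ennreal (F x) > u}" using real by (auto simp: ennreal_less_iff)
      have "{x\<in>space lebesgue. ennreal (F x) > u} \<in> sets lebesgue" by measurable
      then have "emeasure lebesgue {x. F x > 2 ^ i * c} \<le> emeasure lebesgue {x. ennreal (F x) > u}"
        using sub by (intro emeasure_mono) auto
      then show False using u less by (meson leD le_less_trans order_trans)
    qed
    define A where "A i = (if 2 ^ i * c < g then 2 ^ i * c / 2 else 0)" for i :: nat
    have A0: "A i \<ge> 0" for i using c by (simp add: A_def)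
    \<comment> \<open>The second bound, of the partial sum by half the next level, carries the
      induction: a term is added only if 2 ^ n c < g.\<close>
    have "sum A {..<n} \<le> g \<and> sum A {..<n} \<le> 2 ^ n * c / 2" for n
    proof (induction n)
      case 0
      then show ?case using real c by simp
    next
      case (Suc n)
      have "(2::real) ^ n * c > 0" using c by simp
      then show ?case using Suc by (auto simp: A_def)
    qed
    then have A: "sum A {..<n} \<le> g" for n by blast
    have "(\<Sum>i. ennreal (2 ^ i * c / 2) * (if ennreal s < emeasure lebesgue {x. F x > 2 ^ i * c} then 1 else 0)) \<le> (\<Sum>i. ennreal (A i))"
      by (intro suminf_le) (use imp in \<open>auto simp: A_def\<close>)
    also have "\<dots> \<le> u"
    proof (rule suminf_le_const[OF summableI])
      fix n
      have "(\<Sum>i<n. ennreal (A i)) = ennreal (sum A {..<n})" using A0 by (rule sum_ennreal)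
      also have "\<dots> \<le> u" unfolding real using A by (intro ennreal_leI)
      finally show "(\<Sum>i<n. ennreal (A i)) \<le> u" .
    qed
    finally show ?thesis .
  qed simp
qed

text \<open>The (1/p)-th power of the measure of a superlevel set is the integral of (1/p) s^(1/p -
  1) over the s below that measure. Exchanging sum and integral leaves the dyadic sum, which the
  rearrangement dominates. The factor 2 undoes the halving there, and the factor 1/p \<le> 1 is
  dropped.\<close>

lemma level_norm_le_Lorentz_norm:
  assumes F [measurable]: "F \<in> borel_measurable lebesgue" and c: "c > 0"
  shows "level_norm F c \<le> 2 * Lorentz_norm p_crit 1 (\<lambda>x. ennreal (F x))"
proof -
  let ?p = p_crit
  let ?D = "\<lambda>i::nat. emeasure lebesgue {x. F x > 2 ^ i * c}"
  let ?h = "\<lambda>i s. if ennreal s < ?D i then 1 else (0::ennreal)"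
  let ?w = "\<lambda>s. ennreal (1 / ?p * s powr (1 / ?p - 1))"
  let ?R = "decreasing_rearrangement (\<lambda>x. ennreal (F x))"
  have p1: "?p \<ge> 1" by (rule p_crit_ge_1)
  then have p0: "1 / ?p > 0" "1 / ?p \<le> 1" by auto
  have split: "ennreal (2 ^ i * c) = 2 * ennreal (2 ^ i * c / 2)" for i :: nat
  proof -
    have "ennreal (2 * (2 ^ i * c / 2)) = ennreal 2 * ennreal (2 ^ i * c / 2)" using c by (intro ennreal_mult) auto
    then show ?thesis by simp
  qed
  have lev: "level_norm F c = 2 * (\<Sum>i. ennreal (2 ^ i * c / 2) * (\<integral>\<^sup>+s. ?w s * ?h i s * indicator {0<..} s \<partial>lborel))"
    unfolding level_norm_def split nn_integral_powr_up_to[OF p0(1)] ennreal_suminf_cmult[symmetric] by (simp only: mult.assoc)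
  have "(\<Sum>i. ennreal (2 ^ i * c / 2) * (\<integral>\<^sup>+s. ?w s * ?h i s * indicator {0<..} s \<partial>lborel))
    = (\<integral>\<^sup>+s. (\<Sum>i. ennreal (2 ^ i * c / 2) * (?w s * ?h i s * indicator {0<..} s)) \<partial>lborel)"
    by (subst nn_integral_suminf) (auto simp: nn_integral_cmult)
  also have "\<dots> \<le> (\<integral>\<^sup>+s\<in>{0<..}. ennpowr (ennreal (s powr (1 / ?p)) * ?R s) (enn2real 1) / ennreal s \<partial>lborel)"
  proof (rule nn_integral_mono)
    fix s :: real
    show "(\<Sum>i. ennreal (2 ^ i * c / 2) * (?w s * ?h i s * indicator {0<..} s))
      \<le> ennpowr (ennreal (s powr (1 / ?p)) * ?R s) (enn2real 1) / ennreal s * indicator {0<..} s"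
    proof (cases "s > 0")
      case True
      have ind: "indicator {0<..} s = (1::ennreal)" using True by simp
      have swap: "x * (y * h * 1) = y * (x * h)" for x y h :: ennreal by (simp only: mult_1_right mult.left_commute)
      have "(\<Sum>i. ennreal (2 ^ i * c / 2) * (?w s * ?h i s * indicator {0<..} s)) = (\<Sum>i. ?w s * (ennreal (2 ^ i * c / 2) * ?h i s))"
        unfolding ind swap ..
      also have "\<dots> = ?w s * (\<Sum>i. ennreal (2 ^ i * c / 2) * ?h i s)" by (rule ennreal_suminf_cmult)
      also have "\<dots> \<le> ?w s * ?R s" by (intro mult_left_mono dyadic_sum_le_rearrangement F c) simp
      also have "\<dots> \<le> ennreal (s powr (1 / ?p) / s) * ?R s"
      proof (intro mult_right_mono ennreal_leI)
        have "1 / ?p * s powr (1 / ?p - 1) \<le> 1 * s powr (1 / ?p - 1)" using p0 by (intro mult_right_mono) auto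
        also have "\<dots> = s powr (1 / ?p) / s" using True by (simp add: powr_diff)
        finally show "1 / ?p * s powr (1 / ?p - 1) \<le> s powr (1 / ?p) / s" .
      qed simp
      also have "ennreal (s powr (1 / ?p) / s) = ennreal (s powr (1 / ?p)) / ennreal s"
        using True by (intro divide_ennreal[symmetric]) auto
      also have "ennreal (s powr (1 / ?p)) / ennreal s * ?R s = ennreal (s powr (1 / ?p)) * ?R s / ennreal s"
        by (simp add: ennreal_times_divide mult.commute)
      finally show ?thesis using True by simp
    qed simp
  qed
  also have "\<dots> = Lorentz_norm ?p 1 (\<lambda>x. ennreal (F x))" by (simp add: Lorentz_norm_def)
  finally show ?thesis unfolding lev by (rule mult_left_mono) simp
qed

text \<open>To bound the rearrangement at s, the weak type bound is applied at a level u whose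
  exceptional set has measure at most s. The constant 4 C collects 2 from giving half of u to
  \<alpha> and 2 from comparing the level norm with the Lorentz norm; the other half of u covers c
  times the mass.\<close>

lemma maximal_function_Lorentz:
  "\<exists>C::real. \<forall>f\<in>Lorentz_space p_crit 1.
    (AE x in lebesgue. \<forall>t>0. convolution_exists f (dilate t \<mu>) x) \<and>
    maximal_function \<mu> f \<in> borel_measurable lebesgue \<and>
    Lorentz_norm p_crit \<infinity> (maximal_function \<mu> f) \<le> ennreal C * Lorentz_norm p_crit 1 (\<lambda>x. ennreal (cmod (f x)))"
proof -
  let ?p = p_crit
  have p0: "?p > 0" using p_crit_ge_1 by linarith
  obtain C where C: "C > 0" and wk: "\<forall>f c \<alpha> \<tau>. f \<in> borel_measurable lebesgue \<longrightarrow> 0 < c \<longrightarrow> 0 < \<alpha> \<longrightarrow> 0 < \<tau> \<longrightarrow>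
    (\<exists>W\<in>sets borel. {x. maximal_function \<mu> f x > ennreal (c * mass + \<alpha>)} \<subseteq> W \<and>
      emeasure lborel W \<le> ennpowr (ennreal (C / \<alpha>) * (level_norm (\<lambda>x. cmod (f x)) c + ennreal \<tau>)) p_crit)"
    using weak_type_level by blast
  have m: "mass + 1 > 0" by (simp add: add_nonneg_pos)
  show ?thesis
  proof (intro exI[of _ "4 * C"] ballI)
    fix f :: "'a \<Rightarrow> complex" assume fL: "f \<in> Lorentz_space ?p 1"
    let ?L = "Lorentz_norm ?p 1 (\<lambda>x. ennreal (cmod (f x)))"
    have f [measurable]: "f \<in> borel_measurable lebesgue" and fin: "?L < \<infinity>" using fL by (auto simp: Lorentz_space_def)
    obtain l where l: "l \<ge> 0" "?L = ennreal l" using fin by (cases ?L) auto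
    have lev: "level_norm (\<lambda>x. cmod (f x)) c \<le> ennreal (2 * l)" if c: "c > 0" for c
    proof -
      have "level_norm (\<lambda>x. cmod (f x)) c \<le> 2 * ennreal l" unfolding l(2)[symmetric]
        by (rule level_norm_le_Lorentz_norm[OF _ c]) simp
      also have "\<dots> = ennreal (2 * l)" using l by (simp add: ennreal_mult)
      finally show ?thesis .
    qed
    have "level_norm (\<lambda>x. cmod (f x)) 1 < \<infinity>" by (rule le_less_trans[OF lev]) auto
    note em = convolution_exists_and_measurable[OF f zero_less_one this]
    have "Lorentz_norm ?p \<infinity> (maximal_function \<mu> f) \<le> ennreal (4 * C) * ennreal l"
      unfolding Lorentz_norm_def if_P[OF refl]
    proof (rule SUP_least)
      fix s :: real assume "s \<in> {0<..}"
      then have s: "s > 0" by simp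
      show "ennreal (s powr (1 / ?p)) * decreasing_rearrangement (maximal_function \<mu> f) s \<le> ennreal (4 * C) * ennreal l"
      proof (rule ennreal_le_epsilon)
        fix e :: real assume e: "0 < e"
        define z where "z = s powr (1 / ?p)"
        have z: "z > 0" using s by (simp add: z_def)
        \<comment> \<open>The additional e keeps u positive when the norm l is 0; together with
          \<tau> = e / (2 C) it makes C / \<alpha> times 2 l + \<tau> equal to z exactly.\<close>
        define u where "u = (4 * C * l + e) / z"
        have num: "4 * C * l + e > 0" using C l e by (simp add: add_nonneg_pos)
        have u: "u > 0" using num z by (simp add: u_def)
        define \<alpha> where "\<alpha> = u / 2"
        define c where "c = u / (2 * (mass + 1))"
        define \<tau> where "\<tau> = e / (2 * C)"
        have pos: "\<alpha> > 0" "c > 0" "\<tau> > 0" using u e C m by (auto simp: \<alpha>_def c_def \<tau>_def)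
        have "\<exists>W\<in>sets borel. {x. maximal_function \<mu> f x > ennreal (c * mass + \<alpha>)} \<subseteq> W \<and>
          emeasure lborel W \<le> ennpowr (ennreal (C / \<alpha>) * (level_norm (\<lambda>x. cmod (f x)) c + ennreal \<tau>)) p_crit"
          by (rule wk[rule_format, OF f pos(2,1,3)])
        then obtain W where W: "W \<in> sets borel" "{x. maximal_function \<mu> f x > ennreal (c * mass + \<alpha>)} \<subseteq> W"
          "emeasure lborel W \<le> ennpowr (ennreal (C / \<alpha>) * (level_norm (\<lambda>x. cmod (f x)) c + ennreal \<tau>)) p_crit"
          by blast
        have "c * mass \<le> c * (mass + 1)" using pos by (intro mult_left_mono) auto
        also have "\<dots> = u / 2" using m by (simp add: c_def field_simps)
        finally have "c * mass + \<alpha> \<le> u" by (simp add: \<alpha>_def)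
        then have sub: "{x. maximal_function \<mu> f x > ennreal u} \<subseteq> W"
          using W(2) by (auto dest: ennreal_leI intro: le_less_trans)
        have "ennreal (C / \<alpha>) * (level_norm (\<lambda>x. cmod (f x)) c + ennreal \<tau>) \<le> ennreal (C / \<alpha>) * (ennreal (2 * l) + ennreal \<tau>)"
          using lev[OF pos(2)] by (intro mult_left_mono add_right_mono) auto
        also have "\<dots> = ennreal (C / \<alpha>) * ennreal (2 * l + \<tau>)" using l pos by (subst ennreal_plus) auto
        also have "\<dots> = ennreal (C / \<alpha> * (2 * l + \<tau>))" using l pos C by (intro ennreal_mult[symmetric]) auto
        also have "C / \<alpha> * (2 * l + \<tau>) = z"
        proof -
          have "C / \<alpha> * (2 * l + \<tau>) = (4 * C * l + e) / u" using C u by (simp add: \<alpha>_def \<tau>_def field_simps)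
          then show ?thesis using num z by (simp add: u_def)
        qed
        finally have "ennpowr (ennreal (C / \<alpha>) * (level_norm (\<lambda>x. cmod (f x)) c + ennreal \<tau>)) p_crit \<le> ennpowr (ennreal z) ?p"
          using p0 by (intro ennpowr_mono) auto
        also have "\<dots> = ennreal s" using z p0 s by (simp add: ennpowr_ennreal) (simp add: z_def powr_powr)
        finally have We: "emeasure lborel W \<le> ennreal s" using W(3) by (rule order_trans[rotated])
        have "emeasure lebesgue {x. maximal_function \<mu> f x > ennreal u} \<le> emeasure lebesgue W"
          using sub W by (intro emeasure_mono) auto
        also have "\<dots> = emeasure lborel W" using W by simp
        finally have "emeasure lebesgue {x. maximal_function \<mu> f x > ennreal u} \<le> ennreal s" using We by (rule order_trans)
        then have "decreasing_rearrangement (maximal_function \<mu> f) s \<le> ennreal u"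
          unfolding decreasing_rearrangement_def by (intro Inf_lower) simp
        then have "ennreal z * decreasing_rearrangement (maximal_function \<mu> f) s \<le> ennreal z * ennreal u" by (intro mult_left_mono) auto
        also have "\<dots> = ennreal (z * u)" using z u by (intro ennreal_mult[symmetric]) auto
        also have "z * u = 4 * C * l + e" using z by (simp add: u_def)
        also have "ennreal (4 * C * l + e) = ennreal (4 * C * l) + ennreal e" using C l e by (intro ennreal_plus) auto
        also have "ennreal (4 * C * l) = ennreal (4 * C) * ennreal l" using C l by (intro ennreal_mult) auto
        finally show "ennreal (s powr (1 / ?p)) * decreasing_rearrangement (maximal_function \<mu> f) s \<le> ennreal (4 * C) * ennreal l + ennreal e"
          by (simp only: z_def)
      qed
    qed
    then show "(AE x in lebesgue. \<forall>t>0. convolution_exists f (dilate t \<mu>) x) \<and>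
      maximal_function \<mu> f \<in> borel_measurable lebesgue \<and>
      Lorentz_norm ?p \<infinity> (maximal_function \<mu> f) \<le> ennreal (4 * C) * ?L"
      using em unfolding l(2) by blast
  qed
qed

end

text \<open>Existence of the averages and measurability of the maximal function are part of the
  conclusion: an undefined average counts as 0, and the norms are meaningful only for measurable
  functions, so the inequality alone would say too little. Taking p among the extended nonnegative
  reals includes the essential supremum.\<close>

theorem theorem1p3:
  fixes \<mu> :: "'a::euclidean_space measure" and a b C\<^sub>0 :: real
  defines "p\<^sub>c \<equiv> critical_exponent (real DIM('a)) a b"
  assumes "sets \<mu> = sets borel" and "finite_measure \<mu>" and "compactly_supported \<mu>"
    and "a > 1 / 2" and "real DIM('a) - 1 < b" and "b \<le> real DIM('a)"
    and "\<And>\<xi>. \<xi> \<noteq> 0 \<Longrightarrow> cmod (fourier_measure \<mu> \<xi>) \<le> C\<^sub>0 * norm \<xi> powr (- a)"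
    and "\<And>x r. r > 0 \<Longrightarrow> measure \<mu> (ball x r) \<le> C\<^sub>0 * r powr b"
  shows
    "(\<forall>p::ennreal. p > ennreal p\<^sub>c \<longrightarrow>
        (\<exists>C::real. \<forall>f\<in>Lp_space p.
           (AE x in lebesgue. \<forall>t>0. convolution_exists f (dilate t \<mu>) x) \<and>
           maximal_function \<mu> f \<in> borel_measurable lebesgue \<and>
           Lp_norm p (maximal_function \<mu> f) \<le> ennreal C * Lp_norm p (\<lambda>x. ennreal (cmod (f x))))) \<and>
     (\<exists>C::real. \<forall>f\<in>Lorentz_space p\<^sub>c 1.
           (AE x in lebesgue. \<forall>t>0. convolution_exists f (dilate t \<mu>) x) \<and>
           maximal_function \<mu> f \<in> borel_measurable lebesgue \<and>
           Lorentz_norm p\<^sub>c \<infinity> (maximal_function \<mu> f)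
             \<le> ennreal C * Lorentz_norm p\<^sub>c 1 (\<lambda>x. ennreal (cmod (f x))))"
proof -
  obtain K where K: "compact K" "emeasure \<mu> (- K) = 0"
    using \<open>compactly_supported \<mu>\<close> by (auto simp: compactly_supported_def)
  \<comment> \<open>A compact set lies in a ball about the origin, and that ball then carries
    \<mu>.\<close>
  obtain R where "R > 0" "\<forall>x\<in>K. norm x \<le> R"
    using compact_imp_bounded[OF K(1)] unfolding bounded_pos by blast
  then have R: "R > 0" "K \<subseteq> cball 0 R" by auto
  have "- K \<in> sets \<mu>" using compact_imp_closed[OF K(1)] \<open>sets \<mu> = sets borel\<close> by (simp add: open_Compl)
  then have "emeasure \<mu> (- cball 0 R) \<le> emeasure \<mu> (- K)" using R(2) by (intro emeasure_mono) auto
  then have support: "emeasure \<mu> (- cball 0 R) = 0" using K(2) by simp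
  interpret decaying_measure \<mu> a b C\<^sub>0 R
    by (rule decaying_measure.intro[OF assms(2,3) R(1) support assms(5-9)])
  have "p\<^sub>c = p_crit" by (simp add: p\<^sub>c_def p_crit_def)
  then show ?thesis using maximal_function_Lp maximal_function_Lorentz by simp
qed
end
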